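(* Let $(B_t)$ be a Brownian motion started at $0$ with local time $(L_t)$ at $0$. Let $\mu$ be a symmetric probability measure on $\mathbb{R}$ with finite first moment and a strictly positive density on $\mathbb{R}$. Let $\psi_\mu(x)=\int_0^x \frac{s}{\bar\mu(s)}\,\mu(ds)$ for $x\ge0$, where $\bar\mu(s)=\mu([s,\infty))$, let $\phi_\mu$ be the inverse of $\psi_\mu$ and $\tau_\mu=\inf\{u>0:|B_u|=\phi_\mu(L_u)\}$. Let $F:[0,\infty)\to[0,\infty)$ be convex and increasing (no differentiability or boundedness assumption on $F'$). Then for all $\tau\in\mathcal{T}(\mu)$, $\mathbb{E}[F(L_\tau)]\le\mathbb{E}[F(L_{\tau_\mu})]$.
   Context: $\mathcal{T}(\mu)$ denotes the set of stopping times $\tau$ such that $(B_{t\wedge\tau})_{t\ge0}$ is a uniformly integrable martingale and $B_\tau\sim\mu$. *)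

theory Defs
  imports "HOL-Probability.Probability"
begin

definition is_filtration :: "'a measure \<Rightarrow> (real \<Rightarrow> 'a measure) \<Rightarrow> bool" where
  "is_filtration M F \<longleftrightarrow>
     (\<forall>t. space (F t) = space M \<and> sets (F t) \<subseteq> sets M) \<and>
     (\<forall>s t. s \<le> t \<longrightarrow> sets (F s) \<subseteq> sets (F t))"

definition brownian_motion :: "'a measure \<Rightarrow> (real \<Rightarrow> 'a measure) \<Rightarrow> (real \<Rightarrow> 'a \<Rightarrow> real) \<Rightarrow> bool" where
  "brownian_motion M F B \<longleftrightarrow>
     prob_space M \<and> is_filtration M F \<and>
     (\<forall>\<omega>\<in>space M. B 0 \<omega> = 0) \<and>
     (\<forall>\<omega>\<in>space M. continuous_on {0..} (\<lambda>t. B t \<omega>)) \<and>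
     (\<forall>t\<ge>0. B t \<in> borel_measurable (F t)) \<and>
     (\<forall>s t. 0 \<le> s \<and> s < t \<longrightarrow>
        distributed M lborel (\<lambda>\<omega>. B t \<omega> - B s \<omega>) (\<lambda>x. ennreal (normal_density 0 (sqrt (t - s)) x))) \<and>
     (\<forall>s t. 0 \<le> s \<and> s \<le> t \<longrightarrow>
        (\<forall>A\<in>sets (F s). \<forall>C\<in>sets borel.
           measure M (A \<inter> {\<omega>\<in>space M. B t \<omega> - B s \<omega> \<in> C})
             = measure M A * measure M {\<omega>\<in>space M. B t \<omega> - B s \<omega> \<in> C}))"

text \<open>Local time at 0 (occupation density normalisation, so that |B| - L is a martingale):
  L_t = lim_{eps -> 0+} (1/(2 eps)) Leb{s \<in> [0,t] : |B_s| < eps}.\<close>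
definition local_time0 :: "(real \<Rightarrow> 'a \<Rightarrow> real) \<Rightarrow> real \<Rightarrow> 'a \<Rightarrow> real" where
  "local_time0 B t \<omega> =
     Lim (at_right 0) (\<lambda>\<epsilon>. measure lborel {s\<in>{0..t}. \<bar>B s \<omega>\<bar> < \<epsilon>} / (2 * \<epsilon>))"

definition stopping_time_ext :: "(real \<Rightarrow> 'a measure) \<Rightarrow> ('a \<Rightarrow> ereal) \<Rightarrow> bool" where
  "stopping_time_ext F \<tau> \<longleftrightarrow>
     (\<forall>\<omega>. 0 \<le> \<tau> \<omega>) \<and> (\<forall>t. {\<omega>\<in>space (F t). \<tau> \<omega> \<le> ereal t} \<in> sets (F t))"

definition stopped_at :: "(real \<Rightarrow> 'a \<Rightarrow> real) \<Rightarrow> ('a \<Rightarrow> ereal) \<Rightarrow> 'a \<Rightarrow> real" where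
  "stopped_at X \<tau> \<omega> = X (real_of_ereal (\<tau> \<omega>)) \<omega>"

definition stopped_process :: "(real \<Rightarrow> 'a \<Rightarrow> real) \<Rightarrow> ('a \<Rightarrow> ereal) \<Rightarrow> real \<Rightarrow> 'a \<Rightarrow> real" where
  "stopped_process X \<tau> t \<omega> = X (real_of_ereal (min (ereal t) (\<tau> \<omega>))) \<omega>"

definition martingale :: "'a measure \<Rightarrow> (real \<Rightarrow> 'a measure) \<Rightarrow> (real \<Rightarrow> 'a \<Rightarrow> real) \<Rightarrow> bool" where
  "martingale M F X \<longleftrightarrow>
     (\<forall>t\<ge>0. X t \<in> borel_measurable (F t) \<and> integrable M (X t)) \<and>
     (\<forall>s t. 0 \<le> s \<and> s \<le> t \<longrightarrow> (AE \<omega> in M. real_cond_exp M (F s) (X t) \<omega> = X s \<omega>))"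

definition uniformly_integrable :: "'a measure \<Rightarrow> (real \<Rightarrow> 'a \<Rightarrow> real) \<Rightarrow> bool" where
  "uniformly_integrable M X \<longleftrightarrow>
     (\<forall>t\<ge>0. integrable M (X t)) \<and>
     ((\<lambda>K. \<Squnion>t\<in>{0..}. \<integral>\<^sup>+\<omega>. ennreal \<bar>X t \<omega>\<bar> * indicator {\<omega>. K < \<bar>X t \<omega>\<bar>} \<omega> \<partial>M)
        \<longlongrightarrow> 0) at_top"

definition T_class :: "'a measure \<Rightarrow> (real \<Rightarrow> 'a measure) \<Rightarrow> (real \<Rightarrow> 'a \<Rightarrow> real)
    \<Rightarrow> real measure \<Rightarrow> ('a \<Rightarrow> ereal) set" where
  "T_class M F B \<mu> = {\<tau>. stopping_time_ext F \<tau> \<and>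
      martingale M F (stopped_process B \<tau>) \<and>
      uniformly_integrable M (stopped_process B \<tau>) \<and>
      (AE \<omega> in M. \<tau> \<omega> < \<infinity>) \<and>
      stopped_at B \<tau> \<in> borel_measurable M \<and>
      distr M borel (stopped_at B \<tau>) = \<mu>}"

definition mu_bar :: "real measure \<Rightarrow> real \<Rightarrow> real" where
  "mu_bar \<mu> s = measure \<mu> {s..}"

definition psi_mu :: "real measure \<Rightarrow> real \<Rightarrow> real" where
  "psi_mu \<mu> x = (\<integral>s\<in>{0..x}. s / mu_bar \<mu> s \<partial>\<mu>)"

definition phi_mu :: "real measure \<Rightarrow> real \<Rightarrow> real" where
  "phi_mu \<mu> = the_inv_into {0..} (psi_mu \<mu>)"

definition tau_mu :: "real measure \<Rightarrow> (real \<Rightarrow> 'a \<Rightarrow> real) \<Rightarrow> 'a \<Rightarrow> ereal" where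
  "tau_mu \<mu> B \<omega> = Inf (ereal ` {u. 0 < u \<and> \<bar>B u \<omega>\<bar> = phi_mu \<mu> (local_time0 B u \<omega>)})"

end

theory Submission
  imports Defs "HOL-Real_Asymp.Real_Asymp"
begin

text \<open>
  By convexity it is enough to treat the payoffs \<open>(l - k)\<^sup>+\<close>. For a bounded Lipschitz \<open>\<Gamma>\<close> with right
  derivative \<open>\<gamma>\<close>, the process \<open>\<Gamma>(L\<^sub>t) - |B\<^sub>t| \<gamma>(L\<^sub>t)\<close> is a martingale. With \<open>b = \<phi>\<^sub>\<mu>(k)\<close> and the convex
  function \<open>H(x) = \<integral>\<^sub>0\<^sup>x m(b) / m(min y b) dy\<close> (where \<open>m(s) = \<mu>[s, \<infinity>)\<close>) one gets, for \<open>\<gamma> = H' \<circ> \<phi>\<^sub>\<mu>\<close>, the pathwise inequality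
  \<open>(l - k)\<^sup>+ \<le> H(x) + \<Gamma>(l) - x \<gamma>(l)\<close>, hence \<open>E (L\<^sub>\<tau> - k)\<^sup>+ \<le> \<integral> H(|x|) d\<mu> = \<integral> (\<psi>\<^sub>\<mu>(|x|) - k)\<^sup>+ d\<mu>\<close>. Conversely, the
  martingale with \<open>\<Gamma> = 1 / (2 m \<circ> \<phi>\<^sub>\<mu>)\<close> vanishes on the boundary \<open>|x| = \<phi>\<^sub>\<mu>(l)\<close>, which shows that the local time
  at the Vallois time stochastically dominates \<open>\<psi>\<^sub>\<mu>(|X|)\<close>, \<open>X \<sim> \<mu>\<close>.

  The martingale property is obtained without stochastic integration: the local time is approximated by
  additive functionals \<open>\<integral>\<^sub>0\<^sup>t g\<^sub>n(B\<^sub>s) ds\<close> with \<open>2 g\<^sub>n = f\<^sub>n''\<close>, \<open>f\<^sub>n \<rightarrow> |x|\<close>, and all expectations are computed on a time grid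
  by a second order Taylor expansion, the error terms being controlled by \<open>P(|B\<^sub>t| < a) \<le> a / \<surd>t\<close>.
\<close>

section \<open>Convergence and convex order\<close>

text \<open>The weight in \<open>H\<close> is forced. Equality on the boundary x = \<phi>(l)
  prescribes \<Gamma> = \<phi> \<gamma> - H(\<phi>) + (l - k)^+, and \<Gamma>' = \<gamma> then
  becomes \<gamma> = \<phi> \<gamma>' below k, with \<gamma> = 1 from k on. Formally \<phi>' =
  m(\<phi>) / (\<phi> f(\<phi>)), so the solutions are the multiples of 1 / m(\<phi>). The same
  equation makes r(l) - x r'(l) vanish at x = \<phi>(l) for r = 1 / (2 m(\<phi>)). Four obstacles
  shape the argument. The kernels approximating |x| lose all smoothness in the limit, so the maximal
  inequality must have a constant that sees only their radius. The density is merely measurable, so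
  \<phi> need not be differentiable and the equation is obtained from difference bounds. Truncating
  the payoffs leaves corners, hence right derivatives. At l = 0 the boundary has height 0 and r' = r
  / \<phi> explodes; the hitting problem is therefore posed only after the local time has reached
  \<delta> > 0, and the infimum over \<delta> of the resulting local times serves as a minorant of
  the local time at \<open>tau_mu\<close>.\<close>

lemma vitali_convergence:
  fixes X :: "nat \<Rightarrow> 'a \<Rightarrow> real"
  assumes "prob_space M"
    and X [measurable]: "\<And>n. X n \<in> borel_measurable M" and Y [measurable]: "Y \<in> borel_measurable M"
    and lim: "AE \<omega> in M. (\<lambda>n. X n \<omega>) \<longlonglongrightarrow> Y \<omega>"
    and ui: "\<And>e. e > 0 \<Longrightarrow> \<exists>K\<ge>0. \<forall>n. (\<integral>\<^sup>+\<omega>. ennreal (max 0 (\<bar>X n \<omega>\<bar> - K)) \<partial>M) \<le> ennreal e"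
  shows "integrable M Y" and "integrable M (X n)"
    and "(\<lambda>n. \<integral>\<omega>. X n \<omega> \<partial>M) \<longlonglongrightarrow> (\<integral>\<omega>. Y \<omega> \<partial>M)"
proof -
  interpret prob_space M by fact
  \<comment> \<open>Fatou's lemma carries the tail bound over to the limit, so one K serves all
    \<open>X n\<close> and \<open>Y\<close> at once. Measuring tails by the excess over K keeps the
    integrand continuous in X, so its values converge along with X.\<close>
  have ui': "\<exists>K\<ge>0. (\<forall>n. (\<integral>\<^sup>+\<omega>. ennreal (max 0 (\<bar>X n \<omega>\<bar> - K)) \<partial>M) \<le> ennreal e) \<and>
       (\<integral>\<^sup>+\<omega>. ennreal (max 0 (\<bar>Y \<omega>\<bar> - K)) \<partial>M) \<le> ennreal e" if e: "e > 0" for e :: real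
  proof -
    obtain K where K: "K \<ge> 0" "\<And>n. (\<integral>\<^sup>+\<omega>. ennreal (max 0 (\<bar>X n \<omega>\<bar> - K)) \<partial>M) \<le> ennreal e"
      using ui[OF e] by blast
    have "(\<integral>\<^sup>+\<omega>. ennreal (max 0 (\<bar>Y \<omega>\<bar> - K)) \<partial>M)
        = (\<integral>\<^sup>+\<omega>. liminf (\<lambda>n. ennreal (max 0 (\<bar>X n \<omega>\<bar> - K))) \<partial>M)"
    proof (rule nn_integral_cong_AE, use lim in eventually_elim)
      fix \<omega> assume "(\<lambda>n. X n \<omega>) \<longlonglongrightarrow> Y \<omega>"
      then have "(\<lambda>n. ennreal (max 0 (\<bar>X n \<omega>\<bar> - K))) \<longlonglongrightarrow> ennreal (max 0 (\<bar>Y \<omega>\<bar> - K))"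
        by (intro tendsto_intros)
      then show "ennreal (max 0 (\<bar>Y \<omega>\<bar> - K)) = liminf (\<lambda>n. ennreal (max 0 (\<bar>X n \<omega>\<bar> - K)))"
        by (simp add: lim_imp_Liminf)
    qed
    also have "\<dots> \<le> liminf (\<lambda>n. \<integral>\<^sup>+\<omega>. ennreal (max 0 (\<bar>X n \<omega>\<bar> - K)) \<partial>M)"
      by (rule nn_integral_liminf) simp
    also have "\<dots> \<le> ennreal e"
      by (rule Liminf_le) (auto intro!: always_eventually K(2) simp del: ennreal_max_0 ennreal_max_0')
    finally show ?thesis using K by blast
  qed
  have int: "integrable M Z" if [measurable]: "Z \<in> borel_measurable M"
    and le: "(\<integral>\<^sup>+\<omega>. ennreal (max 0 (\<bar>Z \<omega>\<bar> - K)) \<partial>M) \<le> ennreal e" and "K \<ge> 0" for Z :: "'a \<Rightarrow> real" and K e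
  proof (rule integrableI_bounded)
    have "(\<integral>\<^sup>+\<omega>. ennreal (norm (Z \<omega>)) \<partial>M) \<le> (\<integral>\<^sup>+\<omega>. ennreal (max 0 (\<bar>Z \<omega>\<bar> - K)) + ennreal K \<partial>M)"
    proof (rule nn_integral_mono)
      fix \<omega>
      have "ennreal (norm (Z \<omega>)) \<le> ennreal (max 0 (\<bar>Z \<omega>\<bar> - K) + K)" by (rule ennreal_leI) simp
      also have "\<dots> = ennreal (max 0 (\<bar>Z \<omega>\<bar> - K)) + ennreal K" using \<open>K \<ge> 0\<close> by (intro ennreal_plus) auto
      finally show "ennreal (norm (Z \<omega>)) \<le> ennreal (max 0 (\<bar>Z \<omega>\<bar> - K)) + ennreal K" .
    qed
    also have "\<dots> = (\<integral>\<^sup>+\<omega>. ennreal (max 0 (\<bar>Z \<omega>\<bar> - K)) \<partial>M) + ennreal K"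
      by (subst nn_integral_add) (auto simp: emeasure_space_1)
    also have "\<dots> \<le> ennreal e + ennreal K" using le by (rule add_right_mono)
    also have "\<dots> < \<infinity>" by simp
    finally show "(\<integral>\<^sup>+\<omega>. ennreal (norm (Z \<omega>)) \<partial>M) < \<infinity>" .
  qed simp
  obtain K where K: "K \<ge> 0" "\<And>n. (\<integral>\<^sup>+\<omega>. ennreal (max 0 (\<bar>X n \<omega>\<bar> - K)) \<partial>M) \<le> ennreal 1"
       "(\<integral>\<^sup>+\<omega>. ennreal (max 0 (\<bar>Y \<omega>\<bar> - K)) \<partial>M) \<le> ennreal 1" using ui'[of 1] by auto
  show iY: "integrable M Y" by (rule int[OF Y K(3,1)])
  have iX: "integrable M (X n)" for n by (rule int[OF X K(2,1)])
  then show "integrable M (X n)" .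
  show "(\<lambda>n. \<integral>\<omega>. X n \<omega> \<partial>M) \<longlonglongrightarrow> (\<integral>\<omega>. Y \<omega> \<partial>M)"
  proof (rule LIMSEQ_I)
    fix r :: real assume r: "r > 0"
    define e where "e = r / 3"
    obtain K where K: "K \<ge> 0" "\<And>n. (\<integral>\<^sup>+\<omega>. ennreal (max 0 (\<bar>X n \<omega>\<bar> - K)) \<partial>M) \<le> ennreal e"
       "(\<integral>\<^sup>+\<omega>. ennreal (max 0 (\<bar>Y \<omega>\<bar> - K)) \<partial>M) \<le> ennreal e" using ui'[of e] r by (auto simp: e_def)
    \<comment> \<open>Clipping at K moves each value by exactly its excess over K, hence each
      expectation by at most e; the clipped expectations converge by domination. Three errors of
      size e = r / 3 add up to r.\<close>
    define c where "c x = max (-K) (min K x)" for x :: real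
    have c [measurable]: "c \<in> borel_measurable borel" unfolding c_def by simp
    have cb: "\<bar>c x\<bar> \<le> K" for x using K(1) by (auto simp: c_def)
    have ci: "integrable M (\<lambda>\<omega>. c (Z \<omega>))" if [measurable]: "Z \<in> borel_measurable M" for Z
      by (rule integrable_const_bound[of _ K]) (auto simp: cb)
    have close: "\<bar>(\<integral>\<omega>. Z \<omega> \<partial>M) - (\<integral>\<omega>. c (Z \<omega>) \<partial>M)\<bar> \<le> e"
      if Z: "integrable M Z" and le: "(\<integral>\<^sup>+\<omega>. ennreal (max 0 (\<bar>Z \<omega>\<bar> - K)) \<partial>M) \<le> ennreal e" for Z
    proof -
      have [measurable]: "Z \<in> borel_measurable M" using Z by simp
      have *: "\<bar>x - c x\<bar> = max 0 (\<bar>x\<bar> - K)" for x using K(1) by (auto simp: c_def)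
      have i: "integrable M (\<lambda>\<omega>. Z \<omega> - c (Z \<omega>))" using Z ci by simp
      have "\<bar>(\<integral>\<omega>. Z \<omega> \<partial>M) - (\<integral>\<omega>. c (Z \<omega>) \<partial>M)\<bar> = \<bar>\<integral>\<omega>. Z \<omega> - c (Z \<omega>) \<partial>M\<bar>"
        using Z ci by simp
      also have "\<dots> \<le> (\<integral>\<omega>. \<bar>Z \<omega> - c (Z \<omega>)\<bar> \<partial>M)" by (rule integral_abs_bound)
      finally have "ennreal \<bar>(\<integral>\<omega>. Z \<omega> \<partial>M) - (\<integral>\<omega>. c (Z \<omega>) \<partial>M)\<bar> \<le> ennreal (\<integral>\<omega>. \<bar>Z \<omega> - c (Z \<omega>)\<bar> \<partial>M)"
        by (rule ennreal_leI)
      also have "\<dots> = (\<integral>\<^sup>+\<omega>. ennreal \<bar>Z \<omega> - c (Z \<omega>)\<bar> \<partial>M)"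
        using i by (subst nn_integral_eq_integral) auto
      also have "\<dots> \<le> ennreal e" using le by (simp add: *)
      finally show ?thesis using r by (simp add: e_def)
    qed
    have "(\<lambda>n. \<integral>\<omega>. c (X n \<omega>) \<partial>M) \<longlonglongrightarrow> (\<integral>\<omega>. c (Y \<omega>) \<partial>M)"
    proof (rule integral_dominated_convergence[where w = "\<lambda>_. K"])
      show "AE \<omega> in M. (\<lambda>n. c (X n \<omega>)) \<longlonglongrightarrow> c (Y \<omega>)"
        using lim by eventually_elim (auto simp: c_def intro!: tendsto_intros)
    qed (auto simp: cb)
    then obtain N where N: "\<And>n. n \<ge> N \<Longrightarrow> \<bar>(\<integral>\<omega>. c (X n \<omega>) \<partial>M) - (\<integral>\<omega>. c (Y \<omega>) \<partial>M)\<bar> < e"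
      using LIMSEQ_D[of _ _ e] r unfolding e_def by (metis divide_pos_pos real_norm_def zero_less_numeral)
    show "\<exists>no. \<forall>n\<ge>no. norm ((\<integral>\<omega>. X n \<omega> \<partial>M) - (\<integral>\<omega>. Y \<omega> \<partial>M)) < r"
    proof (intro exI allI impI)
      fix n assume "N \<le> n"
      from N[OF this] close[OF iX K(2), of n] close[OF iY K(3)]
      show "norm ((\<integral>\<omega>. X n \<omega> \<partial>M) - (\<integral>\<omega>. Y \<omega> \<partial>M)) < r"
        unfolding e_def real_norm_def by linarith
    qed
  qed
qed

text \<open>Uniform continuity bounds the error per cell by h * (e / T), and at most N cells are
  added. The bound is uniform in the upper index i because i will be the random grid index of a
  discretised stopping time.\<close>

lemma riemann_sums_uniform:
  fixes q :: "real \<Rightarrow> real"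
  assumes q: "continuous_on {0..T} q" and T: "T > 0" and e: "e > 0"
  shows "\<exists>N0::nat. \<forall>N::nat\<ge>N0. \<forall>i::nat\<le>N. N > 0 \<longrightarrow>
     \<bar>(\<Sum>j<i. T / N * q (j * (T / N))) - integral {0..i * (T / N)} q\<bar> \<le> e"
proof -
  have "uniformly_continuous_on {0..T} q"
    by (rule compact_uniformly_continuous[OF q]) simp
  then obtain d where d: "d > 0"
    "\<And>x y. x \<in> {0..T} \<Longrightarrow> y \<in> {0..T} \<Longrightarrow> dist y x < d \<Longrightarrow> dist (q y) (q x) < e / T"
    unfolding uniformly_continuous_on_def using e T by (metis divide_pos_pos)
  obtain N0 :: nat where N0: "T / d < N0" using reals_Archimedean2 by blast
  show ?thesis
  proof (intro exI[of _ N0] allI impI)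
    fix N i :: nat assume N: "N0 \<le> N" and iN: "i \<le> N" and Npos: "N > 0"
    define h where "h = T / N"
    have h: "h > 0" using T Npos by (simp add: h_def)
    have Nh: "N * h = T" using Npos by (simp add: h_def)
    have hd: "h < d"
    proof -
      have "T / d < N" using N0 N by linarith
      then show ?thesis using d(1) Npos by (simp add: h_def field_simps)
    qed
    have "\<bar>(\<Sum>j<i. h * q (j * h)) - integral {0..i * h} q\<bar> \<le> i * (h * (e / T))"
      using iN
    proof (induction i)
      case (Suc i)
      have iT: "i * h + h \<le> T" using mult_right_mono[of "real (Suc i)" N h] Suc.prems h Nh by (simp add: algebra_simps)
      have i0: "0 \<le> i * h" using h by simp
      have int: "q integrable_on {a..b}" if "0 \<le> a" "b \<le> T" for a b
        by (rule integrable_continuous_real, rule continuous_on_subset[OF q]) (use that in auto)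
      have "integral {0..i * h} q + integral {i*h..i*h + h} q = integral {0..i*h + h} q"
        using i0 h iT by (intro Henstock_Kurzweil_Integration.integral_combine int) auto
      moreover have "\<bar>h * q (i * h) - integral {i*h..i*h + h} q\<bar> \<le> h * (e / T)"
      proof -
        have "integral {i*h..i*h + h} (\<lambda>x. q x - q (i*h)) = integral {i*h..i*h + h} q - h * q (i*h)"
          using int[of "i*h" "i*h+h"] i0 iT h by (subst Henstock_Kurzweil_Integration.integral_diff) auto
        moreover have "norm (integral {i*h..i*h + h} (\<lambda>x. q x - q (i*h))) \<le> (e / T) * (i*h+h - i*h)"
        proof (rule integral_bound)
          show "continuous_on {i*h..i*h + h} (\<lambda>x. q x - q (i*h))"
            by (intro continuous_intros continuous_on_subset[OF q]) (use i0 iT in auto)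
          show "norm (q t - q (i*h)) \<le> e / T" if "t \<in> {i*h..i*h + h}" for t
          proof -
            have "0 \<le> t" using order_trans[OF i0] that by simp
            moreover have "dist t (i*h) < d" "t \<le> T" using that iT h hd by (auto simp: dist_real_def)
            ultimately show ?thesis using d(2)[of "i*h" t] i0 iT h by (auto simp: dist_real_def)
          qed
        qed (use h in auto)
        ultimately show ?thesis by (simp add: algebra_simps)
      qed
      moreover have "\<bar>(\<Sum>j<i. h * q (j * h)) - integral {0..i * h} q\<bar> \<le> i * (h * (e / T))"
        using Suc by simp
      moreover have e1: "real (Suc i) * (h * (e / T)) = i * (h * (e / T)) + h * (e / T)"
        and e2: "real (Suc i) * h = i * h + h" by (simp_all add: distrib_right add_divide_distrib)
      ultimately show ?case unfolding sum.lessThan_Suc e1 e2 by linarith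
    qed (use h in simp)
    also have "\<dots> \<le> N * (h * (e / T))"
      using iN h e T by (intro mult_right_mono) auto
    also have "\<dots> = e" using Nh T by (simp add: mult.assoc[symmetric])
    finally show "\<bar>(\<Sum>j<i. T / N * q (j * (T / N))) - integral {0..i * (T / N)} q\<bar> \<le> e"
      by (simp add: h_def)
  qed
qed

text \<open>The step-size-\<open>h\<close> secant interpolant of \<open>G\<close>, delayed by \<open>h\<close>, is a non-negative combination of
  call payoffs and stays below \<open>G\<close>.\<close>

lemma convex_mono_call_approximation:
  fixes G :: "real \<Rightarrow> real"
  assumes cvx: "convex_on {0..} G" and mono: "mono_on {0..} G" and nn: "\<And>x. 0 \<le> x \<Longrightarrow> 0 \<le> G x"
    and h: "h > 0"
  shows "\<exists>c. (\<forall>i. 0 \<le> c i) \<and> (\<forall>l\<ge>0.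
     ennreal (G (max 0 (l - 2 * h))) \<le> ennreal (G 0) + (\<Sum>i. ennreal (c i) * ennreal (max 0 (l - real (Suc i) * h))) \<and>
     ennreal (G 0) + (\<Sum>i. ennreal (c i) * ennreal (max 0 (l - real (Suc i) * h))) \<le> ennreal (G l))"
proof -
  \<comment> \<open>The slope of G over the cell ending at i * h. The truncation makes
    \<open>s 0\<close> vanish, so \<open>c 0\<close> = \<open>s 1\<close> is non-negative by
    monotonicity, while the later \<open>c i\<close> are second differences, non-negative by
    midpoint convexity.\<close>
  define s where "s i = (G (real i * h) - G (max 0 (real i * h - h))) / h" for i :: nat
  define c where "c i = s (Suc i) - s i" for i
  have G_le: "G x \<le> G y" if "0 \<le> x" "x \<le> y" for x y
    using mono_onD[OF mono, of x y] that by auto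
  have s0: "0 \<le> s i" for i
    unfolding s_def using h by (intro divide_nonneg_pos) (auto intro!: G_le)
  have c0: "0 \<le> c i" for i
  proof (cases i)
    case 0
    then show ?thesis using s0[of 1] h by (simp add: c_def s_def max_def)
  next
    case (Suc j)
    have 1: "G ((1 - 1/2) *\<^sub>R (real j * h) + (1/2) *\<^sub>R ((real j + 2) * h)) \<le> (1 - 1/2) * G (real j * h) + 1/2 * G ((real j + 2) * h)"
      by (rule convex_onD[OF cvx]) (use h in auto)
    have 2: "(1 - 1/2) *\<^sub>R (real j * h) + (1/2) *\<^sub>R ((real j + 2) * h) = (real j + 1) * h"
      by (simp add: algebra_simps)
    have s1: "s (Suc (Suc j)) = (G ((real j + 2) * h) - G ((real j + 1) * h)) / h"
      unfolding s_def using h by (simp add: algebra_simps max_def)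
    have s2: "s (Suc j) = (G ((real j + 1) * h) - G (real j * h)) / h"
      unfolding s_def using h by (simp add: algebra_simps max_def)
    show ?thesis unfolding c_def Suc s1 s2 diff_divide_distrib[symmetric]
      using 1[unfolded 2] h by (intro divide_nonneg_pos) auto
  qed
  \<comment> \<open>Summation by parts: on the cell starting at j * h the calls in the money add up
    to the secant of the preceding cell, which is the announced delay.\<close>
  have sum: "G 0 + (\<Sum>i<j. c i * (l - real (Suc i) * h)) = G (max 0 (real j * h - h)) + s j * (l - real j * h)" for j l
  proof (induction j)
    case 0
    then show ?case using h by (simp add: s_def)
  next
    case (Suc j)
    have "s j * h = G (real j * h) - G (max 0 (real j * h - h))" using h by (simp add: s_def)
    moreover have "max 0 (real (Suc j) * h - h) = real j * h" using h by (simp add: algebra_simps)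
    ultimately show ?case using Suc by (simp add: c_def algebra_simps)
  qed
  have "ennreal (G (max 0 (l - 2 * h))) \<le> ennreal (G 0) + (\<Sum>i. ennreal (c i) * ennreal (max 0 (l - real (Suc i) * h))) \<and>
     ennreal (G 0) + (\<Sum>i. ennreal (c i) * ennreal (max 0 (l - real (Suc i) * h))) \<le> ennreal (G l)" if l: "l \<ge> 0" for l
  proof -
    \<comment> \<open>The cell that contains l: calls with strike (i + 1) * h are in the money
      exactly for i < j, so the series is a finite sum of linear terms.\<close>
    define j where "j = nat \<lfloor>l / h\<rfloor>"
    have j1: "real j * h \<le> l"
    proof -
      have "real j \<le> l / h" unfolding j_def using l h by (simp add: of_nat_nat)
      then show ?thesis using h by (simp add: field_simps)
    qed
    have j2: "l < (real j + 1) * h"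
    proof -
      have "l / h < real j + 1" unfolding j_def using l h by (simp add: of_nat_nat)
      then show ?thesis using h by (simp add: field_simps)
    qed
    have z: "max 0 (l - real (Suc i) * h) = 0" if "i \<ge> j" for i
    proof -
      have "(real j + 1) * h \<le> real (Suc i) * h" using that h by (intro mult_right_mono) auto
      then show ?thesis using j2 by simp
    qed
    have p: "max 0 (l - real (Suc i) * h) = l - real (Suc i) * h" if "i < j" for i
    proof -
      have "real (Suc i) * h \<le> real j * h" using that h by (intro mult_right_mono) auto
      then show ?thesis using j1 by simp
    qed
    have "(\<Sum>i. ennreal (c i) * ennreal (max 0 (l - real (Suc i) * h))) = (\<Sum>i<j. ennreal (c i) * ennreal (max 0 (l - real (Suc i) * h)))"
      using z by (intro suminf_finite) auto
    also have "\<dots> = ennreal (\<Sum>i<j. c i * (l - real (Suc i) * h))"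
    proof -
      have "(\<Sum>i<j. ennreal (c i) * ennreal (max 0 (l - real (Suc i) * h))) = (\<Sum>i<j. ennreal (c i * max 0 (l - real (Suc i) * h)))"
        using c0 by (simp add: ennreal_mult)
      also have "\<dots> = ennreal (\<Sum>i<j. c i * max 0 (l - real (Suc i) * h))"
        using c0 by (intro sum_ennreal) simp
      also have "(\<Sum>i<j. c i * max 0 (l - real (Suc i) * h)) = (\<Sum>i<j. c i * (l - real (Suc i) * h))"
        using p by (intro sum.cong) auto
      finally show ?thesis .
    qed
    finally have se: "(\<Sum>i. ennreal (c i) * ennreal (max 0 (l - real (Suc i) * h))) = ennreal (\<Sum>i<j. c i * (l - real (Suc i) * h))" .
    have eq: "ennreal (G 0) + (\<Sum>i. ennreal (c i) * ennreal (max 0 (l - real (Suc i) * h)))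
        = ennreal (G 0 + (\<Sum>i<j. c i * (l - real (Suc i) * h)))"
    proof -
      have "0 \<le> (\<Sum>i<j. c i * (l - real (Suc i) * h))"
      proof (intro sum_nonneg mult_nonneg_nonneg c0)
        fix i assume "i \<in> {..<j}"
        then have "0 \<le> max 0 (l - real (Suc i) * h)" "i < j" by auto
        then show "0 \<le> l - real (Suc i) * h" using p[of i] by metis
      qed
      then show ?thesis unfolding se using nn[of 0] by (simp add: ennreal_plus)
    qed
    define v where "v = G 0 + (\<Sum>i<j. c i * (l - real (Suc i) * h))"
    have v: "v = G (max 0 (real j * h - h)) + s j * (l - real j * h)" unfolding v_def by (rule sum)
    have "G (max 0 (l - 2 * h)) \<le> G (max 0 (real j * h - h))"
      using j2 by (intro G_le) (auto simp: algebra_simps)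
    also have "\<dots> \<le> v" using v s0[of j] j1 by simp
    finally have lo: "G (max 0 (l - 2 * h)) \<le> v" .
    have "v \<le> G (max 0 (real j * h - h)) + s j * h"
      unfolding v using s0[of j] j2 by (intro add_left_mono mult_left_mono) (auto simp: algebra_simps)
    also have "\<dots> = G (real j * h)" using h by (simp add: s_def)
    also have "\<dots> \<le> G l" using j1 h by (intro G_le) auto
    finally show ?thesis unfolding eq v_def[symmetric] using lo by (auto intro: ennreal_leI)
  qed
  then show ?thesis using c0 by blast
qed

text \<open>Non-negative call portfolios inherit the inequality between calls. They lie between a
  slightly shifted G and G itself, so Fatou on the side of Y and monotonicity on the side of Z
  suffice, in [0, \<infinity>] and without integrability questions.\<close>

lemma increasing_convex_order:
  fixes Y :: "'a \<Rightarrow> real" and Z :: "'b \<Rightarrow> real" and G :: "real \<Rightarrow> real"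
  assumes cvx: "convex_on {0..} G" and mono: "mono_on {0..} G" and nn: "\<And>x. 0 \<le> x \<Longrightarrow> 0 \<le> G x"
    and P: "prob_space P" and Q: "prob_space Q"
    and Y [measurable]: "Y \<in> borel_measurable P" and Y0: "\<And>x. 0 \<le> Y x"
    and Z [measurable]: "Z \<in> borel_measurable Q" and Z0: "\<And>x. 0 \<le> Z x"
    and call: "\<And>k. k > 0 \<Longrightarrow> (\<integral>\<^sup>+x. ennreal (max 0 (Y x - k)) \<partial>P) \<le> (\<integral>\<^sup>+x. ennreal (max 0 (Z x - k)) \<partial>Q)"
  shows "(\<integral>\<^sup>+x. ennreal (G (Y x)) \<partial>P) \<le> (\<integral>\<^sup>+x. ennreal (G (Z x)) \<partial>Q)"
proof -
  interpret P: prob_space P by fact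
  interpret Q: prob_space Q by fact
  define h where "h n = 1 / real (Suc n)" for n
  have h0: "h n > 0" for n by (simp add: h_def)
  have G_le: "G x \<le> G y" if "0 \<le> x" "x \<le> y" for x y
    using mono_onD[OF mono, of x y] that by auto
  have "\<forall>n. \<exists>c. (\<forall>i. 0 \<le> c i) \<and> (\<forall>l\<ge>0.
     ennreal (G (max 0 (l - 2 * h n))) \<le> ennreal (G 0) + (\<Sum>i. ennreal (c i) * ennreal (max 0 (l - real (Suc i) * h n))) \<and>
     ennreal (G 0) + (\<Sum>i. ennreal (c i) * ennreal (max 0 (l - real (Suc i) * h n))) \<le> ennreal (G l))"
    using convex_mono_call_approximation[OF cvx mono nn h0] by blast
  from choice[OF this] obtain c where cc: "\<forall>n. (\<forall>i. 0 \<le> c n i) \<and> (\<forall>l\<ge>0.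
     ennreal (G (max 0 (l - 2 * h n))) \<le> ennreal (G 0) + (\<Sum>i. ennreal (c n i) * ennreal (max 0 (l - real (Suc i) * h n))) \<and>
     ennreal (G 0) + (\<Sum>i. ennreal (c n i) * ennreal (max 0 (l - real (Suc i) * h n))) \<le> ennreal (G l))" by (elim exE)
  have c: "ennreal (G (max 0 (l - 2 * h n))) \<le> ennreal (G 0) + (\<Sum>i. ennreal (c n i) * ennreal (max 0 (l - real (Suc i) * h n)))"
    "ennreal (G 0) + (\<Sum>i. ennreal (c n i) * ennreal (max 0 (l - real (Suc i) * h n))) \<le> ennreal (G l)" if "l \<ge> 0" for n l
    using cc[rule_format, of n, THEN conjunct2, rule_format, OF that] by auto
  define K where "K n l = ennreal (G 0) + (\<Sum>i. ennreal (c n i) * ennreal (max 0 (l - real (Suc i) * h n)))" for n l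
  have [measurable]: "K n \<in> borel_measurable borel" for n unfolding K_def by measurable
  have KP: "(\<integral>\<^sup>+x. K n (Y x) \<partial>P) \<le> (\<integral>\<^sup>+x. K n (Z x) \<partial>Q)" for n
  proof -
    have "(\<integral>\<^sup>+x. K n (Y x) \<partial>P) = ennreal (G 0) + (\<Sum>i. ennreal (c n i) * (\<integral>\<^sup>+x. ennreal (max 0 (Y x - real (Suc i) * h n)) \<partial>P))"
      unfolding K_def by (simp add: nn_integral_add nn_integral_suminf nn_integral_cmult P.emeasure_space_1)
    also have "\<dots> \<le> ennreal (G 0) + (\<Sum>i. ennreal (c n i) * (\<integral>\<^sup>+x. ennreal (max 0 (Z x - real (Suc i) * h n)) \<partial>Q))"
      by (intro add_left_mono suminf_le mult_left_mono call) (auto simp: h0 intro!: mult_pos_pos)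
    also have "\<dots> = (\<integral>\<^sup>+x. K n (Z x) \<partial>Q)"
      unfolding K_def by (simp add: nn_integral_add nn_integral_suminf nn_integral_cmult Q.emeasure_space_1)
    finally show ?thesis .
  qed
  have cont: "continuous_on {0<..} G"
    by (rule convex_on_continuous) (auto intro: convex_on_subset[OF cvx])
  have h_lim: "h \<longlonglongrightarrow> 0" unfolding h_def by real_asymp
  have "(\<integral>\<^sup>+x. ennreal (G (Y x)) \<partial>P) \<le> (\<integral>\<^sup>+x. liminf (\<lambda>n. K n (Y x)) \<partial>P)"
  proof (rule nn_integral_mono)
    fix x
    have "(\<lambda>n. G (max 0 (Y x - 2 * h n))) \<longlonglongrightarrow> G (Y x)"
    \<comment> \<open>Convexity gives continuity only on the open half-line; at 0 the truncated
      shift leaves the argument fixed.\<close>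
    proof (cases "Y x = 0")
      case True
      then have "max 0 (Y x - 2 * h n) = 0" for n using h0[of n] by simp
      then show ?thesis using True by simp
    next
      case False
      then have Yx: "Y x > 0" using Y0[of x] by simp
      then have "isCont G (Y x)"
        using cont by (simp add: continuous_on_eq_continuous_at)
      moreover have "(\<lambda>n. max 0 (Y x - 2 * h n)) \<longlonglongrightarrow> max 0 (Y x - 2 * 0)"
        by (intro tendsto_intros h_lim)
      moreover have "max 0 (Y x - 2 * 0) = Y x" using Yx by simp
      ultimately show ?thesis using isCont_tendsto_compose[of "Y x" G] by metis
    qed
    then have "(\<lambda>n. ennreal (G (max 0 (Y x - 2 * h n)))) \<longlonglongrightarrow> ennreal (G (Y x))" by (rule tendsto_ennrealI)
    then have "ennreal (G (Y x)) = liminf (\<lambda>n. ennreal (G (max 0 (Y x - 2 * h n))))" by (simp add: lim_imp_Liminf)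
    also have "\<dots> \<le> liminf (\<lambda>n. K n (Y x))"
      using c(1) Y0 by (intro Liminf_mono) (auto simp: K_def)
    finally show "ennreal (G (Y x)) \<le> liminf (\<lambda>n. K n (Y x))" .
  qed
  also have "\<dots> \<le> liminf (\<lambda>n. \<integral>\<^sup>+x. K n (Y x) \<partial>P)" by (rule nn_integral_liminf) simp
  also have "\<dots> \<le> (\<integral>\<^sup>+x. ennreal (G (Z x)) \<partial>Q)"
  proof (rule Liminf_le)
    have "(\<integral>\<^sup>+x. K n (Y x) \<partial>P) \<le> (\<integral>\<^sup>+x. ennreal (G (Z x)) \<partial>Q)" for n
      using KP[of n] by (rule order_trans) (intro nn_integral_mono, unfold K_def, rule c(2), rule Z0)
    then show "\<forall>\<^sub>F n in sequentially. (\<integral>\<^sup>+x. K n (Y x) \<partial>P) \<le> (\<integral>\<^sup>+x. ennreal (G (Z x)) \<partial>Q)" by simp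
  qed simp
  finally show ?thesis .
qed

section \<open>Smooth approximations of the absolute value\<close>

text \<open>The factor 2 makes \<open>g\<close> half the second derivative of \<open>f\<close>, that
  is the generator of Brownian motion applied to \<open>f\<close>: f(B) minus the time integral of
  g(B) is the approximate martingale. The Lipschitz constant K of \<open>g\<close> controls third
  order Taylor errors.\<close>

definition quad_kernel :: "real \<Rightarrow> (real \<Rightarrow> real) \<Rightarrow> (real \<Rightarrow> real) \<Rightarrow> (real \<Rightarrow> real) \<Rightarrow> bool" where
  "quad_kernel K f P g \<longleftrightarrow> 0 \<le> K \<and> (\<forall>x. (f has_real_derivative P x) (at x)) \<and>
     (\<forall>x. (P has_real_derivative 2 * g x) (at x)) \<and> (\<forall>x y. \<bar>g x - g y\<bar> \<le> K * \<bar>x - y\<bar>)"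

lemma mvt_symmetric:
  fixes f f' :: "real \<Rightarrow> real"
  assumes "\<And>x. (f has_real_derivative f' x) (at x)"
  shows "\<exists>z. \<bar>z - x\<bar> \<le> \<bar>y - x\<bar> \<and> f y - f x = (y - x) * f' z"
proof -
  consider "x < y" | "x = y" | "y < x" by linarith
  then show ?thesis
  proof cases
    case 1
    then obtain z where "x < z" "z < y" "f y - f x = (y - x) * f' z" using MVT2[of x y f f'] assms by blast
    then show ?thesis by (intro exI[of _ z]) auto
  next
    case 2 then show ?thesis by auto
  next
    case 3
    then obtain z where "y < z" "z < x" "f x - f y = (x - y) * f' z" using MVT2[of y x f f'] assms by blast
    then show ?thesis by (intro exI[of _ z]) (auto simp: algebra_simps)
  qed
qed

text \<open>The mean value theorem is used twice, once for \<open>P\<close> with the Lipschitz bound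
  on \<open>g\<close>, once for the remainder \<open>u\<close>, whose derivative the first use has
  bounded by 2 * K times a square. The cubic error has mean of order h * sqrt h over a step of
  length h, so it vanishes when summed.\<close>

lemma quad_kernel_taylor:
  assumes "quad_kernel K f P g"
  shows "\<bar>f (x + y) - f x - P x * y - g x * y\<^sup>2\<bar> \<le> 2 * K * \<bar>y\<bar> ^ 3"
proof -
  note k = assms[unfolded quad_kernel_def]
  have K: "0 \<le> K" using k by blast
  have P: "\<bar>P (x + s) - P x - 2 * g x * s\<bar> \<le> 2 * K * s\<^sup>2" for s
  proof -
    obtain z where z: "\<bar>z - x\<bar> \<le> \<bar>x + s - x\<bar>" "P (x + s) - P x = (x + s - x) * (2 * g z)"
      using mvt_symmetric[of P "\<lambda>x. 2 * g x" x "x + s"] k by blast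
    have "P (x + s) - P x - 2 * g x * s = 2 * s * (g z - g x)" using z(2) by (simp add: algebra_simps)
    then have "\<bar>P (x + s) - P x - 2 * g x * s\<bar> = 2 * \<bar>s\<bar> * \<bar>g z - g x\<bar>" by (simp add: abs_mult)
    also have "\<dots> \<le> 2 * \<bar>s\<bar> * (K * \<bar>s\<bar>)"
    proof (intro mult_left_mono)
      have "\<bar>g z - g x\<bar> \<le> K * \<bar>z - x\<bar>" using k by blast
      also have "\<dots> \<le> K * \<bar>s\<bar>" using z(1) K by (intro mult_left_mono) auto
      finally show "\<bar>g z - g x\<bar> \<le> K * \<bar>s\<bar>" .
    qed auto
    also have "\<dots> = 2 * K * s\<^sup>2" by (simp add: power2_eq_square)
    finally show ?thesis .
  qed
  define u where "u s = f (x + s) - P x * s - g x * s\<^sup>2" for s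
  have du: "(u has_real_derivative (P (x + s) - P x - 2 * g x * s)) (at s)" for s
    unfolding u_def using k
    by (auto intro!: derivative_eq_intros DERIV_chain2[of f "P (x + s)" "\<lambda>s. x + s" s 1, simplified])
  obtain z where z: "\<bar>z - 0\<bar> \<le> \<bar>y - 0\<bar>" "u y - u 0 = (y - 0) * (P (x + z) - P x - 2 * g x * z)"
    using mvt_symmetric[OF du, of 0 y] by blast
  have "\<bar>f (x + y) - f x - P x * y - g x * y\<^sup>2\<bar> = \<bar>y\<bar> * \<bar>P (x + z) - P x - 2 * g x * z\<bar>"
    using z(2) by (simp add: u_def abs_mult[symmetric] algebra_simps)
  also have "\<dots> \<le> \<bar>y\<bar> * (2 * K * y\<^sup>2)"
    using P[of z] z(1) K by (intro mult_left_mono) (auto intro!: order_trans[OF P] mult_left_mono simp: power2_le_iff_abs_le abs_le_square_iff[symmetric])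
  also have "\<dots> = 2 * K * \<bar>y\<bar> ^ 3" by (simp add: power3_eq_cube power2_eq_square)
  finally show ?thesis .
qed

lemma quad_kernel_diff:
  assumes "quad_kernel K f P g" "quad_kernel K' f' P' g'"
  shows "quad_kernel (K + K') (\<lambda>x. f x - f' x) (\<lambda>x. P x - P' x) (\<lambda>x. g x - g' x)"
proof -
  have "\<bar>g x - g' x - (g y - g' y)\<bar> \<le> (K + K') * \<bar>x - y\<bar>" for x y
  proof -
    have "\<bar>g x - g y\<bar> \<le> K * \<bar>x - y\<bar>" "\<bar>g' x - g' y\<bar> \<le> K' * \<bar>x - y\<bar>"
      using assms by (auto simp: quad_kernel_def)
    then show ?thesis unfolding distrib_right by linarith
  qed
  then show ?thesis using assms
    by (auto simp: quad_kernel_def intro!: derivative_eq_intros)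
qed

lemma quad_kernel_continuous:
  assumes "quad_kernel K f P g"
  shows "continuous_on A f" "continuous_on A P" "continuous_on A g"
proof -
  show "continuous_on A f" "continuous_on A P"
    using assms by (auto simp: quad_kernel_def intro!: continuous_at_imp_continuous_on DERIV_isCont)
  have "K-lipschitz_on A g" using assms by (auto simp: quad_kernel_def lipschitz_on_def dist_real_def)
  then show "continuous_on A g" by (rule lipschitz_on_continuous_on)
qed

lemma quad_kernel_measurable:
  assumes "quad_kernel K f P g"
  shows "f \<in> borel_measurable borel" "P \<in> borel_measurable borel" "g \<in> borel_measurable borel"
  using quad_kernel_continuous[OF assms] by (auto intro: borel_measurable_continuous_onI)

text \<open>The trapezoid of unit mass equal to \<open>1 / (r + s)\<close> on \<open>[-r, r]\<close> and vanishing outside \<open>[-s, s]\<close>, written as a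
  second difference of positive parts so that its two antiderivatives are explicit.\<close>

definition trap_num :: "real \<Rightarrow> real \<Rightarrow> real \<Rightarrow> real" where
  "trap_num r s x = max 0 (x + s) + max 0 (x - s) - max 0 (x + r) - max 0 (x - r)"

definition trap :: "real \<Rightarrow> real \<Rightarrow> real \<Rightarrow> real" where
  "trap r s x = trap_num r s x / (s\<^sup>2 - r\<^sup>2)"

text \<open>The antiderivative of twice the trapezoid; the shift by 1 makes it run from -1 to 1, a
  smoothed sign function.\<close>

definition trap_P :: "real \<Rightarrow> real \<Rightarrow> real \<Rightarrow> real" where
  "trap_P r s x = ((max 0 (x + s))\<^sup>2 + (max 0 (x - s))\<^sup>2 - (max 0 (x + r))\<^sup>2 - (max 0 (x - r))\<^sup>2) / (s\<^sup>2 - r\<^sup>2) - 1"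

text \<open>The antiderivative of \<open>trap_P\<close>, a smoothed absolute value. Subtracting s^3
  - r^3 normalises it to vanish at 0, which gives the bound by |x| without a constant.\<close>

definition trap_F :: "real \<Rightarrow> real \<Rightarrow> real \<Rightarrow> real" where
  "trap_F r s x = ((max 0 (x + s))^3 + (max 0 (x - s))^3 - (max 0 (x + r))^3 - (max 0 (x - r))^3
      - (s^3 - r^3)) / (3 * (s\<^sup>2 - r\<^sup>2)) - x"

text \<open>Away from the kink the function is locally a power or 0; at the kink an exponent of at
  least 2 leaves a difference quotient of size at most |h| to the power
  \<open>Suc n\<close>.\<close>

lemma DERIV_max0_power:
  "((\<lambda>x::real. (max 0 (x + c)) ^ Suc (Suc n)) has_real_derivative (real (Suc (Suc n)) * (max 0 (x + c)) ^ Suc n)) (at x)"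
proof -
  consider "x + c > 0" | "x + c < 0" | "x + c = 0" by linarith
  then show ?thesis
  proof cases
    case 1
    have "((\<lambda>x. (x + c) ^ Suc (Suc n)) has_real_derivative (real (Suc (Suc n)) * (x + c) ^ Suc n)) (at x)"
      by (auto intro!: derivative_eq_intros simp del: power_Suc)
    then have "((\<lambda>x. (max 0 (x + c)) ^ Suc (Suc n)) has_real_derivative (real (Suc (Suc n)) * (x + c) ^ Suc n)) (at x)"
      by (rule has_field_derivative_transform_within_open[of _ _ _ "{-c<..}"]) (use 1 in auto)
    then show ?thesis using 1 by simp
  next
    case 2
    have "((\<lambda>x. 0) has_real_derivative 0) (at x)" by simp
    then have "((\<lambda>x. (max 0 (x + c)) ^ Suc (Suc n)) has_real_derivative 0) (at x)"
      by (rule has_field_derivative_transform_within_open[of _ _ _ "{..<-c}"]) (use 2 in auto)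
    then show ?thesis using 2 by simp
  next
    case 3
    have "((\<lambda>h. ((max 0 (x + h + c)) ^ Suc (Suc n) - (max 0 (x + c)) ^ Suc (Suc n)) / h) \<longlongrightarrow> 0) (at 0)"
    proof (rule Lim_null_comparison)
      show "((\<lambda>h::real. \<bar>h\<bar> ^ Suc n) \<longlongrightarrow> 0) (at 0)"
        by (auto intro!: tendsto_eq_intros)
      have "norm (((max 0 (x + h + c)) ^ Suc (Suc n) - (max 0 (x + c)) ^ Suc (Suc n)) / h) \<le> \<bar>h\<bar> ^ Suc n" if "h \<noteq> 0" for h
      proof -
        have e: "x + h + c = h" using 3 by simp
        show ?thesis unfolding e using 3 that by (cases "0 \<le> h") (auto simp: max_def intro!: mult_nonpos_nonneg)
      qed
      then show "\<forall>\<^sub>F h in at 0. norm (((max 0 (x + h + c)) ^ Suc (Suc n) - (max 0 (x + c)) ^ Suc (Suc n)) / h) \<le> \<bar>h\<bar> ^ Suc n"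
        by (auto simp: eventually_at_filter)
    qed
    then show ?thesis using 3 by (simp add: DERIV_def)
  qed
qed

context
  fixes r s :: real
  assumes rs: "0 < r" "r < s"
begin

lemma trap_denom: "0 < s\<^sup>2 - r\<^sup>2" "s\<^sup>2 - r\<^sup>2 = (s - r) * (s + r)"
  using rs by (auto simp: power2_eq_square algebra_simps mult_strict_mono)

lemma trap_nonneg: "0 \<le> trap r s x"
  unfolding trap_def using rs trap_denom by (intro divide_nonneg_pos) (auto simp: trap_num_def max_def)

lemma trap_le: "trap r s x \<le> 1 / (r + s)"
proof -
  have "trap_num r s x \<le> s - r" using rs by (auto simp: trap_num_def max_def)
  then have "trap r s x \<le> (s - r) / (s\<^sup>2 - r\<^sup>2)"
    unfolding trap_def using trap_denom by (intro divide_right_mono) auto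
  also have "\<dots> = 1 / (r + s)" using rs unfolding trap_denom(2) by (simp add: add.commute)
  finally show ?thesis .
qed

lemma trap_inside: "\<bar>x\<bar> \<le> r \<Longrightarrow> trap r s x = 1 / (r + s)"
proof -
  assume "\<bar>x\<bar> \<le> r"
  then have "trap_num r s x = s - r" using rs by (auto simp: trap_num_def max_def)
  then show ?thesis unfolding trap_def trap_denom(2) using rs by (simp add: add.commute)
qed

lemma trap_outside: "s \<le> \<bar>x\<bar> \<Longrightarrow> trap r s x = 0"
proof -
  assume "s \<le> \<bar>x\<bar>"
  then have "s \<le> x \<or> x \<le> -s" by linarith
  then have "trap_num r s x = 0" using rs by (auto simp: trap_num_def)
  then show ?thesis by (simp add: trap_def)
qed

lemma trap_kernel: "quad_kernel (4 / (s\<^sup>2 - r\<^sup>2)) (trap_F r s) (trap_P r s) (trap r s)"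
proof -
  have "\<bar>trap r s x - trap r s y\<bar> \<le> 4 / (s\<^sup>2 - r\<^sup>2) * \<bar>x - y\<bar>" for x y
  proof -
    have m: "\<bar>max 0 (x + c) - max 0 (y + c)\<bar> \<le> \<bar>x - y\<bar>" for c by linarith
    have "\<bar>trap_num r s x - trap_num r s y\<bar> \<le> 4 * \<bar>x - y\<bar>"
    proof -
      have aux: "\<bar>a + b - c - d - (a' + b' - c' - d')\<bar> \<le> 4 * D"
        if "\<bar>a - a'\<bar> \<le> D" "\<bar>b - b'\<bar> \<le> D" "\<bar>c - c'\<bar> \<le> D" "\<bar>d - d'\<bar> \<le> D" for a b c d a' b' c' d' D :: real
        using that unfolding abs_le_iff by linarith
      show ?thesis unfolding trap_num_def
        by (rule aux) (use m[of s] m[of "-s"] m[of r] m[of "-r"] in \<open>simp_all only: diff_conv_add_uminus\<close>)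
    qed
    then have "\<bar>trap_num r s x - trap_num r s y\<bar> / (s\<^sup>2 - r\<^sup>2) \<le> 4 * \<bar>x - y\<bar> / (s\<^sup>2 - r\<^sup>2)"
      using trap_denom by (intro divide_right_mono) auto
    moreover have "\<bar>trap r s x - trap r s y\<bar> = \<bar>trap_num r s x - trap_num r s y\<bar> / (s\<^sup>2 - r\<^sup>2)"
      using trap_denom by (simp add: trap_def diff_divide_distrib[symmetric] abs_divide)
    ultimately show ?thesis by simp
  qed
  moreover have "(trap_P r s has_real_derivative 2 * trap r s x) (at x)" for x
  proof -
    define q where "q = s\<^sup>2 - r\<^sup>2"
    have q: "q \<noteq> 0" using trap_denom(1) unfolding q_def by simp
    have d: "((\<lambda>x. (max 0 (x + c))\<^sup>2) has_real_derivative 2 * max 0 (x + c)) (at x)" for c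
      using DERIV_max0_power[of c 0 x] by (simp add: numeral_2_eq_2)
    show ?thesis unfolding trap_P_def[abs_def] trap_def trap_num_def q_def[symmetric]
      using DERIV_diff[OF DERIV_cdivide[OF DERIV_diff[OF DERIV_diff[OF DERIV_add[OF d[of s] d[of "-s"]] d[of r]] d[of "-r"]], of q] DERIV_const[of 1]]
      by (simp add: diff_divide_distrib add_divide_distrib algebra_simps)
  qed
  moreover have "(trap_F r s has_real_derivative trap_P r s x) (at x)" for x
  proof -
    define q where "q = s\<^sup>2 - r\<^sup>2"
    have q: "q \<noteq> 0" using trap_denom(1) unfolding q_def by simp
    have d: "((\<lambda>x. (max 0 (x + c))^3) has_real_derivative 3 * (max 0 (x + c))\<^sup>2) (at x)" for c
      using DERIV_max0_power[of c 1 x] by (simp add: numeral_3_eq_3 numeral_2_eq_2)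
    have d': "((\<lambda>x. (max 0 (x - c))^3) has_real_derivative 3 * (max 0 (x - c))\<^sup>2) (at x)" for c
      using d[of "-c"] by simp
    have eq: "(3 * u + 3 * v - 3 * y - 3 * z - 0) / (3 * q) - 1 = (u+v-y-z)/q - 1" for u v y z :: real
      using q by (simp add: field_simps)
    show ?thesis unfolding trap_F_def[abs_def] trap_P_def q_def[symmetric]
      by (rule DERIV_cong[OF DERIV_diff[OF DERIV_cdivide[OF DERIV_diff[OF DERIV_diff[OF DERIV_diff[OF
            DERIV_add[OF d[of s] d'[of s]] d[of r]] d'[of r]] DERIV_const]] DERIV_ident] eq])
  qed
  ultimately show ?thesis using trap_denom by (auto simp: quad_kernel_def)
qed

lemma trap_P_right: "s \<le> x \<Longrightarrow> trap_P r s x = 1"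
proof -
  assume "s \<le> x"
  then have "trap_P r s x = ((x+s)\<^sup>2 + (x-s)\<^sup>2 - (x+r)\<^sup>2 - (x-r)\<^sup>2) / (s\<^sup>2 - r\<^sup>2) - 1"
    using rs by (simp add: trap_P_def max_def)
  also have "(x+s)\<^sup>2 + (x-s)\<^sup>2 - (x+r)\<^sup>2 - (x-r)\<^sup>2 = 2 * (s\<^sup>2 - r\<^sup>2)" by algebra
  finally show ?thesis using trap_denom(1) by (simp add: field_simps)
qed

lemma trap_P_left: "x \<le> -s \<Longrightarrow> trap_P r s x = -1"
  using rs by (simp add: trap_P_def max_def)

lemma trap_P_abs_le: "\<bar>trap_P r s x\<bar> \<le> 1"
proof -
  have mono: "trap_P r s x \<le> trap_P r s y" if "x \<le> y" for x y
    by (rule DERIV_nonneg_imp_nondecreasing[OF that])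
       (use trap_kernel trap_nonneg in \<open>auto simp: quad_kernel_def intro!: exI\<close>)
  have "-1 \<le> trap_P r s x"
    using mono[of "min x (-s)" x] trap_P_left[of "min x (-s)"] by simp
  moreover have "trap_P r s x \<le> 1"
    using mono[of x "max x s"] trap_P_right[of "max x s"] by simp
  ultimately show ?thesis by simp
qed

lemma trap_F_0: "trap_F r s 0 = 0"
  using rs by (simp add: trap_F_def max_def)

lemma trap_F_lipschitz: "\<bar>trap_F r s y - trap_F r s x\<bar> \<le> \<bar>y - x\<bar>"
proof -
  obtain z where "trap_F r s y - trap_F r s x = (y - x) * trap_P r s z"
    using mvt_symmetric[of "trap_F r s" "trap_P r s" x y] trap_kernel by (auto simp: quad_kernel_def)
  then show ?thesis using mult_left_mono[OF trap_P_abs_le, of "\<bar>y - x\<bar>" z] by (simp add: abs_mult)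
qed

lemma trap_F_abs_le: "\<bar>trap_F r s x\<bar> \<le> \<bar>x\<bar>"
  using trap_F_lipschitz[of x 0] trap_F_0 by simp

text \<open>Outside [-s, s] the slope is exactly that of |x|, so the discrepancy is frozen at its
  value at the endpoints, where both functions are at most s in absolute value.\<close>

lemma trap_F_approx: "\<bar>trap_F r s x - \<bar>x\<bar>\<bar> \<le> 2 * s"
proof -
  have der: "(trap_F r s has_real_derivative trap_P r s x) (at x)" for x
    using trap_kernel by (auto simp: quad_kernel_def)
  have R: "trap_F r s x = trap_F r s s + (x - s)" if "s \<le> x"
  proof (cases "s = x")
    case False
    then have "s < x" using that by simp
    then obtain z where "s < z" "z < x" "trap_F r s x - trap_F r s s = (x - s) * trap_P r s z"
      using MVT2[of s x "trap_F r s" "trap_P r s"] der by blast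
    then show ?thesis using trap_P_right[of z] by simp
  qed simp
  have L: "trap_F r s x = trap_F r s (-s) + (-s - x)" if "x \<le> -s"
  proof (cases "x = -s")
    case False
    then have "x < -s" using that by simp
    then obtain z where "x < z" "z < -s" "trap_F r s (-s) - trap_F r s x = (-s - x) * trap_P r s z"
      using MVT2[of x "-s" "trap_F r s" "trap_P r s"] der by blast
    then show ?thesis using trap_P_left[of z] by simp
  qed simp
  show ?thesis using R L trap_F_abs_le[of s] trap_F_abs_le[of "-s"] trap_F_abs_le[of x] rs by linarith
qed

text \<open>This product is the cross term that arises when the additive functional moves while
  \<open>trap_F\<close> is not yet 0. On the support of the kernel the first factor is at most s and
  the second at most 1 / (r + s), so the product costs no more than the occupation of (-s,
  s).\<close>

lemma trap_F_mult_trap: "\<bar>trap_F r s x\<bar> * trap r s x \<le> indicator {-s<..<s} x"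
proof (cases "s \<le> \<bar>x\<bar>")
  case True
  then show ?thesis using trap_outside by simp
next
  case False
  have "\<bar>trap_F r s x\<bar> * trap r s x \<le> s * (1 / (r + s))"
    using trap_F_abs_le[of x] trap_le[of x] trap_nonneg[of x] False rs by (intro mult_mono) auto
  also have "\<dots> \<le> 1" using rs by simp
  finally show ?thesis using False by (auto simp: indicator_def abs_less_iff)
qed

end

section \<open>Moments of Brownian increments\<close>

lemma sum_inverse_sqrt_le: "(\<Sum>i<n. 1 / sqrt (real (Suc i))) \<le> 2 * sqrt (real n)"
proof (induction n)
  case (Suc n)
  have "2 * sqrt n + 1 / sqrt (Suc n) \<le> 2 * sqrt (Suc n)"
  proof -
    define a b where "a = sqrt n" and "b = sqrt (Suc n)"
    have b: "b > 0" "b\<^sup>2 = a\<^sup>2 + 1" "a \<ge> 0" by (auto simp: a_def b_def)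
    have "0 \<le> (b - a)\<^sup>2" by simp
    then have "2 * a * b + 1 \<le> 2 * b\<^sup>2" using b by (simp add: power2_eq_square algebra_simps)
    then show ?thesis using b unfolding a_def[symmetric] b_def[symmetric]
      by (simp add: field_simps power2_eq_square)
  qed
  then show ?case using Suc by simp
qed simp

locale bm =
  fixes M :: "'a measure" and F :: "real \<Rightarrow> 'a measure" and B :: "real \<Rightarrow> 'a \<Rightarrow> real"
  assumes BM: "brownian_motion M F B"

sublocale bm \<subseteq> prob_space M
  using BM by (simp add: brownian_motion_def)

context bm
begin

lemma filt: "is_filtration M F" using BM by (simp add: brownian_motion_def)
lemma space_F [simp]: "space (F t) = space M" using filt by (simp add: is_filtration_def)
lemma sets_F_M: "sets (F t) \<subseteq> sets M" using filt by (simp add: is_filtration_def)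
lemma sets_F_mono: "s \<le> t \<Longrightarrow> sets (F s) \<subseteq> sets (F t)" using filt by (simp add: is_filtration_def)

lemma measurable_F_mono: "X \<in> measurable (F s) N \<Longrightarrow> s \<le> t \<Longrightarrow> X \<in> measurable (F t) N"
  using sets_F_mono[of s t] by (auto simp: measurable_def)

lemma measurable_F_M: "X \<in> measurable (F s) N \<Longrightarrow> X \<in> measurable M N"
  using sets_F_M[of s] by (auto simp: measurable_def)

lemma B0: "\<omega> \<in> space M \<Longrightarrow> B 0 \<omega> = 0" using BM by (simp add: brownian_motion_def)

lemma B_cont: "\<omega> \<in> space M \<Longrightarrow> continuous_on {0..} (\<lambda>t. B t \<omega>)"
  using BM by (simp add: brownian_motion_def)

lemma B_adapted: "0 \<le> t \<Longrightarrow> B t \<in> borel_measurable (F t)"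
  using BM by (simp add: brownian_motion_def)

lemma B_F: "0 \<le> s \<Longrightarrow> s \<le> t \<Longrightarrow> B s \<in> borel_measurable (F t)"
  using B_adapted measurable_F_mono by blast

lemma B_M: "0 \<le> t \<Longrightarrow> B t \<in> borel_measurable M"
  using B_adapted measurable_F_M by blast

lemma incr_distributed: "0 \<le> s \<Longrightarrow> s < t \<Longrightarrow>
   distributed M lborel (\<lambda>\<omega>. B t \<omega> - B s \<omega>) (\<lambda>x. ennreal (normal_density 0 (sqrt (t - s)) x))"
  using BM by (auto simp: brownian_motion_def)

text \<open>The definition of Brownian motion gives the product rule for events of
  \<open>F s\<close> and increment events; the preimages under W and under the increment are
  Int-stable generators, which lifts it to independence of the random variables.\<close>

lemma incr_indep:
  assumes st: "0 \<le> s" "s \<le> t" and W: "W \<in> borel_measurable (F s)"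
  shows "indep_var borel W borel (\<lambda>\<omega>. B t \<omega> - B s \<omega>)"
proof -
  have [measurable]: "B t \<in> borel_measurable M" "B s \<in> borel_measurable M" using st B_M by auto
  have WM: "W \<in> borel_measurable M" using W measurable_F_M by blast
  let ?D = "\<lambda>\<omega>. B t \<omega> - B s \<omega>"
  let ?A = "{W -` A \<inter> space M |A. A \<in> sets borel}" and ?C = "{?D -` C \<inter> space M |C. C \<in> sets borel}"
  have "indep_set (sigma_sets (space M) ?A) (sigma_sets (space M) ?C)"
  proof (rule indep_set_sigma_sets)
    show "indep_set ?A ?C"
    proof (rule indep_setI)
      show "?A \<subseteq> events" using WM by (auto intro: measurable_sets)
      show "?C \<subseteq> events" by (auto intro!: measurable_sets)
      fix a c assume "a \<in> ?A" "c \<in> ?C"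
      then obtain A C where AC: "A \<in> sets borel" "a = W -` A \<inter> space M" "C \<in> sets borel" "c = ?D -` C \<inter> space M" by blast
      have "a \<in> sets (F s)" using measurable_sets[OF W AC(1)] AC(2) by simp
      moreover have "c = {\<omega>\<in>space M. ?D \<omega> \<in> C}" using AC(4) by auto
      ultimately show "prob (a \<inter> c) = prob a * prob c"
        using BM st AC(3) by (auto simp: brownian_motion_def)
    qed
    show "Int_stable ?A" 
    proof (rule Int_stableI)
      fix a b assume "a \<in> ?A" "b \<in> ?A"
      then obtain A A' where "A \<in> sets borel" "A' \<in> sets borel" "a = W -` A \<inter> space M" "b = W -` A' \<inter> space M" by blast
      then have "A \<inter> A' \<in> sets borel" "a \<inter> b = W -` (A \<inter> A') \<inter> space M" by auto
      then show "a \<inter> b \<in> ?A" by blast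
    qed
    show "Int_stable ?C" 
    proof (rule Int_stableI)
      fix a b assume "a \<in> ?C" "b \<in> ?C"
      then obtain A A' where "A \<in> sets borel" "A' \<in> sets borel" "a = ?D -` A \<inter> space M" "b = ?D -` A' \<inter> space M" by blast
      then have "A \<inter> A' \<in> sets borel" "a \<inter> b = ?D -` (A \<inter> A') \<inter> space M" by auto
      then show "a \<inter> b \<in> ?C" by blast
    qed
  qed
  then show ?thesis using WM by (simp add: indep_var_eq)
qed

lemma expectation_mult_incr:
  fixes W :: "'a \<Rightarrow> real" and p :: "real \<Rightarrow> real"
  assumes st: "0 \<le> s" "s \<le> t" and W: "W \<in> borel_measurable (F s)" "integrable M W"
    and p [measurable]: "p \<in> borel_measurable borel" and ip: "integrable M (\<lambda>\<omega>. p (B t \<omega> - B s \<omega>))"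
  shows "integrable M (\<lambda>\<omega>. W \<omega> * p (B t \<omega> - B s \<omega>))"
    and "(\<integral>\<omega>. W \<omega> * p (B t \<omega> - B s \<omega>) \<partial>M) = (\<integral>\<omega>. W \<omega> \<partial>M) * (\<integral>\<omega>. p (B t \<omega> - B s \<omega>) \<partial>M)"
proof -
  have i: "indep_var borel (id \<circ> W) borel (p \<circ> (\<lambda>\<omega>. B t \<omega> - B s \<omega>))"
    by (rule indep_var_compose[OF incr_indep[OF st W(1)]]) auto
  then have i: "indep_var borel W borel (\<lambda>\<omega>. p (B t \<omega> - B s \<omega>))" by (simp add: comp_def)
  show "integrable M (\<lambda>\<omega>. W \<omega> * p (B t \<omega> - B s \<omega>))"
    by (rule indep_var_integrable[OF i W(2) ip])
  show "(\<integral>\<omega>. W \<omega> * p (B t \<omega> - B s \<omega>) \<partial>M) = (\<integral>\<omega>. W \<omega> \<partial>M) * (\<integral>\<omega>. p (B t \<omega> - B s \<omega>) \<partial>M)"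
    by (rule indep_var_lebesgue_integral[OF i W(2) ip])
qed

lemma incr_moments:
  assumes st: "0 \<le> s" "s < t"
  shows "integrable M (\<lambda>\<omega>. (B t \<omega> - B s \<omega>) ^ k)"
    and "(\<integral>\<omega>. (B t \<omega> - B s \<omega>) \<partial>M) = 0"
    and "(\<integral>\<omega>. (B t \<omega> - B s \<omega>)\<^sup>2 \<partial>M) = t - s"
    and "(\<integral>\<omega>. (B t \<omega> - B s \<omega>)^4 \<partial>M) = 3 * (t - s)\<^sup>2"
    and "(\<integral>\<omega>. (B t \<omega> - B s \<omega>)^6 \<partial>M) = 15 * (t - s)^3"
    and "(\<integral>\<omega>. \<bar>B t \<omega> - B s \<omega>\<bar>^3 \<partial>M) \<le> 2 * (t - s) * sqrt (t - s)"
    and "integrable M (\<lambda>\<omega>. \<bar>B t \<omega> - B s \<omega>\<bar> ^ k)"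
proof -
  define h where "h = t - s"
  have h: "h > 0" "sqrt h > 0" using st by (auto simp: h_def)
  note D = incr_distributed[OF st, folded h_def]
  have int: "(\<integral>\<omega>. p (B t \<omega> - B s \<omega>) \<partial>M) = (\<integral>x. normal_density 0 (sqrt h) x * p x \<partial>lborel)"
    if "p \<in> borel_measurable borel" for p :: "real \<Rightarrow> real"
    using distributed_integral[OF D, of p] that by simp
  have intg: "integrable M (\<lambda>\<omega>. p (B t \<omega> - B s \<omega>)) \<longleftrightarrow> integrable lborel (\<lambda>x. normal_density 0 (sqrt h) x * p x)"
    if "p \<in> borel_measurable borel" for p :: "real \<Rightarrow> real"
    using distributed_integrable[OF D, of p] that by simp
  show i1: "integrable M (\<lambda>\<omega>. (B t \<omega> - B s \<omega>) ^ k)" for k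
    using integrable_normal_moment[OF h(2), of 0 k] intg[of "\<lambda>x. x ^ k"] by simp
  show i2: "integrable M (\<lambda>\<omega>. \<bar>B t \<omega> - B s \<omega>\<bar> ^ k)" for k
    using integrable_normal_moment_abs[OF h(2), of 0 k] intg[of "\<lambda>x. \<bar>x\<bar> ^ k"] by simp
  show "(\<integral>\<omega>. (B t \<omega> - B s \<omega>) \<partial>M) = 0"
    using integral_normal_moment_odd[OF h(2), of 0 0] int[of "\<lambda>x. x"] by simp
  have e2: "(\<integral>\<omega>. (B t \<omega> - B s \<omega>)\<^sup>2 \<partial>M) = h"
    using integral_normal_moment_even[OF h(2), of 0 1] int[of "\<lambda>x. x\<^sup>2"] h by simp
  have e4: "(\<integral>\<omega>. (B t \<omega> - B s \<omega>)^4 \<partial>M) = 3 * h\<^sup>2"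
    using integral_normal_moment_even[OF h(2), of 0 2] int[of "\<lambda>x. x^4"] h
    by (simp add: fact_numeral power_divide)
  have e6: "(\<integral>\<omega>. (B t \<omega> - B s \<omega>)^6 \<partial>M) = 15 * h^3"
    using integral_normal_moment_even[OF h(2), of 0 3] int[of "\<lambda>x. x^6"] h
    by (simp add: fact_numeral power_divide)
  show "(\<integral>\<omega>. (B t \<omega> - B s \<omega>)\<^sup>2 \<partial>M) = t - s"
    "(\<integral>\<omega>. (B t \<omega> - B s \<omega>)^4 \<partial>M) = 3 * (t - s)\<^sup>2"
    "(\<integral>\<omega>. (B t \<omega> - B s \<omega>)^6 \<partial>M) = 15 * (t - s)^3"
    using e2 e4 e6 by (simp_all add: h_def)
  \<comment> \<open>The arithmetic-geometric mean inequality between the second and fourth powers.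
    The weight sqrt h balances their means h and 3 h^2 and gives (1 + 3) / 2 = 2 as the constant of
    the third absolute moment.\<close>
  have am: "\<bar>x\<bar>^3 \<le> (sqrt h * x\<^sup>2 + x^4 / sqrt h) / 2" for x
  proof -
    define y where "y = \<bar>x\<bar>"
    have y: "x\<^sup>2 = y\<^sup>2" "x^4 = y^4" by (simp_all add: y_def power_even_abs)
    have "0 \<le> (sqrt h - y)\<^sup>2 * y\<^sup>2" by simp
    also have "\<dots> = sqrt h * (sqrt h * y\<^sup>2) - sqrt h * (2 * y^3) + y^4" by algebra
    finally have "sqrt h * (2 * y^3) \<le> sqrt h * (sqrt h * y\<^sup>2 + y^4 / sqrt h)"
      using h by (simp add: distrib_left)
    then have "2 * y^3 \<le> sqrt h * y\<^sup>2 + y^4 / sqrt h" using h(2) mult_le_cancel_left_pos by blast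
    then show ?thesis unfolding y y_def[symmetric] by simp
  qed
  have "(\<integral>\<omega>. \<bar>B t \<omega> - B s \<omega>\<bar>^3 \<partial>M) \<le> (\<integral>\<omega>. (sqrt h * (B t \<omega> - B s \<omega>)\<^sup>2 + (B t \<omega> - B s \<omega>)^4 / sqrt h) / 2 \<partial>M)"
    by (intro integral_mono am i2 integrable_divide Bochner_Integration.integrable_add integrable_mult_right i1)
  also have "\<dots> = (sqrt h * h + 3 * h\<^sup>2 / sqrt h) / 2"
    using i1 e2 e4 by simp
  also have "\<dots> = 2 * h * sqrt h"
  proof -
    have "h\<^sup>2 / sqrt h = h * sqrt h" using h real_sqrt_mult_self[of h]
      by (simp add: field_simps power2_eq_square)
    then show ?thesis by (simp add: algebra_simps)
  qed
  finally show "(\<integral>\<omega>. \<bar>B t \<omega> - B s \<omega>\<bar>^3 \<partial>M) \<le> 2 * (t - s) * sqrt (t - s)" by (simp add: h_def)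
qed

lemma B_small_ball:
  assumes t: "t > 0" and a: "a > 0"
  shows "prob {\<omega>\<in>space M. \<bar>B t \<omega>\<bar> < a} \<le> a / sqrt t"
proof -
  have [measurable]: "B t \<in> borel_measurable M" "B 0 \<in> borel_measurable M" using t B_M by auto
  have D: "distributed M lborel (\<lambda>\<omega>. B t \<omega> - B 0 \<omega>) (\<lambda>x. ennreal (normal_density 0 (sqrt t) x))"
    using incr_distributed[of 0 t] t by simp
  have "emeasure M {\<omega>\<in>space M. \<bar>B t \<omega>\<bar> < a} = (\<integral>\<^sup>+\<omega>. indicator {-a<..<a} (B t \<omega> - B 0 \<omega>) \<partial>M)"
  proof -
    have "emeasure M {\<omega>\<in>space M. \<bar>B t \<omega>\<bar> < a} = (\<integral>\<^sup>+\<omega>. indicator {\<omega>\<in>space M. \<bar>B t \<omega>\<bar> < a} \<omega> \<partial>M)"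
      by (rule nn_integral_indicator[symmetric]) measurable
    also have "\<dots> = (\<integral>\<^sup>+\<omega>. indicator {-a<..<a} (B t \<omega> - B 0 \<omega>) \<partial>M)"
      by (rule nn_integral_cong) (auto simp: indicator_def B0 abs_less_iff)
    finally show ?thesis .
  qed
  also have "\<dots> = (\<integral>\<^sup>+x. ennreal (normal_density 0 (sqrt t) x) * indicator {-a<..<a} x \<partial>lborel)"
    by (rule distributed_nn_integral[OF D, symmetric]) simp
  also have "\<dots> \<le> (\<integral>\<^sup>+x. ennreal (1 / (2 * sqrt t)) * indicator {-a<..<a} x \<partial>lborel)"
  proof (intro nn_integral_mono mult_right_mono ennreal_leI)
    fix x
    have "normal_density 0 (sqrt t) x \<le> 1 / sqrt (2 * pi * t)"
      using t by (simp add: normal_density_def divide_right_mono)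
    \<comment> \<open>Here \<pi> \<ge> 2 replaces the normalising constant by a convenient one; an
      interval of length 2 a then yields exactly a / sqrt t.\<close>
    also have "\<dots> \<le> 1 / sqrt (4 * t)"
      using t pi_ge_two by (intro divide_left_mono real_sqrt_le_mono) auto
    also have "\<dots> = 1 / (2 * sqrt t)" by (simp add: real_sqrt_mult)
    finally show "normal_density 0 (sqrt t) x \<le> 1 / (2 * sqrt t)" .
  qed simp
  also have "\<dots> = ennreal (1 / (2 * sqrt t)) * ennreal (2 * a)"
    using a by (simp add: nn_integral_cmult)
  also have "\<dots> = ennreal (a / sqrt t)" using t a by (simp add: ennreal_mult[symmetric])
  finally show ?thesis using t a by (simp add: emeasure_eq_measure)
qed

text \<open>The discrete form of integrating a / sqrt t over [0, T], which gives 2 a sqrt T. The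
  grid point 0, where the small-ball bound is void, is paid for by one full step T / N.\<close>

lemma grid_occupation:
  assumes T: "T > 0" and N: "N > 0" and a: "a > 0"
  shows "(\<Sum>i<N. T / real N * prob {\<omega>\<in>space M. \<bar>B (real i * (T / real N)) \<omega>\<bar> < a}) \<le> T / real N + 2 * a * sqrt T"
proof -
  define h where "h = T / real N"
  have h: "h > 0" using T N by (simp add: h_def)
  obtain n where n: "N = Suc n" using N by (cases N) auto
  have "(\<Sum>i<N. h * prob {\<omega>\<in>space M. \<bar>B (real i * h) \<omega>\<bar> < a})
    = h * prob {\<omega>\<in>space M. \<bar>B (real 0 * h) \<omega>\<bar> < a} + (\<Sum>i<n. h * prob {\<omega>\<in>space M. \<bar>B (real (Suc i) * h) \<omega>\<bar> < a})"
    unfolding n by (rule sum.lessThan_Suc_shift)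
  also have "\<dots> \<le> h * 1 + (\<Sum>i<n. h * (a / (sqrt (real (Suc i)) * sqrt h)))"
    using h B_small_ball[OF _ a] by (intro add_mono mult_left_mono sum_mono) (auto simp: real_sqrt_mult[symmetric])
  also have "(\<Sum>i<n. h * (a / (sqrt (real (Suc i)) * sqrt h))) = a * sqrt h * (\<Sum>i<n. 1 / sqrt (real (Suc i)))"
    unfolding sum_distrib_left
  proof (rule sum.cong)
    fix i
    have "h = sqrt h * sqrt h" using h by simp
    then show "h * (a / (sqrt (real (Suc i)) * sqrt h)) = a * sqrt h * (1 / sqrt (real (Suc i)))"
      using h by (simp add: field_simps)
  qed simp
  also have "\<dots> \<le> a * sqrt h * (2 * sqrt (real n))"
    using a h by (intro mult_left_mono sum_inverse_sqrt_le) auto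
  also have "\<dots> \<le> 2 * a * sqrt T"
  proof -
    have "sqrt h * sqrt n \<le> sqrt T" unfolding real_sqrt_mult[symmetric]
      using T by (intro real_sqrt_le_mono) (simp add: h_def n field_simps)
    then show ?thesis using a mult_left_mono[of "sqrt h * sqrt n" "sqrt T" "2 * a"] by (simp add: algebra_simps)
  qed
  finally show ?thesis by (simp add: h_def)
qed

end

section \<open>A maximal inequality for additive functionals\<close>

lemma grid_point_tendsto:
  fixes t T :: real
  assumes "0 \<le> t" "t \<le> T" "T > 0"
  shows "(\<lambda>m. real (nat \<lfloor>t * real (Suc m) / T\<rfloor>) * (T / real (Suc m))) \<longlonglongrightarrow> t"
    and "nat \<lfloor>t * real (Suc m) / T\<rfloor> \<le> Suc m"
proof -
  have lim: "(\<lambda>m. t - T / real (Suc m)) \<longlonglongrightarrow> t" by real_asymp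
  have lo: "t - T / real (Suc m) \<le> real (nat \<lfloor>t * real (Suc m) / T\<rfloor>) * (T / real (Suc m))" for m
  proof -
    have "t * real (Suc m) / T - 1 \<le> real (nat \<lfloor>t * real (Suc m) / T\<rfloor>)" using assms by (simp add: of_nat_nat)
    then have "(t * real (Suc m) / T - 1) * (T / real (Suc m)) \<le> real (nat \<lfloor>t * real (Suc m) / T\<rfloor>) * (T / real (Suc m))"
      using assms by (intro mult_right_mono) auto
    moreover have "(t * real (Suc m) / T - 1) * (T / real (Suc m)) = t - T / real (Suc m)"
    proof -
      have "(t * n / T - 1) * (T / n) = t - T / n" if "n > 0" for n using that assms by (simp add: field_simps)
      then show ?thesis by simp
    qed
    ultimately show ?thesis by simp
  qed
  have up: "real (nat \<lfloor>t * real (Suc m) / T\<rfloor>) * (T / real (Suc m)) \<le> t" for m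
  proof -
    have "real (nat \<lfloor>t * real (Suc m) / T\<rfloor>) \<le> t * real (Suc m) / T" using assms by (simp add: of_nat_nat)
    then have "real (nat \<lfloor>t * real (Suc m) / T\<rfloor>) * (T / real (Suc m)) \<le> (t * real (Suc m) / T) * (T / real (Suc m))"
      using assms by (intro mult_right_mono) auto
    then show ?thesis using assms by simp
  qed
  show "(\<lambda>m. real (nat \<lfloor>t * real (Suc m) / T\<rfloor>) * (T / real (Suc m))) \<longlonglongrightarrow> t"
    by (rule tendsto_sandwich[OF always_eventually[OF allI[OF lo]] always_eventually[OF allI[OF up]] lim tendsto_const])
  have "t * real (Suc m) / T \<le> real (Suc m)"
    using mult_right_mono[of t T "real (Suc m)"] assms by (simp add: divide_le_eq mult.commute del: of_nat_Suc)
  then show "nat \<lfloor>t * real (Suc m) / T\<rfloor> \<le> Suc m" by linarith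
qed

context bm
begin

definition add_fun :: "(real \<Rightarrow> real) \<Rightarrow> real \<Rightarrow> 'a \<Rightarrow> real" where
  "add_fun g t \<omega> = integral {0..t} (\<lambda>s. g (B s \<omega>))"

lemma cont_comp_B:
  assumes "\<omega> \<in> space M" "continuous_on UNIV g"
  shows "continuous_on {0..} (\<lambda>s. g (B s \<omega>))"
  using continuous_on_compose2[OF assms(2) B_cont[OF assms(1)]] by simp

lemma add_fun_cont:
  assumes "\<omega> \<in> space M" "continuous_on UNIV g"
  shows "continuous_on {0..T} (\<lambda>t. add_fun g t \<omega>)"
proof -
  have "continuous_on {0..T} (\<lambda>s. g (B s \<omega>))"
    by (rule continuous_on_subset[OF cont_comp_B[OF assms]]) auto
  then show ?thesis unfolding add_fun_def by (intro indefinite_integral_continuous_1 integrable_continuous_real)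
qed

lemma riemann_add_fun:
  assumes "\<omega> \<in> space M" "continuous_on UNIV g" "T > 0" "e > 0"
  shows "\<exists>N0. \<forall>N\<ge>N0. \<forall>i\<le>N. N > 0 \<longrightarrow>
     \<bar>(\<Sum>j<i. T / real N * g (B (real j * (T / real N)) \<omega>)) - add_fun g (real i * (T / real N)) \<omega>\<bar> \<le> e"
  unfolding add_fun_def
  by (rule riemann_sums_uniform[OF continuous_on_subset[OF cont_comp_B[OF assms(1,2)]] assms(3,4)]) auto

text \<open>The path integral is a pointwise limit of Riemann sums whose nodes lie in [0, t], so
  \<open>F t\<close>-measurability follows from that of the single values of B.\<close>

lemma add_fun_adapted:
  assumes g: "continuous_on UNIV g" and t: "0 \<le> t"
  shows "add_fun g t \<in> borel_measurable (F t)"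
proof (cases "t = 0")
  case True
  then show ?thesis by (simp add: add_fun_def[abs_def])
next
  case False
  then have t: "t > 0" using t by simp
  have [measurable]: "g \<in> borel_measurable borel" using g by (rule borel_measurable_continuous_onI)
  show ?thesis
  proof (rule borel_measurable_LIMSEQ_real)
    show "(\<lambda>\<omega>. \<Sum>j<Suc m. t / real (Suc m) * g (B (real j * (t / real (Suc m))) \<omega>)) \<in> borel_measurable (F t)" for m
    proof (intro borel_measurable_sum borel_measurable_times borel_measurable_const measurable_compose[OF _ \<open>g \<in> _\<close>] B_F)
      fix j assume "j \<in> {..<Suc m}"
      then have "real j \<le> real (Suc m)" by auto
      then have "real j * (t / real (Suc m)) \<le> real (Suc m) * (t / real (Suc m))"
        using t by (intro mult_right_mono) auto
      then show "real j * (t / real (Suc m)) \<le> t" by simp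
    qed (use t in auto)
    show "(\<lambda>m. \<Sum>j<Suc m. t / real (Suc m) * g (B (real j * (t / real (Suc m))) \<omega>)) \<longlonglongrightarrow> add_fun g t \<omega>"
      if \<omega>: "\<omega> \<in> space (F t)" for \<omega>
    proof (rule LIMSEQ_I)
      fix r :: real assume r: "r > 0"
      obtain N0 where N0: "\<forall>N\<ge>N0. \<forall>i\<le>N. N > 0 \<longrightarrow>
         \<bar>(\<Sum>j<i. t / real N * g (B (real j * (t / real N)) \<omega>)) - add_fun g (real i * (t / real N)) \<omega>\<bar> \<le> r / 2"
        using riemann_add_fun[OF _ g t, of \<omega> "r / 2"] \<omega> r unfolding space_F by (meson half_gt_zero)
      show "\<exists>no. \<forall>n\<ge>no. norm ((\<Sum>j<Suc n. t / real (Suc n) * g (B (real j * (t / real (Suc n))) \<omega>)) - add_fun g t \<omega>) < r"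
      proof (intro exI[of _ N0] allI impI)
        fix n assume "N0 \<le> n"
        then have "\<bar>(\<Sum>j<Suc n. t / real (Suc n) * g (B (real j * (t / real (Suc n))) \<omega>)) - add_fun g (real (Suc n) * (t / real (Suc n))) \<omega>\<bar> \<le> r / 2"
          using N0[rule_format, of "Suc n" "Suc n"] by simp
        moreover have "real (Suc n) * (t / real (Suc n)) = t" by simp
        ultimately have "\<bar>(\<Sum>j<Suc n. t / real (Suc n) * g (B (real j * (t / real (Suc n))) \<omega>)) - add_fun g t \<omega>\<bar> \<le> r / 2" by (simp only:)
        then show "norm ((\<Sum>j<Suc n. t / real (Suc n) * g (B (real j * (t / real (Suc n))) \<omega>)) - add_fun g t \<omega>) < r"
          using r unfolding real_norm_def by linarith
      qed
    qed
  qed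
qed

text \<open>Freezing the almost-martingale \<open>Y\<close> when it first exceeds \<open>lam\<close> keeps it bounded in the cross terms.\<close>

lemma maximal_grid:
  assumes qk: "quad_kernel K f P g" and f0: "f 0 = 0" and G: "\<And>x. \<bar>g x\<bar> \<le> G"
    and P2: "\<And>x. \<bar>P x\<bar> \<le> 2" and P0: "\<And>x. a \<le> \<bar>x\<bar> \<Longrightarrow> P x = 0"
    and a: "a > 0" and T: "T > 0" and N: "N > 0" and lam: "lam > 0"
    and h_def: "h = T / real N"
    and Y_def: "Y = (\<lambda>i \<omega>. f (B (real i * h) \<omega>) - (\<Sum>j<i. h * g (B (real j * h) \<omega>)))"
  shows "{\<omega>\<in>space M. \<exists>i\<le>N. \<bar>Y i \<omega>\<bar> > lam} \<in> sets M"
    and "lam\<^sup>2 * prob {\<omega>\<in>space M. \<exists>i\<le>N. \<bar>Y i \<omega>\<bar> > lam}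
     \<le> (1 + sqrt h) * 4 * (h + 2 * a * sqrt T) + T * (8 * lam * K * sqrt h + (1 + 1 / sqrt h) * (4 * G\<^sup>2 * h + 120 * K\<^sup>2 * h\<^sup>2))"
proof -
  have h: "h > 0" "sqrt h > 0" using T N by (auto simp: h_def)
  have Nh: "real N * h = T" using N by (simp add: h_def)
  have K: "K \<ge> 0" using qk by (simp add: quad_kernel_def)
  note [measurable] = quad_kernel_measurable[OF qk]
  have BF: "B (real j * h) \<in> borel_measurable (F (real i * h))" if "j \<le> i" for i j
    using that h by (intro B_F) (auto intro!: mult_right_mono)
  have YF: "Y j \<in> borel_measurable (F (real i * h))" if "j \<le> i" for i j
    unfolding Y_def
    by (intro borel_measurable_diff borel_measurable_sum borel_measurable_times borel_measurable_const
        measurable_compose[OF BF \<open>f \<in> _\<close>] measurable_compose[OF BF \<open>g \<in> _\<close>]) (use that in auto)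
  have YM [measurable]: "Y j \<in> borel_measurable M" for j using YF[of j j] measurable_F_M by blast
  show sets: "{\<omega>\<in>space M. \<exists>i\<le>N. \<bar>Y i \<omega>\<bar> > lam} \<in> sets M" by measurable
  \<comment> \<open>The switch is 1 as long as \<open>Y\<close> has stayed within [-lam, lam] up to
    time i; it is known at time i * h, before the increment it multiplies.\<close>
  define W :: "nat \<Rightarrow> 'a \<Rightarrow> real" where "W i \<omega> = (if \<forall>j\<le>i. \<bar>Y j \<omega>\<bar> \<le> lam then 1 else 0)" for i \<omega>
  have WF: "W i \<in> borel_measurable (F (real i * h))" for i
  proof -
    have "{\<omega>\<in>space (F (real i * h)). \<forall>j\<le>i. \<bar>Y j \<omega>\<bar> \<le> lam} = (\<Inter>j\<in>{..i}. {\<omega>\<in>space (F (real i * h)). \<bar>Y j \<omega>\<bar> \<le> lam})" by auto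
    also have "\<dots> \<in> sets (F (real i * h))"
    proof (rule sets.finite_INT)
      fix j assume "j \<in> {..i}"
      then have "Y j \<in> borel_measurable (F (real i * h))" by (intro YF) simp
      then have "Y j -` {-lam..lam} \<inter> space (F (real i * h)) \<in> sets (F (real i * h))" by (rule measurable_sets) simp
      also have "Y j -` {-lam..lam} \<inter> space (F (real i * h)) = {\<omega>\<in>space (F (real i * h)). \<bar>Y j \<omega>\<bar> \<le> lam}"
        by auto
      finally show "{\<omega>\<in>space (F (real i * h)). \<bar>Y j \<omega>\<bar> \<le> lam} \<in> sets (F (real i * h))" .
    qed auto
    finally have "{\<omega>\<in>space (F (real i * h)). \<forall>j\<le>i. \<bar>Y j \<omega>\<bar> \<le> lam} \<in> sets (F (real i * h))" .
    then show ?thesis unfolding W_def[abs_def] by (rule measurable_If[rotated 2]) simp_all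
  qed
  define \<xi> where "\<xi> i \<omega> = Y (Suc i) \<omega> - Y i \<omega>" for i \<omega>
  define Z where "Z n \<omega> = (\<Sum>i<n. W i \<omega> * \<xi> i \<omega>)" for n \<omega>
  define D where "D i \<omega> = B (real (Suc i) * h) \<omega> - B (real i * h) \<omega>" for i \<omega>
  define V :: "nat \<Rightarrow> 'a \<Rightarrow> real" where "V i \<omega> = indicator {-a<..<a} (B (real i * h) \<omega>)" for i \<omega>
  have W01: "W i \<omega> = 0 \<or> W i \<omega> = 1" for i \<omega> by (simp add: W_def)
  have path1: "(W n \<omega> = 1 \<longrightarrow> Z n \<omega> = Y n \<omega>) \<and> (W n \<omega> = 0 \<longrightarrow> \<bar>Z n \<omega>\<bar> > lam)" if "\<omega> \<in> space M" for n \<omega>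
  proof (induction n)
    case 0
    have "Y 0 \<omega> = 0" using B0[OF that] f0 by (simp add: Y_def)
    then show ?case using lam by (simp add: W_def Z_def)
  next
    case (Suc n)
    show ?case
    proof (cases "W n \<omega> = 1")
      case True
      then have "Z (Suc n) \<omega> = Y (Suc n) \<omega>" using Suc by (simp add: Z_def \<xi>_def)
      moreover have "\<bar>Y (Suc n) \<omega>\<bar> > lam" if "W (Suc n) \<omega> = 0"
        using that True by (auto simp: W_def le_Suc_eq split: if_splits)
      ultimately show ?thesis by auto
    next
      case False
      then have 0: "W n \<omega> = 0" using W01[of n \<omega>] by simp
      then have "W (Suc n) \<omega> = 0" by (auto simp: W_def split: if_splits intro: le_SucI)
      then show ?thesis using Suc 0 by (simp add: Z_def)
    qed
  qed
  \<comment> \<open>Expanding the squares produces 2 Z \<xi>; since \<open>Z\<close> equals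
    \<open>Y\<close> while the switch is on, the coefficient becomes W Y, which is bounded by
    lam.\<close>
  have path2: "(Z n \<omega>)\<^sup>2 = (\<Sum>i<n. W i \<omega> * (2 * Y i \<omega> * \<xi> i \<omega> + (\<xi> i \<omega>)\<^sup>2))" if "\<omega> \<in> space M" for n \<omega>
  proof (induction n)
    case (Suc n)
    have "(Z (Suc n) \<omega>)\<^sup>2 = (Z n \<omega>)\<^sup>2 + W n \<omega> * (2 * Z n \<omega> * \<xi> n \<omega> + (\<xi> n \<omega>)\<^sup>2)"
      using W01[of n \<omega>] by (auto simp: Z_def power2_eq_square algebra_simps)
    also have "W n \<omega> * (2 * Z n \<omega> * \<xi> n \<omega> + (\<xi> n \<omega>)\<^sup>2) = W n \<omega> * (2 * Y n \<omega> * \<xi> n \<omega> + (\<xi> n \<omega>)\<^sup>2)"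
      using W01[of n \<omega>] path1[OF that, of n] by auto
    finally show ?case using Suc by simp
  qed (simp add: Z_def)
  define U1 where "U1 i \<omega> = 2 * W i \<omega> * Y i \<omega> * P (B (real i * h) \<omega>)" for i \<omega>
  define U2 where "U2 i \<omega> = 2 * W i \<omega> * Y i \<omega> * g (B (real i * h) \<omega>)" for i \<omega>
  \<comment> \<open>A majorant of the increment of the squared frozen process whose mean can be
    computed: two terms of mean zero, the Taylor error weighted by |W Y| \<le> lam, the main term
    P^2 d^2 carried by |x| < a, and a remainder of higher order.\<close>
  define R where "R i \<omega> = U1 i \<omega> * D i \<omega> + U2 i \<omega> * ((D i \<omega>)\<^sup>2 - h) + 4 * lam * K * \<bar>D i \<omega>\<bar>^3
      + (1 + sqrt h) * 4 * (V i \<omega> * (D i \<omega>)\<^sup>2)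
      + (1 + 1 / sqrt h) * (2 * G\<^sup>2 * ((D i \<omega>)^4 - 2 * h * (D i \<omega>)\<^sup>2 + h\<^sup>2) + 8 * K\<^sup>2 * (D i \<omega>)^6)" for i \<omega>
  have WY: "W i \<omega> * \<bar>Y i \<omega>\<bar> \<le> lam" for i \<omega> using lam by (auto simp: W_def)
  have bound: "W i \<omega> * (2 * Y i \<omega> * \<xi> i \<omega> + (\<xi> i \<omega>)\<^sup>2) \<le> R i \<omega>" for i \<omega>
  proof -
    define x d w y where "x = B (real i * h) \<omega>" and "d = D i \<omega>" and "w = W i \<omega>" and "y = Y i \<omega>"
    define r where "r = f (x + d) - f x - P x * d - g x * d\<^sup>2"
    define q where "q = g x * (d\<^sup>2 - h) + r"
    have w: "w = 0 \<or> w = 1" using W01 by (simp add: w_def)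
    have r: "\<bar>r\<bar> \<le> 2 * K * \<bar>d\<bar>^3" unfolding r_def by (rule quad_kernel_taylor[OF qk])
    have xd: "B (real (Suc i) * h) \<omega> = x + d" by (simp add: x_def d_def D_def)
    have \<xi>: "\<xi> i \<omega> = P x * d + q"
      unfolding \<xi>_def Y_def sum.lessThan_Suc xd x_def[symmetric] q_def r_def by (simp add: algebra_simps)
    have wy: "w * \<bar>y\<bar> \<le> lam" using WY by (simp add: w_def y_def)
    have 1: "w * (2 * y * \<xi> i \<omega>) \<le> U1 i \<omega> * d + U2 i \<omega> * (d\<^sup>2 - h) + 4 * lam * K * \<bar>d\<bar>^3"
    proof -
      have "w * (2 * y * \<xi> i \<omega>) = U1 i \<omega> * d + U2 i \<omega> * (d\<^sup>2 - h) + 2 * (w * y) * r"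
        unfolding \<xi> q_def U1_def U2_def x_def[symmetric] w_def[symmetric] y_def[symmetric] by (simp add: algebra_simps)
      moreover have "2 * (w * y) * r \<le> 2 * lam * (2 * K * \<bar>d\<bar>^3)"
      proof -
        have "2 * (w * y) * r \<le> \<bar>2 * (w * y) * r\<bar>" by simp
        also have "\<dots> = 2 * (w * \<bar>y\<bar>) * \<bar>r\<bar>" using w by (auto simp: abs_mult)
        also have "\<dots> \<le> 2 * lam * (2 * K * \<bar>d\<bar>^3)" using wy r w lam by (intro mult_mono) auto
        finally show ?thesis .
      qed
      ultimately show ?thesis by simp
    qed
    have 2: "w * (\<xi> i \<omega>)\<^sup>2 \<le> (1 + sqrt h) * 4 * (V i \<omega> * d\<^sup>2)
      + (1 + 1 / sqrt h) * (2 * G\<^sup>2 * (d^4 - 2 * h * d\<^sup>2 + h\<^sup>2) + 8 * K\<^sup>2 * d^6)"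
    proof -
      define p where "p = P x * d"
      have "w * (\<xi> i \<omega>)\<^sup>2 \<le> (p + q)\<^sup>2" using w unfolding \<xi> p_def by auto
      \<comment> \<open>Young's inequality with weight sqrt h. The mean of q^2 is of order h^2, so
        even after division by sqrt h it sums to something that vanishes, while the main term p^2
        keeps a factor tending to 1.\<close>
      also have "(p + q)\<^sup>2 \<le> (1 + sqrt h) * p\<^sup>2 + (1 + 1 / sqrt h) * q\<^sup>2"
      proof -
        have "0 \<le> (sqrt h * p - q)\<^sup>2 / sqrt h" using h by simp
        also have "\<dots> = sqrt h * p\<^sup>2 - 2 * p * q + q\<^sup>2 / sqrt h"
          using h(2) by (simp add: power2_eq_square field_simps)
        finally show ?thesis by (simp add: power2_eq_square algebra_simps)
      qed
      also have "\<dots> \<le> (1 + sqrt h) * (4 * (V i \<omega> * d\<^sup>2)) + (1 + 1 / sqrt h) * (2 * G\<^sup>2 * (d^4 - 2 * h * d\<^sup>2 + h\<^sup>2) + 8 * K\<^sup>2 * d^6)"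
      proof (intro add_mono mult_left_mono)
        have "(P x)\<^sup>2 \<le> 4 * V i \<omega>"
        proof (cases "a \<le> \<bar>x\<bar>")
          case True then show ?thesis using P0[of x] by (simp add: V_def)
        next
          case False
          then have "V i \<omega> = 1" by (auto simp: V_def x_def indicator_def abs_less_iff)
          moreover have "(P x)\<^sup>2 \<le> 2\<^sup>2" using P2[of x] by (intro power2_le_iff_abs_le[THEN iffD2]) auto
          ultimately show ?thesis by simp
        qed
        then have "(P x)\<^sup>2 * d\<^sup>2 \<le> 4 * V i \<omega> * d\<^sup>2" by (intro mult_right_mono) auto
        then show "p\<^sup>2 \<le> 4 * (V i \<omega> * d\<^sup>2)" by (simp add: p_def power_mult_distrib)
        have "q\<^sup>2 \<le> 2 * (g x * (d\<^sup>2 - h))\<^sup>2 + 2 * r\<^sup>2"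
        proof -
          have "0 \<le> (g x * (d\<^sup>2 - h) - r)\<^sup>2" by simp
          then show ?thesis unfolding q_def by (simp add: power2_eq_square algebra_simps)
        qed
        also have "\<dots> \<le> 2 * (G\<^sup>2 * (d\<^sup>2 - h)\<^sup>2) + 2 * (2 * K * \<bar>d\<bar>^3)\<^sup>2"
        proof (intro add_mono mult_left_mono)
          show "(g x * (d\<^sup>2 - h))\<^sup>2 \<le> G\<^sup>2 * (d\<^sup>2 - h)\<^sup>2"
            unfolding power_mult_distrib using G[of x]
            by (intro mult_right_mono) (auto simp: power2_le_iff_abs_le)
          show "r\<^sup>2 \<le> (2 * K * \<bar>d\<bar>^3)\<^sup>2" using r by (subst power2_le_iff_abs_le) (use K in auto)
        qed auto
        also have "\<dots> = 2 * G\<^sup>2 * (d^4 - 2 * h * d\<^sup>2 + h\<^sup>2) + 8 * K\<^sup>2 * d^6"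
        proof -
          have "(\<bar>d\<bar>^3)\<^sup>2 = d^6" by (simp add: power_mult[symmetric] power_even_abs)
          moreover have "(d\<^sup>2 - h)\<^sup>2 = d^4 - 2 * h * d\<^sup>2 + h\<^sup>2" by algebra
          ultimately show ?thesis by (simp add: power_mult_distrib)
        qed
        finally show "q\<^sup>2 \<le> 2 * G\<^sup>2 * (d^4 - 2 * h * d\<^sup>2 + h\<^sup>2) + 8 * K\<^sup>2 * d^6" .
      qed (use h in auto)
      finally show ?thesis unfolding mult.assoc .
    qed
    show ?thesis unfolding R_def d_def[symmetric] distrib_left w_def[symmetric] y_def[symmetric]
      using 1 2 unfolding distrib_left by simp
  qed
  have s: "0 \<le> real i * h" "real i * h < real (Suc i) * h" "real i * h \<le> real (Suc i) * h" "real (Suc i) * h - real i * h = h" for i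
    using h by (auto simp: algebra_simps)
  note mom = incr_moments[OF s(1,2), folded D_def, unfolded s(4)]
  have iU1: "integrable M (U1 i)" "U1 i \<in> borel_measurable (F (real i * h))" for i
  proof -
    show m: "U1 i \<in> borel_measurable (F (real i * h))"
      unfolding U1_def by (intro borel_measurable_times borel_measurable_const WF YF measurable_compose[OF BF \<open>P \<in> _\<close>]) auto
    show "integrable M (U1 i)"
    proof (rule integrable_const_bound[where B = "4 * lam"])
      show "AE \<omega> in M. norm (U1 i \<omega>) \<le> 4 * lam"
      proof (rule AE_I2)
        fix \<omega>
        have "norm (U1 i \<omega>) = 2 * (W i \<omega> * \<bar>Y i \<omega>\<bar>) * \<bar>P (B (real i * h) \<omega>)\<bar>"
          using W01[of i \<omega>] by (auto simp: U1_def abs_mult)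
        also have "\<dots> \<le> 2 * lam * 2" using W01[of i \<omega>] WY P2 lam by (intro mult_mono) auto
        finally show "norm (U1 i \<omega>) \<le> 4 * lam" by simp
      qed
    qed (use m measurable_F_M in blast)
  qed
  have G0: "G \<ge> 0" using G[of 0] by simp
  have iU2: "integrable M (U2 i)" "U2 i \<in> borel_measurable (F (real i * h))" for i
  proof -
    show m: "U2 i \<in> borel_measurable (F (real i * h))"
      unfolding U2_def by (intro borel_measurable_times borel_measurable_const WF YF measurable_compose[OF BF \<open>g \<in> _\<close>]) auto
    show "integrable M (U2 i)"
    proof (rule integrable_const_bound[where B = "2 * lam * G"])
      show "AE \<omega> in M. norm (U2 i \<omega>) \<le> 2 * lam * G"
      proof (rule AE_I2)
        fix \<omega>
        have "norm (U2 i \<omega>) = 2 * (W i \<omega> * \<bar>Y i \<omega>\<bar>) * \<bar>g (B (real i * h) \<omega>)\<bar>"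
          using W01[of i \<omega>] by (auto simp: U2_def abs_mult)
        also have "\<dots> \<le> 2 * lam * G" using W01[of i \<omega>] WY G lam by (intro mult_mono) auto
        finally show "norm (U2 i \<omega>) \<le> 2 * lam * G" .
      qed
    qed (use m measurable_F_M in blast)
  qed
  have iV: "integrable M (V i)" "V i \<in> borel_measurable (F (real i * h))"
    "(\<integral>\<omega>. V i \<omega> \<partial>M) = prob {\<omega>\<in>space M. \<bar>B (real i * h) \<omega>\<bar> < a}" for i
  proof -
    note [measurable] = BF[of i i, simplified] B_M[OF s(1), of i]
    show "V i \<in> borel_measurable (F (real i * h))" unfolding V_def by measurable
    show "integrable M (V i)" unfolding V_def by (rule integrable_const_bound[where B = 1]) auto
    have "(\<integral>\<omega>. V i \<omega> \<partial>M) = (\<integral>\<omega>. indicator {\<omega>\<in>space M. \<bar>B (real i * h) \<omega>\<bar> < a} \<omega> \<partial>M)"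
      by (rule Bochner_Integration.integral_cong) (auto simp: V_def indicator_def abs_less_iff)
    then show "(\<integral>\<omega>. V i \<omega> \<partial>M) = prob {\<omega>\<in>space M. \<bar>B (real i * h) \<omega>\<bar> < a}" by simp
  qed
  have t1: "integrable M (\<lambda>\<omega>. U1 i \<omega> * D i \<omega>)" "(\<integral>\<omega>. U1 i \<omega> * D i \<omega> \<partial>M) = 0" for i
    using expectation_mult_incr[OF s(1,3) iU1(2,1), of "\<lambda>x. x"] mom(1)[of i 1] mom(2)[of i] by (simp_all add: D_def)
  have t2: "integrable M (\<lambda>\<omega>. U2 i \<omega> * ((D i \<omega>)\<^sup>2 - h))" "(\<integral>\<omega>. U2 i \<omega> * ((D i \<omega>)\<^sup>2 - h) \<partial>M) = 0" for i
    using expectation_mult_incr[OF s(1,3) iU2(2,1), of "\<lambda>x. x\<^sup>2 - h"] mom(1)[of i 2] mom(3)[of i]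
    by (simp_all add: D_def prob_space)
  have t4: "integrable M (\<lambda>\<omega>. V i \<omega> * (D i \<omega>)\<^sup>2)"
    "(\<integral>\<omega>. V i \<omega> * (D i \<omega>)\<^sup>2 \<partial>M) = prob {\<omega>\<in>space M. \<bar>B (real i * h) \<omega>\<bar> < a} * h" for i
    using expectation_mult_incr[OF s(1,3) iV(2,1), of "\<lambda>x. x\<^sup>2"] mom(1)[of i 2] mom(3)[of i] iV(3)[of i]
    by (simp_all add: D_def)
  have iR: "integrable M (R i)" for i
    unfolding R_def
    by (intro Bochner_Integration.integrable_add integrable_mult_right t1(1) t2(1) t4(1) mom(1) mom(7) Bochner_Integration.integrable_diff integrable_const)
  have ER: "(\<integral>\<omega>. R i \<omega> \<partial>M) \<le> (1 + sqrt h) * 4 * (h * prob {\<omega>\<in>space M. \<bar>B (real i * h) \<omega>\<bar> < a})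
     + h * (8 * lam * K * sqrt h + (1 + 1 / sqrt h) * (4 * G\<^sup>2 * h + 120 * K\<^sup>2 * h\<^sup>2))" for i
  proof -
    have "(\<integral>\<omega>. R i \<omega> \<partial>M) = 0 + 0 + 4 * lam * K * (\<integral>\<omega>. \<bar>D i \<omega>\<bar>^3 \<partial>M)
      + (1 + sqrt h) * 4 * (prob {\<omega>\<in>space M. \<bar>B (real i * h) \<omega>\<bar> < a} * h)
      + (1 + 1 / sqrt h) * (2 * G\<^sup>2 * (3 * h\<^sup>2 - 2 * h * h + h\<^sup>2) + 8 * K\<^sup>2 * (15 * h^3))"
      unfolding R_def
      by (simp add: t1 t2 t4 mom prob_space
            Bochner_Integration.integrable_add Bochner_Integration.integrable_diff)
    also have "\<dots> \<le> 4 * lam * K * (2 * h * sqrt h)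
      + (1 + sqrt h) * 4 * (prob {\<omega>\<in>space M. \<bar>B (real i * h) \<omega>\<bar> < a} * h)
      + (1 + 1 / sqrt h) * (2 * G\<^sup>2 * (3 * h\<^sup>2 - 2 * h * h + h\<^sup>2) + 8 * K\<^sup>2 * (15 * h^3))"
      using mult_left_mono[OF mom(6)[of i], of "4 * lam * K"] lam K by simp
    also have "\<dots> = (1 + sqrt h) * 4 * (h * prob {\<omega>\<in>space M. \<bar>B (real i * h) \<omega>\<bar> < a})
     + h * (8 * lam * K * sqrt h + (1 + 1 / sqrt h) * (4 * G\<^sup>2 * h + 120 * K\<^sup>2 * h\<^sup>2))"
    proof -
      define c where "c = 1 + 1 / sqrt h"
      show ?thesis unfolding c_def[symmetric] by (simp add: power2_eq_square power3_eq_cube algebra_simps)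
    qed
    finally show ?thesis .
  qed
  have "lam\<^sup>2 * prob {\<omega>\<in>space M. \<exists>i\<le>N. \<bar>Y i \<omega>\<bar> > lam} = (\<integral>\<omega>. lam\<^sup>2 * indicator {\<omega>\<in>space M. \<exists>i\<le>N. \<bar>Y i \<omega>\<bar> > lam} \<omega> \<partial>M)"
    by simp
  also have "\<dots> \<le> (\<integral>\<omega>. (\<Sum>i<N. R i \<omega>) \<partial>M)"
  proof (rule integral_mono)
    show "integrable M (\<lambda>\<omega>. lam\<^sup>2 * indicator {\<omega>\<in>space M. \<exists>i\<le>N. \<bar>Y i \<omega>\<bar> > lam} \<omega> :: real)"
      using sets by (intro integrable_mult_right integrable_real_indicator) (auto simp: emeasure_eq_measure)
    show "integrable M (\<lambda>\<omega>. \<Sum>i<N. R i \<omega>)" by (intro Bochner_Integration.integrable_sum iR)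
    fix \<omega> assume \<omega>: "\<omega> \<in> space M"
    have Z2: "(Z N \<omega>)\<^sup>2 \<le> (\<Sum>i<N. R i \<omega>)" unfolding path2[OF \<omega>] by (intro sum_mono bound)
    show "lam\<^sup>2 * indicator {\<omega>\<in>space M. \<exists>i\<le>N. \<bar>Y i \<omega>\<bar> > lam} \<omega> \<le> (\<Sum>i<N. R i \<omega>)"
    proof (cases "\<exists>i\<le>N. \<bar>Y i \<omega>\<bar> > lam")
      case True
      then have "W N \<omega> = 0" by (auto simp: W_def not_le)
      then have "lam < \<bar>Z N \<omega>\<bar>" using path1[OF \<omega>, of N] by simp
      then have "lam\<^sup>2 \<le> (Z N \<omega>)\<^sup>2" using lam by (simp add: abs_le_square_iff[symmetric])
      then show ?thesis using True \<omega> Z2 by simp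
    next
      case False
      have "0 \<le> (\<Sum>i<N. R i \<omega>)" using order_trans[OF zero_le_power2 Z2] .
      then show ?thesis using False by simp
    qed
  qed
  also have "\<dots> = (\<Sum>i<N. \<integral>\<omega>. R i \<omega> \<partial>M)" by (rule Bochner_Integration.integral_sum) (rule iR)
  also have "\<dots> \<le> (\<Sum>i<N. (1 + sqrt h) * 4 * (h * prob {\<omega>\<in>space M. \<bar>B (real i * h) \<omega>\<bar> < a})
     + h * (8 * lam * K * sqrt h + (1 + 1 / sqrt h) * (4 * G\<^sup>2 * h + 120 * K\<^sup>2 * h\<^sup>2)))"
    by (intro sum_mono ER)
  also have "\<dots> = (1 + sqrt h) * 4 * (\<Sum>i<N. h * prob {\<omega>\<in>space M. \<bar>B (real i * h) \<omega>\<bar> < a})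
     + real N * (h * (8 * lam * K * sqrt h + (1 + 1 / sqrt h) * (4 * G\<^sup>2 * h + 120 * K\<^sup>2 * h\<^sup>2)))"
  proof -
    have "(\<Sum>i<N. c * x i + d) = c * (\<Sum>i<N. x i) + real N * d" for c d :: real and x
      by (simp add: sum.distrib sum_distrib_left)
    then show ?thesis .
  qed
  also have "\<dots> \<le> (1 + sqrt h) * 4 * (h + 2 * a * sqrt T)
     + real N * (h * (8 * lam * K * sqrt h + (1 + 1 / sqrt h) * (4 * G\<^sup>2 * h + 120 * K\<^sup>2 * h\<^sup>2)))"
    using grid_occupation[OF T N a, folded h_def] h by (intro add_right_mono mult_left_mono) auto
  also have "\<dots> = (1 + sqrt h) * 4 * (h + 2 * a * sqrt T)
     + T * (8 * lam * K * sqrt h + (1 + 1 / sqrt h) * (4 * G\<^sup>2 * h + 120 * K\<^sup>2 * h\<^sup>2))"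
    by (simp only: mult.assoc[symmetric] Nh)
  finally show "lam\<^sup>2 * prob {\<omega>\<in>space M. \<exists>i\<le>N. \<bar>Y i \<omega>\<bar> > lam}
     \<le> (1 + sqrt h) * 4 * (h + 2 * a * sqrt T) + T * (8 * lam * K * sqrt h + (1 + 1 / sqrt h) * (4 * G\<^sup>2 * h + 120 * K\<^sup>2 * h\<^sup>2))" .
qed

end

section \<open>Existence of the local time\<close>

lemma exists_rat_greater:
  fixes \<phi> :: "real \<Rightarrow> real"
  assumes c: "continuous_on {0..T} \<phi>" and T: "T > 0" and t: "t \<in> {0..T}" and gt: "\<phi> t > c"
  shows "\<exists>q\<in>\<rat>. 0 \<le> q \<and> q \<le> T \<and> \<phi> q > c"
proof -
  obtain d where d: "d > 0" "\<And>s. s \<in> {0..T} \<Longrightarrow> dist s t < d \<Longrightarrow> dist (\<phi> s) (\<phi> t) < \<phi> t - c"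
    using c t gt unfolding continuous_on_iff by (metis diff_gt_0_iff_gt)
  have "max 0 (t - d) < min T (t + d)" using d(1) T t by auto
  then obtain q where q: "q \<in> \<rat>" "max 0 (t - d) < q" "q < min T (t + d)" using Rats_dense_in_real by blast
  then have "dist (\<phi> q) (\<phi> t) < \<phi> t - c" by - (rule d(2), auto simp: dist_real_def)
  then have "\<phi> q > c" by (auto simp: dist_real_def)
  then show ?thesis using q by force
qed

context bm
begin

text \<open>As the grid is refined, every term containing K or G vanishes and only 4 * 2 a sqrt T is
  left. The bound thus sees the kernel through its radius a alone, which is essential because K and
  G blow up for shrinking kernels. A strict exceedance of lam is visible on all fine grids, so
  Fatou's lemma applies to the grid events.\<close>

lemma maximal_continuous:
  assumes qk: "quad_kernel K f P g" and f0: "f 0 = 0" and G: "\<And>x. \<bar>g x\<bar> \<le> G"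
    and P2: "\<And>x. \<bar>P x\<bar> \<le> 2" and P0: "\<And>x. a \<le> \<bar>x\<bar> \<Longrightarrow> P x = 0"
    and a: "a > 0" and T: "T > 0" and lam: "lam > 0"
  shows "{\<omega>\<in>space M. \<exists>t\<in>{0..T}. \<bar>f (B t \<omega>) - add_fun g t \<omega>\<bar> > lam} \<in> sets M" (is "?Bad \<in> _")
    and "prob {\<omega>\<in>space M. \<exists>t\<in>{0..T}. \<bar>f (B t \<omega>) - add_fun g t \<omega>\<bar> > lam} \<le> 8 * a * sqrt T / lam\<^sup>2"
proof -
  note cont = quad_kernel_continuous[OF qk, of UNIV]
  note [measurable] = quad_kernel_measurable[OF qk]
  define \<phi> where "\<phi> t \<omega> = f (B t \<omega>) - add_fun g t \<omega>" for t \<omega>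
  have \<phi>c: "continuous_on {0..T} (\<lambda>t. \<phi> t \<omega>)" if "\<omega> \<in> space M" for \<omega>
    unfolding \<phi>_def
    by (intro continuous_on_diff add_fun_cont[OF that cont(3)] continuous_on_subset[OF cont_comp_B[OF that cont(1)]]) auto
  have \<phi>m: "(\<lambda>\<omega>. \<phi> t \<omega>) \<in> borel_measurable M" if "0 \<le> t" for t
    unfolding \<phi>_def using B_M[OF that] measurable_F_M[OF add_fun_adapted[OF cont(3) that]] by measurable
  \<comment> \<open>A strict inequality along a continuous path persists at some rational time, so
    the uncountable union over t is a countable one.\<close>
  have "?Bad = (\<Union>q\<in>\<rat> \<inter> {0..T}. {\<omega>\<in>space M. \<bar>\<phi> q \<omega>\<bar> > lam})"
  proof (intro equalityI subsetI)
    fix \<omega> assume "\<omega> \<in> ?Bad"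
    then obtain t where t: "t \<in> {0..T}" "\<bar>\<phi> t \<omega>\<bar> > lam" and \<omega>: "\<omega> \<in> space M" by (auto simp: \<phi>_def)
    obtain q where "q \<in> \<rat>" "0 \<le> q" "q \<le> T" "\<bar>\<phi> q \<omega>\<bar> > lam"
      using exists_rat_greater[OF continuous_on_rabs[OF \<phi>c[OF \<omega>]] T t] by blast
    then show "\<omega> \<in> (\<Union>q\<in>\<rat> \<inter> {0..T}. {\<omega>\<in>space M. \<bar>\<phi> q \<omega>\<bar> > lam})" using \<omega> by auto
  qed (auto simp: \<phi>_def)
  also have "\<dots> \<in> sets M"
  proof (rule sets.countable_UN'')
    show "countable (\<rat> \<inter> {0..T})" using countable_rat by blast
    fix q assume "q \<in> \<rat> \<inter> {0..T}"
    then have [measurable]: "(\<lambda>\<omega>. \<phi> q \<omega>) \<in> borel_measurable M" by (intro \<phi>m) auto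
    show "{\<omega>\<in>space M. \<bar>\<phi> q \<omega>\<bar> > lam} \<in> sets M" by measurable
  qed
  finally show Bad: "?Bad \<in> sets M" .
  define h where "h m = T / real (Suc m)" for m
  define Y where "Y m = (\<lambda>i \<omega>. f (B (real i * h m) \<omega>) - (\<Sum>j<i. h m * g (B (real j * h m) \<omega>)))" for m
  define E where "E m = {\<omega>\<in>space M. \<exists>i\<le>Suc m. \<bar>Y m i \<omega>\<bar> > lam}" for m
  define C where "C m = (1 + sqrt (h m)) * 4 * (h m + 2 * a * sqrt T) + T * (8 * lam * K * sqrt (h m) + (1 + 1 / sqrt (h m)) * (4 * G\<^sup>2 * h m + 120 * K\<^sup>2 * (h m)\<^sup>2))" for m
  note mg = maximal_grid[OF qk f0 G P2 P0 a T zero_less_Suc lam h_def Y_def]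
  have E [measurable]: "E m \<in> sets M" for m unfolding E_def by (rule mg(1))
  have PE: "lam\<^sup>2 * prob (E m) \<le> C m" for m unfolding E_def C_def by (rule mg(2))
  have Clim: "C \<longlonglongrightarrow> 8 * a * sqrt T"
  proof -
    have hl: "h \<longlonglongrightarrow> 0" unfolding h_def by real_asymp
    have hp: "h m > 0" for m using T by (simp add: h_def)
    have sl: "(\<lambda>m. sqrt (h m)) \<longlonglongrightarrow> 0" using tendsto_real_sqrt[OF hl] by simp
    \<comment> \<open>The factor 1 + 1 / sqrt h is multiplied out beforehand: each product with it
      is then a positive power of h and the limit can be taken termwise.\<close>
    have "(\<lambda>m. (1 + sqrt (h m)) * 4 * (h m + 2 * a * sqrt T) + T * (8 * lam * K * sqrt (h m) + (4 * G\<^sup>2 * h m + 120 * K\<^sup>2 * (h m)\<^sup>2) + (4 * G\<^sup>2 * sqrt (h m) + 120 * K\<^sup>2 * (h m * sqrt (h m)))))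
      \<longlonglongrightarrow> (1 + 0) * 4 * (0 + 2 * a * sqrt T) + T * (8 * lam * K * 0 + (4 * G\<^sup>2 * 0 + 120 * K\<^sup>2 * 0\<^sup>2) + (4 * G\<^sup>2 * 0 + 120 * K\<^sup>2 * (0 * 0)))"
      by (intro tendsto_intros hl sl)
    moreover have "C = (\<lambda>m. (1 + sqrt (h m)) * 4 * (h m + 2 * a * sqrt T) + T * (8 * lam * K * sqrt (h m) + (4 * G\<^sup>2 * h m + 120 * K\<^sup>2 * (h m)\<^sup>2) + (4 * G\<^sup>2 * sqrt (h m) + 120 * K\<^sup>2 * (h m * sqrt (h m)))))"
    proof
      fix m
      define s where "s = sqrt (h m)"
      have s: "s > 0" "h m = s * s" using hp[of m] by (auto simp: s_def)
      show "C m = (1 + sqrt (h m)) * 4 * (h m + 2 * a * sqrt T) + T * (8 * lam * K * sqrt (h m) + (4 * G\<^sup>2 * h m + 120 * K\<^sup>2 * (h m)\<^sup>2) + (4 * G\<^sup>2 * sqrt (h m) + 120 * K\<^sup>2 * (h m * sqrt (h m))))"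
        unfolding C_def s_def[symmetric] unfolding s(2) using s(1)
        by (simp add: field_simps power2_eq_square)
    qed
    ultimately show ?thesis by (simp add: mult.assoc)
  qed
  have sub: "\<forall>\<^sub>F m in sequentially. \<omega> \<in> E m" if b: "\<omega> \<in> ?Bad" for \<omega>
  proof -
    obtain t where t: "t \<in> {0..T}" "\<bar>\<phi> t \<omega>\<bar> > lam" and \<omega>: "\<omega> \<in> space M" using b by (auto simp: \<phi>_def)
    \<comment> \<open>Half of the overshoot above lam: one half is spent on the Riemann sum error,
      the other on moving t to a grid point.\<close>
    define e where "e = (\<bar>\<phi> t \<omega>\<bar> - lam) / 2"
    have e: "e > 0" using t by (simp add: e_def)
    obtain N0 where N0: "\<And>N i. N \<ge> N0 \<Longrightarrow> i \<le> N \<Longrightarrow> N > 0 \<Longrightarrow>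
     \<bar>(\<Sum>j<i. T / real N * g (B (real j * (T / real N)) \<omega>)) - add_fun g (real i * (T / real N)) \<omega>\<bar> \<le> e"
      using riemann_add_fun[OF \<omega> cont(3) T e] by blast
    define i where "i m = nat \<lfloor>t * real (Suc m) / T\<rfloor>" for m
    have il: "(\<lambda>m. real (i m) * h m) \<longlonglongrightarrow> t" and iN: "i m \<le> Suc m" for m
      unfolding i_def h_def using grid_point_tendsto[of t T] t T by auto
    have in_T: "real (i m) * h m \<in> {0..T}" for m
    proof -
      have "real (i m) * h m \<le> real (Suc m) * h m" using iN[of m] T by (intro mult_right_mono) (auto simp: h_def simp del: of_nat_Suc)
      also have "\<dots> = T" by (simp add: h_def)
      finally show ?thesis using T by (auto simp: h_def)
    qed
    have "(\<lambda>m. \<phi> (real (i m) * h m) \<omega>) \<longlonglongrightarrow> \<phi> t \<omega>"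
      by (rule continuous_on_tendsto_compose[OF \<phi>c[OF \<omega>] il t(1)]) (intro always_eventually allI in_T)
    from tendstoD[OF this e] have "\<forall>\<^sub>F m in sequentially. dist (\<phi> (real (i m) * h m) \<omega>) (\<phi> t \<omega>) < e" .
    then show ?thesis using eventually_ge_at_top[of N0]
    proof eventually_elim
      case (elim m)
      have "\<bar>Y m (i m) \<omega> - \<phi> (real (i m) * h m) \<omega>\<bar> \<le> e"
        using N0[of "Suc m" "i m"] elim iN[of m] by (simp add: Y_def \<phi>_def h_def)
      then have "\<bar>Y m (i m) \<omega>\<bar> > lam" using elim(1) unfolding dist_real_def e_def by (simp add: abs_if split: if_splits)
      then show ?case using \<omega> iN[of m] unfolding E_def by blast
    qed
  qed
  have "emeasure M ?Bad = (\<integral>\<^sup>+\<omega>. indicator ?Bad \<omega> \<partial>M)" using Bad by simp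
  also have "\<dots> \<le> (\<integral>\<^sup>+\<omega>. liminf (\<lambda>m. indicator (E m) \<omega>) \<partial>M)"
  proof (rule nn_integral_mono)
    fix \<omega>
    show "indicator ?Bad \<omega> \<le> liminf (\<lambda>m. indicator (E m) \<omega> :: ennreal)"
    proof (cases "\<omega> \<in> ?Bad")
      case True
      have "1 \<le> liminf (\<lambda>m. indicator (E m) \<omega> :: ennreal)"
        using sub[OF True] by (intro Liminf_bounded) (auto elim!: eventually_mono)
      then show ?thesis using True by simp
    qed simp
  qed
  also have "\<dots> \<le> liminf (\<lambda>m. \<integral>\<^sup>+\<omega>. indicator (E m) \<omega> \<partial>M)" by (rule nn_integral_liminf) simp
  also have "\<dots> = liminf (\<lambda>m. ennreal (prob (E m)))" by (simp add: emeasure_eq_measure)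
  also have "\<dots> \<le> liminf (\<lambda>m. ennreal (C m / lam\<^sup>2))"
    using PE lam by (intro Liminf_mono always_eventually allI ennreal_leI) (simp add: field_simps)
  also have "\<dots> = ennreal (8 * a * sqrt T / lam\<^sup>2)"
    by (intro lim_imp_Liminf tendsto_intros Clim) (use lam in auto)
  finally show "prob ?Bad \<le> 8 * a * sqrt T / lam\<^sup>2"
    using a T lam by (simp add: emeasure_eq_measure)
qed

end

text \<open>The radii decay fast enough for Borel--Cantelli, and slowly enough for consecutive ratios to tend to \<open>1\<close>.\<close>

definition rad :: "nat \<Rightarrow> real" where "rad n = 1 / real (Suc n) ^ 6"

lemma rad_pos: "rad n > 0" by (simp add: rad_def)
lemma rad_Suc_less: "rad (Suc n) < rad n"
  unfolding rad_def by (intro divide_strict_left_mono power_strict_mono) auto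
lemma rad_antimono: "m \<le> n \<Longrightarrow> rad n \<le> rad m"
  by (rule lift_Suc_antimono_le[of rad]) (auto intro: less_imp_le rad_Suc_less)
lemma rad_tendsto: "rad \<longlonglongrightarrow> 0" unfolding rad_def by real_asymp

abbreviation "gk n \<equiv> trap (rad (Suc n)) (rad n)"
abbreviation "Pk n \<equiv> trap_P (rad (Suc n)) (rad n)"
abbreviation "fk n \<equiv> trap_F (rad (Suc n)) (rad n)"

lemmas trap_rules = trap_nonneg[OF rad_pos rad_Suc_less] trap_le[OF rad_pos rad_Suc_less]
  trap_inside[OF rad_pos rad_Suc_less] trap_outside[OF rad_pos rad_Suc_less]

lemma gk_kernel: "\<exists>K. quad_kernel K (fk n) (Pk n) (gk n)"
  using trap_kernel[OF rad_pos rad_Suc_less] by blast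

lemma gk_cont: "continuous_on A (gk n)"
  using gk_kernel quad_kernel_continuous by blast

lemma fk_cont: "continuous_on A (fk n)"
  using gk_kernel quad_kernel_continuous by blast

lemma continuous_on_halfline:
  fixes f :: "real \<Rightarrow> real"
  assumes "\<And>T. T > 0 \<Longrightarrow> continuous_on {0..T} f"
  shows "continuous_on {0..} f"
  unfolding continuous_on_eq_continuous_within
proof
  fix x :: real assume x: "x \<in> {0..}"
  have "continuous (at x within {0..x+1}) f"
    using assms[of "x + 1"] x by (simp add: continuous_on_eq_continuous_within)
  moreover have "at x within {0..x+1} = at x within {0..}"
    by (rule at_within_nhd[of _ "{..<x+1}"]) auto
  ultimately show "continuous (at x within {0..}) f" by simp
qed

context bm
begin

text \<open>Consecutive smoothed absolute values have the same slope outside [-rad n, rad n], so the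
  maximal inequality applies to their difference with that radius. With deviation level (n + 1)^-2
  its bound is a multiple of (n + 1)^-6 * (n + 1)^4, hence summable; this is where the exponent 6 in
  \<open>rad\<close> comes from.\<close>

lemma kernel_increments:
  "AE \<omega> in M. \<forall>k. \<forall>\<^sub>F n in sequentially. \<forall>t\<in>{0..real (Suc k)}.
     \<bar>(fk n (B t \<omega>) - add_fun (gk n) t \<omega>) - (fk (Suc n) (B t \<omega>) - add_fun (gk (Suc n)) t \<omega>)\<bar> \<le> 1 / (real (Suc n))\<^sup>2"
  unfolding AE_all_countable
proof
  fix k
  define T where "T = real (Suc k)"
  have T: "T > 0" by (simp add: T_def)
  define D where "D n x = fk n x - fk (Suc n) x" for n x
  define g where "g n x = gk n x - gk (Suc n) x" for n x
  define lam where "lam n = 1 / (real (Suc n))\<^sup>2" for n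
  have lam: "lam n > 0" for n by (simp add: lam_def)
  define Bad where "Bad n = {\<omega>\<in>space M. \<exists>t\<in>{0..T}. \<bar>D n (B t \<omega>) - add_fun (g n) t \<omega>\<bar> > lam n}" for n
  have Bad: "Bad n \<in> sets M" "prob (Bad n) \<le> 8 * sqrt T / (real (Suc n))\<^sup>2" for n
  proof -
    obtain K K' where K: "quad_kernel K (fk n) (Pk n) (gk n)" "quad_kernel K' (fk (Suc n)) (Pk (Suc n)) (gk (Suc n))"
      using gk_kernel by blast
    have qk: "quad_kernel (K + K') (D n) (\<lambda>x. Pk n x - Pk (Suc n) x) (g n)"
      unfolding D_def g_def by (rule quad_kernel_diff[OF K])
    have D0: "D n 0 = 0" by (simp add: D_def trap_F_0[OF rad_pos rad_Suc_less])
    have G: "\<bar>g n x\<bar> \<le> 1 / (rad (Suc n) + rad n) + 1 / (rad (Suc (Suc n)) + rad (Suc n))" for x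
      unfolding g_def using trap_rules(1,2)[of n x] trap_rules(1,2)[of "Suc n" x] by linarith
    have P2: "\<bar>Pk n x - Pk (Suc n) x\<bar> \<le> 2" for x
      using trap_P_abs_le[OF rad_pos rad_Suc_less, of n x] trap_P_abs_le[OF rad_pos rad_Suc_less, of "Suc n" x] by linarith
    have P0: "Pk n x - Pk (Suc n) x = 0" if "rad n \<le> \<bar>x\<bar>" for x
    proof (cases "x \<ge> 0")
      case True
      then show ?thesis using that trap_P_right[OF rad_pos rad_Suc_less] rad_Suc_less[of n] by simp
    next
      case False
      then show ?thesis using that trap_P_left[OF rad_pos rad_Suc_less] rad_Suc_less[of n] by simp
    qed
    note m = maximal_continuous[OF qk D0 G P2 P0 rad_pos[of n] T lam[of n]]
    show "Bad n \<in> sets M" unfolding Bad_def by (rule m(1))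
    have "8 * rad n * sqrt T / (lam n)\<^sup>2 = 8 * sqrt T / (real (Suc n))\<^sup>2"
      by (simp add: rad_def lam_def power_divide field_simps power_mult[symmetric] power_add[symmetric] del: of_nat_Suc)
    then show "prob (Bad n) \<le> 8 * sqrt T / (real (Suc n))\<^sup>2" unfolding Bad_def using m(2) by simp
  qed
  have "AE \<omega> in M. eventually (\<lambda>n. \<omega> \<in> space M - Bad n) sequentially"
  proof (rule borel_cantelli_AE1)
    have "summable (\<lambda>n. 1 / (real (Suc n))\<^sup>2)"
      using summable_Suc_iff[of "\<lambda>n. 1 / (real n)\<^sup>2"] inverse_power_summable[of 2, where 'a=real] by (simp add: inverse_eq_divide)
    then have "summable (\<lambda>n. 8 * sqrt T * (1 / (real (Suc n))\<^sup>2))" by (rule summable_mult)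
    then show "summable (\<lambda>n. prob (Bad n))"
      by (rule summable_comparison_test') (use Bad(2) in simp)
  qed (auto simp: Bad emeasure_eq_measure)
  then show "AE \<omega> in M. \<forall>\<^sub>F n in sequentially. \<forall>t\<in>{0..real (Suc k)}.
     \<bar>(fk n (B t \<omega>) - add_fun (gk n) t \<omega>) - (fk (Suc n) (B t \<omega>) - add_fun (gk (Suc n)) t \<omega>)\<bar> \<le> 1 / (real (Suc n))\<^sup>2"
    using AE_space
  proof eventually_elim
    case (elim \<omega>)
    from elim(1) show ?case
    proof eventually_elim
      case (elim n)
      show ?case
      proof
        fix t assume t: "t \<in> {0..real (Suc k)}"
        have "\<bar>D n (B t \<omega>) - add_fun (g n) t \<omega>\<bar> \<le> lam n"
          using elim t unfolding Bad_def T_def by force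
        moreover have "add_fun (g n) t \<omega> = add_fun (gk n) t \<omega> - add_fun (gk (Suc n)) t \<omega>"
          unfolding add_fun_def g_def
          by (intro Henstock_Kurzweil_Integration.integral_diff integrable_continuous_real
               continuous_on_subset[OF cont_comp_B[OF _ gk_cont]]) (use \<open>\<omega> \<in> space M\<close> in auto)
        ultimately show "\<bar>(fk n (B t \<omega>) - add_fun (gk n) t \<omega>) - (fk (Suc n) (B t \<omega>) - add_fun (gk (Suc n)) t \<omega>)\<bar> \<le> 1 / (real (Suc n))\<^sup>2"
          by (simp add: D_def lam_def algebra_simps)
      qed
    qed
  qed
qed

text \<open>An approximate form of Tanaka's formula: the near-martingales f_n(B) minus their
  additive functionals converge uniformly on compacts by the Weierstrass test, and f_n(B) converges
  to |B|. The additive functionals therefore converge to a continuous limit.\<close>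

lemma add_fun_limit:
  "AE \<omega> in M. \<exists>\<Lambda>. continuous_on {0..} \<Lambda> \<and> (\<forall>t\<ge>0. (\<lambda>n. add_fun (gk n) t \<omega>) \<longlonglongrightarrow> \<Lambda> t)"
  using kernel_increments AE_space
proof eventually_elim
  case (elim \<omega>)
  define m where "m n t = fk n (B t \<omega>) - add_fun (gk n) t \<omega>" for n t
  \<comment> \<open>Defining the limit by \<open>lim\<close>, independently of the horizon, makes
    the limits on the intervals [0, k + 1] agree automatically.\<close>
  define \<Lambda> where "\<Lambda> t = lim (\<lambda>n. add_fun (gk n) t \<omega>)" for t
  have *: "continuous_on {0..real (Suc k)} \<Lambda> \<and> (\<forall>t\<in>{0..real (Suc k)}. (\<lambda>n. add_fun (gk n) t \<omega>) \<longlonglongrightarrow> \<Lambda> t)" for k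
  proof -
    let ?I = "{0..real (Suc k)}"
    have ev: "\<forall>\<^sub>F n in sequentially. \<forall>t\<in>?I. norm (m (Suc n) t - m n t) \<le> 1 / (real (Suc n))\<^sup>2"
      using elim(1)[rule_format, of k] by (auto simp: m_def abs_minus_commute elim!: eventually_mono)
    have sm: "summable (\<lambda>n. 1 / (real (Suc n))\<^sup>2)"
      using summable_Suc_iff[of "\<lambda>n. 1 / (real n)\<^sup>2"] inverse_power_summable[of 2, where 'a=real] by (simp add: inverse_eq_divide)
    define S where "S t = (\<Sum>i. m (Suc i) t - m i t)" for t
    have ul: "uniform_limit ?I (\<lambda>n t. \<Sum>i<n. m (Suc i) t - m i t) S sequentially"
      unfolding S_def by (rule Weierstrass_m_test_ev[OF ev sm])
    have ul: "uniform_limit ?I (\<lambda>n t. m n t - m 0 t) S sequentially"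
    proof -
      have "(\<Sum>i<n. m (Suc i) t - m i t) = m n t - m 0 t" for n t by (rule sum_lessThan_telescope)
      then show ?thesis using ul by (simp only:)
    qed
    have cm: "continuous_on ?I (m n)" for n
      unfolding m_def
      by (intro continuous_on_diff add_fun_cont[OF elim(2) gk_cont] continuous_on_subset[OF cont_comp_B[OF elim(2) fk_cont]]) auto
    have cS: "continuous_on ?I S"
      by (rule uniform_limit_theorem[OF _ ul]) (intro always_eventually allI continuous_on_diff cm, simp)
    have lim: "(\<lambda>n. add_fun (gk n) t \<omega>) \<longlonglongrightarrow> \<bar>B t \<omega>\<bar> - (S t + m 0 t)" if t: "t \<in> ?I" for t
    proof -
      have "(\<lambda>n. m n t - m 0 t) \<longlonglongrightarrow> S t" using tendsto_uniform_limitI[OF ul t] .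
      then have "(\<lambda>n. (m n t - m 0 t) + m 0 t) \<longlonglongrightarrow> S t + m 0 t" by (intro tendsto_intros)
      then have 1: "(\<lambda>n. m n t) \<longlonglongrightarrow> S t + m 0 t" by simp
      have "(\<lambda>n. fk n (B t \<omega>) - \<bar>B t \<omega>\<bar>) \<longlonglongrightarrow> 0"
      proof (rule Lim_null_comparison)
        show "\<forall>\<^sub>F n in sequentially. norm (fk n (B t \<omega>) - \<bar>B t \<omega>\<bar>) \<le> 2 * rad n"
          using trap_F_approx[OF rad_pos rad_Suc_less] by simp
        show "(\<lambda>n. 2 * rad n) \<longlonglongrightarrow> 0" using tendsto_mult_right_zero[OF rad_tendsto] by simp
      qed
      from tendsto_add[OF this tendsto_const[of "\<bar>B t \<omega>\<bar>"]]
      have 2: "(\<lambda>n. fk n (B t \<omega>)) \<longlonglongrightarrow> \<bar>B t \<omega>\<bar>" by simp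
      from tendsto_diff[OF 2 1] show ?thesis by (simp add: m_def)
    qed
    have eq: "\<Lambda> t = \<bar>B t \<omega>\<bar> - (S t + m 0 t)" if "t \<in> ?I" for t
      unfolding \<Lambda>_def using lim[OF that] by (rule limI)
    have "continuous_on ?I (\<lambda>t. \<bar>B t \<omega>\<bar> - (S t + m 0 t))"
      by (intro continuous_intros cS cm continuous_on_subset[OF B_cont[OF elim(2)]]) auto
    then have "continuous_on ?I \<Lambda>" by (rule continuous_on_eq) (simp add: eq)
    moreover have "(\<lambda>n. add_fun (gk n) t \<omega>) \<longlonglongrightarrow> \<Lambda> t" if "t \<in> ?I" for t
      unfolding eq[OF that] by (rule lim[OF that])
    ultimately show ?thesis by blast
  qed
  have "continuous_on {0..} \<Lambda>"
  proof (rule continuous_on_halfline)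
    fix T :: real
    obtain k where "T < real k" using reals_Archimedean2 by blast
    then show "continuous_on {0..T} \<Lambda>" by (intro continuous_on_subset[OF *[THEN conjunct1, of k]]) auto
  qed
  moreover have "(\<lambda>n. add_fun (gk n) t \<omega>) \<longlonglongrightarrow> \<Lambda> t" if "t \<ge> 0" for t
  proof -
    obtain k where "t < real k" using reals_Archimedean2 by blast
    then have "t \<in> {0..real (Suc k)}" using that by simp
    then show ?thesis using * by blast
  qed
  ultimately show ?case by blast
qed

text \<open>Multiplied by rad (n + 1) + rad n, the kernel equals 1 on |x| \<le> rad (n + 1),
  vanishes for |x| \<ge> rad n and lies in [0, 1] between. It is thus squeezed between indicators of
  symmetric intervals.\<close>

lemma occupation_bounds:
  assumes \<omega>: "\<omega> \<in> space M" and t: "t \<ge> 0" and e: "e > 0"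
  shows "e \<le> rad (Suc n) \<Longrightarrow> measure lborel {s\<in>{0..t}. \<bar>B s \<omega>\<bar> < e} \<le> (rad (Suc n) + rad n) * add_fun (gk n) t \<omega>"
    and "rad n \<le> e \<Longrightarrow> (rad (Suc n) + rad n) * add_fun (gk n) t \<omega> \<le> measure lborel {s\<in>{0..t}. \<bar>B s \<omega>\<bar> < e}"
proof -
  let ?S = "{s\<in>{0..t}. \<bar>B s \<omega>\<bar> < e}" and ?c = "rad (Suc n) + rad n"
  have c0: "?c > 0" using rad_pos[of n] rad_pos[of "Suc n"] by simp
  have Sm: "?S \<in> sets borel"
  proof -
    have "continuous_on {0..t} (\<lambda>s. \<bar>B s \<omega>\<bar>)"
      by (intro continuous_intros continuous_on_subset[OF B_cont[OF \<omega>]]) auto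
    then have "openin (top_of_set {0..t}) ({0..t} \<inter> (\<lambda>s. \<bar>B s \<omega>\<bar>) -` {..<e})"
      by (rule continuous_openin_preimage_gen) simp
    then obtain U where "open U" "{0..t} \<inter> (\<lambda>s. \<bar>B s \<omega>\<bar>) -` {..<e} = {0..t} \<inter> U"
      unfolding openin_open by blast
    moreover have "?S = {0..t} \<inter> (\<lambda>s. \<bar>B s \<omega>\<bar>) -` {..<e}" by auto
    ultimately show ?thesis by simp
  qed
  have fin: "emeasure lborel ?S < \<infinity>"
  proof -
    have "emeasure lborel ?S \<le> emeasure lborel {0..t}" by (rule emeasure_mono) auto
    then show ?thesis using t by (simp add: order_le_less_trans)
  qed
  have iS: "integrable lborel (indicator ?S :: real \<Rightarrow> real)" using Sm fin by (intro integrable_real_indicator) auto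
  have mS: "measure lborel ?S = (\<integral>s. indicator ?S s \<partial>lborel)" by simp
  have cc: "continuous_on {0..t} (\<lambda>s. gk n (B s \<omega>))"
    by (rule continuous_on_subset[OF cont_comp_B[OF \<omega> gk_cont]]) auto
  have ig: "set_integrable lborel {0..t} (\<lambda>s. gk n (B s \<omega>))"
    unfolding set_integrable_def by (rule borel_integrable_compact[OF _ cc]) simp
  have A: "add_fun (gk n) t \<omega> = (\<integral>s. indicator {0..t} s *\<^sub>R gk n (B s \<omega>) \<partial>lborel)"
    unfolding add_fun_def using set_borel_integral_eq_integral(2)[OF ig] by (simp add: set_lebesgue_integral_def)
  have ig': "integrable lborel (\<lambda>s. ?c * (indicator {0..t} s *\<^sub>R gk n (B s \<omega>)))"
    using ig unfolding set_integrable_def by (rule integrable_mult_right)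
  have A': "?c * add_fun (gk n) t \<omega> = (\<integral>s. ?c * (indicator {0..t} s *\<^sub>R gk n (B s \<omega>)) \<partial>lborel)"
    unfolding A by simp
  show "measure lborel ?S \<le> ?c * add_fun (gk n) t \<omega>" if le: "e \<le> rad (Suc n)"
    unfolding A' mS
  proof (rule integral_mono[OF iS ig'])
    fix s
    show "indicator ?S s \<le> ?c * (indicator {0..t} s *\<^sub>R gk n (B s \<omega>))"
      using trap_rules(3)[of "B s \<omega>" n] trap_rules(1)[of n "B s \<omega>"] le c0 by (auto simp: indicator_def)
  qed
  show "?c * add_fun (gk n) t \<omega> \<le> measure lborel ?S" if le: "rad n \<le> e"
    unfolding A' mS
  proof (rule integral_mono[OF ig' iS])
    fix s
    have "?c * gk n (B s \<omega>) \<le> 1"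
      using trap_rules(2)[of n "B s \<omega>"] c0 by (simp add: field_simps)
    then show "?c * (indicator {0..t} s *\<^sub>R gk n (B s \<omega>)) \<le> indicator ?S s"
      using trap_rules(4)[of n "B s \<omega>"] le by (auto simp: indicator_def not_less)
  qed
qed

text \<open>For every small \<epsilon> a wider and a narrower kernel bracket the indicator of |x| <
  \<epsilon>. The normalising constants do not match \<epsilon> exactly, but their ratios tend to 1
  because consecutive radii are asymptotically equal.\<close>

lemma local_time0_eq_limit:
  assumes \<omega>: "\<omega> \<in> space M" and t: "t \<ge> 0" and lim: "(\<lambda>n. add_fun (gk n) t \<omega>) \<longlonglongrightarrow> \<Lambda>"
  shows "local_time0 B t \<omega> = \<Lambda>"
proof -
  let ?o = "\<lambda>e. measure lborel {s\<in>{0..t}. \<bar>B s \<omega>\<bar> < e} / (2 * e)"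
  define lo where "lo n = (rad (Suc (Suc (Suc n))) + rad (Suc (Suc n))) / (2 * rad (Suc n)) * add_fun (gk (Suc (Suc n))) t \<omega>" for n
  define up where "up n = (rad (Suc n) + rad n) / (2 * rad (Suc (Suc n))) * add_fun (gk n) t \<omega>" for n
  have ratio: "(\<lambda>n. (rad (Suc (Suc (Suc n))) + rad (Suc (Suc n))) / (2 * rad (Suc n))) \<longlonglongrightarrow> 1"
     "(\<lambda>n. (rad (Suc n) + rad n) / (2 * rad (Suc (Suc n)))) \<longlonglongrightarrow> 1"
    unfolding rad_def by real_asymp+
  have lo: "lo \<longlonglongrightarrow> \<Lambda>" unfolding lo_def
    using tendsto_mult[OF ratio(1) LIMSEQ_ignore_initial_segment[OF lim, of 2]] by (simp add: numeral_2_eq_2)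
  have up: "up \<longlonglongrightarrow> \<Lambda>" unfolding up_def using tendsto_mult[OF ratio(2) lim] by simp
  have "(?o \<longlongrightarrow> \<Lambda>) (at_right 0)"
  proof (rule tendstoI)
    fix r :: real assume r: "r > 0"
    obtain n0 where n0: "\<And>n. n \<ge> n0 \<Longrightarrow> dist (lo n) \<Lambda> < r \<and> dist (up n) \<Lambda> < r"
      using eventually_conj[OF tendstoD[OF lo r] tendstoD[OF up r]] unfolding eventually_sequentially by blast
    have "dist (?o e) \<Lambda> < r" if e: "0 < e" "e < rad (Suc n0)" for e
    proof -
      have "\<exists>n. rad n < e" using order_tendstoD(2)[OF rad_tendsto e(1)] by (auto simp: eventually_sequentially)
      \<comment> \<open>Minimality gives rad N < e \<le> rad (N - 1). The kernel with index N fits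
        inside the interval, and the one with index N - 2 equals its plateau value on it since that
        plateau reaches to rad (N - 1).\<close>
      define N where "N = (LEAST n. rad n < e)"
      have N: "rad N < e" unfolding N_def by (rule LeastI_ex) fact
      have "N > Suc n0" using N e(2) rad_antimono[of N "Suc n0"] by (force simp: not_less[symmetric])
      then have n: "N = Suc (Suc (N - 2))" "N - 2 \<ge> n0" by arith+
      define n where "n = N - 2"
      note n = n[folded n_def]
      have n1: "rad (Suc n) \<ge> e" using not_less_Least[of "Suc n" "\<lambda>n. rad n < e"] n(1) unfolding N_def[symmetric] by simp
      have A0: "0 \<le> add_fun (gk k) t \<omega>" for k
        unfolding add_fun_def by (intro integral_nonneg integrable_continuous_real
               continuous_on_subset[OF cont_comp_B[OF \<omega> gk_cont]]) (auto simp: trap_rules)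
      have c0: "0 \<le> (rad (Suc k) + rad k) * add_fun (gk j) t \<omega>" for k j
        using A0 rad_pos[of k] rad_pos[of "Suc k"] by (intro mult_nonneg_nonneg) auto
      have "?o e \<le> (rad (Suc n) + rad n) * add_fun (gk n) t \<omega> / (2 * rad (Suc (Suc n)))"
        using occupation_bounds(1)[OF \<omega> t e(1) n1] N n(1) rad_pos[of "Suc (Suc n)"] c0 by (intro frac_le) auto
      then have u: "?o e \<le> up n" by (simp add: up_def)
      have "(rad (Suc (Suc (Suc n))) + rad (Suc (Suc n))) * add_fun (gk (Suc (Suc n))) t \<omega> / (2 * rad (Suc n)) \<le> ?o e"
        using occupation_bounds(2)[OF \<omega> t e(1), of "Suc (Suc n)"] N n(1) n1 e(1) by (intro frac_le) (auto intro!: mult_nonneg_nonneg)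
      then have l: "lo n \<le> ?o e" by (simp add: lo_def)
      show ?thesis using u l n0[OF n(2)] unfolding dist_real_def by linarith
    qed
    then show "\<forall>\<^sub>F e in at_right 0. dist (?o e) \<Lambda> < r"
      unfolding eventually_at_right_field using rad_pos by blast
  qed
  then show ?thesis unfolding local_time0_def by (intro tendsto_Lim) auto
qed

text \<open>One null set serves all times simultaneously; it is the set fixed later in the locale in
  which the local time is treated as a process.\<close>

lemma local_time_good_set:
  "\<exists>N\<in>null_sets M. \<forall>\<omega>\<in>space M - N. continuous_on {0..} (\<lambda>t. local_time0 B t \<omega>) \<and>
     (\<forall>t\<ge>0. (\<lambda>n. add_fun (gk n) t \<omega>) \<longlonglongrightarrow> local_time0 B t \<omega>)"
proof -
  from add_fun_limit obtain N where N: "N \<in> null_sets M"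
    "\<And>\<omega>. \<omega> \<in> space M - N \<Longrightarrow> \<exists>\<Lambda>. continuous_on {0..} \<Lambda> \<and> (\<forall>t\<ge>0. (\<lambda>n. add_fun (gk n) t \<omega>) \<longlonglongrightarrow> \<Lambda> t)"
    by (rule AE_E3) blast
  have "continuous_on {0..} (\<lambda>t. local_time0 B t \<omega>) \<and>
     (\<forall>t\<ge>0. (\<lambda>n. add_fun (gk n) t \<omega>) \<longlonglongrightarrow> local_time0 B t \<omega>)" if \<omega>: "\<omega> \<in> space M - N" for \<omega>
  proof -
    obtain \<Lambda> where \<Lambda>: "continuous_on {0..} \<Lambda>" "\<And>t. t \<ge> 0 \<Longrightarrow> (\<lambda>n. add_fun (gk n) t \<omega>) \<longlonglongrightarrow> \<Lambda> t"
      using N(2)[OF \<omega>] by blast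
    have eq: "local_time0 B t \<omega> = \<Lambda> t" if "t \<ge> 0" for t
      using local_time0_eq_limit[OF _ that \<Lambda>(2)[OF that]] \<omega> by simp
    have "continuous_on {0..} (\<lambda>t. local_time0 B t \<omega>)"
      by (rule continuous_on_eq[OF \<Lambda>(1)]) (simp add: eq)
    then show ?thesis using \<Lambda>(2) eq by simp
  qed
  then show ?thesis using N(1) by blast
qed

end

section \<open>Discretised optional stopping\<close>

definition trunc_time :: "real \<Rightarrow> ('a \<Rightarrow> ereal) \<Rightarrow> 'a \<Rightarrow> real" where
  "trunc_time T \<sigma> \<omega> = real_of_ereal (min (ereal T) (\<sigma> \<omega>))"

lemma trunc_time_bounds:
  assumes "0 \<le> T" "0 \<le> \<sigma> \<omega>"
  shows "0 \<le> trunc_time T \<sigma> \<omega>" "trunc_time T \<sigma> \<omega> \<le> T" "ereal (trunc_time T \<sigma> \<omega>) = min (ereal T) (\<sigma> \<omega>)"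
  unfolding trunc_time_def using assms by (cases "\<sigma> \<omega>"; auto simp: min_def)+

text \<open>The switches \<open>W\<close> are on exactly before time s, so the weighted sum of
  increments telescopes to the first grid index not before s, capped at N. The same index J works
  for every sequence v, so several processes can be stopped together.\<close>

lemma grid_stopped_sum:
  fixes v :: "nat \<Rightarrow> real" and s :: ereal
  assumes T: "T > 0" and N: "N > 0" and s: "0 \<le> s" and h: "h = T / real N"
    and W: "\<And>i. i < N \<Longrightarrow> W i = (if ereal (real i * h) < s then 1 else 0 :: real)"
  shows "\<exists>J\<le>N. \<bar>real J * h - real_of_ereal (min (ereal T) s)\<bar> \<le> h \<and>
     (\<forall>v. (\<Sum>i<N. W i * (v (Suc i) - v i)) = v J - v 0)"
proof -
  \<comment> \<open>The alternative j = N provides the cap at T and ensures that the least element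
    exists even when s is infinite.\<close>
  define J where "J = (LEAST j. j = N \<or> s \<le> ereal (real j * h))"
  have hp: "h > 0" using T N h by simp
  have Nh: "real N * h = T" using N h by simp
  have J: "J = N \<or> s \<le> ereal (real J * h)" unfolding J_def by (rule LeastI[of _ N]) simp
  have JN: "J \<le> N" unfolding J_def by (rule Least_le) simp
  have lt: "ereal (real i * h) < s \<and> i \<noteq> N" if "i < J" for i
    using not_less_Least[of i "\<lambda>j. j = N \<or> s \<le> ereal (real j * h)"] that unfolding J_def[symmetric] by auto
  have ge: "s \<le> ereal (real i * h)" if "J \<le> i" "i < N" for i
  proof -
    have "s \<le> ereal (real J * h)" using J that by auto
    also have "\<dots> \<le> ereal (real i * h)" using that hp by (simp add: mult_right_mono)
    finally show ?thesis .
  qed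
  have W1: "W i = 1" if "i < J" for i using lt[OF that] W[of i] that JN by auto
  have W0: "W i = 0" if "J \<le> i" "i < N" for i using ge[OF that] W[of i] that by auto
  have "(\<Sum>i<N. W i * (v (Suc i) - v i)) = v J - v 0" for v
  proof -
    have "(\<Sum>i<N. W i * (v (Suc i) - v i)) = (\<Sum>i<J. W i * (v (Suc i) - v i))"
      by (rule sum.mono_neutral_right) (use JN W0 in auto)
    also have "\<dots> = (\<Sum>i<J. v (Suc i) - v i)" by (rule sum.cong) (auto simp: W1)
    also have "\<dots> = v J - v 0" by (rule sum_lessThan_telescope)
    finally show ?thesis .
  qed
  moreover have "\<bar>real J * h - real_of_ereal (min (ereal T) s)\<bar> \<le> h"
  proof -
    define r where "r = real_of_ereal (min (ereal T) s)"
    have r: "ereal r = min (ereal T) s" "0 \<le> r" "r \<le> T" unfolding r_def using s T by (cases s; auto simp: min_def)+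
    have JT: "real J * h \<le> T" using mult_right_mono[of "real J" "real N" h] JN hp Nh by simp
    have 1: "r \<le> real J * h"
    proof (cases "J = N")
      case True then show ?thesis using r Nh by simp
    next
      case False
      then have "ereal r \<le> ereal (real J * h)" unfolding r(1) using J by (auto simp: min.coboundedI2)
      then show ?thesis by simp
    qed
    have 2: "real J * h - h \<le> r"
    proof (cases J)
      case 0 then show ?thesis using r hp by simp
    next
      case (Suc j)
      have "ereal (real j * h) \<le> min (ereal T) s"
        using lt[of j] Suc JT hp by (auto simp: algebra_simps intro: less_imp_le)
      then have "real j * h \<le> r" unfolding r(1)[symmetric] by simp
      then show ?thesis using Suc by (simp add: algebra_simps)
    qed
    show ?thesis using 1 2 hp unfolding r_def by linarith
  qed
  ultimately show ?thesis using JN by blast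
qed

context bm
begin

text \<open>Rounding the time down to a multiple of 1 / (n + 1) leaves countably many values, for
  which measurability is that of the single \<open>X t\<close>; continuity of the path removes the
  rounding.\<close>

lemma random_time_measurable:
  fixes X :: "real \<Rightarrow> 'a \<Rightarrow> real"
  assumes X: "\<And>t. 0 \<le> t \<Longrightarrow> X t \<in> borel_measurable M"
    and c: "\<And>\<omega>. \<omega> \<in> space M \<Longrightarrow> continuous_on {0..} (\<lambda>t. X t \<omega>)"
    and \<rho> [measurable]: "\<rho> \<in> borel_measurable M" and \<rho>0: "\<And>\<omega>. 0 \<le> \<rho> \<omega>"
  shows "(\<lambda>\<omega>. X (\<rho> \<omega>) \<omega>) \<in> borel_measurable M"
proof (rule borel_measurable_LIMSEQ_real)
  show "(\<lambda>\<omega>. X (real (nat \<lfloor>\<rho> \<omega> * real (Suc n)\<rfloor>) / real (Suc n)) \<omega>) \<in> borel_measurable M" for n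
    by (rule measurable_compose_countable[where f = "\<lambda>i \<omega>. X (real i / real (Suc n)) \<omega>"]) (auto intro!: X)
  fix \<omega> assume \<omega>: "\<omega> \<in> space M"
  have "(\<lambda>n. real (nat \<lfloor>\<rho> \<omega> * real (Suc n)\<rfloor>) / real (Suc n)) \<longlonglongrightarrow> \<rho> \<omega>"
  proof (rule tendsto_sandwich[OF always_eventually[OF allI] always_eventually[OF allI]])
    show "(\<lambda>n. \<rho> \<omega> - 1 / real (Suc n)) \<longlonglongrightarrow> \<rho> \<omega>" by real_asymp
    show "(\<lambda>n. \<rho> \<omega>) \<longlonglongrightarrow> \<rho> \<omega>" by simp
    show "\<rho> \<omega> - 1 / real (Suc n) \<le> real (nat \<lfloor>\<rho> \<omega> * real (Suc n)\<rfloor>) / real (Suc n)" for n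
    proof -
      have "\<rho> \<omega> * real (Suc n) - 1 \<le> real (nat \<lfloor>\<rho> \<omega> * real (Suc n)\<rfloor>)" using \<rho>0[of \<omega>] by (simp add: of_nat_nat)
      from divide_right_mono[OF this, of "real (Suc n)"] show ?thesis
        by (simp add: diff_divide_distrib del: of_nat_Suc)
    qed
    show "real (nat \<lfloor>\<rho> \<omega> * real (Suc n)\<rfloor>) / real (Suc n) \<le> \<rho> \<omega>" for n
    proof -
      have "real (nat \<lfloor>\<rho> \<omega> * real (Suc n)\<rfloor>) \<le> \<rho> \<omega> * real (Suc n)" using \<rho>0[of \<omega>] by (simp add: of_nat_nat)
      from divide_right_mono[OF this, of "real (Suc n)"] show ?thesis by (simp del: of_nat_Suc)
    qed
  qed
  then show "(\<lambda>n. X (real (nat \<lfloor>\<rho> \<omega> * real (Suc n)\<rfloor>) / real (Suc n)) \<omega>) \<longlonglongrightarrow> X (\<rho> \<omega>) \<omega>"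
    by (rule continuous_on_tendsto_compose[OF c[OF \<omega>]]) (auto simp: \<rho>0)
qed

text \<open>The filtration need not contain the null sets, so events are only required to be adapted up to them.\<close>

definition ae_stopping :: "('a \<Rightarrow> ereal) \<Rightarrow> bool" where
  "ae_stopping \<sigma> \<longleftrightarrow> \<sigma> \<in> borel_measurable M \<and> (\<forall>\<omega>. 0 \<le> \<sigma> \<omega>) \<and>
     (\<forall>t\<ge>0. \<exists>A\<in>sets (F t). AE \<omega> in M. ereal t < \<sigma> \<omega> \<longleftrightarrow> \<omega> \<in> A)"

text \<open>A discrete Ito product rule for \<Gamma>(A) - f(B) \<gamma>(A). The growth \<gamma>(A) h
  g of the first term cancels the mean of the second order part of the other, and the first order
  part has mean zero. There remain a squared increment of A, a Taylor error, and f(B) times the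
  increment of \<gamma>(A), which is at most Q h on |B| < a. Only the last contributes after
  refinement, with total 2 Q a sqrt T, and it disappears when the kernel shrinks.\<close>

lemma grid_identity:
  fixes \<Gamma> \<gamma> :: "real \<Rightarrow> real"
  assumes qk: "quad_kernel K f P g" and f0: "f 0 = 0" and g0: "\<And>x. 0 \<le> g x" and G: "\<And>x. g x \<le> G"
    and P1: "\<And>x. \<bar>P x\<bar> \<le> 1" and fg: "\<And>x. \<bar>f x\<bar> * g x \<le> indicator {-a<..<a} x"
    and a: "a > 0" and T: "T > 0" and N: "N > 0" and h_def: "h = T / real N"
    and \<Gamma>c: "continuous_on UNIV \<Gamma>" and \<gamma>c: "continuous_on UNIV \<gamma>"
    and \<Gamma>b: "\<And>x. 0 \<le> x \<Longrightarrow> \<bar>\<Gamma> x\<bar> \<le> C" and \<gamma>b: "\<And>x. 0 \<le> x \<Longrightarrow> \<bar>\<gamma> x\<bar> \<le> C"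
    and \<gamma>l: "\<And>x y. 0 \<le> x \<Longrightarrow> x \<le> y \<Longrightarrow> \<bar>\<gamma> y - \<gamma> x\<bar> \<le> Q * (y - x)"
    and \<Gamma>t: "\<And>x y. 0 \<le> x \<Longrightarrow> x \<le> y \<Longrightarrow> \<bar>\<Gamma> y - \<Gamma> x - \<gamma> y * (y - x)\<bar> \<le> Q * (y - x)\<^sup>2"
    and Q: "Q \<ge> 0"
    and W: "\<And>i. W i \<in> borel_measurable (F (real i * h))" and W01: "\<And>i \<omega>. 0 \<le> W i \<omega> \<and> W i \<omega> \<le> 1"
    and A_def: "A = (\<lambda>i \<omega>. \<Sum>j<i. h * g (B (real j * h) \<omega>))"
    and u_def: "u = (\<lambda>i \<omega>. \<Gamma> (A i \<omega>) - f (B (real i * h) \<omega>) * \<gamma> (A i \<omega>))"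
  shows "(\<lambda>\<omega>. \<Sum>i<N. W i \<omega> * (u (Suc i) \<omega> - u i \<omega>)) \<in> borel_measurable M"
    and "\<bar>\<integral>\<omega>. (\<Sum>i<N. W i \<omega> * (u (Suc i) \<omega> - u i \<omega>)) \<partial>M\<bar> \<le> Q * (h + 2 * a * sqrt T) + T * (Q * G\<^sup>2 * h + 4 * C * K * sqrt h)"
    and "\<And>i. 0 \<le> A i \<omega>"
proof -
  have h: "h > 0" "sqrt h > 0" using T N by (auto simp: h_def)
  have Nh: "real N * h = T" using N by (simp add: h_def)
  have K: "K \<ge> 0" using qk by (simp add: quad_kernel_def)
  have C: "C \<ge> 0" using \<Gamma>b[of 0] by simp
  have G0: "G \<ge> 0" using g0[of 0] G[of 0] by simp
  have mf: "f \<in> borel_measurable borel" and mP: "P \<in> borel_measurable borel" and mg: "g \<in> borel_measurable borel"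
    using quad_kernel_measurable[OF qk] by auto
  have m\<Gamma>: "\<Gamma> \<in> borel_measurable borel" and m\<gamma>: "\<gamma> \<in> borel_measurable borel"
    using \<Gamma>c \<gamma>c by (auto intro: borel_measurable_continuous_onI)
  have A0: "0 \<le> A i \<omega>" for i \<omega> unfolding A_def using h g0 by (intro sum_nonneg mult_nonneg_nonneg) auto
  then show "\<And>i. 0 \<le> A i \<omega>" .
  have BF: "B (real j * h) \<in> borel_measurable (F (real i * h))" if "j \<le> i" for i j
    using that h by (intro B_F) (auto intro!: mult_right_mono)
  \<comment> \<open>The left Riemann sum with index i + 1 uses B only up to time i * h. This shift
    by one is what allows \<open>\<gamma> (A (Suc i) \<omega>)\<close> to be pulled out of
    expectations against the next increment.\<close>
  have AF: "A j \<in> borel_measurable (F (real i * h))" if "j \<le> Suc i" for i j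
    unfolding A_def
    by (intro borel_measurable_sum borel_measurable_times borel_measurable_const measurable_compose[OF BF mg]) (use that in auto)
  have WM: "W i \<in> borel_measurable M" for i using W measurable_F_M by blast
  have uM: "u i \<in> borel_measurable M" for i
    unfolding u_def
    by (intro borel_measurable_diff borel_measurable_times measurable_compose[OF measurable_F_M[OF AF, of i i] m\<Gamma>]
       measurable_compose[OF measurable_F_M[OF AF, of i i] m\<gamma>] measurable_compose[OF measurable_F_M[OF BF, of i i] mf]) auto
  show "(\<lambda>\<omega>. \<Sum>i<N. W i \<omega> * (u (Suc i) \<omega> - u i \<omega>)) \<in> borel_measurable M"
    by (intro borel_measurable_sum borel_measurable_times borel_measurable_diff WM uM)
  define D where "D i \<omega> = B (real (Suc i) * h) \<omega> - B (real i * h) \<omega>" for i \<omega>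
  define V :: "nat \<Rightarrow> 'a \<Rightarrow> real" where "V i \<omega> = indicator {-a<..<a} (B (real i * h) \<omega>)" for i \<omega>
  define U1 where "U1 i \<omega> = - (W i \<omega> * \<gamma> (A (Suc i) \<omega>) * P (B (real i * h) \<omega>))" for i \<omega>
  define U2 where "U2 i \<omega> = - (W i \<omega> * \<gamma> (A (Suc i) \<omega>) * g (B (real i * h) \<omega>))" for i \<omega>
  define R where "R i \<omega> = W i \<omega> * (u (Suc i) \<omega> - u i \<omega>) - U1 i \<omega> * D i \<omega> - U2 i \<omega> * ((D i \<omega>)\<^sup>2 - h)" for i \<omega>
  have R: "\<bar>R i \<omega>\<bar> \<le> Q * G\<^sup>2 * h\<^sup>2 + Q * h * V i \<omega> + 2 * C * K * \<bar>D i \<omega>\<bar>^3" for i \<omega>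
  proof -
    define x d w where "x = B (real i * h) \<omega>" and "d = D i \<omega>" and "w = W i \<omega>"
    define p q where "p = A i \<omega>" and "q = A (Suc i) \<omega>"
    have w: "0 \<le> w" "w \<le> 1" using W01 by (auto simp: w_def)
    have xd: "B (real (Suc i) * h) \<omega> = x + d" by (simp add: x_def d_def D_def)
    have qp: "q - p = h * g x" by (simp add: q_def p_def A_def x_def)
    have "0 \<le> h * g x" using h g0[of x] by simp
    then have pq: "0 \<le> p" "p \<le> q" using A0[of i \<omega>] qp by (auto simp: p_def)
    define r where "r = f (x + d) - f x - P x * d - g x * d\<^sup>2"
    have r: "\<bar>r\<bar> \<le> 2 * K * \<bar>d\<bar>^3" unfolding r_def by (rule quad_kernel_taylor[OF qk])
    have qpe: "q = p + h * g x" using qp by simp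
    \<comment> \<open>Choosing the new value q = A (i + 1) in \<gamma> makes both \<gamma>(q) h g
      terms cancel exactly; with the old value an additional error would remain.\<close>
    have eq: "R i \<omega> = w * ((\<Gamma> q - \<Gamma> p - \<gamma> q * (q - p)) - f x * (\<gamma> q - \<gamma> p) - \<gamma> q * r)"
      unfolding R_def u_def U1_def U2_def xd d_def[symmetric] x_def[symmetric] w_def[symmetric] p_def[symmetric] q_def[symmetric] qp r_def
      by (simp add: algebra_simps)
    have "\<bar>R i \<omega>\<bar> \<le> \<bar>(\<Gamma> q - \<Gamma> p - \<gamma> q * (q - p)) - f x * (\<gamma> q - \<gamma> p) - \<gamma> q * r\<bar>"
      unfolding eq abs_mult using w by (intro mult_left_le_one_le) auto
    also have "\<dots> \<le> \<bar>\<Gamma> q - \<Gamma> p - \<gamma> q * (q - p)\<bar> + \<bar>f x\<bar> * \<bar>\<gamma> q - \<gamma> p\<bar> + \<bar>\<gamma> q\<bar> * \<bar>r\<bar>"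
      unfolding abs_mult[symmetric] by linarith
    also have "\<dots> \<le> Q * (h * g x)\<^sup>2 + \<bar>f x\<bar> * (Q * (h * g x)) + C * (2 * K * \<bar>d\<bar>^3)"
      using \<Gamma>t[OF pq] \<gamma>l[OF pq] \<gamma>b[of q] pq r C unfolding qp
      by (intro add_mono mult_mono mult_left_mono) auto
    also have "\<dots> \<le> Q * (G\<^sup>2 * h\<^sup>2) + Q * h * V i \<omega> + C * (2 * K * \<bar>d\<bar>^3)"
    proof (intro add_mono)
      have "(h * g x)\<^sup>2 \<le> (h * G)\<^sup>2" using h g0[of x] G[of x] by (intro power_mono mult_left_mono) auto
      then show "Q * (h * g x)\<^sup>2 \<le> Q * (G\<^sup>2 * h\<^sup>2)" using Q by (intro mult_left_mono) (auto simp: power_mult_distrib mult.commute)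
      have "\<bar>f x\<bar> * (Q * (h * g x)) = Q * h * (\<bar>f x\<bar> * g x)" by simp
      also have "\<dots> \<le> Q * h * V i \<omega>" using fg[of x] Q h unfolding V_def x_def by (intro mult_left_mono) auto
      finally show "\<bar>f x\<bar> * (Q * (h * g x)) \<le> Q * h * V i \<omega>" .
    qed simp
    finally show ?thesis by (simp add: d_def algebra_simps)
  qed
  have s: "0 \<le> real i * h" "real i * h < real (Suc i) * h" "real i * h \<le> real (Suc i) * h" "real (Suc i) * h - real i * h = h" for i
    using h by (auto simp: algebra_simps)
  note mom = incr_moments[OF s(1,2), folded D_def, unfolded s(4)]
  have iU1: "U1 i \<in> borel_measurable (F (real i * h))" "integrable M (U1 i)" for i
  proof -
    show m: "U1 i \<in> borel_measurable (F (real i * h))"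
      unfolding U1_def by (intro borel_measurable_uminus borel_measurable_times W measurable_compose[OF AF m\<gamma>] measurable_compose[OF BF mP]) auto
    show "integrable M (U1 i)"
    proof (rule integrable_const_bound[where B = "1 * C * 1"])
      show "AE \<omega> in M. norm (U1 i \<omega>) \<le> 1 * C * 1"
        unfolding U1_def real_norm_def abs_minus_cancel abs_mult
        using W01 \<gamma>b A0 P1 C by (intro AE_I2 mult_mono) auto
    qed (use m measurable_F_M in blast)
  qed
  have iU2: "U2 i \<in> borel_measurable (F (real i * h))" "integrable M (U2 i)" for i
  proof -
    show m: "U2 i \<in> borel_measurable (F (real i * h))"
      unfolding U2_def by (intro borel_measurable_uminus borel_measurable_times W measurable_compose[OF AF m\<gamma>] measurable_compose[OF BF mg]) auto
    show "integrable M (U2 i)"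
    proof (rule integrable_const_bound[where B = "1 * C * G"])
      show "AE \<omega> in M. norm (U2 i \<omega>) \<le> 1 * C * G"
        unfolding U2_def real_norm_def abs_minus_cancel abs_mult
        using W01 \<gamma>b A0 G g0 C by (intro AE_I2 mult_mono) auto
    qed (use m measurable_F_M in blast)
  qed
  have iV: "integrable M (V i)"
    "(\<integral>\<omega>. V i \<omega> \<partial>M) = prob {\<omega>\<in>space M. \<bar>B (real i * h) \<omega>\<bar> < a}" for i
  proof -
    note [measurable] = B_M[OF s(1), of i]
    show "integrable M (V i)" unfolding V_def by (rule integrable_const_bound[where B = 1]) auto
    have "(\<integral>\<omega>. V i \<omega> \<partial>M) = (\<integral>\<omega>. indicator {\<omega>\<in>space M. \<bar>B (real i * h) \<omega>\<bar> < a} \<omega> \<partial>M)"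
      by (rule Bochner_Integration.integral_cong) (auto simp: V_def indicator_def abs_less_iff)
    then show "(\<integral>\<omega>. V i \<omega> \<partial>M) = prob {\<omega>\<in>space M. \<bar>B (real i * h) \<omega>\<bar> < a}" by simp
  qed
  have t1: "integrable M (\<lambda>\<omega>. U1 i \<omega> * D i \<omega>)" "(\<integral>\<omega>. U1 i \<omega> * D i \<omega> \<partial>M) = 0" for i
    using expectation_mult_incr[OF s(1,3) iU1, of "\<lambda>x. x"] mom(1)[of i 1] mom(2)[of i] by (simp_all add: D_def)
  have t2: "integrable M (\<lambda>\<omega>. U2 i \<omega> * ((D i \<omega>)\<^sup>2 - h))" "(\<integral>\<omega>. U2 i \<omega> * ((D i \<omega>)\<^sup>2 - h) \<partial>M) = 0" for i
    using expectation_mult_incr[OF s(1,3) iU2, of "\<lambda>x. x\<^sup>2 - h"] mom(1)[of i 2] mom(3)[of i]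
    by (simp_all add: D_def prob_space)
  let ?b = "\<lambda>i \<omega>. Q * G\<^sup>2 * h\<^sup>2 + Q * h * V i \<omega> + 2 * C * K * \<bar>D i \<omega>\<bar>^3"
  have ib: "integrable M (?b i)" for i
    by (intro Bochner_Integration.integrable_add integrable_mult_right iV mom(7) integrable_const)
  have iR: "integrable M (R i)" for i
  proof (rule Bochner_Integration.integrable_bound[OF ib])
    have DM: "D i \<in> borel_measurable M" unfolding D_def by (intro borel_measurable_diff B_M s)
    show "R i \<in> borel_measurable M" unfolding R_def
      by (intro borel_measurable_diff borel_measurable_times WM uM borel_measurable_power borel_measurable_const
           measurable_F_M[OF iU1(1)] measurable_F_M[OF iU2(1)] DM)
    show "AE \<omega> in M. norm (R i \<omega>) \<le> norm (?b i \<omega>)"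
      using R by (intro AE_I2) (auto intro: order_trans[OF _ abs_ge_self])
  qed
  have ER: "\<bar>\<integral>\<omega>. R i \<omega> \<partial>M\<bar> \<le> Q * (h * prob {\<omega>\<in>space M. \<bar>B (real i * h) \<omega>\<bar> < a}) + h * (Q * G\<^sup>2 * h + 4 * C * K * sqrt h)" for i
  proof -
    have "\<bar>\<integral>\<omega>. R i \<omega> \<partial>M\<bar> \<le> (\<integral>\<omega>. \<bar>R i \<omega>\<bar> \<partial>M)" by (rule integral_abs_bound)
    also have "\<dots> \<le> (\<integral>\<omega>. ?b i \<omega> \<partial>M)" by (intro integral_mono integrable_abs iR ib R)
    also have "\<dots> = Q * G\<^sup>2 * h\<^sup>2 + Q * h * prob {\<omega>\<in>space M. \<bar>B (real i * h) \<omega>\<bar> < a} + 2 * C * K * (\<integral>\<omega>. \<bar>D i \<omega>\<bar>^3 \<partial>M)"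
      by (simp add: iV mom prob_space)
    also have "\<dots> \<le> Q * G\<^sup>2 * h\<^sup>2 + Q * h * prob {\<omega>\<in>space M. \<bar>B (real i * h) \<omega>\<bar> < a} + 2 * C * K * (2 * h * sqrt h)"
      using mom(6)[of i] C K by (intro add_left_mono mult_left_mono) auto
    also have "\<dots> = Q * (h * prob {\<omega>\<in>space M. \<bar>B (real i * h) \<omega>\<bar> < a}) + h * (Q * G\<^sup>2 * h + 4 * C * K * sqrt h)"
      by (simp add: power2_eq_square algebra_simps)
    finally show ?thesis .
  qed
  have ieq: "W i \<omega> * (u (Suc i) \<omega> - u i \<omega>) = R i \<omega> + U1 i \<omega> * D i \<omega> + U2 i \<omega> * ((D i \<omega>)\<^sup>2 - h)" for i \<omega>
    by (simp add: R_def)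
  have ii: "integrable M (\<lambda>\<omega>. W i \<omega> * (u (Suc i) \<omega> - u i \<omega>))" for i
    unfolding ieq by (intro Bochner_Integration.integrable_add iR t1 t2)
  have ei: "(\<integral>\<omega>. W i \<omega> * (u (Suc i) \<omega> - u i \<omega>) \<partial>M) = (\<integral>\<omega>. R i \<omega> \<partial>M)" for i
    unfolding ieq by (simp add: iR t1 t2)
  have "\<bar>\<integral>\<omega>. (\<Sum>i<N. W i \<omega> * (u (Suc i) \<omega> - u i \<omega>)) \<partial>M\<bar> = \<bar>\<Sum>i<N. \<integral>\<omega>. R i \<omega> \<partial>M\<bar>"
    by (simp add: Bochner_Integration.integral_sum[OF ii] ei)
  also have "\<dots> \<le> (\<Sum>i<N. \<bar>\<integral>\<omega>. R i \<omega> \<partial>M\<bar>)" by (rule sum_abs)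
  also have "\<dots> \<le> (\<Sum>i<N. Q * (h * prob {\<omega>\<in>space M. \<bar>B (real i * h) \<omega>\<bar> < a}) + h * (Q * G\<^sup>2 * h + 4 * C * K * sqrt h))"
    by (intro sum_mono ER)
  also have "\<dots> = Q * (\<Sum>i<N. h * prob {\<omega>\<in>space M. \<bar>B (real i * h) \<omega>\<bar> < a}) + real N * (h * (Q * G\<^sup>2 * h + 4 * C * K * sqrt h))"
  proof -
    have "(\<Sum>i<N. c * x i + d) = c * (\<Sum>i<N. x i) + real N * d" for c d :: real and x
      by (simp add: sum.distrib sum_distrib_left)
    then show ?thesis .
  qed
  also have "\<dots> \<le> Q * (h + 2 * a * sqrt T) + real N * (h * (Q * G\<^sup>2 * h + 4 * C * K * sqrt h))"
    using grid_occupation[OF T N a, folded h_def] Q by (intro add_right_mono mult_left_mono) auto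
  also have "\<dots> = Q * (h + 2 * a * sqrt T) + T * (Q * G\<^sup>2 * h + 4 * C * K * sqrt h)"
    by (simp only: mult.assoc[symmetric] Nh)
  finally show "\<bar>\<integral>\<omega>. (\<Sum>i<N. W i \<omega> * (u (Suc i) \<omega> - u i \<omega>)) \<partial>M\<bar> \<le> Q * (h + 2 * a * sqrt T) + T * (Q * G\<^sup>2 * h + 4 * C * K * sqrt h)" .
qed

text \<open>Orthogonality of the switched increments bounds the second moment by elapsed time. This
  yields uniform integrability of the discretised stopped Brownian motion.\<close>

lemma grid_martingale_L2:
  assumes h: "h > 0" and W: "\<And>i. W i \<in> borel_measurable (F (real i * h))" and W01: "\<And>i \<omega>. 0 \<le> W i \<omega> \<and> W i \<omega> \<le> (1::real)"
    and X_def: "X = (\<lambda>n \<omega>. \<Sum>i<n. W i \<omega> * (B (real (Suc i) * h) \<omega> - B (real i * h) \<omega>))"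
  shows "X n \<in> borel_measurable M" "integrable M (\<lambda>\<omega>. (X n \<omega>)\<^sup>2)" "(\<integral>\<omega>. (X n \<omega>)\<^sup>2 \<partial>M) \<le> real n * h"
proof -
  define D where "D i \<omega> = B (real (Suc i) * h) \<omega> - B (real i * h) \<omega>" for i \<omega>
  have s: "0 \<le> real i * h" "real i * h < real (Suc i) * h" "real i * h \<le> real (Suc i) * h" "real (Suc i) * h - real i * h = h" for i
    using h by (auto simp: algebra_simps)
  note mom = incr_moments[OF s(1,2), folded D_def, unfolded s(4)]
  have XF: "X n \<in> borel_measurable (F (real n * h))" for n
    unfolding X_def
  proof (intro borel_measurable_sum borel_measurable_times borel_measurable_diff)
    fix i assume "i \<in> {..<n}"
    then have le: "real i * h \<le> real n * h" "real (Suc i) * h \<le> real n * h"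
      using h by (auto intro!: mult_right_mono simp del: of_nat_Suc)
    show "W i \<in> borel_measurable (F (real n * h))" using W le(1) by (rule measurable_F_mono)
    show "B (real (Suc i) * h) \<in> borel_measurable (F (real n * h))" "B (real i * h) \<in> borel_measurable (F (real n * h))"
      using le s by (auto intro!: B_F simp del: of_nat_Suc)
  qed
  then show XM: "X n \<in> borel_measurable M" for n using measurable_F_M by blast
  have WM: "W i \<in> borel_measurable M" for i using W measurable_F_M by blast
  have "integrable M (\<lambda>\<omega>. (X n \<omega>)\<^sup>2) \<and> (\<integral>\<omega>. (X n \<omega>)\<^sup>2 \<partial>M) \<le> real n * h" for n
  proof (induction n)
    case 0 then show ?case by (simp add: X_def)
  next
    case (Suc n)
    have iX: "integrable M (X n)" using square_integrable_imp_integrable[OF XM] Suc by blast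
    have iWX: "integrable M (\<lambda>\<omega>. 2 * (W n \<omega> * X n \<omega>))"
    proof (rule Bochner_Integration.integrable_bound)
      show "integrable M (\<lambda>\<omega>. 2 * X n \<omega>)" using iX by simp
      show "AE \<omega> in M. norm (2 * (W n \<omega> * X n \<omega>)) \<le> norm (2 * X n \<omega>)"
        using W01 by (intro AE_I2) (auto simp: abs_mult intro!: mult_left_le_one_le)
    qed (intro borel_measurable_times WM XM borel_measurable_const)
    have iW2: "integrable M (\<lambda>\<omega>. (W n \<omega>)\<^sup>2)"
    proof (rule integrable_const_bound[where B = 1])
      show "AE \<omega> in M. norm ((W n \<omega>)\<^sup>2) \<le> 1" using W01 by (intro AE_I2) (auto intro!: power_le_one)
    qed (intro borel_measurable_power WM)
    have mm: "(\<lambda>\<omega>. 2 * (W n \<omega> * X n \<omega>)) \<in> borel_measurable (F (real n * h))" "(\<lambda>\<omega>. (W n \<omega>)\<^sup>2) \<in> borel_measurable (F (real n * h))"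
      by (intro borel_measurable_times borel_measurable_power W XF borel_measurable_const)+
    have t1: "integrable M (\<lambda>\<omega>. 2 * (W n \<omega> * X n \<omega>) * D n \<omega>)" "(\<integral>\<omega>. 2 * (W n \<omega> * X n \<omega>) * D n \<omega> \<partial>M) = 0"
      using expectation_mult_incr[OF s(1,3) mm(1) iWX, of "\<lambda>x. x"] mom(1)[of n 1] mom(2)[of n] by (simp_all add: D_def)
    have t2: "integrable M (\<lambda>\<omega>. (W n \<omega>)\<^sup>2 * (D n \<omega>)\<^sup>2)" "(\<integral>\<omega>. (W n \<omega>)\<^sup>2 * (D n \<omega>)\<^sup>2 \<partial>M) = (\<integral>\<omega>. (W n \<omega>)\<^sup>2 \<partial>M) * h"
      using expectation_mult_incr[OF s(1,3) mm(2) iW2, of "\<lambda>x. x\<^sup>2"] mom(1)[of n 2] mom(3)[of n] by (simp_all add: D_def)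
    have eq: "(X (Suc n) \<omega>)\<^sup>2 = (X n \<omega>)\<^sup>2 + 2 * (W n \<omega> * X n \<omega>) * D n \<omega> + (W n \<omega>)\<^sup>2 * (D n \<omega>)\<^sup>2" for \<omega>
    proof -
      have e: "X (Suc n) \<omega> = X n \<omega> + W n \<omega> * D n \<omega>" unfolding X_def sum.lessThan_Suc D_def by simp
      show ?thesis unfolding e by algebra
    qed
    have "(\<integral>\<omega>. (W n \<omega>)\<^sup>2 \<partial>M) \<le> (\<integral>\<omega>. 1 \<partial>M)"
      using W01 by (intro integral_mono iW2) (auto intro!: power_le_one)
    then have W1: "(\<integral>\<omega>. (W n \<omega>)\<^sup>2 \<partial>M) * h \<le> h" using h by (simp add: prob_space)
    show ?case
    proof
      show "integrable M (\<lambda>\<omega>. (X (Suc n) \<omega>)\<^sup>2)" unfolding eq using Suc t1 t2 by (intro Bochner_Integration.integrable_add) auto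
      have "(\<integral>\<omega>. (X (Suc n) \<omega>)\<^sup>2 \<partial>M) = (\<integral>\<omega>. (X n \<omega>)\<^sup>2 \<partial>M) + 0 + (\<integral>\<omega>. (W n \<omega>)\<^sup>2 \<partial>M) * h"
        unfolding eq using Suc t1 t2 by simp
      then show "(\<integral>\<omega>. (X (Suc n) \<omega>)\<^sup>2 \<partial>M) \<le> real (Suc n) * h" using Suc W1 by (simp add: distrib_right)
    qed
  qed
  then show "integrable M (\<lambda>\<omega>. (X n \<omega>)\<^sup>2)" "(\<integral>\<omega>. (X n \<omega>)\<^sup>2 \<partial>M) \<le> real n * h" by blast+
qed

end

section \<open>The stopped martingale identity\<close>

context bm
begin

lemma trunc_time_measurable:
  assumes "\<sigma> \<in> borel_measurable M"
  shows "trunc_time T \<sigma> \<in> borel_measurable M"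
  unfolding trunc_time_def[abs_def] using assms by measurable

lemma B_trunc_time_measurable:
  assumes "ae_stopping \<sigma>" "T > 0"
  shows "(\<lambda>\<omega>. B (trunc_time T \<sigma> \<omega>) \<omega>) \<in> borel_measurable M"
  by (rule random_time_measurable[OF B_M B_cont trunc_time_measurable])
     (use assms trunc_time_bounds(1)[of T \<sigma>] in \<open>auto simp: ae_stopping_def\<close>)

text \<open>The switch at i * h is the indicator of an event of \<open>F (i * h)\<close> that agrees
  almost surely with i * h < \<sigma>. Since there are countably many grid points, one null set
  covers all disagreements, and off it the telescoping to a single index J m is exact.\<close>

lemma stopped_grid_limit:
  assumes \<sigma>: "ae_stopping \<sigma>" and T: "T > 0"
  shows "\<exists>W :: nat \<Rightarrow> nat \<Rightarrow> 'a \<Rightarrow> real. (\<forall>m i. W m i \<in> borel_measurable (F (real i * (T / real (Suc m)))) \<and> (\<forall>\<omega>. 0 \<le> W m i \<omega> \<and> W m i \<omega> \<le> 1)) \<and>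
    (AE \<omega> in M. \<exists>J. \<forall>m. J m \<le> Suc m \<and> \<bar>real (J m) * (T / real (Suc m)) - trunc_time T \<sigma> \<omega>\<bar> \<le> T / real (Suc m) \<and>
       (\<forall>v. (\<Sum>i<Suc m. W m i \<omega> * (v (Suc i) - v i)) = v (J m) - v 0))"
proof -
  define h where "h m = T / real (Suc m)" for m
  have hp: "h m > 0" for m using T by (simp add: h_def)
  have "\<exists>A\<in>sets (F (real i * h m)). AE \<omega> in M. ereal (real i * h m) < \<sigma> \<omega> \<longleftrightarrow> \<omega> \<in> A" for m i
  proof -
    have "0 \<le> real i * h m" using hp[of m] by simp
    then show ?thesis using \<sigma> unfolding ae_stopping_def by blast
  qed
  then have "\<forall>p. \<exists>A. A \<in> sets (F (real (snd p) * h (fst p))) \<and> (AE \<omega> in M. ereal (real (snd p) * h (fst p)) < \<sigma> \<omega> \<longleftrightarrow> \<omega> \<in> A)"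
    by blast
  from choice[OF this] obtain A' where A': "\<forall>p. A' p \<in> sets (F (real (snd p) * h (fst p))) \<and> (AE \<omega> in M. ereal (real (snd p) * h (fst p)) < \<sigma> \<omega> \<longleftrightarrow> \<omega> \<in> A' p)"
    by (elim exE)
  define A where "A m i = A' (m, i)" for m i
  have A: "A m i \<in> sets (F (real i * h m))" "AE \<omega> in M. ereal (real i * h m) < \<sigma> \<omega> \<longleftrightarrow> \<omega> \<in> A m i" for m i
    using A'[rule_format, of "(m, i)"] by (simp_all add: A_def)
  define W :: "nat \<Rightarrow> nat \<Rightarrow> 'a \<Rightarrow> real" where "W m i = indicator (A m i)" for m i
  have "AE \<omega> in M. \<forall>m i. ereal (real i * h m) < \<sigma> \<omega> \<longleftrightarrow> \<omega> \<in> A m i"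
    using A(2) by (simp add: AE_all_countable)
  then have "AE \<omega> in M. \<exists>J. \<forall>m. J m \<le> Suc m \<and> \<bar>real (J m) * h m - trunc_time T \<sigma> \<omega>\<bar> \<le> h m \<and>
       (\<forall>v. (\<Sum>i<Suc m. W m i \<omega> * (v (Suc i) - v i)) = v (J m) - v 0)"
  proof eventually_elim
    case (elim \<omega>)
    have "\<exists>J\<le>Suc m. \<bar>real J * h m - trunc_time T \<sigma> \<omega>\<bar> \<le> h m \<and>
       (\<forall>v. (\<Sum>i<Suc m. W m i \<omega> * (v (Suc i) - v i)) = v J - v 0)" for m
      unfolding trunc_time_def
      by (rule grid_stopped_sum[OF T zero_less_Suc _ h_def])
         (use \<sigma> elim in \<open>auto simp: ae_stopping_def W_def indicator_def\<close>)
    then show ?case by (intro choice) blast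
  qed
  moreover have "W m i \<in> borel_measurable (F (real i * h m)) \<and> (\<forall>\<omega>. 0 \<le> W m i \<omega> \<and> W m i \<omega> \<le> 1)" for m i
    unfolding W_def using A(1) by (auto intro!: borel_measurable_indicator simp: indicator_def)
  ultimately show ?thesis unfolding h_def by blast
qed

text \<open>The discretised stopped values of B are bounded in L2 by T, so Vitali's theorem passes
  to the stopped value itself. The functional u is bounded by an affine function of |B|, so the same
  uniform integrability lets the discrete identity pass to the limit in the step size, leaving only
  the error of the kernel radius.\<close>

lemma B_stopped_integrable:
  assumes \<sigma>: "ae_stopping \<sigma>" and T: "T > 0"
  shows "integrable M (\<lambda>\<omega>. B (trunc_time T \<sigma> \<omega>) \<omega>)"
    and kernel_stopped_identity:
    "\<And>K f P g G a \<Gamma> \<gamma> C Q.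
      quad_kernel K f P g \<Longrightarrow> f 0 = 0 \<Longrightarrow> (\<And>x. 0 \<le> g x) \<Longrightarrow> (\<And>x. g x \<le> G) \<Longrightarrow>
      (\<And>x. \<bar>P x\<bar> \<le> 1) \<Longrightarrow> (\<And>x. \<bar>f x\<bar> * g x \<le> indicator {-a<..<a} x) \<Longrightarrow> (\<And>x. \<bar>f x\<bar> \<le> \<bar>x\<bar>) \<Longrightarrow> a > 0 \<Longrightarrow>
      continuous_on UNIV \<Gamma> \<Longrightarrow> continuous_on UNIV \<gamma> \<Longrightarrow>
      (\<And>x. 0 \<le> x \<Longrightarrow> \<bar>\<Gamma> x\<bar> \<le> C) \<Longrightarrow> (\<And>x. 0 \<le> x \<Longrightarrow> \<bar>\<gamma> x\<bar> \<le> C) \<Longrightarrow>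
      (\<And>x y. 0 \<le> x \<Longrightarrow> x \<le> y \<Longrightarrow> \<bar>\<gamma> y - \<gamma> x\<bar> \<le> Q * (y - x)) \<Longrightarrow>
      (\<And>x y. 0 \<le> x \<Longrightarrow> x \<le> y \<Longrightarrow> \<bar>\<Gamma> y - \<Gamma> x - \<gamma> y * (y - x)\<bar> \<le> Q * (y - x)\<^sup>2) \<Longrightarrow> Q \<ge> 0 \<Longrightarrow>
      \<bar>(\<integral>\<omega>. \<Gamma> (add_fun g (trunc_time T \<sigma> \<omega>) \<omega>) - f (B (trunc_time T \<sigma> \<omega>) \<omega>) * \<gamma> (add_fun g (trunc_time T \<sigma> \<omega>) \<omega>) \<partial>M) - \<Gamma> 0\<bar>
        \<le> Q * 2 * a * sqrt T"
proof -
  define h where "h m = T / real (Suc m)" for m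
  have hp: "h m > 0" for m using T by (simp add: h_def)
  have Nh: "real (Suc m) * h m = T" for m by (simp add: h_def)
  have hl: "h \<longlonglongrightarrow> 0" unfolding h_def by real_asymp
  define \<rho> where "\<rho> = trunc_time T \<sigma>"
  have \<rho>b: "0 \<le> \<rho> \<omega>" "\<rho> \<omega> \<le> T" for \<omega>
    unfolding \<rho>_def using trunc_time_bounds[of T \<sigma> \<omega>] T \<sigma> by (auto simp: ae_stopping_def)
  have \<rho>m: "\<rho> \<in> borel_measurable M" unfolding \<rho>_def using \<sigma> by (intro trunc_time_measurable) (simp add: ae_stopping_def)
  obtain W :: "nat \<Rightarrow> nat \<Rightarrow> 'a \<Rightarrow> real" where
    W: "\<And>m i. W m i \<in> borel_measurable (F (real i * h m))" and W01: "\<And>m i \<omega>. 0 \<le> W m i \<omega> \<and> W m i \<omega> \<le> 1" and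
    WJ: "AE \<omega> in M. \<exists>J. \<forall>m. J m \<le> Suc m \<and> \<bar>real (J m) * h m - \<rho> \<omega>\<bar> \<le> h m \<and>
       (\<forall>v. (\<Sum>i<Suc m. W m i \<omega> * (v (Suc i) - v i)) = v (J m) - v 0)"
    using stopped_grid_limit[OF \<sigma> T] unfolding h_def \<rho>_def by blast
  define X where "X m \<omega> = (\<Sum>i<Suc m. W m i \<omega> * (B (real (Suc i) * h m) \<omega> - B (real i * h m) \<omega>))" for m \<omega>
  have X2: "X m \<in> borel_measurable M" "integrable M (\<lambda>\<omega>. (X m \<omega>)\<^sup>2)" "(\<integral>\<omega>. (X m \<omega>)\<^sup>2 \<partial>M) \<le> T" for m
    using grid_martingale_L2[OF hp W W01 refl, of m "Suc m"] unfolding Nh X_def by blast+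
  \<comment> \<open>The threshold T / e comes from max 0 (|x| - T / e) \<le> (e / T) x^2, whose mean
    is at most e when the second moment is at most T.\<close>
  have ui: "\<exists>K\<ge>0. \<forall>m. (\<integral>\<^sup>+\<omega>. ennreal (max 0 (\<bar>X m \<omega>\<bar> - K)) \<partial>M) \<le> ennreal e" if e: "e > 0" for e
  proof (intro exI[of _ "T / e"] conjI allI)
    show "T / e \<ge> 0" using T e by simp
    fix m
    have p: "max 0 (\<bar>x\<bar> - T / e) \<le> e / T * x\<^sup>2" for x
    proof -
      have Te: "T / e > 0" using T e by simp
      have "\<bar>x\<bar> - T / e \<le> e / T * x\<^sup>2"
      proof -
        have "0 \<le> (\<bar>x\<bar> * (e / T) - 1)\<^sup>2 + \<bar>x\<bar> * (e/T) + \<bar>x\<bar> * (e/T) - \<bar>x\<bar> * (e/T)" using T e by simp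
        then have "\<bar>x\<bar> * (e / T) - 1 \<le> (\<bar>x\<bar> * (e/T))\<^sup>2" by (simp add: power2_eq_square algebra_simps)
        then have "(\<bar>x\<bar> * (e / T) - 1) * (T / e) \<le> (\<bar>x\<bar> * (e/T))\<^sup>2 * (T / e)" using Te by (intro mult_right_mono) auto
        moreover have "(\<bar>x\<bar> * (e / T) - 1) * (T / e) = \<bar>x\<bar> - T / e" using T e by (simp add: field_simps)
        moreover have "(\<bar>x\<bar> * (e/T))\<^sup>2 * (T / e) = e / T * x\<^sup>2" using T e by (simp add: field_simps power2_eq_square)
        ultimately show ?thesis by simp
      qed
      moreover have "0 \<le> e / T * x\<^sup>2" using T e by simp
      ultimately show ?thesis by simp
    qed
    have "(\<integral>\<^sup>+\<omega>. ennreal (max 0 (\<bar>X m \<omega>\<bar> - T / e)) \<partial>M) \<le> (\<integral>\<^sup>+\<omega>. ennreal (e / T * (X m \<omega>)\<^sup>2) \<partial>M)"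
      by (intro nn_integral_mono ennreal_leI p)
    also have "\<dots> = ennreal (\<integral>\<omega>. e / T * (X m \<omega>)\<^sup>2 \<partial>M)"
      using X2(2)[of m] T e by (intro nn_integral_eq_integral) auto
    also have "\<dots> \<le> ennreal e"
    proof (rule ennreal_leI)
      have "(\<integral>\<omega>. e / T * (X m \<omega>)\<^sup>2 \<partial>M) = e / T * (\<integral>\<omega>. (X m \<omega>)\<^sup>2 \<partial>M)" by simp
      also have "\<dots> \<le> e / T * T" using X2(3)[of m] T e by (intro mult_left_mono) auto
      finally show "(\<integral>\<omega>. e / T * (X m \<omega>)\<^sup>2 \<partial>M) \<le> e" using T by simp
    qed
    finally show "(\<integral>\<^sup>+\<omega>. ennreal (max 0 (\<bar>X m \<omega>\<bar> - T / e)) \<partial>M) \<le> ennreal e" .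
  qed
  have Jlim: "(\<lambda>m. real (J m) * h m) \<longlonglongrightarrow> \<rho> \<omega>" if "\<And>m. \<bar>real (J m) * h m - \<rho> \<omega>\<bar> \<le> h m" for J \<omega>
  proof -
    have "(\<lambda>m. real (J m) * h m - \<rho> \<omega>) \<longlonglongrightarrow> 0"
      by (rule Lim_null_comparison[OF _ hl]) (use that in simp)
    from tendsto_add[OF this tendsto_const[of "\<rho> \<omega>"]] show ?thesis by simp
  qed
  have BJlim: "(\<lambda>m. B (real (J m) * h m) \<omega>) \<longlonglongrightarrow> B (\<rho> \<omega>) \<omega>" if "\<And>m. \<bar>real (J m) * h m - \<rho> \<omega>\<bar> \<le> h m" "\<omega> \<in> space M" for J \<omega>
  proof (rule continuous_on_tendsto_compose[OF B_cont[OF that(2)] Jlim])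
    show "\<bar>real (J m) * h m - \<rho> \<omega>\<bar> \<le> h m" for m using that by simp
    show "\<forall>\<^sub>F m in sequentially. real (J m) * h m \<in> {0..}" using hp by (auto simp: less_imp_le intro!: always_eventually)
  qed (use \<rho>b in auto)
  have XB: "AE \<omega> in M. (\<lambda>m. X m \<omega>) \<longlonglongrightarrow> B (\<rho> \<omega>) \<omega>"
    using WJ AE_space
  proof eventually_elim
    case (elim \<omega>)
    then obtain J where J: "\<And>m. \<bar>real (J m) * h m - \<rho> \<omega>\<bar> \<le> h m"
      "\<And>m v. (\<Sum>i<Suc m. W m i \<omega> * (v (Suc i) - v i)) = v (J m) - v 0" by blast
    have "X m \<omega> = B (real (J m) * h m) \<omega>" for m
      using J(2)[of m "\<lambda>i. B (real i * h m) \<omega>"] B0[OF elim(2)] by (simp add: X_def)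
    then show ?case using BJlim[OF J(1) elim(2)] by simp
  qed
  have B\<rho>m: "(\<lambda>\<omega>. B (\<rho> \<omega>) \<omega>) \<in> borel_measurable M" unfolding \<rho>_def by (rule B_trunc_time_measurable[OF \<sigma> T])
  show "integrable M (\<lambda>\<omega>. B (trunc_time T \<sigma> \<omega>) \<omega>)"
    using vitali_convergence(1)[OF prob_space_axioms X2(1) B\<rho>m XB ui] unfolding \<rho>_def .
  fix K G a C Q :: real and f P g \<Gamma> \<gamma> :: "real \<Rightarrow> real"
  assume qk: "quad_kernel K f P g" and f0: "f 0 = 0" and g0: "\<And>x. 0 \<le> g x" and G: "\<And>x. g x \<le> G"
    and P1: "\<And>x. \<bar>P x\<bar> \<le> 1" and fg: "\<And>x. \<bar>f x\<bar> * g x \<le> indicator {-a<..<a} x"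
    and fx: "\<And>x. \<bar>f x\<bar> \<le> \<bar>x\<bar>" and a: "a > 0"
    and \<Gamma>c: "continuous_on UNIV \<Gamma>" and \<gamma>c: "continuous_on UNIV \<gamma>"
    and \<Gamma>b: "\<And>x. 0 \<le> x \<Longrightarrow> \<bar>\<Gamma> x\<bar> \<le> C" and \<gamma>b: "\<And>x. 0 \<le> x \<Longrightarrow> \<bar>\<gamma> x\<bar> \<le> C"
    and \<gamma>l: "\<And>x y. 0 \<le> x \<Longrightarrow> x \<le> y \<Longrightarrow> \<bar>\<gamma> y - \<gamma> x\<bar> \<le> Q * (y - x)"
    and \<Gamma>t: "\<And>x y. 0 \<le> x \<Longrightarrow> x \<le> y \<Longrightarrow> \<bar>\<Gamma> y - \<Gamma> x - \<gamma> y * (y - x)\<bar> \<le> Q * (y - x)\<^sup>2"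
    and Q: "Q \<ge> 0"
  note cont = quad_kernel_continuous[OF qk, of UNIV]
  have m\<Gamma>: "\<Gamma> \<in> borel_measurable borel" and m\<gamma>: "\<gamma> \<in> borel_measurable borel"
    using \<Gamma>c \<gamma>c by (auto intro: borel_measurable_continuous_onI)
  have C: "C \<ge> 0" using \<Gamma>b[of 0] by simp
  define A where "A m = (\<lambda>i \<omega>. \<Sum>j<i. h m * g (B (real j * h m) \<omega>))" for m
  define u where "u m = (\<lambda>i \<omega>. \<Gamma> (A m i \<omega>) - f (B (real i * h m) \<omega>) * \<gamma> (A m i \<omega>))" for m
  define U where "U m \<omega> = (\<Sum>i<Suc m. W m i \<omega> * (u m (Suc i) \<omega> - u m i \<omega>))" for m \<omega>
  define Y where "Y \<omega> = \<Gamma> (add_fun g (\<rho> \<omega>) \<omega>) - f (B (\<rho> \<omega>) \<omega>) * \<gamma> (add_fun g (\<rho> \<omega>) \<omega>)" for \<omega>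
  note gi = grid_identity[OF qk f0 g0 G P1 fg a T zero_less_Suc h_def \<Gamma>c \<gamma>c \<Gamma>b \<gamma>b \<gamma>l \<Gamma>t Q W W01 A_def u_def]
  have UM: "U m \<in> borel_measurable M" for m unfolding U_def by (rule gi(1))
  have EU: "\<bar>\<integral>\<omega>. U m \<omega> \<partial>M\<bar> \<le> Q * (h m + 2 * a * sqrt T) + T * (Q * G\<^sup>2 * h m + 4 * C * K * sqrt (h m))" for m
    unfolding U_def by (rule gi(2))
  have A0: "0 \<le> A m i \<omega>" for m i \<omega> by (rule gi(3))
  have u0: "u m 0 \<omega> = \<Gamma> 0" if "\<omega> \<in> space M" for m \<omega> using B0[OF that] f0 by (simp add: u_def A_def)
  have mA: "(\<lambda>\<omega>. add_fun g (\<rho> \<omega>) \<omega>) \<in> borel_measurable M"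
  proof (rule random_time_measurable[OF _ _ \<rho>m \<rho>b(1)])
    show "add_fun g t \<in> borel_measurable M" if "0 \<le> t" for t
      using add_fun_adapted[OF cont(3) that] by (rule measurable_F_M)
    show "continuous_on {0..} (\<lambda>t. add_fun g t \<omega>)" if "\<omega> \<in> space M" for \<omega>
      by (rule continuous_on_halfline, rule add_fun_cont[OF that cont(3)])
  qed
  have mY: "Y \<in> borel_measurable M" unfolding Y_def
    by (intro borel_measurable_diff borel_measurable_times measurable_compose[OF mA m\<Gamma>] measurable_compose[OF mA m\<gamma>]
        measurable_compose[OF B\<rho>m quad_kernel_measurable(1)[OF qk]])
  have lim: "AE \<omega> in M. (\<lambda>m. U m \<omega>) \<longlonglongrightarrow> Y \<omega> - \<Gamma> 0"
    using WJ AE_space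
  proof eventually_elim
    case (elim \<omega>)
    then obtain J where JS: "\<And>m. J m \<le> Suc m" and J: "\<And>m. \<bar>real (J m) * h m - \<rho> \<omega>\<bar> \<le> h m"
      "\<And>m v. (\<Sum>i<Suc m. W m i \<omega> * (v (Suc i) - v i)) = v (J m) - v 0" by blast
    have U: "U m \<omega> = u m (J m) \<omega> - \<Gamma> 0" for m
      using J(2)[of m "\<lambda>i. u m i \<omega>"] u0[OF elim(2)] by (simp add: U_def)
    have JT: "real (J m) * h m \<in> {0..T}" for m
      using mult_right_mono[of "real (J m)" "real (Suc m)" "h m"] JS[of m] hp[of m] Nh[of m] by (auto simp del: of_nat_Suc)
    have "(\<lambda>m. A m (J m) \<omega> - add_fun g (real (J m) * h m) \<omega>) \<longlonglongrightarrow> 0"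
    proof (rule LIMSEQ_I)
      fix r :: real assume r: "r > 0"
      then have "r / 2 > 0" by simp
      from riemann_add_fun[OF elim(2) cont(3) T this] obtain N0 where N0: "\<forall>N\<ge>N0. \<forall>i\<le>N. N > 0 \<longrightarrow>
         \<bar>(\<Sum>j<i. T / real N * g (B (real j * (T / real N)) \<omega>)) - add_fun g (real i * (T / real N)) \<omega>\<bar> \<le> r / 2" by blast
      show "\<exists>no. \<forall>n\<ge>no. norm (A n (J n) \<omega> - add_fun g (real (J n) * h n) \<omega> - 0) < r"
      proof (intro exI[of _ N0] allI impI)
        fix n assume "N0 \<le> n"
        then have "\<bar>A n (J n) \<omega> - add_fun g (real (J n) * h n) \<omega>\<bar> \<le> r / 2"
          using N0[rule_format, of "Suc n" "J n"] JS[of n] unfolding A_def h_def by simp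
        then show "norm (A n (J n) \<omega> - add_fun g (real (J n) * h n) \<omega> - 0) < r" using r by simp
      qed
    qed
    moreover have "(\<lambda>m. add_fun g (real (J m) * h m) \<omega>) \<longlonglongrightarrow> add_fun g (\<rho> \<omega>) \<omega>"
      by (rule continuous_on_tendsto_compose[OF add_fun_cont[OF elim(2) cont(3), of T] Jlim[OF J(1)]])
         (use \<rho>b JT in \<open>auto intro!: always_eventually\<close>)
    ultimately have "(\<lambda>m. (A m (J m) \<omega> - add_fun g (real (J m) * h m) \<omega>) + add_fun g (real (J m) * h m) \<omega>) \<longlonglongrightarrow> 0 + add_fun g (\<rho> \<omega>) \<omega>"
      by (rule tendsto_add)
    then have Alim: "(\<lambda>m. A m (J m) \<omega>) \<longlonglongrightarrow> add_fun g (\<rho> \<omega>) \<omega>" by simp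
    have isc: "isCont \<Gamma> x" "isCont \<gamma> x" "isCont f x" for x
      using \<Gamma>c \<gamma>c cont(1) by (simp_all add: continuous_on_eq_continuous_at)
    have "(\<lambda>m. u m (J m) \<omega> - \<Gamma> 0) \<longlonglongrightarrow> Y \<omega> - \<Gamma> 0"
      unfolding u_def Y_def
      by (intro tendsto_diff tendsto_mult tendsto_const isCont_tendsto_compose[OF isc(1) Alim] isCont_tendsto_compose[OF isc(2) Alim]
          isCont_tendsto_compose[OF isc(3) BJlim[OF J(1) elim(2)]])
    then show ?case unfolding U .
  qed
  \<comment> \<open>Both U and X are evaluated at the same random grid index, so the linear bound on
    f turns into a bound of U by |X| path by path.\<close>
  have Ubound: "AE \<omega> in M. \<bar>U m \<omega>\<bar> \<le> 2 * C + C * \<bar>X m \<omega>\<bar>" for m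
    using WJ AE_space
  proof eventually_elim
    case (elim \<omega>)
    then obtain J where J: "\<And>m v. (\<Sum>i<Suc m. W m i \<omega> * (v (Suc i) - v i)) = v (J m) - v 0" by blast
    have U: "U m \<omega> = u m (J m) \<omega> - \<Gamma> 0"
      using J[of m "\<lambda>i. u m i \<omega>"] u0[OF elim(2)] by (simp add: U_def)
    have X: "X m \<omega> = B (real (J m) * h m) \<omega>"
      using J[of m "\<lambda>i. B (real i * h m) \<omega>"] B0[OF elim(2)] by (simp add: X_def)
    have "\<bar>f (B (real (J m) * h m) \<omega>) * \<gamma> (A m (J m) \<omega>)\<bar> \<le> \<bar>X m \<omega>\<bar> * C"
      unfolding abs_mult X using fx \<gamma>b[OF A0] by (intro mult_mono) auto
    then show ?case using \<Gamma>b[of 0] \<Gamma>b[OF A0[of m "J m" \<omega>]] unfolding U u_def by (simp add: mult.commute)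
  qed
  have uiU: "\<exists>K\<ge>0. \<forall>m. (\<integral>\<^sup>+\<omega>. ennreal (max 0 (\<bar>U m \<omega>\<bar> - K)) \<partial>M) \<le> ennreal e" if e: "e > 0" for e
  proof -
    \<comment> \<open>C may be 0; adding 1 avoids dividing by it, and C / (C + 1) \<le> 1 restores e
      at the end.\<close>
    have "e / (C + 1) > 0" using e C by simp
    from ui[OF this] obtain K where K: "K \<ge> 0" "\<And>m. (\<integral>\<^sup>+\<omega>. ennreal (max 0 (\<bar>X m \<omega>\<bar> - K)) \<partial>M) \<le> ennreal (e / (C + 1))" by blast
    show ?thesis
    proof (intro exI[of _ "2 * C + C * K"] conjI allI)
      show "2 * C + C * K \<ge> 0" using C K by simp
      fix m
      have "(\<integral>\<^sup>+\<omega>. ennreal (max 0 (\<bar>U m \<omega>\<bar> - (2 * C + C * K))) \<partial>M) \<le> (\<integral>\<^sup>+\<omega>. ennreal C * ennreal (max 0 (\<bar>X m \<omega>\<bar> - K)) \<partial>M)"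
      proof (rule nn_integral_mono_AE, use Ubound[of m] in eventually_elim)
        case (elim \<omega>)
        have "\<bar>U m \<omega>\<bar> - (2 * C + C * K) \<le> C * (\<bar>X m \<omega>\<bar> - K)" using elim by (simp add: algebra_simps)
        also have "\<dots> \<le> C * max 0 (\<bar>X m \<omega>\<bar> - K)" using C by (intro mult_left_mono) auto
        finally have "max 0 (\<bar>U m \<omega>\<bar> - (2 * C + C * K)) \<le> C * max 0 (\<bar>X m \<omega>\<bar> - K)" using C by simp
        then show ?case using C by (subst ennreal_mult[symmetric]) (auto intro!: ennreal_leI)
      qed
      also have "\<dots> = ennreal C * (\<integral>\<^sup>+\<omega>. ennreal (max 0 (\<bar>X m \<omega>\<bar> - K)) \<partial>M)"
        using X2(1)[of m] by (intro nn_integral_cmult) simp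
      also have "\<dots> \<le> ennreal C * ennreal (e / (C + 1))" by (intro mult_left_mono K) simp
      also have "\<dots> \<le> ennreal e" using C e by (simp add: ennreal_mult[symmetric] field_simps)
      finally show "(\<integral>\<^sup>+\<omega>. ennreal (max 0 (\<bar>U m \<omega>\<bar> - (2 * C + C * K))) \<partial>M) \<le> ennreal e" .
    qed
  qed
  have mY': "(\<lambda>\<omega>. Y \<omega> - \<Gamma> 0) \<in> borel_measurable M" using mY by simp
  note vi = vitali_convergence[OF prob_space_axioms UM mY' lim uiU]
  have EY: "(\<integral>\<omega>. Y \<omega> - \<Gamma> 0 \<partial>M) = (\<integral>\<omega>. Y \<omega> \<partial>M) - \<Gamma> 0"
  proof -
    have "integrable M (\<lambda>\<omega>. (Y \<omega> - \<Gamma> 0) + \<Gamma> 0)" using vi(1) by (intro Bochner_Integration.integrable_add) auto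
    then show ?thesis by (simp add: prob_space)
  qed
  have "(\<lambda>m. \<bar>\<integral>\<omega>. U m \<omega> \<partial>M\<bar>) \<longlonglongrightarrow> \<bar>(\<integral>\<omega>. Y \<omega> \<partial>M) - \<Gamma> 0\<bar>"
    using vi(3) unfolding EY by (rule tendsto_rabs)
  moreover have "(\<lambda>m. Q * (h m + 2 * a * sqrt T) + T * (Q * G\<^sup>2 * h m + 4 * C * K * sqrt (h m))) \<longlonglongrightarrow>
      Q * (0 + 2 * a * sqrt T) + T * (Q * G\<^sup>2 * 0 + 4 * C * K * sqrt 0)"
    by (intro tendsto_intros hl)
  ultimately have "\<bar>(\<integral>\<omega>. Y \<omega> \<partial>M) - \<Gamma> 0\<bar> \<le> Q * (0 + 2 * a * sqrt T) + T * (Q * G\<^sup>2 * 0 + 4 * C * K * sqrt 0)"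
    by (rule LIMSEQ_le) (use EU in blast)
  then show "\<bar>(\<integral>\<omega>. \<Gamma> (add_fun g (trunc_time T \<sigma> \<omega>) \<omega>) - f (B (trunc_time T \<sigma> \<omega>) \<omega>) * \<gamma> (add_fun g (trunc_time T \<sigma> \<omega>) \<omega>) \<partial>M) - \<Gamma> 0\<bar>
        \<le> Q * 2 * a * sqrt T"
    by (simp add: Y_def \<rho>_def mult.assoc)
qed

end

section \<open>The local time as a continuous increasing process\<close>

locale bm_local_time = bm +
  fixes N\<^sub>0
  assumes N0: "N\<^sub>0 \<in> null_sets M"
    and L_good: "\<And>\<omega>. \<omega> \<in> space M - N\<^sub>0 \<Longrightarrow> continuous_on {0..} (\<lambda>t. local_time0 B t \<omega>)"
      "\<And>\<omega> t. \<omega> \<in> space M - N\<^sub>0 \<Longrightarrow> t \<ge> 0 \<Longrightarrow> (\<lambda>n. add_fun (gk n) t \<omega>) \<longlonglongrightarrow> local_time0 B t \<omega>"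
begin

text \<open>A version of the local time whose paths are continuous for every sample point of the
  space. The exceptional set need not belong to any \<open>F t\<close>, so adaptedness of this
  version is available only up to null sets.\<close>

definition L :: "real \<Rightarrow> 'a \<Rightarrow> real" where
  "L t \<omega> = (if \<omega> \<in> N\<^sub>0 then 0 else local_time0 B t \<omega>)"

lemma AE_N0: "AE \<omega> in M. \<omega> \<in> space M - N\<^sub>0"
  using AE_not_in[OF N0] AE_space by eventually_elim simp

lemma L_eq: "\<omega> \<notin> N\<^sub>0 \<Longrightarrow> L t \<omega> = local_time0 B t \<omega>" by (simp add: L_def)

lemma L_cont: "\<omega> \<in> space M \<Longrightarrow> continuous_on {0..} (\<lambda>t. L t \<omega>)"
  using L_good(1)[of \<omega>] by (cases "\<omega> \<in> N\<^sub>0") (simp_all add: L_def)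

lemma L_lim: "\<omega> \<in> space M - N\<^sub>0 \<Longrightarrow> t \<ge> 0 \<Longrightarrow> (\<lambda>n. add_fun (gk n) t \<omega>) \<longlonglongrightarrow> L t \<omega>"
  using L_good(2)[of \<omega> t] by (simp add: L_def)

lemma gk_integrable: "\<omega> \<in> space M \<Longrightarrow> 0 \<le> s \<Longrightarrow> (\<lambda>u. gk n (B u \<omega>)) integrable_on {s..t}"
  by (intro integrable_continuous_real continuous_on_subset[OF cont_comp_B[OF _ gk_cont]]) auto

lemma add_fun_split:
  assumes "\<omega> \<in> space M" "0 \<le> s" "s \<le> t"
  shows "add_fun (gk n) t \<omega> = add_fun (gk n) s \<omega> + integral {s..t} (\<lambda>u. gk n (B u \<omega>))"
  unfolding add_fun_def using assms
  by (intro Henstock_Kurzweil_Integration.integral_combine[symmetric] gk_integrable) auto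

lemma L_mono:
  assumes \<omega>: "\<omega> \<in> space M" and st: "0 \<le> s" "s \<le> t"
  shows "L s \<omega> \<le> L t \<omega>"
proof (cases "\<omega> \<in> N\<^sub>0")
  case False
  then have \<omega>': "\<omega> \<in> space M - N\<^sub>0" using \<omega> by simp
  have "add_fun (gk n) s \<omega> \<le> add_fun (gk n) t \<omega>" for n
    unfolding add_fun_split[OF \<omega> st] using gk_integrable[OF \<omega> st(1)] by (simp add: integral_nonneg trap_rules)
  then show ?thesis using L_lim[OF \<omega>', of s] L_lim[OF \<omega>', of t] st by (intro LIMSEQ_le[of _ "L s \<omega>"]) auto
qed (simp add: L_def)

lemma L_0: "\<omega> \<in> space M \<Longrightarrow> L 0 \<omega> = 0"
proof (cases "\<omega> \<in> N\<^sub>0")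
  case False
  assume "\<omega> \<in> space M"
  then have "(\<lambda>n. add_fun (gk n) 0 \<omega>) \<longlonglongrightarrow> L 0 \<omega>" using False by (intro L_lim) auto
  then show ?thesis by (simp add: add_fun_def LIMSEQ_const_iff)
qed (simp add: L_def)

lemma L_nonneg: "\<omega> \<in> space M \<Longrightarrow> 0 \<le> t \<Longrightarrow> 0 \<le> L t \<omega>"
  using L_mono[of \<omega> 0 t] L_0[of \<omega>] by simp

text \<open>On a compact interval without zeros |B| has a positive minimum, and every kernel of
  smaller radius vanishes along the path: the local time grows only at zeros of B.\<close>

lemma L_const:
  assumes \<omega>: "\<omega> \<in> space M" and st: "0 \<le> s" "s \<le> t" and nz: "\<And>u. u \<in> {s..t} \<Longrightarrow> B u \<omega> \<noteq> 0"
  shows "L s \<omega> = L t \<omega>"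
proof (cases "\<omega> \<in> N\<^sub>0")
  case False
  then have \<omega>': "\<omega> \<in> space M - N\<^sub>0" using \<omega> by simp
  have "continuous_on {s..t} (\<lambda>u. \<bar>B u \<omega>\<bar>)"
    by (intro continuous_intros continuous_on_subset[OF B_cont[OF \<omega>]]) (use st in auto)
  then obtain v where v: "v \<in> {s..t}" "\<And>u. u \<in> {s..t} \<Longrightarrow> \<bar>B v \<omega>\<bar> \<le> \<bar>B u \<omega>\<bar>"
    using continuous_attains_inf[of "{s..t}" "\<lambda>u. \<bar>B u \<omega>\<bar>"] st by auto
  have "\<bar>B v \<omega>\<bar> > 0" using nz[OF v(1)] by simp
  from order_tendstoD(2)[OF rad_tendsto this] have "\<forall>\<^sub>F n in sequentially. add_fun (gk n) t \<omega> = add_fun (gk n) s \<omega>"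
  proof eventually_elim
    case (elim n)
    have "integral {s..t} (\<lambda>u. gk n (B u \<omega>)) = integral {s..t} (\<lambda>u. 0)"
      by (rule integral_cong) (use v elim in \<open>force intro!: trap_rules(4)\<close>)
    then show ?case using add_fun_split[OF \<omega> st, of n] by simp
  qed
  then have "(\<lambda>n. add_fun (gk n) s \<omega>) \<longlonglongrightarrow> L t \<omega>"
    using L_lim[OF \<omega>', of t] st by (simp add: tendsto_cong)
  then show ?thesis using L_lim[OF \<omega>' st(1)] LIMSEQ_unique by blast
qed (simp add: L_def)

text \<open>The limit of the additive functionals, taken without reference to the exceptional set,
  is \<open>F t\<close>-measurable and agrees with \<open>L t\<close> off it.\<close>

lemma L_adapted:
  assumes t: "0 \<le> t"
  shows "\<exists>Y\<in>borel_measurable (F t). AE \<omega> in M. L t \<omega> = Y \<omega>" and L_measurable: "L t \<in> borel_measurable M"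
proof -
  define Y where "Y \<omega> = lim (\<lambda>n. add_fun (gk n) t \<omega>)" for \<omega>
  have Y: "Y \<in> borel_measurable (F t)"
    unfolding Y_def by (rule borel_measurable_lim_metric, rule add_fun_adapted[OF gk_cont t])
  have eq: "L t \<omega> = Y \<omega>" if "\<omega> \<in> space M - N\<^sub>0" for \<omega> unfolding Y_def using L_lim[OF that t] by (simp add: limI)
  show "\<exists>Y\<in>borel_measurable (F t). AE \<omega> in M. L t \<omega> = Y \<omega>"
    using Y AE_N0 eq by (intro bexI[of _ Y]) auto
  have [measurable]: "N\<^sub>0 \<in> sets M" "Y \<in> borel_measurable M" using N0 Y measurable_F_M by auto
  have "(\<lambda>\<omega>. if \<omega> \<in> N\<^sub>0 then 0 else Y \<omega>) \<in> borel_measurable M" by measurable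
  then show "L t \<in> borel_measurable M"
    by (rule measurable_cong[THEN iffD1, rotated]) (use eq in \<open>auto simp: L_def\<close>)
qed

lemma L_trunc_measurable:
  assumes "ae_stopping \<sigma>" "T > 0"
  shows "(\<lambda>\<omega>. L (trunc_time T \<sigma> \<omega>) \<omega>) \<in> borel_measurable M"
  by (rule random_time_measurable[OF L_measurable L_cont trunc_time_measurable])
     (use assms trunc_time_bounds(1)[of T \<sigma>] in \<open>auto simp: ae_stopping_def\<close>)

text \<open>The kernel identity has error 2 Q rad n sqrt T, which vanishes as n grows; the
  integrands converge almost surely and are dominated by an affine function of the integrable |B| at
  the stopped time.\<close>

lemma stopped_identity_C11:
  fixes \<Gamma> \<gamma> :: "real \<Rightarrow> real"
  assumes \<sigma>: "ae_stopping \<sigma>" and T: "T > 0"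
    and \<Gamma>c: "continuous_on UNIV \<Gamma>" and \<gamma>c: "continuous_on UNIV \<gamma>"
    and \<Gamma>b: "\<And>x. 0 \<le> x \<Longrightarrow> \<bar>\<Gamma> x\<bar> \<le> C" and \<gamma>b: "\<And>x. 0 \<le> x \<Longrightarrow> \<bar>\<gamma> x\<bar> \<le> C"
    and \<gamma>l: "\<And>x y. 0 \<le> x \<Longrightarrow> x \<le> y \<Longrightarrow> \<bar>\<gamma> y - \<gamma> x\<bar> \<le> Q * (y - x)"
    and \<Gamma>t: "\<And>x y. 0 \<le> x \<Longrightarrow> x \<le> y \<Longrightarrow> \<bar>\<Gamma> y - \<Gamma> x - \<gamma> y * (y - x)\<bar> \<le> Q * (y - x)\<^sup>2"
    and Q: "Q \<ge> 0"
  shows "(\<integral>\<omega>. \<Gamma> (L (trunc_time T \<sigma> \<omega>) \<omega>) - \<bar>B (trunc_time T \<sigma> \<omega>) \<omega>\<bar> * \<gamma> (L (trunc_time T \<sigma> \<omega>) \<omega>) \<partial>M) = \<Gamma> 0"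
proof -
  define \<rho> where "\<rho> = trunc_time T \<sigma>"
  have \<rho>b: "0 \<le> \<rho> \<omega>" "\<rho> \<omega> \<le> T" for \<omega>
    unfolding \<rho>_def using trunc_time_bounds[of T \<sigma> \<omega>] T \<sigma> by (auto simp: ae_stopping_def)
  have \<rho>m: "\<rho> \<in> borel_measurable M" unfolding \<rho>_def using \<sigma> by (intro trunc_time_measurable) (simp add: ae_stopping_def)
  define Y where "Y n \<omega> = \<Gamma> (add_fun (gk n) (\<rho> \<omega>) \<omega>) - fk n (B (\<rho> \<omega>) \<omega>) * \<gamma> (add_fun (gk n) (\<rho> \<omega>) \<omega>)" for n \<omega>
  define Z where "Z \<omega> = \<Gamma> (L (\<rho> \<omega>) \<omega>) - \<bar>B (\<rho> \<omega>) \<omega>\<bar> * \<gamma> (L (\<rho> \<omega>) \<omega>)" for \<omega>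
  have bd: "\<bar>(\<integral>\<omega>. Y n \<omega> \<partial>M) - \<Gamma> 0\<bar> \<le> Q * 2 * rad n * sqrt T" for n
    unfolding Y_def \<rho>_def
    by (rule kernel_stopped_identity[OF \<sigma> T trap_kernel[OF rad_pos rad_Suc_less]
         trap_F_0[OF rad_pos rad_Suc_less] trap_rules(1,2) trap_P_abs_le[OF rad_pos rad_Suc_less]
         trap_F_mult_trap[OF rad_pos rad_Suc_less] trap_F_abs_le[OF rad_pos rad_Suc_less] rad_pos \<Gamma>c \<gamma>c \<Gamma>b \<gamma>b \<gamma>l \<Gamma>t Q])
  have m\<Gamma>: "\<Gamma> \<in> borel_measurable borel" and m\<gamma>: "\<gamma> \<in> borel_measurable borel"
    using \<Gamma>c \<gamma>c by (auto intro: borel_measurable_continuous_onI)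
  have mB: "(\<lambda>\<omega>. B (\<rho> \<omega>) \<omega>) \<in> borel_measurable M" unfolding \<rho>_def by (rule B_trunc_time_measurable[OF \<sigma> T])
  have mL: "(\<lambda>\<omega>. L (\<rho> \<omega>) \<omega>) \<in> borel_measurable M" unfolding \<rho>_def by (rule L_trunc_measurable[OF \<sigma> T])
  have mA: "(\<lambda>\<omega>. add_fun (gk n) (\<rho> \<omega>) \<omega>) \<in> borel_measurable M" for n
  proof (rule random_time_measurable[OF _ _ \<rho>m \<rho>b(1)])
    show "add_fun (gk n) t \<in> borel_measurable M" if "0 \<le> t" for t
      using add_fun_adapted[OF gk_cont that] by (rule measurable_F_M)
    show "continuous_on {0..} (\<lambda>t. add_fun (gk n) t \<omega>)" if "\<omega> \<in> space M" for \<omega>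
      by (rule continuous_on_halfline, rule add_fun_cont[OF that gk_cont])
  qed
  have C: "C \<ge> 0" using \<Gamma>b[of 0] by simp
  have "(\<lambda>n. \<integral>\<omega>. Y n \<omega> \<partial>M) \<longlonglongrightarrow> (\<integral>\<omega>. Z \<omega> \<partial>M)"
  proof (rule integral_dominated_convergence[where w = "\<lambda>\<omega>. C + \<bar>B (\<rho> \<omega>) \<omega>\<bar> * C"])
    show "Z \<in> borel_measurable M" unfolding Z_def
      by (intro borel_measurable_diff borel_measurable_times borel_measurable_abs measurable_compose[OF mL m\<Gamma>] measurable_compose[OF mL m\<gamma>] mB)
    show "Y n \<in> borel_measurable M" for n unfolding Y_def
      by (intro borel_measurable_diff borel_measurable_times measurable_compose[OF mA m\<Gamma>] measurable_compose[OF mA m\<gamma>]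
        measurable_compose[OF mB borel_measurable_continuous_onI[OF fk_cont]])
    show "integrable M (\<lambda>\<omega>. C + \<bar>B (\<rho> \<omega>) \<omega>\<bar> * C)"
      using B_stopped_integrable[OF \<sigma> T] unfolding \<rho>_def by (intro Bochner_Integration.integrable_add integrable_mult_left integrable_abs) auto
    show "AE \<omega> in M. (\<lambda>n. Y n \<omega>) \<longlonglongrightarrow> Z \<omega>"
      using AE_N0
    proof eventually_elim
      case (elim \<omega>)
      note Al = L_lim[OF elim \<rho>b(1)[of \<omega>]]
      have "(\<lambda>n. fk n (B (\<rho> \<omega>) \<omega>) - \<bar>B (\<rho> \<omega>) \<omega>\<bar>) \<longlonglongrightarrow> 0"
      proof (rule Lim_null_comparison)
        show "\<forall>\<^sub>F n in sequentially. norm (fk n (B (\<rho> \<omega>) \<omega>) - \<bar>B (\<rho> \<omega>) \<omega>\<bar>) \<le> 2 * rad n"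
          using trap_F_approx[OF rad_pos rad_Suc_less] by simp
        show "(\<lambda>n. 2 * rad n) \<longlonglongrightarrow> 0" using tendsto_mult_right_zero[OF rad_tendsto] by simp
      qed
      from tendsto_add[OF this tendsto_const[of "\<bar>B (\<rho> \<omega>) \<omega>\<bar>"]]
      have fl: "(\<lambda>n. fk n (B (\<rho> \<omega>) \<omega>)) \<longlonglongrightarrow> \<bar>B (\<rho> \<omega>) \<omega>\<bar>" by simp
      have isc: "isCont \<Gamma> x" "isCont \<gamma> x" for x using \<Gamma>c \<gamma>c by (simp_all add: continuous_on_eq_continuous_at)
      show ?case unfolding Y_def Z_def
        by (intro tendsto_diff tendsto_mult fl isCont_tendsto_compose[OF isc(1) Al] isCont_tendsto_compose[OF isc(2) Al])
    qed
    show "AE \<omega> in M. norm (Y n \<omega>) \<le> C + \<bar>B (\<rho> \<omega>) \<omega>\<bar> * C" for n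
      using AE_space
    proof eventually_elim
      case (elim \<omega>)
      have A0: "0 \<le> add_fun (gk n) (\<rho> \<omega>) \<omega>" unfolding add_fun_def
        using gk_integrable[OF elim, of 0] by (intro integral_nonneg) (auto simp: trap_rules)
      have "norm (Y n \<omega>) \<le> \<bar>\<Gamma> (add_fun (gk n) (\<rho> \<omega>) \<omega>)\<bar> + \<bar>fk n (B (\<rho> \<omega>) \<omega>)\<bar> * \<bar>\<gamma> (add_fun (gk n) (\<rho> \<omega>) \<omega>)\<bar>"
        unfolding Y_def abs_mult[symmetric] by simp
      also have "\<dots> \<le> C + \<bar>B (\<rho> \<omega>) \<omega>\<bar> * C"
        using \<Gamma>b[OF A0] \<gamma>b[OF A0] trap_F_abs_le[OF rad_pos rad_Suc_less] by (intro add_mono mult_mono) auto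
      finally show ?case .
    qed
  qed
  then have "(\<lambda>n. \<bar>(\<integral>\<omega>. Y n \<omega> \<partial>M) - \<Gamma> 0\<bar>) \<longlonglongrightarrow> \<bar>(\<integral>\<omega>. Z \<omega> \<partial>M) - \<Gamma> 0\<bar>"
    by (intro tendsto_rabs tendsto_diff tendsto_const)
  moreover have "(\<lambda>n. Q * 2 * rad n * sqrt T) \<longlonglongrightarrow> Q * 2 * 0 * sqrt T" by (intro tendsto_intros rad_tendsto)
  ultimately have "\<bar>(\<integral>\<omega>. Z \<omega> \<partial>M) - \<Gamma> 0\<bar> \<le> Q * 2 * 0 * sqrt T" by (rule LIMSEQ_le) (use bd in blast)
  then show ?thesis by (simp add: Z_def \<rho>_def)
qed

text \<open>Steklov averages of \<open>\<Gamma>\<close> reduce the general case to Lipschitz \<open>\<gamma>\<close>.\<close>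

lemma stopped_identity:
  fixes \<Gamma> \<gamma> :: "real \<Rightarrow> real"
  assumes \<sigma>: "ae_stopping \<sigma>" and T: "T > 0"
    and \<Gamma>b: "\<And>x. 0 \<le> x \<Longrightarrow> \<bar>\<Gamma> x\<bar> \<le> C" and \<Gamma>l: "\<And>x y. 0 \<le> x \<Longrightarrow> x \<le> y \<Longrightarrow> \<bar>\<Gamma> y - \<Gamma> x\<bar> \<le> C * (y - x)"
    and \<gamma>: "\<And>x. 0 \<le> x \<Longrightarrow> (\<Gamma> has_real_derivative \<gamma> x) (at_right x)"
  shows "(\<integral>\<omega>. \<Gamma> (L (trunc_time T \<sigma> \<omega>) \<omega>) - \<bar>B (trunc_time T \<sigma> \<omega>) \<omega>\<bar> * \<gamma> (L (trunc_time T \<sigma> \<omega>) \<omega>) \<partial>M) = \<Gamma> 0"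
    and "(\<lambda>\<omega>. \<gamma> (L (trunc_time T \<sigma> \<omega>) \<omega>)) \<in> borel_measurable M"
proof -
  define \<rho> where "\<rho> = trunc_time T \<sigma>"
  have \<rho>b: "0 \<le> \<rho> \<omega>" "\<rho> \<omega> \<le> T" for \<omega>
    unfolding \<rho>_def using trunc_time_bounds[of T \<sigma> \<omega>] T \<sigma> by (auto simp: ae_stopping_def)
  \<comment> \<open>The constant extension to the left preserves the Lipschitz bound on the whole
    line.\<close>
  define H where "H x = \<Gamma> (max 0 x)" for x
  define e where "e m = 1 / real (Suc m)" for m
  have e0: "e m > 0" for m by (simp add: e_def)
  have el: "e \<longlonglongrightarrow> 0" unfolding e_def by real_asymp
  have C: "C \<ge> 0" using \<Gamma>b[of 0] by simp
  have Hl: "\<bar>H y - H x\<bar> \<le> C * \<bar>y - x\<bar>" for x y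
  proof -
    have *: "\<bar>H y - H x\<bar> \<le> C * \<bar>y - x\<bar>" if "x \<le> y" for x y
    proof -
      have "\<bar>H y - H x\<bar> \<le> C * (max 0 y - max 0 x)" unfolding H_def using that by (intro \<Gamma>l) auto
      also have "\<dots> \<le> C * \<bar>y - x\<bar>" using C that by (intro mult_left_mono) auto
      finally show ?thesis .
    qed
    show ?thesis using *[of x y] *[of y x] by (cases "x \<le> y") (auto simp: abs_minus_commute)
  qed
  have Hc: "continuous_on A H" for A
    using Hl C by (intro lipschitz_on_continuous_on[of C]) (auto simp: lipschitz_on_def dist_real_def abs_minus_commute)
  \<comment> \<open>Starting the integral at -1 makes every x \<ge> 0 an interior point, so the
    derivative at 0 is two-sided as well.\<close>
  define I where "I x = integral {-1..x} H" for x
  have dI: "(I has_real_derivative H x) (at x)" if "x > -1" for x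
  proof -
    have "(I has_real_derivative H x) (at x within {-1..x+1})"
      unfolding I_def by (rule integral_has_real_derivative[OF Hc]) (use that in auto)
    moreover have "at x within {-1..x+1} = at x" by (rule at_within_interior) (use that in auto)
    ultimately show ?thesis by simp
  qed
  \<comment> \<open>The average of \<Gamma> over [x, x + e m] looks only forward. Its derivative is
    the forward difference quotient \<open>g1\<close>, which is Lipschitz for fixed m and tends to
    the right derivative \<gamma>; this is why a right derivative is all that the statement asks
    for.\<close>
  define G1 where "G1 m x = (I (max 0 x + e m) - I (max 0 x)) / e m" for m x
  define g1 where "g1 m x = (H (x + e m) - H x) / e m" for m x
  have G1m: "\<exists>z. max 0 x < z \<and> z < max 0 x + e m \<and> G1 m x = H z" for m x
  proof -
    have "\<exists>z>max 0 x. z < max 0 x + e m \<and> I (max 0 x + e m) - I (max 0 x) = (max 0 x + e m - max 0 x) * H z"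
      by (rule MVT2) (use e0[of m] dI in auto)
    then show ?thesis using e0[of m] by (auto simp: G1_def)
  qed
  have G1b: "\<bar>G1 m x\<bar> \<le> C" for m x
  proof -
    obtain z where "max 0 x < z" "G1 m x = H z" using G1m by blast
    then show ?thesis using \<Gamma>b[of z] by (simp add: H_def)
  qed
  have G1a: "\<bar>G1 m x - \<Gamma> x\<bar> \<le> C * e m" if "0 \<le> x" for m x
  proof -
    obtain z where z: "max 0 x < z" "z < max 0 x + e m" "G1 m x = H z" using G1m by blast
    have "\<bar>H z - H x\<bar> \<le> C * \<bar>z - x\<bar>" by (rule Hl)
    also have "\<dots> \<le> C * e m" using C z that by (intro mult_left_mono) auto
    finally show ?thesis using z that by (simp add: H_def)
  qed
  have g1b: "\<bar>g1 m x\<bar> \<le> C" for m x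
    using Hl[of "x + e m" x] e0[of m] by (simp add: g1_def abs_divide divide_le_eq)
  have g1l: "\<bar>g1 m y - g1 m x\<bar> \<le> (2 * C / e m) * (y - x)" if "x \<le> y" for m x y
  proof -
    have "\<bar>g1 m y - g1 m x\<bar> = \<bar>(H (y + e m) - H (x + e m)) - (H y - H x)\<bar> / e m"
      using e0[of m] by (simp add: g1_def diff_divide_distrib[symmetric] abs_divide)
    also have "\<dots> \<le> (2 * C * (y - x)) / e m"
      using Hl[of "y + e m" "x + e m"] Hl[of y x] that e0[of m] by (intro divide_right_mono) auto
    finally show ?thesis by simp
  qed
  have G1c: "continuous_on UNIV (G1 m)" for m
  proof -
    have "continuous_on {-1<..} I" using dI by (intro continuous_at_imp_continuous_on ballI DERIV_isCont) auto
    then have *: "continuous_on UNIV (\<lambda>x. I (k x))" if "continuous_on UNIV k" "\<And>x. k x > -1" for k :: "real \<Rightarrow> real"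
      by (rule continuous_on_compose2) (use that in auto)
    have "max 0 x + e m > -1" "max 0 x > (-1::real)" for x :: real using e0[of m] by (auto simp: max_def)
    then show ?thesis unfolding G1_def using e0[of m]
      by (intro continuous_on_divide continuous_on_diff * continuous_intros) auto
  qed
  have g1c: "continuous_on UNIV (g1 m)" for m
    unfolding g1_def using e0[of m] by (intro continuous_on_divide continuous_on_diff continuous_on_compose2[OF Hc[of UNIV]] continuous_intros) auto
  have G1d: "\<bar>G1 m y - G1 m x - g1 m y * (y - x)\<bar> \<le> (2 * C / e m) * (y - x)\<^sup>2" if xy: "0 \<le> x" "x \<le> y" for m x y
  proof (cases "x = y")
    case False
    then have "x < y" using xy by simp
    define k where "k z = (I (z + e m) - I z) / e m" for z
    have dk: "(k has_real_derivative g1 m z) (at z)" if "z \<ge> x" for z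
    proof -
      have z: "z > -1" "z + e m > -1" using that xy e0[of m] by auto
      have "((\<lambda>z. I (z + e m)) has_real_derivative H (z + e m)) (at z)"
        using dI[OF z(2)] by (simp add: DERIV_shift)
      from DERIV_cdivide[OF DERIV_diff[OF this dI[OF z(1)]], of "e m"] show ?thesis
        unfolding k_def[abs_def] g1_def .
    qed
    obtain z where z: "x < z" "z < y" "k y - k x = (y - x) * g1 m z"
      using MVT2[OF \<open>x < y\<close>, of k "g1 m"] dk by auto
    have "G1 m y - G1 m x = k y - k x" using xy by (simp add: G1_def k_def)
    then have eq: "G1 m y - G1 m x - g1 m y * (y - x) = (y - x) * (g1 m z - g1 m y)"
      using z(3) by (simp add: algebra_simps)
    have "\<bar>G1 m y - G1 m x - g1 m y * (y - x)\<bar> = (y - x) * \<bar>g1 m y - g1 m z\<bar>"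
      unfolding eq abs_mult using xy by (simp add: abs_minus_commute)
    also have "\<dots> \<le> (y - x) * ((2 * C / e m) * (y - x))"
    proof (rule mult_left_mono)
      have "\<bar>g1 m y - g1 m z\<bar> \<le> (2 * C / e m) * (y - z)" using z by (intro g1l) auto
      also have "\<dots> \<le> (2 * C / e m) * (y - x)" using z C e0[of m] by (intro mult_left_mono) auto
      finally show "\<bar>g1 m y - g1 m z\<bar> \<le> (2 * C / e m) * (y - x)" .
    qed (use xy in auto)
    also have "\<dots> = (2 * C / e m) * (y - x)\<^sup>2" by (simp add: power2_eq_square)
    finally show ?thesis .
  qed simp
  define Y where "Y m \<omega> = G1 m (L (\<rho> \<omega>) \<omega>) - \<bar>B (\<rho> \<omega>) \<omega>\<bar> * g1 m (L (\<rho> \<omega>) \<omega>)" for m \<omega>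
  have EY: "(\<integral>\<omega>. Y m \<omega> \<partial>M) = G1 m 0" for m
    unfolding Y_def \<rho>_def
    by (rule stopped_identity_C11[OF \<sigma> T G1c g1c G1b g1b g1l G1d]) (use C e0[of m] in auto)
  have mB: "(\<lambda>\<omega>. B (\<rho> \<omega>) \<omega>) \<in> borel_measurable M" unfolding \<rho>_def by (rule B_trunc_time_measurable[OF \<sigma> T])
  have mL: "(\<lambda>\<omega>. L (\<rho> \<omega>) \<omega>) \<in> borel_measurable M" unfolding \<rho>_def by (rule L_trunc_measurable[OF \<sigma> T])
  have L0: "0 \<le> L (\<rho> \<omega>) \<omega>" if "\<omega> \<in> space M" for \<omega> using L_nonneg[OF that \<rho>b(1)] .
  have G1lim: "(\<lambda>m. G1 m x) \<longlonglongrightarrow> \<Gamma> x" if "0 \<le> x" for x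
  proof -
    have "(\<lambda>m. G1 m x - \<Gamma> x) \<longlonglongrightarrow> 0"
      by (rule Lim_null_comparison[of _ "\<lambda>m. C * e m"]) (use G1a[OF that] tendsto_mult_right_zero[OF el] in auto)
    from tendsto_add[OF this tendsto_const[of "\<Gamma> x"]] show ?thesis by simp
  qed
  have g1lim: "(\<lambda>m. g1 m x) \<longlonglongrightarrow> \<gamma> x" if x: "0 \<le> x" for x
  proof -
    have "((\<lambda>y. (\<Gamma> y - \<Gamma> x) / (y - x)) \<longlongrightarrow> \<gamma> x) (at_right x)"
      using \<gamma>[OF x] by (simp add: has_field_derivative_iff)
    moreover have "filterlim (\<lambda>m. x + e m) (at_right x) sequentially"
      unfolding filterlim_at using e0 less_imp_neq[OF e0] tendsto_add[OF tendsto_const[of x] el]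
      by (auto intro!: always_eventually)
    ultimately have "(\<lambda>m. (\<Gamma> (x + e m) - \<Gamma> x) / (x + e m - x)) \<longlonglongrightarrow> \<gamma> x" by (rule filterlim_compose)
    moreover have "g1 m x = (\<Gamma> (x + e m) - \<Gamma> x) / (x + e m - x)" for m using x e0[of m] by (simp add: g1_def H_def)
    ultimately show ?thesis by simp
  qed
  have mg1: "g1 m \<in> borel_measurable borel" and mG1: "G1 m \<in> borel_measurable borel" for m
    using g1c G1c by (auto intro: borel_measurable_continuous_onI)
  show m\<gamma>: "(\<lambda>\<omega>. \<gamma> (L (trunc_time T \<sigma> \<omega>) \<omega>)) \<in> borel_measurable M"
  proof (rule borel_measurable_LIMSEQ_real)
    show "(\<lambda>m. g1 m (L (trunc_time T \<sigma> \<omega>) \<omega>)) \<longlonglongrightarrow> \<gamma> (L (trunc_time T \<sigma> \<omega>) \<omega>)" if "\<omega> \<in> space M" for \<omega>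
      using g1lim[OF L0[OF that]] by (simp add: \<rho>_def)
    show "(\<lambda>\<omega>. g1 m (L (trunc_time T \<sigma> \<omega>) \<omega>)) \<in> borel_measurable M" for m
      using measurable_compose[OF mL mg1] by (simp add: \<rho>_def)
  qed
  have m\<Gamma>: "(\<lambda>\<omega>. \<Gamma> (L (\<rho> \<omega>) \<omega>)) \<in> borel_measurable M"
  proof (rule borel_measurable_LIMSEQ_real)
    show "(\<lambda>m. G1 m (L (\<rho> \<omega>) \<omega>)) \<longlonglongrightarrow> \<Gamma> (L (\<rho> \<omega>) \<omega>)" if "\<omega> \<in> space M" for \<omega>
      by (rule G1lim[OF L0[OF that]])
    show "(\<lambda>\<omega>. G1 m (L (\<rho> \<omega>) \<omega>)) \<in> borel_measurable M" for m
      by (rule measurable_compose[OF mL mG1])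
  qed
  have "(\<lambda>m. \<integral>\<omega>. Y m \<omega> \<partial>M) \<longlonglongrightarrow> (\<integral>\<omega>. \<Gamma> (L (\<rho> \<omega>) \<omega>) - \<bar>B (\<rho> \<omega>) \<omega>\<bar> * \<gamma> (L (\<rho> \<omega>) \<omega>) \<partial>M)"
  proof (rule integral_dominated_convergence[where w = "\<lambda>\<omega>. C + \<bar>B (\<rho> \<omega>) \<omega>\<bar> * C"])
    show "(\<lambda>\<omega>. \<Gamma> (L (\<rho> \<omega>) \<omega>) - \<bar>B (\<rho> \<omega>) \<omega>\<bar> * \<gamma> (L (\<rho> \<omega>) \<omega>)) \<in> borel_measurable M"
      using m\<gamma> unfolding \<rho>_def[symmetric] by (intro borel_measurable_diff borel_measurable_times borel_measurable_abs mB m\<Gamma>)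
    show "Y m \<in> borel_measurable M" for m unfolding Y_def
      by (intro borel_measurable_diff borel_measurable_times borel_measurable_abs measurable_compose[OF mL mG1] measurable_compose[OF mL mg1] mB)
    show "integrable M (\<lambda>\<omega>. C + \<bar>B (\<rho> \<omega>) \<omega>\<bar> * C)"
      using B_stopped_integrable[OF \<sigma> T] unfolding \<rho>_def by (intro Bochner_Integration.integrable_add integrable_mult_left integrable_abs) auto
    show "AE \<omega> in M. (\<lambda>m. Y m \<omega>) \<longlonglongrightarrow> \<Gamma> (L (\<rho> \<omega>) \<omega>) - \<bar>B (\<rho> \<omega>) \<omega>\<bar> * \<gamma> (L (\<rho> \<omega>) \<omega>)"
      unfolding Y_def using L0 by (intro AE_I2 tendsto_diff tendsto_mult tendsto_const G1lim g1lim) auto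
    show "AE \<omega> in M. norm (Y m \<omega>) \<le> C + \<bar>B (\<rho> \<omega>) \<omega>\<bar> * C" for m
    proof (rule AE_I2)
      fix \<omega>
      have "norm (Y m \<omega>) \<le> \<bar>G1 m (L (\<rho> \<omega>) \<omega>)\<bar> + \<bar>B (\<rho> \<omega>) \<omega>\<bar> * \<bar>g1 m (L (\<rho> \<omega>) \<omega>)\<bar>"
        unfolding Y_def using abs_triangle_ineq4[of "G1 m (L (\<rho> \<omega>) \<omega>)" "\<bar>B (\<rho> \<omega>) \<omega>\<bar> * g1 m (L (\<rho> \<omega>) \<omega>)"] by (simp add: abs_mult)
      also have "\<dots> \<le> C + \<bar>B (\<rho> \<omega>) \<omega>\<bar> * C" using G1b g1b by (intro add_mono mult_left_mono) auto
      finally show "norm (Y m \<omega>) \<le> C + \<bar>B (\<rho> \<omega>) \<omega>\<bar> * C" .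
    qed
  qed
  moreover have "(\<lambda>m. \<integral>\<omega>. Y m \<omega> \<partial>M) \<longlonglongrightarrow> \<Gamma> 0" unfolding EY by (rule G1lim) simp
  ultimately show "(\<integral>\<omega>. \<Gamma> (L (trunc_time T \<sigma> \<omega>) \<omega>) - \<bar>B (trunc_time T \<sigma> \<omega>) \<omega>\<bar> * \<gamma> (L (trunc_time T \<sigma> \<omega>) \<omega>) \<partial>M) = \<Gamma> 0"
    unfolding \<rho>_def[symmetric] by (rule LIMSEQ_unique)
qed

end

section \<open>The Vallois boundary\<close>

text \<open>A monotone weight on {a<..b} lies between w a and w b. The estimate is used twice: with
  \<mu> for the boundary function \<psi>, and with Lebesgue measure for the dual function.\<close>

lemma monotone_weight_integral:
  fixes w :: "real \<Rightarrow> real"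
  assumes sets: "sets \<nu> = sets borel" and fin: "\<And>a b. emeasure \<nu> {a..b} < \<infinity>"
    and w [measurable]: "w \<in> borel_measurable borel" and w0: "\<And>x. 0 \<le> x \<Longrightarrow> 0 \<le> w x"
    and wm: "\<And>x y. 0 \<le> x \<Longrightarrow> x \<le> y \<Longrightarrow> w x \<le> w y" and ab: "0 \<le> a" "a \<le> b"
  defines "I x \<equiv> (\<integral>s. indicator {0..x} s * w s \<partial>\<nu>)"
  shows "w a * measure \<nu> {a<..b} \<le> I b - I a" "I b - I a \<le> w b * measure \<nu> {a<..b}"
    "ennreal (I b - I a) = (\<integral>\<^sup>+s. ennreal (w s) * indicator {a<..b} s \<partial>\<nu>)"
proof -
  note [measurable_cong] = sets
  have fin': "emeasure \<nu> {a<..b} < \<infinity>" for a b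
    by (rule order_le_less_trans[OF emeasure_mono[of "{a<..b}" "{a..b}" \<nu>] fin[of a b]]) (auto simp: sets)
  have i: "integrable \<nu> (\<lambda>s. indicator {0..x} s * w s)" for x
  proof (rule Bochner_Integration.integrable_bound[of _ "\<lambda>s. indicator {0..x} s * w (max 0 x)"])
    show "integrable \<nu> (\<lambda>s. indicator {0..x} s * w (max 0 x))"
      using fin[of 0 x] by (intro integrable_mult_left integrable_real_indicator) (auto simp: sets)
    have "norm (indicator {0..x} s * w s) \<le> norm (indicator {0..x} s * w (max 0 x))" for s
      using w0[of s] wm[of s "max 0 x"] by (auto simp: indicator_def)
    then show "AE s in \<nu>. norm (indicator {0..x} s * w s) \<le> norm (indicator {0..x} s * w (max 0 x))" by simp
  qed measurable
  have d: "I b - I a = (\<integral>s. indicator {a<..b} s * w s \<partial>\<nu>)"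
  proof -
    have "I b - I a = (\<integral>s. indicator {0..b} s * w s - indicator {0..a} s * w s \<partial>\<nu>)"
      unfolding I_def by (rule Bochner_Integration.integral_diff[symmetric, OF i i])
    also have "\<dots> = (\<integral>s. indicator {a<..b} s * w s \<partial>\<nu>)"
      by (rule Bochner_Integration.integral_cong) (use ab in \<open>auto simp: indicator_def\<close>)
    finally show ?thesis .
  qed
  have id: "integrable \<nu> (\<lambda>s. indicator {a<..b} s * w s)"
    by (rule Bochner_Integration.integrable_bound[OF i[of b]]) (use ab in \<open>auto simp: indicator_def\<close>)
  have ic: "integrable \<nu> (\<lambda>s. indicator {a<..b} s * c)" for c :: real
    using fin'[of a b] by (intro integrable_mult_left integrable_real_indicator) (auto simp: sets)
  have c: "(\<integral>s. indicator {a<..b} s * c \<partial>\<nu>) = c * measure \<nu> {a<..b}" for c :: real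
    by (simp add: sets_eq_imp_space_eq[OF sets])
  show "w a * measure \<nu> {a<..b} \<le> I b - I a"
    unfolding d c[symmetric] using wm ab by (intro integral_mono ic id) (auto simp: indicator_def)
  show "I b - I a \<le> w b * measure \<nu> {a<..b}"
    unfolding d c[symmetric] using wm ab by (intro integral_mono ic id) (auto simp: indicator_def)
  have "ennreal (I b - I a) = (\<integral>\<^sup>+s. ennreal (indicator {a<..b} s * w s) \<partial>\<nu>)"
    unfolding d using w0 ab by (intro nn_integral_eq_integral[symmetric] id) (auto simp: indicator_def)
  also have "\<dots> = (\<integral>\<^sup>+s. ennreal (w s) * indicator {a<..b} s \<partial>\<nu>)"
    by (rule nn_integral_cong) (auto simp: indicator_def)
  finally show "ennreal (I b - I a) = (\<integral>\<^sup>+s. ennreal (w s) * indicator {a<..b} s \<partial>\<nu>)" .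
qed

locale target =
  fixes \<mu> :: "real measure" and f :: "real \<Rightarrow> real"
  assumes f_meas [measurable]: "f \<in> borel_measurable borel"
    and f_pos: "\<And>x. 0 < f x"
    and mu_dens: "\<mu> = density lborel (\<lambda>x. ennreal (f x))"
    and mu_prob: "prob_space \<mu>"
    and mu_symm: "distr \<mu> borel uminus = \<mu>"

sublocale target \<subseteq> real_distribution \<mu>
  using mu_prob by (intro real_distribution.intro real_distribution_axioms.intro) (auto simp: mu_dens)

context target
begin

abbreviation m where "m \<equiv> mu_bar \<mu>"

lemma sets_mu: "sets \<mu> = sets borel" by (simp add: mu_dens)

lemma mu_singleton: "measure \<mu> {x} = 0"
proof -
  have "emeasure \<mu> {x} = (\<integral>\<^sup>+y. ennreal (f y) * indicator {x} y \<partial>lborel)" unfolding mu_dens by (subst emeasure_density) auto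
  also have "\<dots> = 0" by (subst nn_integral_0_iff_AE) (auto intro!: AE_I[of _ _ "{x}"] simp: indicator_def)
  finally show ?thesis by (simp add: measure_def)
qed

lemma mu_interval_pos: "a < b \<Longrightarrow> measure \<mu> {a<..b} > 0"
proof -
  assume ab: "a < b"
  have "emeasure \<mu> {a<..b} = (\<integral>\<^sup>+y. ennreal (f y) * indicator {a<..b} y \<partial>lborel)" unfolding mu_dens by (subst emeasure_density) auto
  also have "\<dots> \<noteq> 0"
  proof
    assume "(\<integral>\<^sup>+y. ennreal (f y) * indicator {a<..b} y \<partial>lborel) = 0"
    then have "AE y in lborel. ennreal (f y) * indicator {a<..b} y = 0" by (subst (asm) nn_integral_0_iff_AE) auto
    then have "AE y in lborel. y \<notin> {a<..b}"
      using f_pos by (auto simp: indicator_def elim!: eventually_mono split: if_splits) (metis ennreal_eq_0_iff not_le)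
    then have "emeasure lborel {a<..b} = 0" by (subst (asm) AE_iff_measurable[OF _ refl]) (auto simp: greaterThanAtMost_def greaterThan_def atMost_def Int_def)
    then show False using ab by simp
  qed
  finally show ?thesis by (simp add: emeasure_eq_measure zero_less_measure_iff)
qed

lemma m_cdf: "m x = 1 - cdf \<mu> x"
proof -
  have "measure \<mu> {x..} = measure \<mu> ({x<..} \<union> {x})" by (rule arg_cong[of _ _ "measure \<mu>"]) auto
  also have "\<dots> = measure \<mu> {x<..}" using mu_singleton by (subst finite_measure_Union) (auto simp: sets_mu)
  also have "{x<..} = space \<mu> - {..x}" by (auto simp: sets_eq_imp_space_eq[OF sets_mu])
  also have "measure \<mu> (space \<mu> - {..x}) = 1 - measure \<mu> {..x}" by (rule prob_compl) (simp add: sets_mu)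
  finally show ?thesis by (simp add: mu_bar_def cdf_def)
qed

lemma mu_interval: "a \<le> b \<Longrightarrow> measure \<mu> {a<..b} = m a - m b"
proof (cases "a = b")
  case False
  assume "a \<le> b"
  then show ?thesis using cdf_diff_eq[of a b] False by (simp add: m_cdf)
qed simp

lemma m_strict: "a < b \<Longrightarrow> m b < m a"
  using mu_interval_pos[of a b] mu_interval[of a b] by simp

lemma m_anti: "a \<le> b \<Longrightarrow> m b \<le> m a"
  using m_strict[of a b] by (cases "a = b") auto

lemma m_pos: "m x > 0"
  using m_strict[of x "x + 1"] by (simp add: mu_bar_def) (metis measure_nonneg order_le_less_trans)

lemma m_cont: "continuous_on A m"
proof -
  have "isCont m x" for x unfolding m_cdf[abs_def] using mu_singleton[of x] isCont_cdf[of x] by (intro continuous_intros) auto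
  then show ?thesis by (simp add: continuous_at_imp_continuous_on)
qed

lemma m_tendsto: "(m \<longlongrightarrow> 0) at_top"
  unfolding m_cdf[abs_def] using tendsto_diff[OF tendsto_const[of 1] cdf_lim_at_top_prob] by simp

lemma m_measurable [measurable]: "m \<in> borel_measurable borel"
  using m_cont by (rule borel_measurable_continuous_onI)

lemma mu_reflect: "A \<in> sets borel \<Longrightarrow> measure \<mu> (uminus -` A) = measure \<mu> A"
  using measure_distr[of uminus \<mu> borel A] mu_symm by (simp add: measurable_cong_sets[OF sets_mu refl] sets_eq_imp_space_eq[OF sets_mu])

lemma m_0: "m 0 = 1 / 2"
proof -
  have "uminus -` {0..} = {..0::real}" by auto
  then have "measure \<mu> {..0} = m 0" using mu_reflect[of "{0..}"] by (simp add: mu_bar_def)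
  then show ?thesis using m_cdf[of 0] by (simp add: cdf_def)
qed

definition \<psi> where "\<psi> = psi_mu \<mu>"
definition \<phi> where "\<phi> = phi_mu \<mu>"

definition w where "w s = s / m s" for s

lemma w_mono: "0 \<le> x \<Longrightarrow> x \<le> y \<Longrightarrow> w x \<le> w y"
  unfolding w_def using m_pos m_anti by (intro frac_le) auto

lemma w_nonneg: "0 \<le> x \<Longrightarrow> 0 \<le> w x" unfolding w_def using m_pos[of x] by simp

lemma w_measurable [measurable]: "w \<in> borel_measurable borel" unfolding w_def[abs_def] by measurable

lemma \<psi>_eq: "\<psi> x = (\<integral>s. indicator {0..x} s * w s \<partial>\<mu>)"
  by (simp add: \<psi>_def psi_mu_def set_lebesgue_integral_def w_def)

lemma \<psi>_diff:
  assumes "0 \<le> a" "a \<le> b"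
  shows "w a * (m a - m b) \<le> \<psi> b - \<psi> a" "\<psi> b - \<psi> a \<le> w b * (m a - m b)"
    "ennreal (\<psi> b - \<psi> a) = (\<integral>\<^sup>+s. ennreal (w s) * indicator {a<..b} s \<partial>\<mu>)"
  using monotone_weight_integral[OF sets_mu _ w_measurable w_nonneg w_mono assms] mu_interval[OF assms(2)]
  unfolding \<psi>_eq by (auto simp: emeasure_eq_measure)

lemma \<psi>_0: "\<psi> 0 = 0"
proof -
  have "\<psi> 0 = (\<integral>s. 0 \<partial>\<mu>)" unfolding \<psi>_eq by (rule Bochner_Integration.integral_cong) (auto simp: indicator_def w_def)
  then show ?thesis by simp
qed

lemma \<psi>_strict: "0 \<le> a \<Longrightarrow> a < b \<Longrightarrow> \<psi> a < \<psi> b"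
proof -
  assume ab: "0 \<le> a" "a < b"
  define c where "c = (a + b) / 2"
  have c: "0 < c" "a \<le> c" "c < b" using ab by (auto simp: c_def)
  have "0 \<le> w a * (m a - m c)" using w_nonneg[OF ab(1)] m_anti[OF c(2)] by simp
  then have "\<psi> a \<le> \<psi> c" using \<psi>_diff(1)[of a c] ab c by simp
  moreover have "0 < w c * (m c - m b)" using c m_pos[of c] m_strict[of c b] by (simp add: w_def)
  then have "\<psi> c < \<psi> b" using \<psi>_diff(1)[of c b] c by simp
  ultimately show ?thesis by simp
qed

lemma \<psi>_mono: "0 \<le> a \<Longrightarrow> a \<le> b \<Longrightarrow> \<psi> a \<le> \<psi> b"
  using \<psi>_strict[of a b] by (cases "a = b") auto

lemma \<psi>_nonneg: "0 \<le> a \<Longrightarrow> 0 \<le> \<psi> a" using \<psi>_mono[of 0 a] \<psi>_0 by simp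

text \<open>Increments of \<psi> are at most a locally bounded weight times increments of the tail
  m, so continuity is inherited from the absence of atoms.\<close>

lemma \<psi>_cont: "continuous_on {0..T} \<psi>"
proof -
  have "\<bar>\<psi> y - \<psi> x\<bar> \<le> w T * \<bar>m x - m y\<bar>" if "x \<in> {0..T}" "y \<in> {0..T}" for x y
  proof -
    have *: "\<bar>\<psi> y - \<psi> x\<bar> \<le> w T * \<bar>m x - m y\<bar>" if "x \<in> {0..T}" "y \<in> {0..T}" "x \<le> y" for x y
    proof -
      have "\<psi> y - \<psi> x \<le> w y * (m x - m y)" using that by (intro \<psi>_diff) auto
      also have "\<dots> \<le> w T * (m x - m y)" using w_mono[of y T] m_anti[of x y] that by (intro mult_right_mono) auto
      finally show ?thesis using \<psi>_mono[of x y] m_anti[of x y] that by simp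
    qed
    show ?thesis using *[of x y] *[of y x] that by (cases "x \<le> y") (auto simp: abs_minus_commute)
  qed
  note bound = this
  show ?thesis unfolding continuous_on_def
  proof
    fix x assume x: "x \<in> {0..T}"
    have "((\<lambda>y. \<psi> y - \<psi> x) \<longlongrightarrow> 0) (at x within {0..T})"
    proof (rule Lim_null_comparison)
      show "\<forall>\<^sub>F y in at x within {0..T}. norm (\<psi> y - \<psi> x) \<le> w T * \<bar>m x - m y\<bar>"
        using bound x by (auto simp: eventually_at_filter)
      have "(m \<longlongrightarrow> m x) (at x within {0..T})" using m_cont[of "{0..T}"] x by (simp add: continuous_on_def)
      then have "((\<lambda>y. w T * \<bar>m x - m y\<bar>) \<longlongrightarrow> w T * \<bar>m x - m x\<bar>) (at x within {0..T})" by (intro tendsto_intros)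
      then show "((\<lambda>y. w T * \<bar>m x - m y\<bar>) \<longlongrightarrow> 0) (at x within {0..T})" by simp
    qed
    then show "(\<psi> \<longlongrightarrow> \<psi> x) (at x within {0..T})" by (simp add: LIM_zero_iff)
  qed
qed

text \<open>From any y \<ge> 1, moving on until the tail has halved adds at least (y / m y) * (m y /
  2) \<ge> 1 / 2 to \<psi>. Hence the inverse \<phi> is defined on all of [0, \<infinity>).\<close>

lemma \<psi>_unbounded: "\<exists>y\<ge>0. \<psi> y \<ge> C"
proof -
  have "\<exists>y\<ge>1. \<psi> y \<ge> real n / 2" for n
  proof (induction n)
    case 0 show ?case using \<psi>_nonneg[of 1] by (intro exI[of _ 1]) auto
  next
    case (Suc n)
    then obtain y where y: "y \<ge> 1" "\<psi> y \<ge> real n / 2" by blast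
    have "\<forall>\<^sub>F z in at_top. m z < m y / 2" using order_tendstoD(2)[OF m_tendsto, of "m y / 2"] m_pos[of y] by simp
    then have "\<forall>\<^sub>F z in at_top. m z < m y / 2 \<and> y \<le> z" using eventually_ge_at_top[of y] by eventually_elim auto
    from eventually_happens[OF this] obtain z where z: "m z < m y / 2" "y \<le> z" by auto
    have "1 / 2 \<le> w y * (m y / 2)" using y m_pos[of y] by (simp add: w_def)
    also have "\<dots> \<le> w y * (m y - m z)" using z w_nonneg[of y] y by (intro mult_left_mono) auto
    also have "\<dots> \<le> \<psi> z - \<psi> y" using y z by (intro \<psi>_diff) auto
    finally show ?case using y z by (intro exI[of _ z]) auto
  qed
  moreover obtain n :: nat where "2 * C < n" using reals_Archimedean2 by blast
  ultimately obtain y where "y \<ge> 1" "\<psi> y \<ge> real n / 2" by blast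
  then show ?thesis using \<open>2 * C < n\<close> by (intro exI[of _ y]) auto
qed

lemma \<psi>_inj: "inj_on \<psi> {0..}"
  unfolding inj_on_def using \<psi>_strict by (metis atLeast_iff linorder_neq_iff)

lemma \<psi>_surj: "0 \<le> l \<Longrightarrow> \<exists>y\<ge>0. \<psi> y = l"
proof -
  assume l: "0 \<le> l"
  obtain z where z: "z \<ge> 0" "\<psi> z \<ge> l" using \<psi>_unbounded by blast
  have "\<exists>y\<ge>0. y \<le> z \<and> \<psi> y = l"
    by (rule IVT') (use z l \<psi>_0 \<psi>_cont in auto)
  then show ?thesis by blast
qed

lemma \<phi>_\<psi>: "0 \<le> y \<Longrightarrow> \<phi> (\<psi> y) = y"
  unfolding \<phi>_def phi_mu_def \<psi>_def[symmetric] using \<psi>_inj by (intro the_inv_into_f_f) auto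

lemma \<phi>: assumes "0 \<le> l" shows "0 \<le> \<phi> l" "\<psi> (\<phi> l) = l"
  using \<psi>_surj[OF assms] \<phi>_\<psi> by auto

lemma \<phi>_less_iff: "0 \<le> l \<Longrightarrow> 0 \<le> y \<Longrightarrow> \<phi> l < y \<longleftrightarrow> l < \<psi> y"
  using \<phi>[of l] \<psi>_strict[of "\<phi> l" y] \<psi>_mono[of y "\<phi> l"] by force

lemma \<phi>_strict: "0 \<le> l \<Longrightarrow> l < l' \<Longrightarrow> \<phi> l < \<phi> l'"
  using \<phi>_less_iff[of l "\<phi> l'"] \<phi>[of l'] by simp

lemma \<phi>_mono: "0 \<le> l \<Longrightarrow> l \<le> l' \<Longrightarrow> \<phi> l \<le> \<phi> l'"
  using \<phi>_strict[of l l'] by (cases "l = l'") auto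

lemma \<phi>_0: "\<phi> 0 = 0" using \<phi>_\<psi>[of 0] \<psi>_0 by simp

lemma \<phi>_pos: "0 < l \<Longrightarrow> 0 < \<phi> l" using \<phi>_strict[of 0 l] \<phi>_0 by simp

lemma \<phi>_cont: "continuous_on {0..} \<phi>"
  unfolding continuous_on_iff
proof (intro ballI allI impI)
  fix l e :: real assume l: "l \<in> {0..}" and e: "e > 0"
  define y where "y = \<phi> l"
  have y: "y \<ge> 0" "\<psi> y = l" using \<phi>[of l] l by (auto simp: y_def)
  have u: "l < \<psi> (y + e)" using \<psi>_strict[of y "y + e"] y e by simp
  show "\<exists>d>0. \<forall>x'\<in>{0..}. dist x' l < d \<longrightarrow> dist (\<phi> x') (\<phi> l) < e"
  proof (cases "y - e < 0")
    case True
    show ?thesis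
    proof (intro exI[of _ "\<psi> (y + e) - l"] conjI ballI impI)
      fix x' assume x': "x' \<in> {0..}" "dist x' l < \<psi> (y + e) - l"
      then have "\<phi> x' < y + e" using y e by (subst \<phi>_less_iff) (auto simp: dist_real_def)
      then show "dist (\<phi> x') (\<phi> l) < e" using True \<phi>(1)[of x'] x' by (auto simp: dist_real_def y_def[symmetric])
    qed (use u in simp)
  next
    case False
    then have v: "\<psi> (y - e) < l" using \<psi>_strict[of "y - e" y] y e by simp
    show ?thesis
    proof (intro exI[of _ "min (\<psi> (y + e) - l) (l - \<psi> (y - e))"] conjI ballI impI)
      fix x' assume x': "x' \<in> {0..}" "dist x' l < min (\<psi> (y + e) - l) (l - \<psi> (y - e))"
      then have 1: "\<phi> x' < y + e" using y e by (subst \<phi>_less_iff) (auto simp: dist_real_def)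
      have "\<psi> (y - e) < x'" using x' by (auto simp: dist_real_def)
      then have "\<phi> (\<psi> (y - e)) < \<phi> x'" using \<psi>_nonneg[of "y - e"] False by (intro \<phi>_strict) auto
      then have 2: "y - e < \<phi> x'" using \<phi>_\<psi>[of "y - e"] False by simp
      show "dist (\<phi> x') (\<phi> l) < e" using 1 2 by (auto simp: dist_real_def y_def[symmetric])
    qed (use u v in simp)
  qed
qed

text \<open>The reciprocal of P(|X| \<ge> \<phi> l) for X with law \<mu>. It solves r' = r / \<phi>
  with r 0 = 1, so r(L) - |B| r'(L) vanishes whenever |B| = \<phi>(L).\<close>

definition r where "r l = 1 / (2 * m (\<phi> l))" for l

lemma r_pos: "r l > 0" unfolding r_def using m_pos by simp

lemma r_0: "r 0 = 1" by (simp add: r_def \<phi>_0 m_0)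

lemma r_mono: "0 \<le> l \<Longrightarrow> l \<le> l' \<Longrightarrow> r l \<le> r l'"
  unfolding r_def using m_pos m_anti[OF \<phi>_mono] by (intro divide_left_mono) auto

lemma r_ge_1: "0 \<le> l \<Longrightarrow> 1 \<le> r l" using r_mono[of 0 l] r_0 by simp

lemma r_cont: "continuous_on {0..} r"
  unfolding r_def using m_pos[THEN less_imp_neq, symmetric]
  by (intro continuous_intros continuous_on_compose2[OF m_cont[of UNIV] \<phi>_cont]) auto

lemma r_unbounded: "\<exists>l>0. r l \<ge> C"
proof -
  define C' where "C' = max C 1"
  have "\<forall>\<^sub>F z in at_top. m z < 1 / (2 * C')" using order_tendstoD(2)[OF m_tendsto, of "1 / (2 * C')"] by (simp add: C'_def)
  then have "\<forall>\<^sub>F z in at_top. m z < 1 / (2 * C') \<and> 1 \<le> z" using eventually_ge_at_top[of 1] by eventually_elim auto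
  from eventually_happens[OF this] obtain z where z: "m z < 1 / (2 * C')" "1 \<le> z" by auto
  have "r (\<psi> z) = 1 / (2 * m z)" using z by (simp add: r_def \<phi>_\<psi>)
  moreover have "C' \<le> 1 / (2 * m z)"
  proof -
    have "C' > 0" by (simp add: C'_def)
    then show ?thesis using z m_pos[of z] by (simp add: field_simps)
  qed
  ultimately have "C \<le> r (\<psi> z)" by (simp add: C'_def)
  moreover have "0 < \<psi> z" using \<psi>_strict[of 0 z] z \<psi>_0 by simp
  ultimately show ?thesis by blast
qed

text \<open>The equation r' = r / \<phi> in difference form. The increment of r is that of the tail
  m divided by 2 m(\<phi> l) m(\<phi> l'), and the increment l' - l of \<psi> brackets the same tail
  increment; eliminating the latter avoids differentiating \<phi>.\<close>

lemma r_diff: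
  assumes "0 < l" "l \<le> l'"
  shows "(l' - l) * (r l / \<phi> l') \<le> r l' - r l" "r l' - r l \<le> (l' - l) * (r l' / \<phi> l)"
proof -
  define y y' where "y = \<phi> l" and "y' = \<phi> l'"
  have y: "0 < y" "y \<le> y'" "\<psi> y = l" "\<psi> y' = l'" using assms \<phi>_pos[of l] \<phi>_mono[of l l'] \<phi>[of l] \<phi>[of l'] by (auto simp: y_def y'_def)
  have mp: "m y > 0" "m y' > 0" using m_pos by auto
  define D where "D = m y - m y'"
  have e: "r l' - r l = D / (2 * m y * m y')" unfolding r_def y_def[symmetric] y'_def[symmetric] D_def using mp by (simp add: field_simps)
  have d: "y / m y * D \<le> l' - l" "l' - l \<le> y' / m y' * D" using \<psi>_diff[of y y'] y by (auto simp: w_def D_def)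
  have "(l' - l) * (r l / y') \<le> (y' / m y' * D) * (r l / y')" using d r_pos[of l] y by (intro mult_right_mono) auto
  also have "\<dots> = D / (2 * m y * m y')" using y by (simp add: r_def y_def[symmetric] field_simps)
  finally show "(l' - l) * (r l / \<phi> l') \<le> r l' - r l" unfolding e y'_def .
  have "D / (2 * m y * m y') = (y / m y * D) * (r l' / y)" using y by (simp add: r_def y'_def[symmetric] field_simps)
  also have "\<dots> \<le> (l' - l) * (r l' / y)" using d r_pos[of l'] y by (intro mult_right_mono) auto
  finally show "r l' - r l \<le> (l' - l) * (r l' / \<phi> l)" unfolding e y_def .
qed

lemma r_deriv:
  assumes l: "0 < l"
  shows "(r has_real_derivative r l / \<phi> l) (at_right l)"
  unfolding has_field_derivative_iff
proof (rule tendsto_sandwich)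
  have at: "at_right l \<le> at l within {0..}" using l by (intro at_le) auto
  have \<phi>l: "(\<phi> \<longlongrightarrow> \<phi> l) (at_right l)" by (rule tendsto_mono[OF at]) (use \<phi>_cont l in \<open>auto simp: continuous_on_def\<close>)
  have rl: "(r \<longlongrightarrow> r l) (at_right l)" by (rule tendsto_mono[OF at]) (use r_cont l in \<open>auto simp: continuous_on_def\<close>)
  show "((\<lambda>y. r l / \<phi> y) \<longlongrightarrow> r l / \<phi> l) (at_right l)" using \<phi>_pos[OF l] by (intro tendsto_intros \<phi>l) auto
  show "((\<lambda>y. r y / \<phi> l) \<longlongrightarrow> r l / \<phi> l) (at_right l)" using \<phi>_pos[OF l] by (intro tendsto_intros rl) auto
  show "\<forall>\<^sub>F y in at_right l. r l / \<phi> y \<le> (r y - r l) / (y - l)"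
    unfolding eventually_at_right_field using r_diff(1)[OF l] by (intro exI[of _ "l + 1"]) (auto simp: field_simps)
  show "\<forall>\<^sub>F y in at_right l. (r y - r l) / (y - l) \<le> r y / \<phi> l"
    unfolding eventually_at_right_field using r_diff(2)[OF l] by (intro exI[of _ "l + 1"]) (auto simp: field_simps)
qed

end

section \<open>The dual function\<close>

context target
begin

context
  fixes k :: real
  assumes k: "k > 0"
begin

text \<open>For y \<le> \<phi> k this is the conditional probability of X \<ge> \<phi> k given X
  \<ge> y, and 1 beyond. Being increasing, it is the slope of a convex function. All constants of
  this context depend on the strike k.\<close>

definition hh where "hh y = m (\<phi> k) / m (min y (\<phi> k))"
definition \<gamma> where "\<gamma> l = hh (\<phi> l)"
definition H where "H x = (\<integral>y. indicator {0..x} y * hh y \<partial>lborel)"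
text \<open>The value that turns the pathwise inequality into an equality at x = \<phi> l. That its
  derivative is \<gamma>, as the martingale requires, is then a fact to be proved.\<close>

definition \<Gamma> where "\<Gamma> l = \<phi> l * \<gamma> l - H (\<phi> l) + max 0 (l - k)"

lemma b_pos: "\<phi> k > 0" using \<phi>_pos[OF k] .

lemma hh_measurable [measurable]: "hh \<in> borel_measurable borel" unfolding hh_def[abs_def] by measurable

lemma hh_mono: "x \<le> y \<Longrightarrow> hh x \<le> hh y"
  unfolding hh_def using m_pos m_anti by (intro divide_left_mono mult_pos_pos) (auto intro: less_imp_le)

lemma hh_nonneg: "0 \<le> hh x" unfolding hh_def using m_pos by (intro divide_nonneg_nonneg) (auto intro: less_imp_le)

lemma hh_1: "\<phi> k \<le> y \<Longrightarrow> hh y = 1"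
  unfolding hh_def using m_pos[of "\<phi> k"] by (simp add: min_absorb2)

lemma hh_le_1: "hh y \<le> 1" using hh_mono[of y "max y (\<phi> k)"] hh_1[of "max y (\<phi> k)"] by simp

lemma H_diff:
  assumes "0 \<le> x" "x \<le> y"
  shows "hh x * (y - x) \<le> H y - H x" "H y - H x \<le> hh y * (y - x)"
    "ennreal (H y - H x) = (\<integral>\<^sup>+s. ennreal (hh s) * indicator {x<..y} s \<partial>lborel)"
proof -
  have fin: "emeasure lborel {a..b::real} < \<infinity>" for a b by (cases "a \<le> b") auto
  show "hh x * (y - x) \<le> H y - H x" "H y - H x \<le> hh y * (y - x)"
    "ennreal (H y - H x) = (\<integral>\<^sup>+s. ennreal (hh s) * indicator {x<..y} s \<partial>lborel)"
    using monotone_weight_integral[OF sets_lborel fin hh_measurable hh_nonneg hh_mono assms] assms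
    unfolding H_def by auto
qed

lemma H_0: "H 0 = 0"
proof -
  have "H 0 = (\<integral>y. indicator {0::real} y * hh 0 \<partial>lborel)" unfolding H_def
    by (rule Bochner_Integration.integral_cong) (auto simp: indicator_def)
  then show ?thesis by simp
qed

lemma H_lipschitz: "0 \<le> x \<Longrightarrow> 0 \<le> y \<Longrightarrow> \<bar>H y - H x\<bar> \<le> \<bar>y - x\<bar>"
proof -
  have *: "\<bar>H y - H x\<bar> \<le> \<bar>y - x\<bar>" if "0 \<le> x" "x \<le> y" for x y
  proof -
    have "0 \<le> hh x * (y - x)" using hh_nonneg that by simp
    moreover have "hh y * (y - x) \<le> 1 * (y - x)" using hh_le_1 that by (intro mult_right_mono) auto
    ultimately show ?thesis using H_diff[OF that] that by simp
  qed
  show "0 \<le> x \<Longrightarrow> 0 \<le> y \<Longrightarrow> ?thesis" using *[of x y] *[of y x] by (cases "x \<le> y") (auto simp: abs_minus_commute)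
qed

lemma H_cont: "continuous_on {0..} H"
  by (intro lipschitz_on_continuous_on[of 1]) (use H_lipschitz in \<open>auto simp: lipschitz_on_def dist_real_def abs_minus_commute\<close>)

lemma H_nonneg: "0 \<le> x \<Longrightarrow> 0 \<le> H x"
  using order_trans[OF mult_nonneg_nonneg[OF hh_nonneg[of 0], of x] , of "H x"] H_diff(1)[of 0 x] H_0 by simp

lemma H_convex:
  assumes "0 \<le> x" "0 \<le> y"
  shows "hh y * (x - y) \<le> H x - H y"
proof (cases "y \<le> x")
  case True then show ?thesis using H_diff(1)[of y x] assms by simp
next
  case False then show ?thesis using H_diff(2)[of x y] assms by (simp add: algebra_simps)
qed

text \<open>Monotonicity lets \<phi> commute with \<open>min\<close>; up to k the dual slope is thus
  a multiple of r and inherits its differential equation.\<close>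

lemma \<gamma>_r: "0 \<le> l \<Longrightarrow> \<gamma> l = r (min l k) / r k"
proof -
  assume l: "0 \<le> l"
  have "min (\<phi> l) (\<phi> k) = \<phi> (min l k)" using \<phi>_mono[of l k] \<phi>_mono[of k l] l k by (auto simp: min_def)
  then show ?thesis by (simp add: \<gamma>_def hh_def r_def)
qed

lemma \<gamma>_mono: "0 \<le> l \<Longrightarrow> l \<le> l' \<Longrightarrow> \<gamma> l \<le> \<gamma> l'" unfolding \<gamma>_def by (intro hh_mono \<phi>_mono)

lemma \<gamma>_nonneg: "0 \<le> \<gamma> l" unfolding \<gamma>_def by (rule hh_nonneg)

lemma \<gamma>_le_1: "\<gamma> l \<le> 1" unfolding \<gamma>_def by (rule hh_le_1)

lemma \<gamma>_1: "k \<le> l \<Longrightarrow> \<gamma> l = 1" unfolding \<gamma>_def using k by (intro hh_1 \<phi>_mono) auto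

lemma \<gamma>_cont: "continuous_on {0..} \<gamma>"
proof -
  have "continuous_on {0..} (\<lambda>l. r (min l k) / r k)"
    using r_pos[of k] k by (intro continuous_intros continuous_on_compose2[OF r_cont]) auto
  then show ?thesis by (rule continuous_on_eq) (simp add: \<gamma>_r)
qed

lemma \<Gamma>_0: "\<Gamma> 0 = 0" using k by (simp add: \<Gamma>_def \<phi>_0 H_0)

lemma \<Gamma>_cont: "continuous_on {0..} \<Gamma>"
  unfolding \<Gamma>_def using \<phi>(1)
  by (intro continuous_intros \<phi>_cont \<gamma>_cont continuous_on_compose2[OF H_cont \<phi>_cont]) auto

text \<open>A discrete product rule: the increment of \<phi> \<gamma> minus that of H(\<phi>) lies
  between \<phi>(l) and \<phi>(l') times the increment of \<gamma>, and \<open>r_diff\<close> turns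
  the latter into (l' - l) \<gamma> / \<phi>. Below k the call payoff is 0, hence the restriction l'
  \<le> k.\<close>

lemma \<Gamma>_diff:
  assumes l: "0 < l" "l \<le> l'" "l' \<le> k"
  shows "(l' - l) * (\<gamma> l * \<phi> l / \<phi> l') \<le> \<Gamma> l' - \<Gamma> l" "\<Gamma> l' - \<Gamma> l \<le> (l' - l) * (\<gamma> l' * \<phi> l' / \<phi> l)"
proof -
  define y y' where "y = \<phi> l" and "y' = \<phi> l'"
  have y: "0 < y" "y \<le> y'" using l \<phi>_pos[of l] \<phi>_mono[of l l'] by (auto simp: y_def y'_def)
  have d: "\<Gamma> l' - \<Gamma> l = y' * \<gamma> l' - y * \<gamma> l - (H y' - H y)"
    unfolding \<Gamma>_def y_def y'_def using l by simp
  have hd: "\<gamma> l * (y' - y) \<le> H y' - H y" "H y' - H y \<le> \<gamma> l' * (y' - y)"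
    using H_diff[of y y'] y unfolding \<gamma>_def y_def y'_def by auto
  have gr: "\<gamma> l = r l / r k" "\<gamma> l' = r l' / r k" using \<gamma>_r[of l] \<gamma>_r[of l'] l by auto
  have g: "(l' - l) * (\<gamma> l / y') \<le> \<gamma> l' - \<gamma> l" "\<gamma> l' - \<gamma> l \<le> (l' - l) * (\<gamma> l' / y)"
    using divide_right_mono[OF r_diff(1)[OF l(1,2)], of "r k"] divide_right_mono[OF r_diff(2)[OF l(1,2)], of "r k"] r_pos[of k]
    unfolding gr y_def y'_def by (simp_all add: diff_divide_distrib mult.commute[of "r k"])
  have "(l' - l) * (\<gamma> l * \<phi> l / \<phi> l') = y * ((l' - l) * (\<gamma> l / y'))" by (simp add: y_def y'_def)
  also have "\<dots> \<le> y * (\<gamma> l' - \<gamma> l)" using g y by (intro mult_left_mono) auto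
  also have "\<dots> \<le> \<Gamma> l' - \<Gamma> l" unfolding d using hd(2) by (simp add: algebra_simps)
  finally show "(l' - l) * (\<gamma> l * \<phi> l / \<phi> l') \<le> \<Gamma> l' - \<Gamma> l" .
  have "\<Gamma> l' - \<Gamma> l \<le> y' * (\<gamma> l' - \<gamma> l)" unfolding d using hd(1) by (simp add: algebra_simps)
  also have "\<dots> \<le> y' * ((l' - l) * (\<gamma> l' / y))" using g y by (intro mult_left_mono) auto
  also have "\<dots> = (l' - l) * (\<gamma> l' * \<phi> l' / \<phi> l)" by (simp add: y_def y'_def)
  finally show "\<Gamma> l' - \<Gamma> l \<le> (l' - l) * (\<gamma> l' * \<phi> l' / \<phi> l)" .
qed

lemma \<Gamma>_deriv:
  assumes l: "0 < l" "l < k"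
  shows "(\<Gamma> has_real_derivative \<gamma> l) (at l)"
proof -
  define A where "A u = \<gamma> l * \<phi> l / \<phi> u" for u
  define C where "C u = \<gamma> u * \<phi> u / \<phi> l" for u
  have op: "at l within {0..} = at l" using l by (intro at_within_interior) auto
  have \<phi>l: "(\<phi> \<longlongrightarrow> \<phi> l) (at l)" using \<phi>_cont[unfolded continuous_on_def, rule_format, of l] l op by simp
  have gl: "(\<gamma> \<longlongrightarrow> \<gamma> l) (at l)" using \<gamma>_cont[unfolded continuous_on_def, rule_format, of l] l op by simp
  have p: "\<phi> l > 0" using \<phi>_pos[OF l(1)] .
  have Al: "(A \<longlongrightarrow> \<gamma> l) (at l)" unfolding A_def using tendsto_divide[OF tendsto_const[of "\<gamma> l * \<phi> l"] \<phi>l] p by simp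
  have Cl: "(C \<longlongrightarrow> \<gamma> l) (at l)" unfolding C_def using tendsto_divide[OF tendsto_mult[OF gl \<phi>l] tendsto_const[of "\<phi> l"]] p by simp
  have "((\<lambda>u. (\<Gamma> u - \<Gamma> l) / (u - l) - \<gamma> l) \<longlongrightarrow> 0) (at l)"
  proof (rule Lim_null_comparison)
    show "((\<lambda>u. \<bar>A u - \<gamma> l\<bar> + \<bar>C u - \<gamma> l\<bar>) \<longlongrightarrow> 0) (at l)"
      using tendsto_add[OF tendsto_rabs[OF LIM_zero[OF Al]] tendsto_rabs[OF LIM_zero[OF Cl]]] by simp
    have "norm ((\<Gamma> u - \<Gamma> l) / (u - l) - \<gamma> l) \<le> \<bar>A u - \<gamma> l\<bar> + \<bar>C u - \<gamma> l\<bar>" if u: "u \<in> {0<..<k}" "u \<noteq> l" for u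
    proof (cases "l < u")
      case True
      then have "A u \<le> (\<Gamma> u - \<Gamma> l) / (u - l)" "(\<Gamma> u - \<Gamma> l) / (u - l) \<le> C u"
        using \<Gamma>_diff[of l u] l u unfolding A_def C_def by (simp_all add: pos_le_divide_eq pos_divide_le_eq mult.commute)
      then show ?thesis unfolding real_norm_def by linarith
    next
      case False
      then have ul: "u < l" using u by simp
      have "(\<Gamma> u - \<Gamma> l) / (u - l) = (\<Gamma> l - \<Gamma> u) / (l - u)" by (metis minus_diff_eq minus_divide_divide)
      moreover have "C u \<le> (\<Gamma> l - \<Gamma> u) / (l - u)" "(\<Gamma> l - \<Gamma> u) / (l - u) \<le> A u"
        using \<Gamma>_diff[of u l] l u ul unfolding A_def C_def by (simp_all add: pos_le_divide_eq pos_divide_le_eq mult.commute)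
      ultimately show ?thesis unfolding real_norm_def by linarith
    qed
    moreover have "\<forall>\<^sub>F u in at l. u \<in> {0<..<k} \<and> u \<noteq> l"
      using eventually_at_in_open[of "{0<..<k}" l] l by (auto elim: eventually_mono)
    ultimately show "\<forall>\<^sub>F u in at l. norm ((\<Gamma> u - \<Gamma> l) / (u - l) - \<gamma> l) \<le> \<bar>A u - \<gamma> l\<bar> + \<bar>C u - \<gamma> l\<bar>"
      by (auto elim: eventually_mono)
  qed
  then show ?thesis unfolding has_field_derivative_iff by (rule LIM_zero_cancel)
qed

text \<open>The difference bounds are void at l = 0, where \<phi> vanishes. The mean value theorem
  requires only continuity at the endpoints and so includes 0; monotonicity of \<gamma> then gives
  both bounds. Beyond k the function has slope 1, and the two ranges are joined at k.\<close>

lemma \<Gamma>_slope: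
  assumes l: "0 \<le> l" "l \<le> l'"
  shows "(l' - l) * \<gamma> l \<le> \<Gamma> l' - \<Gamma> l" "\<Gamma> l' - \<Gamma> l \<le> (l' - l) * \<gamma> l'"
proof -
  have A: "(l' - l) * \<gamma> l \<le> \<Gamma> l' - \<Gamma> l \<and> \<Gamma> l' - \<Gamma> l \<le> (l' - l) * \<gamma> l'" if l: "0 \<le> l" "l \<le> l'" "l' \<le> k" for l l'
  proof (cases "l = l'")
    case False
    then have ll: "l < l'" using l by simp
    have "\<exists>d z. l < z \<and> z < l' \<and> (\<Gamma> has_real_derivative d) (at z) \<and> \<Gamma> l' - \<Gamma> l = (l' - l) * d"
    proof (rule MVT[OF ll])
      show "continuous_on {l..l'} \<Gamma>" by (rule continuous_on_subset[OF \<Gamma>_cont]) (use l in auto)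
      show "\<Gamma> differentiable (at x)" if "l < x" "x < l'" for x
        using \<Gamma>_deriv[of x] that l by (auto simp: real_differentiable_def)
    qed
    then obtain d z where z: "l < z" "z < l'" "(\<Gamma> has_real_derivative d) (at z)" "\<Gamma> l' - \<Gamma> l = (l' - l) * d" by blast
    then have "d = \<gamma> z" using \<Gamma>_deriv[of z] l by (intro DERIV_unique[OF z(3)]) auto
    then show ?thesis using z \<gamma>_mono[of l z] \<gamma>_mono[of z l'] l ll by (auto intro!: mult_left_mono)
  qed simp
  have C: "\<Gamma> l' - \<Gamma> l = l' - l" if l: "k \<le> l" "l \<le> l'" for l l'
  proof -
    have "0 \<le> \<phi> l" "\<phi> l \<le> \<phi> l'" using \<phi>[of l] \<phi>_mono[of l l'] l k by auto
    from H_diff(1,2)[OF this] have "H (\<phi> l') - H (\<phi> l) = \<phi> l' - \<phi> l"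
      using \<gamma>_1[of l] \<gamma>_1[of l'] l by (simp add: \<gamma>_def)
    then show ?thesis using l \<gamma>_1[of l] \<gamma>_1[of l'] by (simp add: \<Gamma>_def)
  qed
  consider "l' \<le> k" | "k \<le> l" | "l < k" "k < l'" by linarith
  then have "(l' - l) * \<gamma> l \<le> \<Gamma> l' - \<Gamma> l \<and> \<Gamma> l' - \<Gamma> l \<le> (l' - l) * \<gamma> l'"
  proof cases
    case 1 then show ?thesis using A l by blast
  next
    case 2 then show ?thesis using C[of l l'] \<gamma>_1[of l] \<gamma>_1[of l'] l by simp
  next
    case 3
    have aux: "s \<le> G2 - G1 \<and> G2 - G1 \<le> l' - l"
      if "p \<le> Gk - G1" "Gk - G1 \<le> k - l" "G2 - Gk = l' - k" "s = p + q" "q \<le> l' - k" for p q s G1 G2 Gk :: real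
      using that by auto
    have e: "\<gamma> k = 1" "\<gamma> l' = 1" using \<gamma>_1[of k] \<gamma>_1[of l'] 3 by auto
    have 1: "(k - l) * \<gamma> l \<le> \<Gamma> k - \<Gamma> l" "\<Gamma> k - \<Gamma> l \<le> (k - l) * \<gamma> k" using A[of l k] l 3 by auto
    have 2: "\<Gamma> l' - \<Gamma> k = l' - k" using C[of k l'] 3 by simp
    have 4: "(l' - l) * \<gamma> l = (k - l) * \<gamma> l + (l' - k) * \<gamma> l" by (simp add: algebra_simps)
    have "(l' - k) * \<gamma> l \<le> (l' - k) * 1" using \<gamma>_le_1 3 by (intro mult_left_mono) auto
    then show ?thesis using aux[OF 1(1) _ 2 4] 1(2) unfolding e by simp
  qed
  then show "(l' - l) * \<gamma> l \<le> \<Gamma> l' - \<Gamma> l" "\<Gamma> l' - \<Gamma> l \<le> (l' - l) * \<gamma> l'" by auto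
qed

lemma \<Gamma>_mono: "0 \<le> l \<Longrightarrow> l \<le> l' \<Longrightarrow> \<Gamma> l \<le> \<Gamma> l'"
  using order_trans[OF mult_nonneg_nonneg[OF _ \<gamma>_nonneg] \<Gamma>_slope(1), of l' l] by simp

lemma \<Gamma>_right_deriv:
  assumes l: "0 \<le> l"
  shows "(\<Gamma> has_real_derivative \<gamma> l) (at_right l)"
  unfolding has_field_derivative_iff
proof (rule tendsto_sandwich)
  have at: "at_right l \<le> at l within {0..}" using l by (intro at_le) auto
  show "((\<lambda>y. \<gamma> l) \<longlongrightarrow> \<gamma> l) (at_right l)" by simp
  show "(\<gamma> \<longlongrightarrow> \<gamma> l) (at_right l)" by (rule tendsto_mono[OF at]) (use \<gamma>_cont l in \<open>auto simp: continuous_on_def\<close>)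
  have "\<gamma> l \<le> (\<Gamma> y - \<Gamma> l) / (y - l) \<and> (\<Gamma> y - \<Gamma> l) / (y - l) \<le> \<gamma> y" if "l < y" for y
    using \<Gamma>_slope[of l y] l that by (simp add: pos_le_divide_eq pos_divide_le_eq mult.commute)
  then show "\<forall>\<^sub>F y in at_right l. \<gamma> l \<le> (\<Gamma> y - \<Gamma> l) / (y - l)" "\<forall>\<^sub>F y in at_right l. (\<Gamma> y - \<Gamma> l) / (y - l) \<le> \<gamma> y"
    unfolding eventually_at_right_field by (auto intro!: exI[of _ "l + 1"])
qed

text \<open>Convexity of \<open>H\<close> is exactly the pathwise inequality, with equality on the Vallois boundary \<open>x = \<phi> l\<close>.\<close>

lemma pathwise_inequality:
  assumes "0 \<le> x" "0 \<le> l"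
  shows "max 0 (l - k) \<le> H x + \<Gamma> l - x * \<gamma> l"
  using H_convex[of x "\<phi> l"] assms \<phi>(1)[OF assms(2)] by (simp add: \<Gamma>_def \<gamma>_def algebra_simps)

text \<open>Fubini writes the left side as an integral of hh(y) m(y) over y > 0. This product equals
  m(max y (\<phi> k)), so undoing Fubini with the new tail produces the mean of X on X \<ge> \<phi>
  k.\<close>

lemma half_integral_H: "(\<integral>\<^sup>+x. ennreal (H x) * indicator {0..} x \<partial>\<mu>) = (\<integral>\<^sup>+x. ennreal x * indicator {\<phi> k..} x \<partial>\<mu>)"
proof -
  interpret pair_sigma_finite lborel \<mu> by unfold_locales
  note [measurable_cong] = sets_mu
  have "(\<integral>\<^sup>+x. ennreal (H x) * indicator {0..} x \<partial>\<mu>) = (\<integral>\<^sup>+x. (\<integral>\<^sup>+y. ennreal (hh y) * indicator {0<..} y * indicator {y..} x \<partial>lborel) \<partial>\<mu>)"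
  proof (rule nn_integral_cong)
    fix x
    show "ennreal (H x) * indicator {0..} x = (\<integral>\<^sup>+y. ennreal (hh y) * indicator {0<..} y * indicator {y..} x \<partial>lborel)"
    proof (cases "0 \<le> x")
      case True
      then have "ennreal (H x) = (\<integral>\<^sup>+s. ennreal (hh s) * indicator {0<..x} s \<partial>lborel)" using H_diff(3)[of 0 x] H_0 by simp
      also have "\<dots> = (\<integral>\<^sup>+y. ennreal (hh y) * indicator {0<..} y * indicator {y..} x \<partial>lborel)"
        by (rule nn_integral_cong) (auto simp: indicator_def)
      finally show ?thesis using True by simp
    next
      case False
      have "(\<integral>\<^sup>+y. ennreal (hh y) * indicator {0<..} y * indicator {y..} x \<partial>lborel) = (\<integral>\<^sup>+y. 0 \<partial>(lborel::real measure))"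
        by (rule nn_integral_cong) (use False in \<open>auto simp: indicator_def\<close>)
      then show ?thesis using False by simp
    qed
  qed
  also have "\<dots> = (\<integral>\<^sup>+y. (\<integral>\<^sup>+x. ennreal (hh y) * indicator {0<..} y * indicator {y..} x \<partial>\<mu>) \<partial>lborel)"
  proof (rule Fubini')
    have "(\<lambda>(y, x). ennreal (hh y) * indicator {0<..} y * (if y \<le> x then 1 else 0)) \<in> borel_measurable (lborel \<Otimes>\<^sub>M \<mu>)" by measurable
    then show "(\<lambda>(y, x). ennreal (hh y) * indicator {0<..} y * indicator {y..} x) \<in> borel_measurable (lborel \<Otimes>\<^sub>M \<mu>)"
      by (simp add: indicator_def)
  qed
  also have "\<dots> = (\<integral>\<^sup>+y. (\<integral>\<^sup>+x. indicator {0<..} y * indicator {max y (\<phi> k)..} x \<partial>\<mu>) \<partial>lborel)"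
  proof (rule nn_integral_cong)
    fix y :: real
    have e: "emeasure \<mu> {z..} = ennreal (m z)" for z by (simp add: emeasure_eq_measure mu_bar_def)
    have hm: "hh y * m y = m (max y (\<phi> k))" unfolding hh_def using m_pos[of y] m_pos[of "\<phi> k"] by (cases "y \<le> \<phi> k") auto
    have "(\<integral>\<^sup>+x. ennreal (hh y) * indicator {0<..} y * indicator {y..} x \<partial>\<mu>) = ennreal (hh y) * indicator {0<..} y * ennreal (m y)"
      by (subst nn_integral_cmult_indicator) (auto simp: sets_mu e)
    also have "\<dots> = indicator {0<..} y * ennreal (m (max y (\<phi> k)))"
      using hm hh_nonneg[of y] by (simp add: indicator_def ennreal_mult[symmetric] measure_nonneg mu_bar_def)
    also have "\<dots> = (\<integral>\<^sup>+x. indicator {0<..} y * indicator {max y (\<phi> k)..} x \<partial>\<mu>)"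
      by (subst nn_integral_cmult_indicator) (auto simp: sets_mu e)
    finally show "(\<integral>\<^sup>+x. ennreal (hh y) * indicator {0<..} y * indicator {y..} x \<partial>\<mu>) = (\<integral>\<^sup>+x. indicator {0<..} y * indicator {max y (\<phi> k)..} x \<partial>\<mu>)" .
  qed
  also have "\<dots> = (\<integral>\<^sup>+x. (\<integral>\<^sup>+y. indicator {0<..} y * indicator {max y (\<phi> k)..} x \<partial>lborel) \<partial>\<mu>)"
  proof (rule Fubini'[symmetric])
    have "(\<lambda>(y, x). indicator {0<..} y * (if max y (\<phi> k) \<le> x then 1 else 0 :: ennreal)) \<in> borel_measurable (lborel \<Otimes>\<^sub>M \<mu>)" by measurable
    then show "(\<lambda>(y, x). indicator {0<..} y * indicator {max y (\<phi> k)..} x :: ennreal) \<in> borel_measurable (lborel \<Otimes>\<^sub>M \<mu>)"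
      by (simp add: indicator_def)
  qed
  also have "\<dots> = (\<integral>\<^sup>+x. ennreal x * indicator {\<phi> k..} x \<partial>\<mu>)"
  proof (rule nn_integral_cong)
    fix x :: real
    have "(\<integral>\<^sup>+y. indicator {0<..} y * indicator {max y (\<phi> k)..} x \<partial>lborel) = (\<integral>\<^sup>+y. indicator {\<phi> k..} x * indicator {0<..x} y \<partial>lborel)"
      by (rule nn_integral_cong) (auto simp: indicator_def)
    also have "\<dots> = indicator {\<phi> k..} x * emeasure lborel {0<..x}" by (subst nn_integral_cmult_indicator) auto
    also have "\<dots> = ennreal x * indicator {\<phi> k..} x" using b_pos by (auto simp: indicator_def)
    finally show "(\<integral>\<^sup>+y. indicator {0<..} y * indicator {max y (\<phi> k)..} x \<partial>lborel) = ennreal x * indicator {\<phi> k..} x" .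
  qed
  finally show ?thesis .
qed

text \<open>The same exchange of integrals with \<mu> in both variables: the weight s / m(s) in
  \<psi> is cancelled by the tail m(s) of the inner integral. The right side coincides with that of
  \<open>half_integral_H\<close>, so the dual function has no gap.\<close>

lemma half_integral_\<psi>: "(\<integral>\<^sup>+x. ennreal (max 0 (\<psi> x - k)) * indicator {0..} x \<partial>\<mu>) = (\<integral>\<^sup>+x. ennreal x * indicator {\<phi> k..} x \<partial>\<mu>)"
proof -
  interpret pair_sigma_finite \<mu> \<mu> by unfold_locales
  note [measurable_cong] = sets_mu
  define b where "b = \<phi> k"
  have b: "b > 0" "\<psi> b = k" using b_pos \<phi>[of k] k by (auto simp: b_def)
  have "(\<integral>\<^sup>+x. ennreal (max 0 (\<psi> x - k)) * indicator {0..} x \<partial>\<mu>) = (\<integral>\<^sup>+x. (\<integral>\<^sup>+s. ennreal (w s) * indicator {b<..} s * indicator {s..} x \<partial>\<mu>) \<partial>\<mu>)"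
  proof (rule nn_integral_cong)
    fix x
    show "ennreal (max 0 (\<psi> x - k)) * indicator {0..} x = (\<integral>\<^sup>+s. ennreal (w s) * indicator {b<..} s * indicator {s..} x \<partial>\<mu>)"
    proof (cases "b \<le> x")
      case True
      have "ennreal (max 0 (\<psi> x - k)) = ennreal (\<psi> x - \<psi> b)" using b by simp
      also have "\<dots> = (\<integral>\<^sup>+s. ennreal (w s) * indicator {b<..x} s \<partial>\<mu>)" using \<psi>_diff(3)[of b x] b True by simp
      also have "\<dots> = (\<integral>\<^sup>+s. ennreal (w s) * indicator {b<..} s * indicator {s..} x \<partial>\<mu>)"
        by (rule nn_integral_cong) (auto simp: indicator_def)
      finally show ?thesis using True b by simp
    next
      case False
      have "(\<integral>\<^sup>+s. ennreal (w s) * indicator {b<..} s * indicator {s..} x \<partial>\<mu>) = (\<integral>\<^sup>+s. 0 \<partial>\<mu>)"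
        by (rule nn_integral_cong) (use False in \<open>auto simp: indicator_def\<close>)
      moreover have "\<psi> x \<le> k" if "0 \<le> x" using \<psi>_mono[of x b] False b that by simp
      ultimately show ?thesis by (auto simp: indicator_def ennreal_neg)
    qed
  qed
  also have "\<dots> = (\<integral>\<^sup>+s. (\<integral>\<^sup>+x. ennreal (w s) * indicator {b<..} s * indicator {s..} x \<partial>\<mu>) \<partial>\<mu>)"
  proof (rule Fubini')
    have "(\<lambda>(y, x). ennreal (w y) * indicator {b<..} y * (if y \<le> x then 1 else 0)) \<in> borel_measurable (\<mu> \<Otimes>\<^sub>M \<mu>)" by measurable
    then show "(\<lambda>(y, x). ennreal (w y) * indicator {b<..} y * indicator {y..} x) \<in> borel_measurable (\<mu> \<Otimes>\<^sub>M \<mu>)"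
      by (simp add: indicator_def)
  qed
  also have "\<dots> = (\<integral>\<^sup>+s. ennreal s * indicator {b<..} s \<partial>\<mu>)"
  proof (rule nn_integral_cong)
    fix s :: real
    have "(\<integral>\<^sup>+x. ennreal (w s) * indicator {b<..} s * indicator {s..} x \<partial>\<mu>) = ennreal (w s) * indicator {b<..} s * ennreal (m s)"
      by (subst nn_integral_cmult_indicator) (auto simp: sets_mu emeasure_eq_measure mu_bar_def)
    also have "\<dots> = ennreal s * indicator {b<..} s"
    proof (cases "b < s")
      case True
      then have "ennreal (w s) * ennreal (m s) = ennreal (w s * m s)" using b w_nonneg[of s] m_pos[of s] by (simp add: ennreal_mult[symmetric])
      also have "w s * m s = s" using m_pos[of s] by (simp add: w_def)
      finally show ?thesis using True by simp
    qed simp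
    finally show "(\<integral>\<^sup>+x. ennreal (w s) * indicator {b<..} s * indicator {s..} x \<partial>\<mu>) = ennreal s * indicator {b<..} s" .
  qed
  \<comment> \<open>The increment formula for \<psi> yields the open ray; the missing endpoint is
    not charged by \<mu>.\<close>
  also have "\<dots> = (\<integral>\<^sup>+x. ennreal x * indicator {b..} x \<partial>\<mu>)"
  proof (rule nn_integral_cong_AE)
    have "emeasure \<mu> {b} = 0" using mu_singleton by (simp add: emeasure_eq_measure)
    then have "AE x in \<mu>. x \<noteq> b" by (intro AE_I[of _ _ "{b}"]) (auto simp: sets_mu)
    then show "AE x in \<mu>. ennreal x * indicator {b<..} x = ennreal x * indicator {b..} x"
      by eventually_elim (auto simp: indicator_def)
  qed
  finally show ?thesis by (simp add: b_def)
qed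

lemma nn_integral_symmetric:
  assumes g [measurable]: "g \<in> borel_measurable borel"
  shows "(\<integral>\<^sup>+x. g \<bar>x\<bar> \<partial>\<mu>) = 2 * (\<integral>\<^sup>+x. g x * indicator {0..} x \<partial>\<mu>)"
proof -
  note [measurable_cong] = sets_mu
  have "emeasure \<mu> {0} = 0" using mu_singleton by (simp add: emeasure_eq_measure)
  then have n0: "AE x in \<mu>. x \<noteq> 0" by (intro AE_I[of _ _ "{0}"]) (auto simp: sets_mu)
  have "(\<integral>\<^sup>+x. g \<bar>x\<bar> \<partial>\<mu>) = (\<integral>\<^sup>+x. g x * indicator {0..} x + g (-x) * indicator {0..} (-x) \<partial>\<mu>)"
    by (rule nn_integral_cong_AE, use n0 in eventually_elim) (auto simp: indicator_def)
  also have "\<dots> = (\<integral>\<^sup>+x. g x * indicator {0..} x \<partial>\<mu>) + (\<integral>\<^sup>+x. g (-x) * indicator {0..} (-x) \<partial>\<mu>)"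
    by (rule nn_integral_add) measurable
  also have "(\<integral>\<^sup>+x. g (-x) * indicator {0..} (-x) \<partial>\<mu>) = (\<integral>\<^sup>+x. g x * indicator {0..} x \<partial>distr \<mu> borel uminus)"
    by (subst nn_integral_distr) auto
  finally show ?thesis by (simp add: mu_symm mult_2)
qed

lemma integral_H_eq: "(\<integral>\<^sup>+x. ennreal (H \<bar>x\<bar>) \<partial>\<mu>) = (\<integral>\<^sup>+x. ennreal (max 0 (\<psi> \<bar>x\<bar> - k)) \<partial>\<mu>)"
proof -
  have "continuous_on UNIV (\<lambda>x. H (max 0 x))" by (rule continuous_on_compose2[OF H_cont]) (auto intro!: continuous_intros)
  then have m1: "(\<lambda>x. ennreal (H (max 0 x))) \<in> borel_measurable borel" by (intro measurable_compose[OF borel_measurable_continuous_onI measurable_ennreal])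
  have "continuous_on {0..} \<psi>" by (rule continuous_on_halfline, rule \<psi>_cont)
  then have "continuous_on UNIV (\<lambda>x. \<psi> (max 0 x))" by (rule continuous_on_compose2) (auto intro!: continuous_intros)
  then have [measurable]: "(\<lambda>x. \<psi> (max 0 x)) \<in> borel_measurable borel" by (rule borel_measurable_continuous_onI)
  have m2: "(\<lambda>x. ennreal (max 0 (\<psi> (max 0 x) - k))) \<in> borel_measurable borel" by measurable
  have "(\<integral>\<^sup>+x. ennreal (H \<bar>x\<bar>) \<partial>\<mu>) = 2 * (\<integral>\<^sup>+x. ennreal (H (max 0 x)) * indicator {0..} x \<partial>\<mu>)"
    using nn_integral_symmetric[OF m1] by simp
  also have "(\<integral>\<^sup>+x. ennreal (H (max 0 x)) * indicator {0..} x \<partial>\<mu>) = (\<integral>\<^sup>+x. ennreal (H x) * indicator {0..} x \<partial>\<mu>)"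
    by (rule nn_integral_cong) (auto simp: indicator_def)
  also have "\<dots> = (\<integral>\<^sup>+x. ennreal (max 0 (\<psi> x - k)) * indicator {0..} x \<partial>\<mu>)"
    unfolding half_integral_H half_integral_\<psi> ..
  also have "\<dots> = (\<integral>\<^sup>+x. ennreal (max 0 (\<psi> (max 0 x) - k)) * indicator {0..} x \<partial>\<mu>)"
    by (rule nn_integral_cong) (auto simp: indicator_def)
  also have "2 * \<dots> = (\<integral>\<^sup>+x. ennreal (max 0 (\<psi> \<bar>x\<bar> - k)) \<partial>\<mu>)"
    using nn_integral_symmetric[OF m2] by simp
  finally show ?thesis .
qed

lemma H_abs_measurable: "(\<lambda>x. H \<bar>x\<bar>) \<in> borel_measurable borel"
  by (intro borel_measurable_continuous_onI continuous_on_compose2[OF H_cont]) (auto intro!: continuous_intros)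

end

lemma \<psi>_abs_measurable: "(\<lambda>x. \<psi> \<bar>x\<bar>) \<in> borel_measurable borel"
proof -
  have "continuous_on {0..} \<psi>" by (rule continuous_on_halfline, rule \<psi>_cont)
  then show ?thesis by (intro borel_measurable_continuous_onI) (rule continuous_on_compose2, auto intro!: continuous_intros)
qed

text \<open>By symmetry the event has probability 2 m(\<phi> t). These are the tails that the local
  time at the boundary will be shown to dominate.\<close>

lemma \<psi>_tail:
  assumes t: "t > 0"
  shows "measure \<mu> {x. t \<le> \<psi> \<bar>x\<bar>} = 1 / r t"
proof -
  have p: "\<phi> t > 0" using \<phi>_pos[OF t] .
  have "{x. t \<le> \<psi> \<bar>x\<bar>} = {\<phi> t..} \<union> uminus -` {\<phi> t..}"
  proof -
    have iff: "t \<le> \<psi> \<bar>x\<bar> \<longleftrightarrow> \<phi> t \<le> \<bar>x\<bar>" for x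
    proof
      assume "t \<le> \<psi> \<bar>x\<bar>"
      then show "\<phi> t \<le> \<bar>x\<bar>" using \<phi>_mono[of t "\<psi> \<bar>x\<bar>"] \<phi>_\<psi>[of "\<bar>x\<bar>"] t by simp
    next
      assume "\<phi> t \<le> \<bar>x\<bar>"
      then show "t \<le> \<psi> \<bar>x\<bar>" using \<psi>_mono[of "\<phi> t" "\<bar>x\<bar>"] \<phi>[of t] t by simp
    qed
    show ?thesis
    proof (intro set_eqI)
      fix x
      have "\<phi> t \<le> \<bar>x\<bar> \<longleftrightarrow> \<phi> t \<le> x \<or> \<phi> t \<le> - x" by linarith
      then show "x \<in> {x. t \<le> \<psi> \<bar>x\<bar>} \<longleftrightarrow> x \<in> {\<phi> t..} \<union> uminus -` {\<phi> t..}"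
        unfolding mem_Collect_eq iff by simp
    qed
  qed
  then have "measure \<mu> {x. t \<le> \<psi> \<bar>x\<bar>} = measure \<mu> ({\<phi> t..} \<union> uminus -` {\<phi> t..})" by simp
  also have "\<dots> = measure \<mu> {\<phi> t..} + measure \<mu> (uminus -` {\<phi> t..})"
  proof (rule finite_measure_Union)
    have "uminus -` {\<phi> t..} = {..- \<phi> t}" by auto
    then show "uminus -` {\<phi> t..} \<in> sets \<mu>" by (simp add: sets_mu)
    show "{\<phi> t..} \<inter> uminus -` {\<phi> t..} = {}" using p by auto
  qed (simp add: sets_mu)
  also have "\<dots> = 2 * m (\<phi> t)" using mu_reflect[of "{\<phi> t..}"] by (simp add: mu_bar_def)
  finally show ?thesis by (simp add: r_def)
qed

end

section \<open>Hitting times and growth of the local time\<close>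

text \<open>A continuous function on a compact interval attains its minimum, so being non-positive
  somewhere is the same as being below every 1 / (n + 1) at some rational point. This makes hitting
  events countable combinations.\<close>

lemma nonpos_on_interval_iff:
  fixes d :: "real \<Rightarrow> real"
  assumes c: "continuous_on {0..t} d" and t: "0 \<le> t"
  shows "(\<exists>u\<in>{0..t}. d u \<le> 0) \<longleftrightarrow> (\<forall>n. \<exists>q\<in>\<rat> \<inter> {0..t}. d q < 1 / real (Suc n))"
proof
  assume "\<exists>u\<in>{0..t}. d u \<le> 0"
  then obtain u where u: "u \<in> {0..t}" "d u \<le> 0" by blast
  show "\<forall>n. \<exists>q\<in>\<rat> \<inter> {0..t}. d q < 1 / real (Suc n)"
  proof
    fix n
    have n0: "0 < 1 / real (Suc n)" by simp
    show "\<exists>q\<in>\<rat> \<inter> {0..t}. d q < 1 / real (Suc n)"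
    proof (cases "t = 0")
      case True
      then have "u = 0" using u by simp
      then have "d 0 < 1 / real (Suc n)" using order_le_less_trans[OF u(2) n0] by simp
      then show ?thesis using t by (intro bexI[of _ 0]) auto
    next
      case False
      then have "t > 0" using t by simp
      moreover have "- d u > - (1 / real (Suc n))" using u n0 by linarith
      ultimately obtain q where "q \<in> \<rat>" "0 \<le> q" "q \<le> t" "- d q > - (1 / real (Suc n))"
        using exists_rat_greater[OF continuous_on_minus[OF c] _ u(1)] by blast
      then show ?thesis by (intro bexI[of _ q]) auto
    qed
  qed
next
  assume a: "\<forall>n. \<exists>q\<in>\<rat> \<inter> {0..t}. d q < 1 / real (Suc n)"
  obtain v where v: "v \<in> {0..t}" "\<And>u. u \<in> {0..t} \<Longrightarrow> d v \<le> d u"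
    using continuous_attains_inf[OF _ _ c] t by auto
  show "\<exists>u\<in>{0..t}. d u \<le> 0"
  proof (rule ccontr)
    assume "\<not> (\<exists>u\<in>{0..t}. d u \<le> 0)"
    then have "d v > 0" using v by force
    then obtain n where n: "1 / real (Suc n) < d v" using nat_approx_posE by blast
    obtain q where "q \<in> {0..t}" "d q < 1 / real (Suc n)" using a by blast
    then show False using v(2)[of q] n by simp
  qed
qed

context bm
begin

text \<open>If D is positive on [0, t], continuity extends this beyond t by some d > 0, so the
  infimum exceeds t. Thus no hitting time can sit at t as an unattained infimum.\<close>

lemma hitting_iff:
  assumes \<omega>: "\<omega> \<in> space M" and c: "continuous_on {0..} (\<lambda>t. D t \<omega> :: real)" and t: "0 \<le> t"
  shows "Inf (ereal ` {u. 0 \<le> u \<and> D u \<omega> \<le> 0}) \<le> ereal t \<longleftrightarrow> (\<exists>u\<in>{0..t}. D u \<omega> \<le> 0)"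
proof
  assume le: "Inf (ereal ` {u. 0 \<le> u \<and> D u \<omega> \<le> 0}) \<le> ereal t"
  show "\<exists>u\<in>{0..t}. D u \<omega> \<le> 0"
  proof (rule ccontr)
    assume n: "\<not> (\<exists>u\<in>{0..t}. D u \<omega> \<le> 0)"
    then have Dt: "D t \<omega> > 0" using t by force
    then obtain d where d: "d > 0" "\<And>s. s \<in> {0..} \<Longrightarrow> dist s t < d \<Longrightarrow> dist (D s \<omega>) (D t \<omega>) < D t \<omega>"
      using c t unfolding continuous_on_iff by (metis atLeast_iff)
    have "ereal (t + d) \<le> Inf (ereal ` {u. 0 \<le> u \<and> D u \<omega> \<le> 0})"
    proof (rule Inf_greatest, clarify)
      fix u assume u: "0 \<le> u" "D u \<omega> \<le> 0"
      then have "t < u" using n by force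
      moreover have "\<not> dist u t < d" using d(2)[of u] u by (force simp: dist_real_def)
      ultimately show "ereal (t + d) \<le> ereal u" by (simp add: dist_real_def)
    qed
    then have "ereal (t + d) \<le> ereal t" using le by (rule order_trans)
    then show False using d(1) by simp
  qed
next
  assume "\<exists>u\<in>{0..t}. D u \<omega> \<le> 0"
  then obtain u where u: "0 \<le> u" "u \<le> t" "D u \<omega> \<le> 0" by auto
  then have "Inf (ereal ` {u. 0 \<le> u \<and> D u \<omega> \<le> 0}) \<le> ereal u" by (intro Inf_lower) auto
  also have "\<dots> \<le> ereal t" using u by simp
  finally show "Inf (ereal ` {u. 0 \<le> u \<and> D u \<omega> \<le> 0}) \<le> ereal t" .
qed

text \<open>Since D is adapted only almost surely, its values at the rational times up to t are
  replaced by \<open>F t\<close>-measurable versions. Countably many null sets are discarded, and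
  the hitting event computed from the versions is the required member of \<open>F t\<close>.\<close>

lemma hitting_ae_stopping:
  assumes Dc: "\<And>\<omega>. \<omega> \<in> space M \<Longrightarrow> continuous_on {0..} (\<lambda>t. D t \<omega> :: real)"
    and DM: "\<And>t. 0 \<le> t \<Longrightarrow> D t \<in> borel_measurable M"
    and DF: "\<And>t. 0 \<le> t \<Longrightarrow> \<exists>Y\<in>borel_measurable (F t). AE \<omega> in M. D t \<omega> = Y \<omega>"
  shows "ae_stopping (\<lambda>\<omega>. Inf (ereal ` {u. 0 \<le> u \<and> D u \<omega> \<le> 0}))"
proof -
  define \<sigma> where "\<sigma> \<omega> = Inf (ereal ` {u. 0 \<le> u \<and> D u \<omega> \<le> 0})" for \<omega>
  have iff: "\<sigma> \<omega> \<le> ereal t \<longleftrightarrow> (\<forall>n. \<exists>q\<in>\<rat> \<inter> {0..t}. D q \<omega> < 1 / real (Suc n))" if "\<omega> \<in> space M" "0 \<le> t" for \<omega> t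
    unfolding \<sigma>_def hitting_iff[where D = D, OF that(1) Dc[OF that(1)] that(2)]
    by (rule nonpos_on_interval_iff[OF continuous_on_subset[OF Dc[OF that(1)]] that(2)]) auto
  have \<sigma>0: "0 \<le> \<sigma> \<omega>" for \<omega> unfolding \<sigma>_def by (rule Inf_greatest) auto
  have cnt: "countable (\<rat> \<inter> {0..t::real})" for t using countable_rat by blast
  have sets: "{\<omega>\<in>space N. \<forall>n. \<exists>q\<in>\<rat> \<inter> {0..t}. Y q \<omega> < 1 / real (Suc n)} \<in> sets N"
    if Y: "\<And>q. q \<in> {0..t} \<Longrightarrow> Y q \<in> borel_measurable N" for Y :: "real \<Rightarrow> 'a \<Rightarrow> real" and N :: "'a measure" and t
  proof -
    have "{\<omega>\<in>space N. Y q \<omega> < 1 / real (Suc n)} \<in> sets N" if "q \<in> \<rat> \<inter> {0..t}" for q n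
    proof -
      have [measurable]: "Y q \<in> borel_measurable N" using Y that by blast
      show ?thesis by measurable
    qed
    then have "{\<omega>\<in>space N. \<exists>q\<in>\<rat> \<inter> {0..t}. Y q \<omega> < 1 / real (Suc n)} \<in> sets N" for n
      by (rule sets.sets_Collect_countable_Ex'[OF _ cnt])
    then show ?thesis by (rule sets.sets_Collect_countable_All)
  qed
  have "\<sigma> \<in> borel_measurable M"
  proof (rule borel_measurableI_le)
    fix y :: ereal
    show "{\<omega>\<in>space M. \<sigma> \<omega> \<le> y} \<in> sets M"
    proof (cases y)
      case (real t)
      show ?thesis
      proof (cases "0 \<le> t")
        case True
        have "{\<omega>\<in>space M. \<sigma> \<omega> \<le> y} = {\<omega>\<in>space M. \<forall>n. \<exists>q\<in>\<rat> \<inter> {0..t}. D q \<omega> < 1 / real (Suc n)}"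
          using iff[OF _ True] real by auto
        also have "\<dots> \<in> sets M" by (rule sets) (auto intro: DM)
        finally show ?thesis .
      next
        case False
        have "\<not> \<sigma> \<omega> \<le> y" for \<omega>
        proof
          assume "\<sigma> \<omega> \<le> y"
          with \<sigma>0[of \<omega>] have "0 \<le> y" by (rule order_trans)
          then show False using False real by simp
        qed
        then show ?thesis by simp
      qed
    next
      case PInf then show ?thesis by simp
    next
      case MInf
      have "\<not> \<sigma> \<omega> \<le> y" for \<omega> using \<sigma>0[of \<omega>] MInf by auto
      then show ?thesis by simp
    qed
  qed
  moreover have "\<exists>A\<in>sets (F t). AE \<omega> in M. ereal t < \<sigma> \<omega> \<longleftrightarrow> \<omega> \<in> A" if t: "0 \<le> t" for t
  proof -
    have "\<forall>q. \<exists>Y. q \<in> {0..t} \<longrightarrow> Y \<in> borel_measurable (F t) \<and> (AE \<omega> in M. D q \<omega> = Y \<omega>)"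
      using DF measurable_F_mono by (metis atLeastAtMost_iff)
    from choice[OF this] obtain Y where Y: "\<And>q. q \<in> {0..t} \<Longrightarrow> Y q \<in> borel_measurable (F t)"
      "\<And>q. q \<in> {0..t} \<Longrightarrow> AE \<omega> in M. D q \<omega> = Y q \<omega>" by blast
    define A where "A = {\<omega>\<in>space (F t). \<forall>n. \<exists>q\<in>\<rat> \<inter> {0..t}. Y q \<omega> < 1 / real (Suc n)}"
    have A: "A \<in> sets (F t)" unfolding A_def by (rule sets[OF Y(1)])
    have "AE \<omega> in M. \<forall>q\<in>\<rat> \<inter> {0..t}. D q \<omega> = Y q \<omega>"
      using Y(2) by (subst AE_ball_countable[OF cnt]) auto
    then have "AE \<omega> in M. ereal t < \<sigma> \<omega> \<longleftrightarrow> \<omega> \<in> space (F t) - A"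
      using AE_space
    proof eventually_elim
      case (elim \<omega>)
      have "\<omega> \<in> A \<longleftrightarrow> \<sigma> \<omega> \<le> ereal t" unfolding iff[OF elim(2) t] A_def using elim by simp
      then show ?case using elim(2) by (auto simp: not_less[symmetric])
    qed
    then show ?thesis using sets.compl_sets[OF A] by blast
  qed
  ultimately show ?thesis using \<sigma>0 unfolding ae_stopping_def \<sigma>_def by blast
qed

lemma infinite_ae_stopping: "ae_stopping (\<lambda>_. \<infinity>)"
  unfolding ae_stopping_def
proof (intro conjI allI impI)
  fix t :: real
  show "\<exists>A\<in>sets (F t). AE \<omega> in M. (ereal t < \<infinity>) = (\<omega> \<in> A)"
    by (rule bexI[OF _ sets.top[of "F t"]]) auto
qed auto

end

section \<open>Exponential martingale, positivity and growth of the local time\<close>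

context bm_local_time
begin

text \<open>The stopped identity for \<Gamma>(l) = exp(-lam l), whose derivative has the sign that
  turns the bracket into 1 + lam |B|; the stopping time is \<infinity>, so truncation leaves the
  fixed time T.\<close>

lemma exponential_identity:
  assumes lam: "lam > 0" and T: "T > 0"
  shows "integrable M (\<lambda>\<omega>. exp (- lam * L T \<omega>) * (1 + lam * \<bar>B T \<omega>\<bar>))"
    and "(\<integral>\<omega>. exp (- lam * L T \<omega>) * (1 + lam * \<bar>B T \<omega>\<bar>) \<partial>M) = 1"
proof -
  let ?C = "max 1 lam"
  have eq: "(\<integral>\<omega>. exp (- lam * L (trunc_time T (\<lambda>_. \<infinity>) \<omega>) \<omega>) - \<bar>B (trunc_time T (\<lambda>_. \<infinity>) \<omega>) \<omega>\<bar> * (- lam * exp (- lam * L (trunc_time T (\<lambda>_. \<infinity>) \<omega>) \<omega>)) \<partial>M) = exp (- lam * 0)"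
  proof (rule stopped_identity(1)[OF infinite_ae_stopping T, where C = ?C])
    fix x :: real assume x: "0 \<le> x"
    have "exp (- lam * x) \<le> 1" using x lam by simp
    then show "\<bar>exp (- lam * x)\<bar> \<le> ?C" unfolding abs_exp_cancel by (rule order_trans) simp
    show "((\<lambda>x. exp (- lam * x)) has_real_derivative - lam * exp (- lam * x)) (at_right x)"
      by (auto intro!: derivative_eq_intros)
    fix y :: real assume y: "x \<le> y"
    have "exp (- lam * x) - exp (- lam * y) = exp (- lam * x) * (1 - exp (- lam * (y - x)))"
    proof -
      have "exp (- lam * x) * exp (- lam * (y - x)) = exp (- lam * y)"
        unfolding exp_add[symmetric] by (simp add: algebra_simps)
      then show ?thesis by (simp add: right_diff_distrib)
    qed
    also have "\<dots> \<le> 1 * (lam * (y - x))"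
    proof (rule mult_mono)
      show "1 - exp (- lam * (y - x)) \<le> lam * (y - x)" using exp_ge_add_one_self[of "- lam * (y - x)"] by simp
    qed (use x y lam in auto)
    also have "\<dots> \<le> ?C * (y - x)" using y by (simp add: mult_right_mono)
    finally have "exp (- lam * x) - exp (- lam * y) \<le> ?C * (y - x)" .
    moreover have "exp (- lam * y) \<le> exp (- lam * x)" using y lam by simp
    ultimately show "\<bar>exp (- lam * y) - exp (- lam * x)\<bar> \<le> ?C * (y - x)" by simp
  qed
  have "trunc_time T (\<lambda>_. \<infinity>) \<omega> = T" for \<omega> :: 'a by (simp add: trunc_time_def)
  then show e1: "(\<integral>\<omega>. exp (- lam * L T \<omega>) * (1 + lam * \<bar>B T \<omega>\<bar>) \<partial>M) = 1"
    using eq by (simp add: algebra_simps)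
  \<comment> \<open>The Bochner integral of a non-integrable function is 0 by convention, so the
    value 1 itself proves integrability.\<close>
  then show "integrable M (\<lambda>\<omega>. exp (- lam * L T \<omega>) * (1 + lam * \<bar>B T \<omega>\<bar>))"
    using not_integrable_integral_eq by fastforce
qed

text \<open>Markov's inequality for the exponential identity. Letting lam grow at c = 0 gives
  positivity of the local time; fixing lam = 1 and letting a grow gives its unboundedness.\<close>

lemma tail_estimate:
  assumes lam: "lam > 0" and T: "T > 0" and a: "a > 0" and c: "c \<ge> 0"
  shows "prob {\<omega>\<in>space M. L T \<omega> \<le> c \<and> a \<le> \<bar>B T \<omega>\<bar>} \<le> exp (lam * c) / (1 + lam * a)"
proof -
  note [measurable] = L_measurable[OF less_imp_le[OF T]] B_M[OF less_imp_le[OF T]]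
  let ?E = "{\<omega>\<in>space M. L T \<omega> \<le> c \<and> a \<le> \<bar>B T \<omega>\<bar>}"
  have "(exp (- lam * c) * (1 + lam * a)) * prob ?E = (\<integral>\<omega>. (exp (- lam * c) * (1 + lam * a)) * indicator ?E \<omega> \<partial>M)" by simp
  also have "\<dots> \<le> (\<integral>\<omega>. exp (- lam * L T \<omega>) * (1 + lam * \<bar>B T \<omega>\<bar>) \<partial>M)"
  proof (rule integral_mono[OF _ exponential_identity(1)[OF lam T]])
    show "integrable M (\<lambda>\<omega>. (exp (- lam * c) * (1 + lam * a)) * indicator ?E \<omega>)"
      by (intro integrable_mult_right integrable_real_indicator) (auto simp: emeasure_eq_measure)
    fix \<omega> assume "\<omega> \<in> space M"
    show "(exp (- lam * c) * (1 + lam * a)) * indicator ?E \<omega> \<le> exp (- lam * L T \<omega>) * (1 + lam * \<bar>B T \<omega>\<bar>)"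
    proof (cases "\<omega> \<in> ?E")
      case True
      then have "exp (- lam * c) * (1 + lam * a) \<le> exp (- lam * L T \<omega>) * (1 + lam * \<bar>B T \<omega>\<bar>)"
        using lam a by (intro mult_mono) auto
      then show ?thesis using True by simp
    next
      case False
      then show ?thesis using lam by simp
    qed
  qed
  also have "\<dots> = 1" by (rule exponential_identity(2)[OF lam T])
  finally have "(exp (- lam * c) * (1 + lam * a)) * prob ?E \<le> 1" .
  moreover have "1 + lam * a > 0" using lam a by (simp add: add_pos_pos)
  ultimately show ?thesis by (simp add: exp_minus field_simps)
qed

text \<open>On the event that the local time vanishes, |B| is either at least a, which has
  probability 0 by letting lam grow, or below a, which has probability at most a / sqrt T; a is
  arbitrary. Monotonicity reduces all u > 0 to the times 1 / (n + 1).\<close>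

lemma L_positive: "AE \<omega> in M. \<forall>u>0. L u \<omega> > 0"
proof -
  have "AE \<omega> in M. L T \<omega> > 0" if T: "T > 0" for T
  proof -
    note [measurable] = L_measurable[OF less_imp_le[OF T]] B_M[OF less_imp_le[OF T]]
    let ?Z = "{\<omega>\<in>space M. L T \<omega> \<le> 0}"
    have pz: "prob ?Z \<le> a / sqrt T" if a: "a > 0" for a
    proof -
      let ?E = "{\<omega>\<in>space M. L T \<omega> \<le> 0 \<and> a \<le> \<bar>B T \<omega>\<bar>}"
      have "prob ?E \<le> 1 / (1 + real (Suc n) * a)" for n using tail_estimate[of "real (Suc n)" T a 0] T a by simp
      moreover have "(\<lambda>n. 1 / (1 + real (Suc n) * a)) \<longlonglongrightarrow> 0" using a by real_asymp
      ultimately have "prob ?E \<le> 0" by (intro LIMSEQ_le_const) auto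
      moreover have "prob ?Z \<le> prob (?E \<union> {\<omega>\<in>space M. \<bar>B T \<omega>\<bar> < a})" by (rule finite_measure_mono) auto
      moreover have "prob (?E \<union> {\<omega>\<in>space M. \<bar>B T \<omega>\<bar> < a}) \<le> prob ?E + prob {\<omega>\<in>space M. \<bar>B T \<omega>\<bar> < a}"
        by (rule measure_Un_le) auto
      ultimately show ?thesis using B_small_ball[OF T a] by simp
    qed
    have "prob ?Z \<le> (1 / real (Suc n)) / sqrt T" for n by (rule pz) simp
    moreover have "(\<lambda>n. (1 / real (Suc n)) / sqrt T) \<longlonglongrightarrow> 0" using T by real_asymp
    ultimately have "prob ?Z \<le> 0" by (intro LIMSEQ_le_const) auto
    then have "prob ?Z = 0" using measure_nonneg[of M ?Z] by simp
    then have "AE \<omega> in M. \<omega> \<notin> ?Z" by (subst (asm) prob_eq_0) auto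
    then show ?thesis using AE_space by eventually_elim auto
  qed
  then have "AE \<omega> in M. \<forall>n. L (1 / real (Suc n)) \<omega> > 0" by (simp add: AE_all_countable)
  then show ?thesis using AE_space
  proof eventually_elim
    case (elim \<omega>)
    show ?case
    proof (intro allI impI)
      fix u :: real assume "u > 0"
      then obtain n where "1 / real (Suc n) < u" using nat_approx_posE by blast
      then have "L (1 / real (Suc n)) \<omega> \<le> L u \<omega>" using elim by (intro L_mono) auto
      then show "L u \<omega> > 0" using elim(1) by (metis order_less_le_trans)
    qed
  qed
qed

text \<open>If the local time stayed below c, then at a late time B would either be small, which is
  unlikely, or large, which the exponential bound makes unlikely.\<close>

lemma L_unbounded: "AE \<omega> in M. \<forall>c. \<exists>n::nat. L (real n) \<omega> > c"
proof -
  have "AE \<omega> in M. \<exists>n::nat. L (real n) \<omega> > real c" for c :: nat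
  proof -
    have Lm [measurable]: "L (real n) \<in> borel_measurable M" for n by (rule L_measurable) simp
    let ?Z = "{\<omega>\<in>space M. \<forall>n. L (real n) \<omega> \<le> real c}"
    have "prob ?Z \<le> exp (real c) / (1 + real (Suc n)) + 1 / real (Suc n)" for n
    proof -
      \<comment> \<open>With T = a^4 the small-ball bound is a / sqrt T = 1 / a, while the
        exponential bound is exp(c) / (1 + a); both vanish. T is also a natural number, as the event
        with integer times requires.\<close>
      define a where "a = real (Suc n)"
      define T where "T = real (Suc n ^ 4)"
      have T: "T > 0" and a: "a > 0" by (auto simp: T_def a_def)
      have sT: "sqrt T = a\<^sup>2"
      proof -
        have "T = (a\<^sup>2)\<^sup>2" by (simp add: T_def a_def power_mult[symmetric])
        then show ?thesis unfolding \<open>T = (a\<^sup>2)\<^sup>2\<close> real_sqrt_abs by simp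
      qed
      note [measurable] = L_measurable[OF less_imp_le[OF T]] B_M[OF less_imp_le[OF T]]
      let ?E = "{\<omega>\<in>space M. L T \<omega> \<le> real c \<and> a \<le> \<bar>B T \<omega>\<bar>}"
      have "prob ?E \<le> exp (real c) / (1 + a)" using tail_estimate[of 1 T a "real c"] T a by simp
      moreover have "prob ?Z \<le> prob (?E \<union> {\<omega>\<in>space M. \<bar>B T \<omega>\<bar> < a})"
      proof (rule finite_measure_mono)
        show "?Z \<subseteq> ?E \<union> {\<omega>\<in>space M. \<bar>B T \<omega>\<bar> < a}" unfolding T_def by (auto simp: not_less simp del: of_nat_power)
        show "?E \<union> {\<omega>\<in>space M. \<bar>B T \<omega>\<bar> < a} \<in> events" by measurable
      qed
      moreover have "prob (?E \<union> {\<omega>\<in>space M. \<bar>B T \<omega>\<bar> < a}) \<le> prob ?E + prob {\<omega>\<in>space M. \<bar>B T \<omega>\<bar> < a}"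
        by (rule measure_Un_le) measurable
      moreover have "a / sqrt T = 1 / a" unfolding sT using a by (simp add: power2_eq_square)
      ultimately show ?thesis using B_small_ball[OF T a] unfolding a_def[symmetric] by linarith
    qed
    moreover have "(\<lambda>n. exp (real c) / (1 + real (Suc n)) + 1 / real (Suc n)) \<longlonglongrightarrow> 0" by real_asymp
    ultimately have "prob ?Z \<le> 0" by (intro LIMSEQ_le_const) auto
    then have "prob ?Z = 0" using measure_nonneg[of M ?Z] by simp
    moreover have "?Z \<in> events" by measurable
    ultimately have "AE \<omega> in M. \<omega> \<notin> ?Z" by (simp add: prob_eq_0)
    then show ?thesis using AE_space by eventually_elim (auto simp: not_le)
  qed
  then have "AE \<omega> in M. \<forall>c::nat. \<exists>n::nat. L (real n) \<omega> > real c" by (simp add: AE_all_countable)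
  then show ?thesis
  proof eventually_elim
    case (elim \<omega>)
    show ?case
    proof
      fix c :: real
      obtain k :: nat where "c < real k" using reals_Archimedean2 by blast
      moreover obtain n :: nat where "L (real n) \<omega> > real k" using elim by blast
      ultimately show "\<exists>n::nat. L (real n) \<omega> > c" by (intro exI[of _ n]) simp
    qed
  qed
qed

end

section \<open>The upper bound\<close>

lemma right_derivative_cong:
  fixes g h :: "real \<Rightarrow> real"
  assumes "e > 0" "\<And>y. x \<le> y \<Longrightarrow> y < x + e \<Longrightarrow> g y = h y" "(h has_real_derivative d) (at_right x)"
  shows "(g has_real_derivative d) (at_right x)"
  unfolding has_field_derivative_iff
proof (rule Lim_transform_eventually)
  show "((\<lambda>y. (h y - h x) / (y - x)) \<longlongrightarrow> d) (at_right x)" using assms(3) by (simp add: has_field_derivative_iff)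
  show "\<forall>\<^sub>F y in at_right x. (h y - h x) / (y - x) = (g y - g x) / (y - x)"
    unfolding eventually_at_right_field using assms(1,2) by (intro exI[of _ "x + e"]) auto
qed

text \<open>The layer-cake formula, used to deduce the comparison of calls from a comparison of
  tails.\<close>

lemma nn_integral_call:
  assumes "prob_space P" and Y [measurable]: "Y \<in> borel_measurable P"
  shows "(\<integral>\<^sup>+x. ennreal (max 0 (Y x - k)) \<partial>P) = (\<integral>\<^sup>+t. emeasure P {x\<in>space P. t \<le> Y x} * indicator {k<..} t \<partial>lborel)"
proof -
  interpret prob_space P by fact
  interpret pair_sigma_finite lborel P by unfold_locales
  have "(\<integral>\<^sup>+x. ennreal (max 0 (Y x - k)) \<partial>P) = (\<integral>\<^sup>+x. (\<integral>\<^sup>+t. indicator {k<..} t * (if t \<le> Y x then 1 else 0) \<partial>lborel) \<partial>P)"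
  proof (rule nn_integral_cong)
    fix x
    have "(\<integral>\<^sup>+t. indicator {k<..} t * (if t \<le> Y x then 1 else 0) \<partial>lborel) = (\<integral>\<^sup>+t. indicator {k<..Y x} t \<partial>lborel)"
      by (rule nn_integral_cong) (auto simp: indicator_def)
    also have "\<dots> = emeasure lborel {k<..Y x}" by (rule nn_integral_indicator) simp
    also have "\<dots> = ennreal (max 0 (Y x - k))" by (cases "k \<le> Y x") (auto simp: ennreal_neg)
    finally show "ennreal (max 0 (Y x - k)) = (\<integral>\<^sup>+t. indicator {k<..} t * (if t \<le> Y x then 1 else 0) \<partial>lborel)" ..
  qed
  also have "\<dots> = (\<integral>\<^sup>+t. (\<integral>\<^sup>+x. indicator {k<..} t * (if t \<le> Y x then 1 else 0) \<partial>P) \<partial>lborel)"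
    by (rule Fubini') measurable
  also have "\<dots> = (\<integral>\<^sup>+t. emeasure P {x\<in>space P. t \<le> Y x} * indicator {k<..} t \<partial>lborel)"
  proof (rule nn_integral_cong)
    fix t :: real
    have "(\<integral>\<^sup>+x. indicator {k<..} t * (if t \<le> Y x then 1 else 0) \<partial>P) = (\<integral>\<^sup>+x. indicator {k<..} t * indicator {x\<in>space P. t \<le> Y x} x \<partial>P)"
      by (rule nn_integral_cong) (auto simp: indicator_def)
    also have "\<dots> = indicator {k<..} t * emeasure P {x\<in>space P. t \<le> Y x}" by (rule nn_integral_cmult_indicator) measurable
    finally show "(\<integral>\<^sup>+x. indicator {k<..} t * (if t \<le> Y x then 1 else 0) \<partial>P) = emeasure P {x\<in>space P. t \<le> Y x} * indicator {k<..} t"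
      by (simp add: mult.commute)
  qed
  finally show ?thesis .
qed

lemma trunc_time_eventually:
  assumes "0 \<le> \<sigma> \<omega>" "\<sigma> \<omega> < \<infinity>"
  shows "\<forall>\<^sub>F n in sequentially. trunc_time (real (Suc n)) \<sigma> \<omega> = real_of_ereal (\<sigma> \<omega>)"
proof -
  obtain s where s: "\<sigma> \<omega> = ereal s" using assms by (cases "\<sigma> \<omega>") auto
  obtain N :: nat where N: "s < real N" using reals_Archimedean2 by blast
  show ?thesis using eventually_ge_at_top[of N]
  proof eventually_elim
    case (elim n)
    then have "s \<le> real (Suc n)" using N by simp
    then show ?case by (simp add: trunc_time_def s min_def)
  qed
qed

locale vallois = bm_local_time M F B N\<^sub>0 + t: target \<mu> f
  for M :: "'a measure" and F B N\<^sub>0 \<mu> f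
begin

lemma T_class_ae_stopping:
  assumes "\<tau> \<in> T_class M F B \<mu>"
  shows "ae_stopping \<tau>"
proof -
  have 0: "0 \<le> \<tau> \<omega>" and st: "{\<omega>\<in>space (F t). \<tau> \<omega> \<le> ereal t} \<in> sets (F t)" for \<omega> t
    using assms by (auto simp: T_class_def stopping_time_ext_def)
  have "\<tau> \<in> borel_measurable M"
  proof (rule borel_measurableI_le)
    fix y show "{\<omega>\<in>space M. \<tau> \<omega> \<le> y} \<in> sets M"
    proof (cases y)
      case (real t) then show ?thesis using st[of t] sets_F_M by auto
    next
      case PInf then show ?thesis by simp
    next
      case MInf
      have "\<not> \<tau> \<omega> \<le> y" for \<omega> using 0[of \<omega>] MInf by auto
      then show ?thesis by simp
    qed
  qed
  moreover have "\<exists>A\<in>sets (F t). AE \<omega> in M. ereal t < \<tau> \<omega> \<longleftrightarrow> \<omega> \<in> A" for t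
  proof (rule bexI)
    show "space (F t) - {\<omega>\<in>space (F t). \<tau> \<omega> \<le> ereal t} \<in> sets (F t)" using st[of t] by blast
    show "AE \<omega> in M. ereal t < \<tau> \<omega> \<longleftrightarrow> \<omega> \<in> space (F t) - {\<omega>\<in>space (F t). \<tau> \<omega> \<le> ereal t}"
      by (rule AE_I2) (auto simp: not_le)
  qed
  ultimately show ?thesis using 0 unfolding ae_stopping_def by blast
qed

lemma final_time_measurable:
  assumes "ae_stopping \<sigma>"
  shows "(\<lambda>\<omega>. real_of_ereal (\<sigma> \<omega>)) \<in> borel_measurable M" "0 \<le> real_of_ereal (\<sigma> \<omega>)"
    "(\<lambda>\<omega>. L (real_of_ereal (\<sigma> \<omega>)) \<omega>) \<in> borel_measurable M" "(\<lambda>\<omega>. B (real_of_ereal (\<sigma> \<omega>)) \<omega>) \<in> borel_measurable M"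
proof -
  have [measurable]: "\<sigma> \<in> borel_measurable M" using assms by (simp add: ae_stopping_def)
  show m: "(\<lambda>\<omega>. real_of_ereal (\<sigma> \<omega>)) \<in> borel_measurable M" by measurable
  show 0: "0 \<le> real_of_ereal (\<sigma> \<omega>)" for \<omega> using assms by (simp add: ae_stopping_def real_of_ereal_pos)
  show "(\<lambda>\<omega>. L (real_of_ereal (\<sigma> \<omega>)) \<omega>) \<in> borel_measurable M" by (rule random_time_measurable[OF L_measurable L_cont m 0])
  show "(\<lambda>\<omega>. B (real_of_ereal (\<sigma> \<omega>)) \<omega>) \<in> borel_measurable M" by (rule random_time_measurable[OF B_M B_cont m 0])
qed

text \<open>Freezing \<Gamma> at K makes it bounded and Lipschitz, as optional stopping requires.
  The expectation of the martingale is \<Gamma> 0 = 0 at each truncated time, and the uniform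
  integrability built into \<open>T_class\<close> carries this to \<tau>; integrating the pathwise
  inequality leaves the mean of H(|B|) at \<tau>, whose law is given.\<close>

lemma truncated_call_upper_bound:
  assumes \<tau>: "\<tau> \<in> T_class M F B \<mu>" and k: "k > 0" and K: "K > k"
  shows "(\<integral>\<^sup>+\<omega>. ennreal (max 0 (min (L (real_of_ereal (\<tau> \<omega>)) \<omega>) K - k)) \<partial>M) \<le> (\<integral>\<^sup>+x. ennreal (t.H k \<bar>x\<bar>) \<partial>\<mu>)"
proof -
  have ast: "ae_stopping \<tau>" by (rule T_class_ae_stopping[OF \<tau>])
  have \<tau>0: "0 \<le> \<tau> \<omega>" for \<omega> using ast by (simp add: ae_stopping_def)
  have K0: "K > 0" using k K by simp
  define R where "R \<omega> = real_of_ereal (\<tau> \<omega>)" for \<omega>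
  note fm = final_time_measurable[OF ast, folded R_def]
  define \<Gamma> where "\<Gamma> l = t.\<Gamma> k (max 0 (min l K))" for l
  define \<gamma> where "\<gamma> l = (if l < K then t.\<gamma> k (max 0 l) else 0)" for l
  define C where "C = max 1 (t.\<Gamma> k K)"
  have \<Gamma>0: "\<Gamma> 0 = 0" using t.\<Gamma>_0[OF k] K0 by (simp add: \<Gamma>_def)
  have \<Gamma>b: "0 \<le> \<Gamma> x" "\<Gamma> x \<le> t.\<Gamma> k K" for x
    unfolding \<Gamma>_def using t.\<Gamma>_mono[OF k, of 0 "max 0 (min x K)"] t.\<Gamma>_mono[OF k, of "max 0 (min x K)" K] t.\<Gamma>_0[OF k] K0 by auto
  have \<Gamma>C: "\<bar>\<Gamma> x\<bar> \<le> C" for x using \<Gamma>b[of x] by (simp add: C_def)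
  have \<gamma>1: "0 \<le> \<gamma> x" "\<gamma> x \<le> 1" for x unfolding \<gamma>_def using t.\<gamma>_nonneg[OF k] t.\<gamma>_le_1[OF k] by auto
  have \<Gamma>l: "\<bar>\<Gamma> y - \<Gamma> x\<bar> \<le> C * (y - x)" if "0 \<le> x" "x \<le> y" for x y
  proof -
    define x' y' where "x' = max 0 (min x K)" and "y' = max 0 (min y K)"
    have xy: "0 \<le> x'" "x' \<le> y'" "y' - x' \<le> y - x" using that by (auto simp: x'_def y'_def)
    have "t.\<Gamma> k y' - t.\<Gamma> k x' \<le> (y' - x') * t.\<gamma> k y'" by (rule t.\<Gamma>_slope(2)[OF k xy(1,2)])
    also have "\<dots> \<le> (y - x) * 1" using xy t.\<gamma>_le_1[OF k] t.\<gamma>_nonneg[OF k] by (intro mult_mono) auto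
    also have "\<dots> \<le> C * (y - x)" using mult_right_mono[of 1 C "y - x"] that by (simp add: C_def)
    finally show ?thesis using t.\<Gamma>_mono[OF k xy(1,2)] by (simp add: \<Gamma>_def x'_def y'_def)
  qed
  have \<Gamma>d: "(\<Gamma> has_real_derivative \<gamma> x) (at_right x)" if x: "0 \<le> x" for x
  proof (cases "x < K")
    case True
    have "(t.\<Gamma> k has_real_derivative t.\<gamma> k x) (at_right x)" by (rule t.\<Gamma>_right_deriv[OF k x])
    then have "(\<Gamma> has_real_derivative t.\<gamma> k x) (at_right x)"
      by (rule right_derivative_cong[rotated -1, where e = "K - x"]) (use True x in \<open>auto simp: \<Gamma>_def\<close>)
    then show ?thesis using True x by (simp add: \<gamma>_def)
  next
    case False
    have "((\<lambda>_. t.\<Gamma> k K) has_real_derivative 0) (at_right x)" by simp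
    then have "(\<Gamma> has_real_derivative 0) (at_right x)"
      by (rule right_derivative_cong[rotated -1, where e = 1]) (use False K0 in \<open>auto simp: \<Gamma>_def\<close>)
    then show ?thesis using False by (simp add: \<gamma>_def)
  qed
  have m\<Gamma>: "\<Gamma> \<in> borel_measurable borel" unfolding \<Gamma>_def[abs_def]
    by (intro borel_measurable_continuous_onI continuous_on_compose2[OF t.\<Gamma>_cont[OF k]]) (auto intro!: continuous_intros)
  have "(\<lambda>l. t.\<gamma> k (max 0 l)) \<in> borel_measurable borel"
    by (intro borel_measurable_continuous_onI continuous_on_compose2[OF t.\<gamma>_cont[OF k]]) (auto intro!: continuous_intros)
  then have m\<gamma>: "\<gamma> \<in> borel_measurable borel" unfolding \<gamma>_def[abs_def] by measurable
  define \<rho> where "\<rho> n = trunc_time (real (Suc n)) \<tau>" for n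
  define Z where "Z n \<omega> = \<Gamma> (L (\<rho> n \<omega>) \<omega>) - \<bar>B (\<rho> n \<omega>) \<omega>\<bar> * \<gamma> (L (\<rho> n \<omega>) \<omega>)" for n \<omega>
  define Y where "Y \<omega> = \<Gamma> (L (R \<omega>) \<omega>) - \<bar>B (R \<omega>) \<omega>\<bar> * \<gamma> (L (R \<omega>) \<omega>)" for \<omega>
  have mB: "(\<lambda>\<omega>. B (\<rho> n \<omega>) \<omega>) \<in> borel_measurable M" and mL: "(\<lambda>\<omega>. L (\<rho> n \<omega>) \<omega>) \<in> borel_measurable M" for n
    unfolding \<rho>_def by (auto intro!: B_trunc_time_measurable[OF ast] L_trunc_measurable[OF ast])
  have mZ: "Z n \<in> borel_measurable M" for n unfolding Z_def
    by (intro borel_measurable_diff borel_measurable_times borel_measurable_abs measurable_compose[OF mL m\<Gamma>] measurable_compose[OF mL m\<gamma>] mB)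
  have mY: "Y \<in> borel_measurable M" unfolding Y_def
    by (intro borel_measurable_diff borel_measurable_times borel_measurable_abs measurable_compose[OF fm(3) m\<Gamma>] measurable_compose[OF fm(3) m\<gamma>] fm(4))
  have EZ: "(\<integral>\<omega>. Z n \<omega> \<partial>M) = 0" for n
    unfolding Z_def \<rho>_def using stopped_identity(1)[OF ast _ \<Gamma>C \<Gamma>l \<Gamma>d, of "real (Suc n)"] \<Gamma>0 by simp
  have fin: "AE \<omega> in M. \<tau> \<omega> < \<infinity>" using \<tau> by (simp add: T_class_def)
  have lim: "AE \<omega> in M. (\<lambda>n. Z n \<omega>) \<longlonglongrightarrow> Y \<omega>"
    using fin
  proof eventually_elim
    case (elim \<omega>)
    have "\<forall>\<^sub>F n in sequentially. Z n \<omega> = Y \<omega>"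
      using trunc_time_eventually[of \<tau> \<omega>, OF \<tau>0 elim] by (auto simp: Z_def Y_def \<rho>_def R_def elim!: eventually_mono)
    then show ?case by (rule tendsto_eventually)
  qed
  have ui: "\<exists>K\<ge>0. \<forall>n. (\<integral>\<^sup>+\<omega>. ennreal (max 0 (\<bar>Z n \<omega>\<bar> - K)) \<partial>M) \<le> ennreal e" if e: "e > 0" for e
  proof -
    \<comment> \<open>The tail supremum from the definition of uniform integrability. Since |Z| is
      at most C + |B| at the truncated time, its excess over C + J is covered by the tail of the
      stopped process at level J.\<close>
    define S where "S K = (\<Squnion>t\<in>{0..}. \<integral>\<^sup>+\<omega>. ennreal \<bar>stopped_process B \<tau> t \<omega>\<bar> * indicator {\<omega>. K < \<bar>stopped_process B \<tau> t \<omega>\<bar>} \<omega> \<partial>M)" for K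
    have "(S \<longlongrightarrow> 0) at_top" using \<tau> unfolding S_def by (simp add: T_class_def uniformly_integrable_def)
    then have "\<forall>\<^sub>F K in at_top. S K < ennreal e" using e by (intro order_tendstoD) auto
    then have "\<forall>\<^sub>F K in at_top. S K < ennreal e \<and> K \<ge> 0" using eventually_ge_at_top[of 0] by eventually_elim auto
    from eventually_happens[OF this] obtain J where J: "S J < ennreal e" "J \<ge> 0" by auto
    show ?thesis
    proof (intro exI[of _ "C + J"] conjI allI)
      show "C + J \<ge> 0" using J by (simp add: C_def)
      fix n
      define X where "X \<omega> = stopped_process B \<tau> (real (Suc n)) \<omega>" for \<omega>
      have XB: "X \<omega> = B (\<rho> n \<omega>) \<omega>" for \<omega> by (simp add: X_def stopped_process_def \<rho>_def trunc_time_def)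
      have "(\<integral>\<^sup>+\<omega>. ennreal (max 0 (\<bar>Z n \<omega>\<bar> - (C + J))) \<partial>M) \<le> (\<integral>\<^sup>+\<omega>. ennreal \<bar>X \<omega>\<bar> * indicator {\<omega>. J < \<bar>X \<omega>\<bar>} \<omega> \<partial>M)"
      proof (rule nn_integral_mono)
        fix \<omega>
        have "\<bar>Z n \<omega>\<bar> \<le> C + \<bar>X \<omega>\<bar> * 1"
        proof -
          have "\<bar>Z n \<omega>\<bar> \<le> \<bar>\<Gamma> (L (\<rho> n \<omega>) \<omega>)\<bar> + \<bar>X \<omega>\<bar> * \<gamma> (L (\<rho> n \<omega>) \<omega>)"
            using abs_triangle_ineq4[of "\<Gamma> (L (\<rho> n \<omega>) \<omega>)" "\<bar>X \<omega>\<bar> * \<gamma> (L (\<rho> n \<omega>) \<omega>)"] \<gamma>1 by (simp add: Z_def XB abs_mult)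
          also have "\<dots> \<le> C + \<bar>X \<omega>\<bar> * 1" using \<Gamma>C \<gamma>1 by (intro add_mono mult_left_mono) auto
          finally show ?thesis .
        qed
        then have "max 0 (\<bar>Z n \<omega>\<bar> - (C + J)) \<le> max 0 (\<bar>X \<omega>\<bar> - J)" by auto
        also have "\<dots> \<le> \<bar>X \<omega>\<bar> * indicator {\<omega>. J < \<bar>X \<omega>\<bar>} \<omega>" using J by (auto simp: indicator_def)
        finally have "ennreal (max 0 (\<bar>Z n \<omega>\<bar> - (C + J))) \<le> ennreal (\<bar>X \<omega>\<bar> * indicator {\<omega>. J < \<bar>X \<omega>\<bar>} \<omega>)" by (rule ennreal_leI)
        also have "\<dots> = ennreal \<bar>X \<omega>\<bar> * indicator {\<omega>. J < \<bar>X \<omega>\<bar>} \<omega>" by (simp add: indicator_def)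
        finally show "ennreal (max 0 (\<bar>Z n \<omega>\<bar> - (C + J))) \<le> ennreal \<bar>X \<omega>\<bar> * indicator {\<omega>. J < \<bar>X \<omega>\<bar>} \<omega>" .
      qed
      also have "\<dots> \<le> S J" unfolding S_def X_def by (rule SUP_upper) simp
      also have "\<dots> \<le> ennreal e" using J by simp
      finally show "(\<integral>\<^sup>+\<omega>. ennreal (max 0 (\<bar>Z n \<omega>\<bar> - (C + J))) \<partial>M) \<le> ennreal e" .
    qed
  qed
  note vi = vitali_convergence[OF prob_space_axioms mZ mY lim ui]
  have EY: "(\<integral>\<omega>. Y \<omega> \<partial>M) = 0" using vi(3) unfolding EZ by (simp add: LIMSEQ_const_iff)
  define W where "W \<omega> = max 0 (min (L (R \<omega>) \<omega>) K - k)" for \<omega>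
  have iW: "integrable M W"
  proof (rule integrable_const_bound[where B = K])
    have "\<bar>W \<omega>\<bar> \<le> K" for \<omega> using K k by (auto simp: W_def)
    then show "AE \<omega> in M. norm (W \<omega>) \<le> K" by simp
    show "W \<in> borel_measurable M" unfolding W_def using fm(3) by measurable
  qed
  have path: "W \<omega> - Y \<omega> \<le> t.H k \<bar>B (R \<omega>) \<omega>\<bar>" if \<omega>: "\<omega> \<in> space M" for \<omega>
  proof -
    define l x where "l = L (R \<omega>) \<omega>" and "x = \<bar>B (R \<omega>) \<omega>\<bar>"
    have l: "0 \<le> l" unfolding l_def by (rule L_nonneg[OF \<omega> fm(2)])
    have x: "0 \<le> x" by (simp add: x_def)
    show ?thesis
    proof (cases "l < K")
      case True
      then have "W \<omega> - Y \<omega> = max 0 (l - k) - (t.\<Gamma> k l - x * t.\<gamma> k l)"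
        using l by (simp add: W_def Y_def l_def[symmetric] x_def[symmetric] \<Gamma>_def \<gamma>_def)
      then show ?thesis using t.pathwise_inequality[OF k x l] unfolding x_def[symmetric] by linarith
    next
      case False
      have "max 0 (K - k) \<le> t.H k x + t.\<Gamma> k K - x * t.\<gamma> k K" by (rule t.pathwise_inequality[OF k x]) (use K0 in simp)
      moreover have "0 \<le> x * t.\<gamma> k K" using x t.\<gamma>_nonneg[OF k] by simp
      moreover have "W \<omega> - Y \<omega> = max 0 (K - k) - t.\<Gamma> k K"
        using False K0 by (simp add: W_def Y_def l_def[symmetric] x_def[symmetric] \<Gamma>_def \<gamma>_def min_absorb2)
      ultimately show ?thesis unfolding x_def[symmetric] by linarith
    qed
  qed
  have iWY: "integrable M (\<lambda>\<omega>. W \<omega> - Y \<omega>)" using iW vi(1) by simp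
  have "(\<integral>\<^sup>+\<omega>. ennreal (W \<omega>) \<partial>M) = ennreal (\<integral>\<omega>. W \<omega> \<partial>M)"
    by (rule nn_integral_eq_integral[OF iW]) (simp add: W_def)
  also have "(\<integral>\<omega>. W \<omega> \<partial>M) = (\<integral>\<omega>. W \<omega> - Y \<omega> \<partial>M)" using iW vi(1) EY by simp
  also have "\<dots> \<le> (\<integral>\<omega>. max 0 (W \<omega> - Y \<omega>) \<partial>M)" by (intro integral_mono iWY integrable_max) auto
  also have "ennreal \<dots> = (\<integral>\<^sup>+\<omega>. ennreal (max 0 (W \<omega> - Y \<omega>)) \<partial>M)"
    by (rule nn_integral_eq_integral[symmetric]) (auto intro!: integrable_max iWY)
  also have "\<dots> \<le> (\<integral>\<^sup>+\<omega>. ennreal (t.H k \<bar>B (R \<omega>) \<omega>\<bar>) \<partial>M)"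
    using path t.H_nonneg[OF k] by (intro nn_integral_mono ennreal_leI) auto
  also have "\<dots> = (\<integral>\<^sup>+x. ennreal (t.H k \<bar>x\<bar>) \<partial>distr M borel (stopped_at B \<tau>))"
  proof -
    have [measurable]: "stopped_at B \<tau> \<in> borel_measurable M" using \<tau> by (simp add: T_class_def)
    note [measurable] = t.H_abs_measurable[OF k]
    show ?thesis by (subst nn_integral_distr) (auto simp: stopped_at_def R_def)
  qed
  also have "distr M borel (stopped_at B \<tau>) = \<mu>" using \<tau> by (simp add: T_class_def)
  finally show ?thesis unfolding W_def R_def by (simp add: ennreal_leI)
qed

text \<open>The cap K is lifted by Fatou's lemma, since the bound by the mean of H(|X|) does not
  involve K; that mean equals the call price on \<psi>(|X|).\<close>

lemma call_upper_bound:
  assumes \<tau>: "\<tau> \<in> T_class M F B \<mu>" and k: "k > 0"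
  shows "(\<integral>\<^sup>+\<omega>. ennreal (max 0 (L (real_of_ereal (\<tau> \<omega>)) \<omega> - k)) \<partial>M) \<le> (\<integral>\<^sup>+x. ennreal (max 0 (t.\<psi> \<bar>x\<bar> - k)) \<partial>\<mu>)"
proof -
  define l where "l \<omega> = L (real_of_ereal (\<tau> \<omega>)) \<omega>" for \<omega>
  have lm [measurable]: "l \<in> borel_measurable M" unfolding l_def using final_time_measurable(3)[OF T_class_ae_stopping[OF \<tau>]] .
  have "(\<integral>\<^sup>+\<omega>. ennreal (max 0 (l \<omega> - k)) \<partial>M) = (\<integral>\<^sup>+\<omega>. liminf (\<lambda>n. ennreal (max 0 (min (l \<omega>) (k + real (Suc n)) - k))) \<partial>M)"
  proof (rule nn_integral_cong)
    fix \<omega>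
    obtain N :: nat where N: "l \<omega> - k < real N" using reals_Archimedean2 by blast
    have "\<forall>\<^sub>F n in sequentially. ennreal (max 0 (min (l \<omega>) (k + real (Suc n)) - k)) = ennreal (max 0 (l \<omega> - k))"
      using eventually_ge_at_top[of N]
    proof eventually_elim
      case (elim n)
      then have "l \<omega> \<le> k + real (Suc n)" using N by simp
      then show ?case by (simp add: min_absorb1)
    qed
    then have "(\<lambda>n. ennreal (max 0 (min (l \<omega>) (k + real (Suc n)) - k))) \<longlonglongrightarrow> ennreal (max 0 (l \<omega> - k))" by (rule tendsto_eventually)
    then show "ennreal (max 0 (l \<omega> - k)) = liminf (\<lambda>n. ennreal (max 0 (min (l \<omega>) (k + real (Suc n)) - k)))"
      by (intro lim_imp_Liminf[symmetric]) auto
  qed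
  also have "\<dots> \<le> liminf (\<lambda>n. \<integral>\<^sup>+\<omega>. ennreal (max 0 (min (l \<omega>) (k + real (Suc n)) - k)) \<partial>M)"
    by (rule nn_integral_liminf) measurable
  also have "\<dots> \<le> (\<integral>\<^sup>+x. ennreal (t.H k \<bar>x\<bar>) \<partial>\<mu>)"
  proof (rule Liminf_le)
    show "\<forall>\<^sub>F n in sequentially. (\<integral>\<^sup>+\<omega>. ennreal (max 0 (min (l \<omega>) (k + real (Suc n)) - k)) \<partial>M) \<le> (\<integral>\<^sup>+x. ennreal (t.H k \<bar>x\<bar>) \<partial>\<mu>)"
      unfolding l_def by (intro always_eventually allI truncated_call_upper_bound[OF \<tau> k]) simp
  qed simp
  also have "\<dots> = (\<integral>\<^sup>+x. ennreal (max 0 (t.\<psi> \<bar>x\<bar> - k)) \<partial>\<mu>)" by (rule t.integral_H_eq[OF k])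
  finally show ?thesis unfolding l_def .
qed

end

section \<open>The law of the local time at the Vallois time\<close>

context vallois
begin

text \<open>The maximum encodes the conjunction of two conditions, local time at least \<delta> and
  |B| at or above the boundary, as non-positivity of one continuous process.\<close>

definition gap :: "real \<Rightarrow> real \<Rightarrow> 'a \<Rightarrow> real" where
  "gap \<delta> u \<omega> = max (\<delta> - L u \<omega>) (t.\<phi> (L u \<omega>) - \<bar>B u \<omega>\<bar>)"

text \<open>Ignoring the boundary until the local time has reached \<open>\<delta>\<close> avoids the degeneracy at the origin.\<close>

definition hit :: "real \<Rightarrow> 'a \<Rightarrow> ereal" where
  "hit \<delta> \<omega> = Inf (ereal ` {u. 0 \<le> u \<and> gap \<delta> u \<omega> \<le> 0})"

lemma \<phi>_max_measurable: "(\<lambda>l. t.\<phi> (max 0 l)) \<in> borel_measurable borel"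
  by (intro borel_measurable_continuous_onI continuous_on_compose2[OF t.\<phi>_cont]) (auto intro!: continuous_intros)

lemma gap_cont: "\<omega> \<in> space M \<Longrightarrow> continuous_on {0..} (\<lambda>u. gap \<delta> u \<omega>)"
  unfolding gap_def using L_nonneg
  by (intro continuous_intros L_cont B_cont continuous_on_compose2[OF t.\<phi>_cont L_cont]) auto

lemma hit_ae_stopping: "ae_stopping (hit \<delta>)"
  unfolding hit_def[abs_def]
proof (rule hitting_ae_stopping[OF gap_cont])
  fix u :: real assume u: "0 \<le> u"
  have eq: "gap \<delta> u \<omega> = max (\<delta> - L u \<omega>) (t.\<phi> (max 0 (L u \<omega>)) - \<bar>B u \<omega>\<bar>)" if "\<omega> \<in> space M" for \<omega>
    using L_nonneg[OF that u] by (simp add: gap_def max_absorb2)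
  have "(\<lambda>\<omega>. max (\<delta> - L u \<omega>) (t.\<phi> (max 0 (L u \<omega>)) - \<bar>B u \<omega>\<bar>)) \<in> borel_measurable M"
    by (intro borel_measurable_max borel_measurable_diff borel_measurable_const borel_measurable_abs
         measurable_compose[OF L_measurable[OF u] \<phi>_max_measurable] L_measurable[OF u] B_M[OF u])
  then show "gap \<delta> u \<in> borel_measurable M" by (rule measurable_cong[THEN iffD1, rotated]) (simp add: eq)
  obtain Y where Y: "Y \<in> borel_measurable (F u)" "AE \<omega> in M. L u \<omega> = Y \<omega>" using L_adapted[OF u] by blast
  have "(\<lambda>\<omega>. max (\<delta> - Y \<omega>) (t.\<phi> (max 0 (Y \<omega>)) - \<bar>B u \<omega>\<bar>)) \<in> borel_measurable (F u)"
    by (intro borel_measurable_max borel_measurable_diff borel_measurable_const borel_measurable_abs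
         measurable_compose[OF Y(1) \<phi>_max_measurable] Y(1) B_adapted[OF u])
  moreover have "AE \<omega> in M. gap \<delta> u \<omega> = max (\<delta> - Y \<omega>) (t.\<phi> (max 0 (Y \<omega>)) - \<bar>B u \<omega>\<bar>)"
    using Y(2) AE_space
  proof eventually_elim
    case (elim \<omega>)
    show ?case unfolding eq[OF elim(2)] elim(1) ..
  qed
  ultimately show "\<exists>Y\<in>borel_measurable (F u). AE \<omega> in M. gap \<delta> u \<omega> = Y \<omega>" 
    by (intro bexI[of _ "\<lambda>\<omega>. max (\<delta> - Y \<omega>) (t.\<phi> (max 0 (Y \<omega>)) - \<bar>B u \<omega>\<bar>)"])
qed

lemma hit_nonneg: "0 \<le> hit \<delta> \<omega>" unfolding hit_def by (rule Inf_greatest) auto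

lemma hit_le: "0 \<le> u \<Longrightarrow> \<delta> \<le> L u \<omega> \<Longrightarrow> t.\<phi> (L u \<omega>) \<le> \<bar>B u \<omega>\<bar> \<Longrightarrow> hit \<delta> \<omega> \<le> ereal u"
  unfolding hit_def by (rule Inf_lower) (auto simp: gap_def)

text \<open>Hitting asks only for |B| \<ge> \<phi>(L). If the inequality were strict at s, it would
  hold just before s, where B has no zero, so L would be constant there and both conditions would
  already have been met earlier.\<close>

lemma hit_value:
  assumes \<omega>: "\<omega> \<in> space M" and \<delta>: "\<delta> > 0" and s: "hit \<delta> \<omega> = ereal s"
  shows "s > 0" "\<delta> \<le> L s \<omega>" "\<bar>B s \<omega>\<bar> = t.\<phi> (L s \<omega>)"
proof -
  have s0: "0 \<le> s" using hit_nonneg[of \<delta> \<omega>] s by simp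
  have "\<exists>u\<in>{0..s}. gap \<delta> u \<omega> \<le> 0"
    using hitting_iff[where D = "gap \<delta>", OF \<omega> gap_cont[OF \<omega>] s0] s by (simp add: hit_def)
  then obtain u where u: "u \<in> {0..s}" "gap \<delta> u \<omega> \<le> 0" by blast
  then have "hit \<delta> \<omega> \<le> ereal u" by (intro hit_le) (auto simp: gap_def)
  then have us: "u = s" using u s by simp
  then have ge: "\<delta> \<le> L s \<omega>" "t.\<phi> (L s \<omega>) \<le> \<bar>B s \<omega>\<bar>" using u by (auto simp: gap_def)
  show "\<delta> \<le> L s \<omega>" by fact
  have "s \<noteq> 0" using ge(1) \<delta> L_0[OF \<omega>] by auto
  then show spos: "s > 0" using s0 by simp
  show "\<bar>B s \<omega>\<bar> = t.\<phi> (L s \<omega>)"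
  proof (rule ccontr)
    assume "\<bar>B s \<omega>\<bar> \<noteq> t.\<phi> (L s \<omega>)"
    then have gt: "\<bar>B s \<omega>\<bar> - t.\<phi> (L s \<omega>) > 0" using ge by simp
    have L0: "0 \<le> L v \<omega>" if "0 \<le> v" for v using L_nonneg[OF \<omega> that] .
    have "continuous_on {0..} (\<lambda>v. \<bar>B v \<omega>\<bar> - t.\<phi> (L v \<omega>))"
      by (intro continuous_intros B_cont[OF \<omega>] continuous_on_compose2[OF t.\<phi>_cont L_cont[OF \<omega>]]) (use L0 in auto)
    then obtain d where d: "d > 0" "\<And>v. v \<in> {0..} \<Longrightarrow> dist v s < d \<Longrightarrow>
        dist (\<bar>B v \<omega>\<bar> - t.\<phi> (L v \<omega>)) (\<bar>B s \<omega>\<bar> - t.\<phi> (L s \<omega>)) < \<bar>B s \<omega>\<bar> - t.\<phi> (L s \<omega>)"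
      using gt s0 unfolding continuous_on_iff by (metis atLeast_iff)
    define v where "v = max (s / 2) (s - d / 2)"
    have v: "0 \<le> v" "v < s" "s - v < d" using spos d(1) by (auto simp: v_def)
    have pos: "\<bar>B x \<omega>\<bar> - t.\<phi> (L x \<omega>) > 0" if "x \<in> {v..s}" for x
    proof -
      have pos: "a > 0" if "dist a b < b" for a b :: real using that by (auto simp: dist_real_def)
      have "x \<in> {0..}" "dist x s < d" using that v by (auto simp: dist_real_def)
      from d(2)[OF this] show ?thesis by (rule pos)
    qed
    have "B x \<omega> \<noteq> 0" if "x \<in> {v..s}" for x
      using pos[OF that] t.\<phi>(1)[OF L0[of x]] that v by auto
    then have "L v \<omega> = L s \<omega>" using v by (intro L_const[OF \<omega>]) auto
    then have "hit \<delta> \<omega> \<le> ereal v" using v ge pos[of v] by (intro hit_le) auto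
    then show False using s v by simp
  qed
qed

text \<open>Exceeding the boundary with local time at least \<delta> would force the hitting time to
  be at most u, hence equal to u, where |B| is exactly on the boundary.\<close>

lemma before_hit:
  assumes \<omega>: "\<omega> \<in> space M" and \<delta>: "\<delta> > 0" and u: "0 \<le> u" "ereal u \<le> hit \<delta> \<omega>" and Lu: "\<delta> \<le> L u \<omega>"
  shows "\<bar>B u \<omega>\<bar> \<le> t.\<phi> (L u \<omega>)"
proof (rule ccontr)
  assume n: "\<not> \<bar>B u \<omega>\<bar> \<le> t.\<phi> (L u \<omega>)"
  then have "hit \<delta> \<omega> \<le> ereal u" using u Lu by (intro hit_le) auto
  then have "hit \<delta> \<omega> = ereal u" using u by simp
  from hit_value(3)[OF \<omega> \<delta> this] show False using n by simp
qed

text \<open>Optional stopping for r clipped to local times in [\<delta>, k]: the initial value is r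
  \<delta>, and at the hitting time the martingale is r k if the local time has reached k, and 0
  otherwise because |B| = \<phi>(L) there. The ratio is therefore the probability of reaching
  k.\<close>

lemma hit_law:
  assumes \<delta>: "\<delta> > 0" and k: "\<delta> < k"
  shows "{\<omega>\<in>space M. hit \<delta> \<omega> = \<infinity> \<or> k \<le> L (real_of_ereal (hit \<delta> \<omega>)) \<omega>} \<in> events" (is "?E \<in> _")
    and "prob {\<omega>\<in>space M. hit \<delta> \<omega> = \<infinity> \<or> k \<le> L (real_of_ereal (hit \<delta> \<omega>)) \<omega>} = t.r \<delta> / t.r k"
proof -
  note ast = hit_ae_stopping[of \<delta>]
  have [measurable]: "hit \<delta> \<in> borel_measurable M" using ast by (simp add: ae_stopping_def)
  note [measurable] = final_time_measurable(3)[OF ast]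
  show E: "?E \<in> events" by measurable
  \<comment> \<open>Below \<delta> the function is constant so that the boundary plays no part yet
    and \<phi> stays away from 0; above k it is constant so that it is bounded.\<close>
  define c where "c l = max \<delta> (min l k)" for l
  define \<Gamma> where "\<Gamma> l = t.r (c l)" for l
  define \<gamma> where "\<gamma> l = (if \<delta> \<le> l \<and> l < k then t.r l / t.\<phi> l else 0)" for l
  have c: "\<delta> \<le> c l" "c l \<le> k" for l using k by (auto simp: c_def)
  have k0: "k > 0" using \<delta> k by simp
  have \<phi>\<delta>: "t.\<phi> \<delta> > 0" by (rule t.\<phi>_pos[OF \<delta>])
  define C where "C = t.r k + t.r k / t.\<phi> \<delta>"
  have Cge: "t.r k \<le> C" "t.r k / t.\<phi> \<delta> \<le> C" using t.r_pos[of k] \<phi>\<delta> by (auto simp: C_def)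
  have \<Gamma>b: "0 \<le> \<Gamma> l" "\<Gamma> l \<le> t.r k" for l
    unfolding \<Gamma>_def using t.r_pos[of "c l"] t.r_mono[of "c l" k] c[of l] \<delta> by auto
  have \<Gamma>C: "\<bar>\<Gamma> l\<bar> \<le> C" for l using \<Gamma>b[of l] Cge by simp
  have \<Gamma>l: "\<bar>\<Gamma> y - \<Gamma> x\<bar> \<le> C * (y - x)" if "0 \<le> x" "x \<le> y" for x y
  proof -
    have xy: "0 < c x" "c x \<le> c y" "c y - c x \<le> y - x" using that \<delta> by (auto simp: c_def)
    have "t.r (c y) - t.r (c x) \<le> (c y - c x) * (t.r (c y) / t.\<phi> (c x))" by (rule t.r_diff(2)[OF xy(1,2)])
    also have "\<dots> \<le> (y - x) * (t.r k / t.\<phi> \<delta>)"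
    proof (rule mult_mono)
      show "t.r (c y) / t.\<phi> (c x) \<le> t.r k / t.\<phi> \<delta>"
        using t.r_mono[of "c y" k] t.\<phi>_mono[of \<delta> "c x"] c[of x] c[of y] \<delta> \<phi>\<delta> t.r_pos[of "c y"] by (intro frac_le) auto
      show "0 \<le> t.r (c y) / t.\<phi> (c x)" using t.r_pos[of "c y"] t.\<phi>_pos[OF xy(1)] by simp
    qed (use xy that in auto)
    also have "\<dots> \<le> C * (y - x)" using mult_right_mono[OF Cge(2), of "y - x"] that by (simp add: mult.commute)
    finally have "t.r (c y) - t.r (c x) \<le> C * (y - x)" .
    moreover have "t.r (c x) \<le> t.r (c y)" using xy by (intro t.r_mono) auto
    ultimately show ?thesis by (simp add: \<Gamma>_def)
  qed
  have \<Gamma>d: "(\<Gamma> has_real_derivative \<gamma> x) (at_right x)" if "0 \<le> x" for x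
  proof -
    consider "x < \<delta>" | "\<delta> \<le> x" "x < k" | "k \<le> x" by linarith
    then show ?thesis
    proof cases
      case 1
      have "((\<lambda>_. t.r \<delta>) has_real_derivative 0) (at_right x)" by simp
      then have "(\<Gamma> has_real_derivative 0) (at_right x)"
        by (rule right_derivative_cong[rotated -1, where e = "\<delta> - x"]) (use 1 k in \<open>auto simp: \<Gamma>_def c_def\<close>)
      then show ?thesis using 1 by (simp add: \<gamma>_def)
    next
      case 2
      then have "(t.r has_real_derivative t.r x / t.\<phi> x) (at_right x)" using \<delta> by (intro t.r_deriv) simp
      then have "(\<Gamma> has_real_derivative t.r x / t.\<phi> x) (at_right x)"
        by (rule right_derivative_cong[rotated -1, where e = "k - x"]) (use 2 in \<open>auto simp: \<Gamma>_def c_def\<close>)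
      then show ?thesis using 2 by (simp add: \<gamma>_def)
    next
      case 3
      have "((\<lambda>_. t.r k) has_real_derivative 0) (at_right x)" by simp
      then have "(\<Gamma> has_real_derivative 0) (at_right x)"
        by (rule right_derivative_cong[rotated -1, where e = 1]) (use 3 k in \<open>auto simp: \<Gamma>_def c_def\<close>)
      then show ?thesis using 3 by (simp add: \<gamma>_def)
    qed
  qed
  define \<rho> where "\<rho> n = trunc_time (real (Suc n)) (hit \<delta>)" for n
  define Z where "Z n \<omega> = \<Gamma> (L (\<rho> n \<omega>) \<omega>) - \<bar>B (\<rho> n \<omega>) \<omega>\<bar> * \<gamma> (L (\<rho> n \<omega>) \<omega>)" for n \<omega>
  have \<Gamma>0: "\<Gamma> 0 = t.r \<delta>" using \<delta> k by (simp add: \<Gamma>_def c_def)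
  have EZ: "(\<integral>\<omega>. Z n \<omega> \<partial>M) = t.r \<delta>" for n
    unfolding Z_def \<rho>_def using stopped_identity(1)[OF ast _ \<Gamma>C \<Gamma>l \<Gamma>d, of "real (Suc n)"] \<Gamma>0 by simp
  have mB: "(\<lambda>\<omega>. B (\<rho> n \<omega>) \<omega>) \<in> borel_measurable M" and mL: "(\<lambda>\<omega>. L (\<rho> n \<omega>) \<omega>) \<in> borel_measurable M"
    and m\<gamma>: "(\<lambda>\<omega>. \<gamma> (L (\<rho> n \<omega>) \<omega>)) \<in> borel_measurable M" for n
    unfolding \<rho>_def by (auto intro!: B_trunc_time_measurable[OF ast] L_trunc_measurable[OF ast] stopped_identity(2)[OF ast _ \<Gamma>C \<Gamma>l \<Gamma>d])
  have m\<Gamma>: "\<Gamma> \<in> borel_measurable borel"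
    unfolding \<Gamma>_def[abs_def] using c \<delta>
    by (intro borel_measurable_continuous_onI continuous_on_compose2[OF t.r_cont])
       (auto intro!: continuous_intros simp: c_def[abs_def])
  have lim: "AE \<omega> in M. (\<lambda>n. Z n \<omega>) \<longlonglongrightarrow> t.r k * indicator ?E \<omega>"
    using L_unbounded AE_space
  proof eventually_elim
    case (elim \<omega>)
    have "\<forall>\<^sub>F n in sequentially. Z n \<omega> = t.r k * indicator ?E \<omega>"
    proof (cases "hit \<delta> \<omega> = \<infinity>")
      case True
      \<comment> \<open>If the boundary is never hit, the local time still passes k, so the
        martingale settles at r k. This is why an infinite hitting time is counted in the
        event.\<close>
      obtain N :: nat where N: "L (real N) \<omega> > k" using elim(1) by blast
      show ?thesis using eventually_ge_at_top[of N]
      proof eventually_elim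
        case (elim n)
        have "\<rho> n \<omega> = real (Suc n)" using True by (simp add: \<rho>_def trunc_time_def)
        moreover have "L (real N) \<omega> \<le> L (real (Suc n)) \<omega>" using \<open>\<omega> \<in> space M\<close> elim by (intro L_mono) auto
        ultimately have "L (\<rho> n \<omega>) \<omega> \<ge> k" using N by simp
        then have "Z n \<omega> = t.r k" using k by (simp add: Z_def \<Gamma>_def \<gamma>_def c_def min_absorb2 max_absorb2)
        then show ?case using True \<open>\<omega> \<in> space M\<close> by simp
      qed
    next
      case False
      then have fin: "hit \<delta> \<omega> < \<infinity>" by simp
      then obtain s where s: "hit \<delta> \<omega> = ereal s" using hit_nonneg[of \<delta> \<omega>] by (cases "hit \<delta> \<omega>") auto
      note hv = hit_value[OF elim(2) \<delta> s]
      show ?thesis using trunc_time_eventually[of "hit \<delta>" \<omega>, OF hit_nonneg fin]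
      proof eventually_elim
        case (elim n)
        then have \<rho>s: "\<rho> n \<omega> = s" using s by (simp add: \<rho>_def)
        show ?case
        proof (cases "k \<le> L s \<omega>")
          case True
          then have "Z n \<omega> = t.r k" using k by (simp add: Z_def \<rho>s \<Gamma>_def \<gamma>_def c_def min_absorb2 max_absorb2)
          then show ?thesis using True \<open>\<omega> \<in> space M\<close> s by simp
        next
          case False
          have "t.\<phi> (L s \<omega>) > 0" using hv \<delta> by (intro t.\<phi>_pos) simp
          then have "Z n \<omega> = 0" using False hv by (simp add: Z_def \<rho>s \<Gamma>_def \<gamma>_def c_def min_absorb1 max_absorb2)
          then show ?thesis using False s by simp
        qed
      qed
    qed
    then show ?case by (rule tendsto_eventually)
  qed
  \<comment> \<open>Domination: \<gamma> is 0 outside [\<delta>, k), and there |B| \<le> \<phi>(L)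
    \<le> \<phi> k up to the hitting time while \<gamma> \<le> r k / \<phi> \<delta>.\<close>
  have "(\<lambda>n. \<integral>\<omega>. Z n \<omega> \<partial>M) \<longlonglongrightarrow> (\<integral>\<omega>. t.r k * indicator ?E \<omega> \<partial>M)"
  proof (rule integral_dominated_convergence[where w = "\<lambda>_. C + t.\<phi> k * (t.r k / t.\<phi> \<delta>)"])
    show "(\<lambda>\<omega>. t.r k * indicator ?E \<omega>) \<in> borel_measurable M" using E by simp
    show "Z n \<in> borel_measurable M" for n unfolding Z_def
      by (intro borel_measurable_diff borel_measurable_times borel_measurable_abs measurable_compose[OF mL m\<Gamma>] m\<gamma> mB)
    show "AE \<omega> in M. norm (Z n \<omega>) \<le> C + t.\<phi> k * (t.r k / t.\<phi> \<delta>)" for n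
      using AE_space
    proof eventually_elim
      case (elim \<omega>)
      define l where "l = L (\<rho> n \<omega>) \<omega>"
      have \<rho>: "0 \<le> \<rho> n \<omega>" "ereal (\<rho> n \<omega>) \<le> hit \<delta> \<omega>"
        unfolding \<rho>_def using trunc_time_bounds[of "real (Suc n)" "hit \<delta>" \<omega>] hit_nonneg[of \<delta> \<omega>] by auto
      have "0 \<le> \<bar>B (\<rho> n \<omega>) \<omega>\<bar> * \<gamma> l \<and> \<bar>B (\<rho> n \<omega>) \<omega>\<bar> * \<gamma> l \<le> t.\<phi> k * (t.r k / t.\<phi> \<delta>)"
      proof (cases "\<delta> \<le> l \<and> l < k")
        case True
        then have "\<bar>B (\<rho> n \<omega>) \<omega>\<bar> \<le> t.\<phi> l" unfolding l_def using before_hit[OF elim \<delta> \<rho>] by simp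
        also have "\<dots> \<le> t.\<phi> k" using True \<delta> by (intro t.\<phi>_mono) auto
        finally have 1: "\<bar>B (\<rho> n \<omega>) \<omega>\<bar> \<le> t.\<phi> k" .
        have 2: "\<gamma> l \<le> t.r k / t.\<phi> \<delta>"
          using True \<delta> \<phi>\<delta> t.r_mono[of l k] t.\<phi>_mono[of \<delta> l] t.r_pos[of l] unfolding \<gamma>_def by (auto intro!: frac_le)
        have 3: "0 \<le> \<gamma> l" using True \<delta> t.r_pos[of l] t.\<phi>_pos[of l] by (simp add: \<gamma>_def)
        show ?thesis using mult_mono[OF 1 2] 3 t.\<phi>_pos[OF k0] by (auto intro!: mult_nonneg_nonneg)
      next
        case False
        then have "\<gamma> l = 0" unfolding \<gamma>_def by (rule if_not_P)
        then show ?thesis using t.\<phi>_pos[OF k0] t.r_pos[of k] \<phi>\<delta> by simp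
      qed
      then show ?case using \<Gamma>C[of l] unfolding Z_def l_def[symmetric] real_norm_def by linarith
    qed
  qed (use lim in auto)
  then have "t.r \<delta> = (\<integral>\<omega>. t.r k * indicator ?E \<omega> \<partial>M)" unfolding EZ by (simp add: LIMSEQ_const_iff)
  also have "\<dots> = t.r k * prob ?E" using E by simp
  finally show "prob ?E = t.r \<delta> / t.r k" using t.r_pos[of k] by (simp add: field_simps)
qed

text \<open>An infinite hitting time lies in the event of \<open>hit_law\<close> for every k, whose
  probability r \<delta> / r k tends to 0 because r is unbounded.\<close>

lemma hit_finite:
  assumes \<delta>: "\<delta> > 0"
  shows "AE \<omega> in M. hit \<delta> \<omega> < \<infinity>"
proof -
  have [measurable]: "hit \<delta> \<in> borel_measurable M" using hit_ae_stopping by (simp add: ae_stopping_def)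
  let ?I = "{\<omega>\<in>space M. hit \<delta> \<omega> = \<infinity>}"
  have "prob ?I \<le> e" if e: "e > 0" for e
  proof -
    obtain k where k: "k > 0" "t.r k \<ge> t.r \<delta> / e" using t.r_unbounded by blast
    define k' where "k' = max k (\<delta> + 1)"
    have k': "\<delta> < k'" "t.r k' \<ge> t.r \<delta> / e" using k t.r_mono[of k k'] by (auto simp: k'_def)
    have "prob ?I \<le> t.r \<delta> / t.r k'"
      unfolding hit_law(2)[OF \<delta> k'(1), symmetric] by (rule finite_measure_mono[OF _ hit_law(1)[OF \<delta> k'(1)]]) auto
    also have "\<dots> \<le> e" using k'(2) e t.r_pos[of k'] by (simp add: field_simps)
    finally show ?thesis .
  qed
  then have "prob ?I \<le> 0" by (rule field_le_epsilon[of _ 0, simplified])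
  then have "prob ?I = 0" using measure_nonneg[of M ?I] by simp
  then have "AE \<omega> in M. \<omega> \<notin> ?I" by (subst (asm) prob_eq_0) auto
  then show ?thesis using AE_space by eventually_elim auto
qed

text \<open>The effect of letting the threshold \<delta> = 1 / (n + 1) tend to 0, taken as an
  infimum of local times rather than as a limit of hitting times. The maximum with 0 keeps it
  bounded below for arguments outside the sample space.\<close>

definition low :: "'a \<Rightarrow> real" where
  "low \<omega> = (INF n::nat. max 0 (L (real_of_ereal (hit (1 / real (Suc n)) \<omega>)) \<omega>))"

lemma low_nonneg: "0 \<le> low \<omega>" unfolding low_def by (rule cINF_greatest) auto

lemma low_le: "low \<omega> \<le> max 0 (L (real_of_ereal (hit (1 / real (Suc n)) \<omega>)) \<omega>)"
  unfolding low_def by (rule cINF_lower) (auto intro!: bdd_belowI[of _ 0])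

lemma low_measurable: "low \<in> borel_measurable M"
  unfolding low_def[abs_def] using final_time_measurable(3)[OF hit_ae_stopping]
  by (intro borel_measurable_cINF_real borel_measurable_max borel_measurable_const) auto

text \<open>For \<delta> < k the local time at the hitting time is at least k with probability r
  \<delta> / r k \<ge> 1 / r k, because r \<ge> 1. These events decrease as \<delta> does, so
  continuity from above keeps the lower bound for the infimum.\<close>

lemma low_tail:
  assumes k: "k > 0"
  shows "prob {\<omega>\<in>space M. k \<le> low \<omega>} \<ge> 1 / t.r k"
proof -
  define \<sigma> where "\<sigma> n = hit (1 / real (Suc n))" for n
  define l where "l n \<omega> = L (real_of_ereal (\<sigma> n \<omega>)) \<omega>" for n \<omega>
  have lm [measurable]: "l n \<in> borel_measurable M" for n unfolding l_def \<sigma>_def by (rule final_time_measurable(3)[OF hit_ae_stopping])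
  have \<sigma>m [measurable]: "\<sigma> n \<in> borel_measurable M" for n using hit_ae_stopping by (simp add: ae_stopping_def \<sigma>_def)
  define V where "V n = {\<omega>\<in>space M. \<forall>j\<le>n. k \<le> l j \<omega>}" for n
  have V [measurable]: "V n \<in> events" for n unfolding V_def by measurable
  have fin: "AE \<omega> in M. \<forall>n. \<sigma> n \<omega> < \<infinity>" unfolding AE_all_countable \<sigma>_def by (intro allI hit_finite) simp
  have "prob (V n) \<ge> 1 / t.r k" if n: "1 / real (Suc n) < k" for n
  proof -
    let ?\<delta> = "1 / real (Suc n)"
    let ?E = "{\<omega>\<in>space M. hit ?\<delta> \<omega> = \<infinity> \<or> k \<le> L (real_of_ereal (hit ?\<delta> \<omega>)) \<omega>}"
    have "1 / t.r k \<le> t.r ?\<delta> / t.r k" using t.r_ge_1[of ?\<delta>] t.r_pos[of k] by (intro divide_right_mono) auto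
    also have "\<dots> = prob ?E" using hit_law(2)[of ?\<delta> k] n by simp
    also have "\<dots> \<le> prob (V n)"
    proof (rule finite_measure_mono_AE[OF _ V])
      show "AE \<omega> in M. \<omega> \<in> ?E \<longrightarrow> \<omega> \<in> V n"
        using fin AE_space
      proof eventually_elim
        case (elim \<omega>)
        show ?case
        proof
          assume "\<omega> \<in> ?E"
          then have kl: "k \<le> l n \<omega>" using elim(1)[rule_format, of n] by (auto simp: l_def \<sigma>_def)
          have "k \<le> l j \<omega>" if j: "j \<le> n" for j
          proof -
            obtain s where s: "\<sigma> n \<omega> = ereal s" using elim(1)[rule_format, of n] hit_nonneg[of "1 / real (Suc n)" \<omega>] by (cases "\<sigma> n \<omega>") (auto simp: \<sigma>_def)
            obtain s' where s': "\<sigma> j \<omega> = ereal s'" using elim(1)[rule_format, of j] hit_nonneg[of "1 / real (Suc j)" \<omega>] by (cases "\<sigma> j \<omega>") (auto simp: \<sigma>_def)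
            have hv: "s' > 0" "1 / real (Suc j) \<le> L s' \<omega>" "\<bar>B s' \<omega>\<bar> = t.\<phi> (L s' \<omega>)"
              using hit_value[OF elim(2) _ s'[unfolded \<sigma>_def]] by auto
            \<comment> \<open>A contact with local time above the larger threshold also counts for
              the smaller one. Lower thresholds are thus hit no later, and local time increases, so
              being above k at the finest threshold implies it at all coarser ones.\<close>
            have "1 / real (Suc n) \<le> 1 / real (Suc j)" using j by (intro divide_left_mono) auto
            then have "\<sigma> n \<omega> \<le> ereal s'" unfolding \<sigma>_def using hv by (intro hit_le) auto
            then have "s \<le> s'" using s by simp
            moreover have "0 \<le> s" using hit_nonneg[of "1 / real (Suc n)" \<omega>] s by (simp add: \<sigma>_def)
            ultimately have "L s \<omega> \<le> L s' \<omega>" by (intro L_mono[OF elim(2)]) auto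
            then show ?thesis using kl s s' by (simp add: l_def)
          qed
          then show "\<omega> \<in> V n" using elim(2) by (simp add: V_def)
        qed
      qed
    qed
    finally show ?thesis .
  qed
  then have ev: "\<forall>\<^sub>F n in sequentially. 1 / t.r k \<le> prob (V n)"
  proof -
    assume *: "\<And>n. 1 / real (Suc n) < k \<Longrightarrow> 1 / t.r k \<le> prob (V n)"
    have "(\<lambda>n. 1 / real (Suc n)) \<longlonglongrightarrow> 0" by real_asymp
    from order_tendstoD(2)[OF this k] show ?thesis by eventually_elim (rule *)
  qed
  have "decseq V" unfolding decseq_def V_def by auto
  then have "(\<lambda>n. prob (V n)) \<longlonglongrightarrow> prob (\<Inter>n. V n)" by (intro finite_Lim_measure_decseq) auto
  then have "1 / t.r k \<le> prob (\<Inter>n. V n)" using ev by (rule tendsto_lowerbound) simp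
  also have "\<dots> \<le> prob {\<omega>\<in>space M. k \<le> low \<omega>}"
  proof (rule finite_measure_mono)
    show "(\<Inter>n. V n) \<subseteq> {\<omega>\<in>space M. k \<le> low \<omega>}"
    proof
      fix \<omega> assume \<omega>: "\<omega> \<in> (\<Inter>n. V n)"
      then have "\<omega> \<in> space M" by (auto simp: V_def)
      moreover have "k \<le> l n \<omega>" for n using \<omega> by (auto simp: V_def)
      then have "k \<le> low \<omega>" unfolding low_def by (intro cINF_greatest) (auto simp: l_def \<sigma>_def le_max_iff_disj)
      ultimately show "\<omega> \<in> {\<omega>\<in>space M. k \<le> low \<omega>}" by simp
    qed
    show "{\<omega>\<in>space M. k \<le> low \<omega>} \<in> events" using low_measurable by measurable
  qed
  finally show ?thesis .
qed

text \<open>By layers, the claim reduces to tails at levels s > k, where \<psi>(|X|) has exactly 1 /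
  r s and \<open>low\<close> at least that.\<close>

lemma call_lower_bound:
  assumes k: "k > 0"
  shows "(\<integral>\<^sup>+x. ennreal (max 0 (t.\<psi> \<bar>x\<bar> - k)) \<partial>\<mu>) \<le> (\<integral>\<^sup>+\<omega>. ennreal (max 0 (low \<omega> - k)) \<partial>M)"
proof -
  have m\<psi>: "(\<lambda>x. t.\<psi> \<bar>x\<bar>) \<in> borel_measurable \<mu>" using t.\<psi>_abs_measurable by (simp add: measurable_cong_sets[OF t.sets_mu refl])
  show ?thesis
    unfolding nn_integral_call[OF t.mu_prob m\<psi>] nn_integral_call[OF prob_space_axioms low_measurable]
  proof (rule nn_integral_mono)
    fix s :: real
    show "emeasure \<mu> {x\<in>space \<mu>. s \<le> t.\<psi> \<bar>x\<bar>} * indicator {k<..} s \<le> emeasure M {\<omega>\<in>space M. s \<le> low \<omega>} * indicator {k<..} s"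
    proof (cases "k < s")
      case True
      then have s: "s > 0" using k by simp
      have "emeasure \<mu> {x\<in>space \<mu>. s \<le> t.\<psi> \<bar>x\<bar>} = ennreal (1 / t.r s)"
        using t.\<psi>_tail[OF s] by (simp add: t.emeasure_eq_measure sets_eq_imp_space_eq[OF t.sets_mu])
      also have "\<dots> \<le> emeasure M {\<omega>\<in>space M. s \<le> low \<omega>}"
        unfolding emeasure_eq_measure using low_tail[OF s] by (rule ennreal_leI)
      finally show ?thesis using True by simp
    qed simp
  qed
qed

text \<open>At any contact time u > 0 the local time is positive, hence exceeds some threshold 1 /
  (n + 1), and u is no earlier than the corresponding hitting time. So \<open>low\<close> is below
  the local time at every contact time.\<close>

lemma low_le_final:
  "AE \<omega> in M. low \<omega> \<le> stopped_at (local_time0 B) (tau_mu \<mu> B) \<omega>"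
proof -
  have fin: "AE \<omega> in M. \<forall>n. hit (1 / real (Suc n)) \<omega> < \<infinity>" unfolding AE_all_countable by (intro allI hit_finite) simp
  show ?thesis using fin L_positive AE_N0
  proof eventually_elim
    case (elim \<omega>)
    then have \<omega>: "\<omega> \<in> space M" by simp
    have Leq: "local_time0 B u \<omega> = L u \<omega>" for u using elim(3) by (simp add: L_eq)
    define S where "S = {u. 0 < u \<and> \<bar>B u \<omega>\<bar> = t.\<phi> (L u \<omega>)}"
    have low_S: "low \<omega> \<le> L u \<omega>" if u: "u \<in> S" for u
    proof -
      have "L u \<omega> > 0" using elim(2) u by (simp add: S_def)
      then obtain n where n: "1 / real (Suc n) < L u \<omega>" using nat_approx_posE by blast
      have le: "hit (1 / real (Suc n)) \<omega> \<le> ereal u" using u n by (intro hit_le) (auto simp: S_def)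
      then have "real_of_ereal (hit (1 / real (Suc n)) \<omega>) \<le> u" using hit_nonneg[of "1 / real (Suc n)" \<omega>]
        by (cases "hit (1 / real (Suc n)) \<omega>") auto
      then have "L (real_of_ereal (hit (1 / real (Suc n)) \<omega>)) \<omega> \<le> L u \<omega>"
        using hit_nonneg[of "1 / real (Suc n)" \<omega>] by (intro L_mono[OF \<omega>]) (auto simp: real_of_ereal_pos)
      then show ?thesis using low_le[of \<omega> n] \<open>L u \<omega> > 0\<close> by simp
    qed
    obtain s where s: "hit (1 / real (Suc 0)) \<omega> = ereal s"
      using elim(1)[rule_format, of 0] hit_nonneg[of "1 / real (Suc 0)" \<omega>] by (cases "hit (1 / real (Suc 0)) \<omega>") auto
    have "s \<in> S" using hit_value[OF \<omega> _ s] by (simp add: S_def)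
    then have ne: "S \<noteq> {}" by blast
    have bdd: "bdd_below S" by (rule bdd_belowI[of _ 0]) (auto simp: S_def)
    define v where "v = Inf S"
    have v0: "0 \<le> v" unfolding v_def by (rule cInf_greatest[OF ne]) (auto simp: S_def)
    have "tau_mu \<mu> B \<omega> = Inf (ereal ` S)" unfolding tau_mu_def S_def Leq t.\<phi>_def ..
    also have "\<dots> = ereal v"
    proof (rule antisym)
      show "ereal v \<le> Inf (ereal ` S)" unfolding v_def using bdd by (intro Inf_greatest) (auto intro: cInf_lower)
      show "Inf (ereal ` S) \<le> ereal v"
      proof (rule ereal_le_epsilon2)
        fix e :: real assume "0 < e"
        then obtain u where "u \<in> S" "u < v + e" using cInf_lessD[OF ne, of "v + e"] by (auto simp: v_def)
        then have "Inf (ereal ` S) \<le> ereal u" by (intro Inf_lower) auto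
        also have "\<dots> \<le> ereal v + ereal e" using \<open>u < v + e\<close> by simp
        finally show "Inf (ereal ` S) \<le> ereal v + ereal e" .
      qed
    qed
    finally have fin: "stopped_at (local_time0 B) (tau_mu \<mu> B) \<omega> = L v \<omega>" by (simp add: stopped_at_def Leq)
    \<comment> \<open>The infimum of contact times may fail to be one, for instance if it were 0; it
      is still a limit of contact times, and continuity of the local time preserves the
      bound.\<close>
    have "v \<in> closure S" unfolding v_def by (rule closure_contains_Inf[OF ne bdd])
    then obtain x where x: "\<And>n. x n \<in> S" "x \<longlonglongrightarrow> v" unfolding closure_sequential by blast
    have "(\<lambda>n. L (x n) \<omega>) \<longlonglongrightarrow> L v \<omega>"
      by (rule continuous_on_tendsto_compose[OF L_cont[OF \<omega>] x(2)]) (use v0 x(1) in \<open>auto simp: S_def less_imp_le\<close>)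
    then have "low \<omega> \<le> L v \<omega>" by (rule LIMSEQ_le_const) (use low_S x(1) in blast)
    then show ?case unfolding fin .
  qed
qed

lemma vallois_maximizes:
  fixes G :: "real \<Rightarrow> real"
  assumes \<tau>: "\<tau> \<in> T_class M F B \<mu>" and cvx: "convex_on {0..} G" and mono: "mono_on {0..} G" and nn: "\<And>x. 0 \<le> x \<Longrightarrow> 0 \<le> G x"
  shows "(\<integral>\<^sup>+\<omega>. ennreal (G (stopped_at (local_time0 B) \<tau> \<omega>)) \<partial>M)
           \<le> (\<integral>\<^sup>+\<omega>. ennreal (G (stopped_at (local_time0 B) (tau_mu \<mu> B) \<omega>)) \<partial>M)"
proof -
  note ast = T_class_ae_stopping[OF \<tau>]
  \<comment> \<open>The maximum changes nothing on the sample space; it only provides non-negativity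
    at every argument, as the comparison lemma demands.\<close>
  define Y where "Y \<omega> = max 0 (L (real_of_ereal (\<tau> \<omega>)) \<omega>)" for \<omega>
  have YL: "Y \<omega> = L (real_of_ereal (\<tau> \<omega>)) \<omega>" if "\<omega> \<in> space M" for \<omega>
    using L_nonneg[OF that final_time_measurable(2)[OF ast]] by (simp add: Y_def max_absorb2)
  have mY: "Y \<in> borel_measurable M" unfolding Y_def[abs_def] using final_time_measurable(3)[OF ast] by measurable
  have "(\<integral>\<^sup>+\<omega>. ennreal (G (stopped_at (local_time0 B) \<tau> \<omega>)) \<partial>M) = (\<integral>\<^sup>+\<omega>. ennreal (G (Y \<omega>)) \<partial>M)"
    by (rule nn_integral_cong_AE, use AE_N0 in eventually_elim) (auto simp: YL L_eq stopped_at_def)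
  also have "\<dots> \<le> (\<integral>\<^sup>+\<omega>. ennreal (G (low \<omega>)) \<partial>M)"
  proof (rule increasing_convex_order[OF cvx mono nn prob_space_axioms prob_space_axioms mY _ low_measurable low_nonneg])
    show "0 \<le> Y \<omega>" for \<omega> by (simp add: Y_def)
    fix k :: real assume k: "k > 0"
    have "(\<integral>\<^sup>+\<omega>. ennreal (max 0 (Y \<omega> - k)) \<partial>M) = (\<integral>\<^sup>+\<omega>. ennreal (max 0 (L (real_of_ereal (\<tau> \<omega>)) \<omega> - k)) \<partial>M)"
      by (rule nn_integral_cong) (simp add: YL)
    also have "\<dots> \<le> (\<integral>\<^sup>+x. ennreal (max 0 (t.\<psi> \<bar>x\<bar> - k)) \<partial>\<mu>)" by (rule call_upper_bound[OF \<tau> k])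
    also have "\<dots> \<le> (\<integral>\<^sup>+\<omega>. ennreal (max 0 (low \<omega> - k)) \<partial>M)" by (rule call_lower_bound[OF k])
    finally show "(\<integral>\<^sup>+\<omega>. ennreal (max 0 (Y \<omega> - k)) \<partial>M) \<le> (\<integral>\<^sup>+\<omega>. ennreal (max 0 (low \<omega> - k)) \<partial>M)" .
  qed
  also have "\<dots> \<le> (\<integral>\<^sup>+\<omega>. ennreal (G (stopped_at (local_time0 B) (tau_mu \<mu> B) \<omega>)) \<partial>M)"
  proof (rule nn_integral_mono_AE, use low_le_final in eventually_elim)
    case (elim \<omega>)
    then show ?case using low_nonneg[of \<omega>] by (intro ennreal_leI mono_onD[OF mono]) auto
  qed
  finally show ?thesis .
qed

end

theorem corollary2p3:
  fixes M :: "'a measure" and F :: "real \<Rightarrow> 'a measure" and B :: "real \<Rightarrow> 'a \<Rightarrow> real"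
    and \<mu> :: "real measure" and f :: "real \<Rightarrow> real" and G :: "real \<Rightarrow> real"
    and \<tau> :: "'a \<Rightarrow> ereal"
  assumes BM: "brownian_motion M F B"
    and f_meas: "f \<in> borel_measurable borel"
    and f_pos: "\<And>x. 0 < f x"
    and mu_dens: "\<mu> = density lborel (\<lambda>x. ennreal (f x))"
    and mu_prob: "prob_space \<mu>"
    and mu_symm: "distr \<mu> borel uminus = \<mu>"
    and mu_moment: "integrable \<mu> (\<lambda>x. \<bar>x\<bar>)"
    and G_convex: "convex_on {0..} G"
    and G_mono: "mono_on {0..} G"
    and G_nonneg: "\<And>x. 0 \<le> x \<Longrightarrow> 0 \<le> G x"
    and tau: "\<tau> \<in> T_class M F B \<mu>"
  shows "(\<integral>\<^sup>+\<omega>. ennreal (G (stopped_at (local_time0 B) \<tau> \<omega>)) \<partial>M)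
           \<le> (\<integral>\<^sup>+\<omega>. ennreal (G (stopped_at (local_time0 B) (tau_mu \<mu> B) \<omega>)) \<partial>M)"
proof -
  interpret b: bm M F B by (rule bm.intro[OF BM])
  obtain N where N: "N \<in> null_sets M"
    "\<And>\<omega>. \<omega> \<in> space M - N \<Longrightarrow> continuous_on {0..} (\<lambda>t. local_time0 B t \<omega>)"
    "\<And>\<omega> t. \<omega> \<in> space M - N \<Longrightarrow> t \<ge> 0 \<Longrightarrow> (\<lambda>n. b.add_fun (gk n) t \<omega>) \<longlonglongrightarrow> local_time0 B t \<omega>"
    using b.local_time_good_set by blast
  interpret vallois M F B N \<mu> f
    by (intro vallois.intro bm_local_time.intro bm.intro bm_local_time_axioms.intro target.intro)
       (fact BM N f_meas f_pos mu_dens mu_prob mu_symm)+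
  show ?thesis by (rule vallois_maximizes[OF tau G_convex G_mono G_nonneg])
qed

end
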